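(* Let $f$ be a Lattès map over a lattice $\mathcal L$ and let $\mathcal C\subset S^2$ be a Jordan curve containing all postcritical points of $f$. Then there exists a constant $c>0$ such that $D_n(f,\mathcal C)\ge c\,(\deg f)^{n/2}$ for all $n>0$.
   Context: $S^2$ is an oriented topological $2$-sphere. A branched covering map $f\colon S^2\to S^2$ is a continuous map that near each point $p$ has the form $z\mapsto z^{d}$, $d=\deg_f(p)\ge1$, in suitable orientation-preserving local coordinates centered at $p$ and $f(p)$; $p$ is critical if $\deg_f(p)\ge2$. $\deg(f)$ is the number of preimages of a non-critical value. The set of postcritical points is $\mathrm{post}(f)=\bigcup_{n\ge1}\{f^n(c): c\text{ critical point of }f\}$. Lattès maps: let $\mathcal L\subset\mathbb R^2$ be a rank-$2$ lattice and $T=\mathbb R^2/\mathcal L$. A torus endomorphism $\bar A\colon T\to T$ is a map induced by an orientation-preserving affine map of $\mathbb R^2$ sending points that differ by an element of $\mathcal L$ to points that differ by an element of $\mathcal L$; it is a torus automorphism if bijective. Its eigenvalues are those of the linear part of the affine map. A branched cover $\Theta\colon T\to S^2$ is induced by a rigid action of a group $G$ on $T$ if every $g\in G$ acts as a torus automorphism and $\Theta(t)=\Theta(t')$ if and only if $t=g(t')$ for some $g\in G$. A Lattès-type map over $\mathcal L$ is a map $f\colon S^2\to S^2$ with $f\circ\Theta=\Theta\circ\bar A$ for some torus endomorphism $\bar A$ of $T$ all of whose eigenvalues have absolute value $>1$ and some branched covering map $\Theta\colon T\to S^2$ induced by a rigid action of a finite cyclic group. A Lattès map is a Lattès-type map that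 is a rational map on $S^2=\widehat{\mathbb C}$. For such maps $\#\mathrm{post}(f)\in\{3,4\}$. $D_n$: the $n$-tiles are the closures of the connected components of $S^2\setminus f^{-n}(\mathcal C)$. The $0$-edges are the closed arcs into which the points of $\mathrm{post}(f)$ divide $\mathcal C$. A set $K\subseteq S^2$ joins opposite sides of $\mathcal C$ if $\#\mathrm{post}(f)\ge4$ and $K$ meets two disjoint $0$-edges, or $\#\mathrm{post}(f)=3$ and $K$ meets all three $0$-edges. $D_n(f,\mathcal C)$ is the minimal $N\in\mathbb N$ such that there are $n$-tiles $X_1,\dots,X_N$ whose union is connected and joins opposite sides of $\mathcal C$. *)

theory Defs
  imports
    "HOL-Complex_Analysis.Complex_Analysis"
    "HOL-Algebra.Group_Action"
    "HOL-Algebra.Elementary_Groups"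
begin

section \<open>Oriented surfaces and branched covering maps\<close>

text \<open>An orientation of a surface is given by an atlas of complex-valued charts with
  orientation-preserving transition maps; a chart is a pair of its domain and the coordinate
  function.\<close>

record 'a oriented_surface =
  surface_top :: "'a topology"
  surface_atlas :: "('a set \<times> ('a \<Rightarrow> complex)) set"

text \<open>Meant for injective continuous \<open>h\<close> on an open set \<open>W\<close>. The image of every small circle
  around \<open>z\<close> then winds around \<open>h z\<close> exactly once, positively or negatively, and \<open>h\<close> preserves
  orientation iff it does so positively.\<close>

definition orientation_preserving_on :: "complex set \<Rightarrow> (complex \<Rightarrow> complex) \<Rightarrow> bool" where
  "orientation_preserving_on W h \<longleftrightarrow>
     (\<forall>z\<in>W. \<forall>\<^sub>F r in at_right 0. winding_number (h \<circ> circlepath z r) (h z) = 1)"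

definition local_coordinate ::
    "'a oriented_surface \<Rightarrow> 'a set \<Rightarrow> ('a \<Rightarrow> complex) \<Rightarrow> bool" where
  "local_coordinate S U \<phi> \<longleftrightarrow>
     openin (surface_top S) U \<and> open (\<phi> ` U) \<and>
     homeomorphic_map (subtopology (surface_top S) U) (top_of_set (\<phi> ` U)) \<phi> \<and>
     (\<forall>(V, \<psi>) \<in> surface_atlas S.
        orientation_preserving_on (\<psi> ` (U \<inter> V)) (\<phi> \<circ> inv_into V \<psi>))"

text \<open>In suitable orientation-preserving coordinates centered at \<open>p\<close> and \<open>f p\<close>, the map \<open>f\<close> is
  \<open>z \<mapsto> z ^ d\<close>. There is at most one such \<open>d \<ge> 1\<close>, the local degree of \<open>f\<close> at \<open>p\<close>.\<close>

definition has_local_degree ::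
    "'a oriented_surface \<Rightarrow> 'b oriented_surface \<Rightarrow> ('a \<Rightarrow> 'b) \<Rightarrow> 'a \<Rightarrow> nat \<Rightarrow> bool" where
  "has_local_degree S S' f p d \<longleftrightarrow> d \<ge> 1 \<and>
     (\<exists>U \<phi> V \<psi>. local_coordinate S U \<phi> \<and> p \<in> U \<and> \<phi> p = 0 \<and>
                local_coordinate S' V \<psi> \<and> f p \<in> V \<and> \<psi> (f p) = 0 \<and>
                (\<forall>x\<in>U. f x \<in> V \<and> \<psi> (f x) = \<phi> x ^ d))"

definition branched_cover ::
    "'a oriented_surface \<Rightarrow> 'b oriented_surface \<Rightarrow> ('a \<Rightarrow> 'b) \<Rightarrow> bool" where
  "branched_cover S S' f \<longleftrightarrow>
     continuous_map (surface_top S) (surface_top S') f \<and>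
     (\<forall>p \<in> topspace (surface_top S). \<exists>d. has_local_degree S S' f p d)"


section \<open>The Riemann sphere and its rational self-maps\<close>

type_synonym riemann = "complex option"

definition sphere_top :: "riemann topology" where
  "sphere_top = Alexandroff_compactification euclidean"

definition riemann_sphere :: "riemann oriented_surface" where
  "riemann_sphere =
     \<lparr>surface_top = sphere_top,
      surface_atlas =
        {(range Some, the),
         (- {Some 0}, \<lambda>x. case x of None \<Rightarrow> 0 | Some z \<Rightarrow> 1 / z)}\<rparr>"

lemma topspace_sphere_top [simp]: "topspace sphere_top = UNIV"
proof -
  have "x = None \<or> x \<in> range Some" for x :: riemann
    by (cases x) auto
  then show ?thesis
    by (auto simp: sphere_top_def)
qed

text \<open>The extension of \<open>p / q\<close> to the sphere, for coprime polynomials \<open>p\<close> and \<open>q\<close>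
  (\<open>q = 0\<close> gives the constant map to infinity).\<close>

definition rational_extension :: "complex poly \<Rightarrow> complex poly \<Rightarrow> riemann \<Rightarrow> riemann" where
  "rational_extension p q x =
     (case x of
        Some z \<Rightarrow> if poly q z = 0 then None else Some (poly p z / poly q z)
      | None \<Rightarrow> if q = 0 \<or> degree q < degree p then None
                else Some (coeff p (degree q) / lead_coeff q))"

definition rational_map :: "(riemann \<Rightarrow> riemann) \<Rightarrow> bool" where
  "rational_map f \<longleftrightarrow> (\<exists>p q. coprime p q \<and> f = rational_extension p q)"


section \<open>Tori\<close>

definition rank2_lattice :: "(real^2) set \<Rightarrow> bool" where
  "rank2_lattice L \<longleftrightarrow>
     (\<exists>a b. a \<noteq> b \<and> independent {a, b} \<and>
            L = {of_int m *\<^sub>R a + of_int n *\<^sub>R b | m n. True})"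

definition torus_proj :: "(real^2) set \<Rightarrow> real^2 \<Rightarrow> (real^2) set" where
  "torus_proj L x = {y. y - x \<in> L}"

definition torus :: "(real^2) set \<Rightarrow> (real^2) set set" where
  "torus L = range (torus_proj L)"

definition torus_top :: "(real^2) set \<Rightarrow> (real^2) set topology" where
  "torus_top L = topology (\<lambda>U. U \<subseteq> torus L \<and> open (torus_proj L -` U))"

lemma openin_torus_top:
  "openin (torus_top L) U \<longleftrightarrow> U \<subseteq> torus L \<and> open (torus_proj L -` U)"
proof -
  have "istopology (\<lambda>U. U \<subseteq> torus L \<and> open (torus_proj L -` U))"
    by (auto simp: istopology_def vimage_Union intro!: open_Int)
  then show ?thesis
    by (simp add: torus_top_def topology_inverse')
qed

lemma topspace_torus_top [simp]: "topspace (torus_top L) = torus L"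
proof
  show "topspace (torus_top L) \<subseteq> torus L"
    by (auto simp: topspace_def openin_torus_top)
  have "torus_proj L -` torus L = UNIV"
    by (auto simp: torus_def)
  then have "openin (torus_top L) (torus L)"
    by (simp add: openin_torus_top)
  then show "torus L \<subseteq> topspace (torus_top L)"
    by (rule openin_subset)
qed

lemma quotient_map_torus_proj: "quotient_map euclidean (torus_top L) (torus_proj L)"
  by (auto simp: quotient_map_def openin_torus_top torus_def vimage_def)

definition oriented_torus :: "(real^2) set \<Rightarrow> (real^2) set oriented_surface" where
  "oriented_torus L =
     \<lparr>surface_top = torus_top L,
      surface_atlas =
        {(torus_proj L ` U, \<lambda>t. let x = inv_into U (torus_proj L) t in Complex (x $ 1) (x $ 2)) | U.
           open U \<and> inj_on (torus_proj L) U}\<rparr>"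

text \<open>\<open>g\<close> is the torus endomorphism induced by the affine map \<open>x \<mapsto> A x + b\<close>.\<close>

definition induces_torus_endomorphism ::
    "(real^2) set \<Rightarrow> real^2^2 \<Rightarrow> real^2 \<Rightarrow> ((real^2) set \<Rightarrow> (real^2) set) \<Rightarrow> bool" where
  "induces_torus_endomorphism L A b g \<longleftrightarrow>
     det A > 0 \<and>
     (\<forall>x y. x - y \<in> L \<longrightarrow> (A *v x + b) - (A *v y + b) \<in> L) \<and>
     (\<forall>x. g (torus_proj L x) = torus_proj L (A *v x + b))"

definition torus_automorphism ::
    "(real^2) set \<Rightarrow> ((real^2) set \<Rightarrow> (real^2) set) \<Rightarrow> bool" where
  "torus_automorphism L g \<longleftrightarrow>
     (\<exists>A b. induces_torus_endomorphism L A b g) \<and> bij_betw g (torus L) (torus L)"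

definition complex_eigenvalue :: "real^2^2 \<Rightarrow> complex \<Rightarrow> bool" where
  "complex_eigenvalue A \<mu> \<longleftrightarrow>
     (\<exists>v :: complex^2. v \<noteq> 0 \<and> (\<chi> i j. complex_of_real (A $ i $ j)) *v v = \<mu> *s v)"

definition induced_by_rigid_action ::
    "(real^2) set \<Rightarrow> 'g monoid \<Rightarrow> ('g \<Rightarrow> (real^2) set \<Rightarrow> (real^2) set) \<Rightarrow>
     ((real^2) set \<Rightarrow> 'b) \<Rightarrow> bool" where
  "induced_by_rigid_action L G \<alpha> \<Theta> \<longleftrightarrow>
     group_action G (torus L) \<alpha> \<and>
     (\<forall>g \<in> carrier G. torus_automorphism L (\<alpha> g)) \<and>
     (\<forall>t \<in> torus L. \<forall>t' \<in> torus L. \<Theta> t = \<Theta> t' \<longleftrightarrow> (\<exists>g \<in> carrier G. t = \<alpha> g t'))"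


section \<open>Lattes maps\<close>

text \<open>Every finite cyclic group is isomorphic to one with integers as elements, so the group may
  be taken of type \<^typ>\<open>int monoid\<close>.\<close>

definition lattes_type_map :: "(real^2) set \<Rightarrow> (riemann \<Rightarrow> riemann) \<Rightarrow> bool" where
  "lattes_type_map L f \<longleftrightarrow>
     (\<exists>A b g \<Theta> (G :: int monoid) \<alpha>.
        induces_torus_endomorphism L A b g \<and>
        (\<forall>\<mu>. complex_eigenvalue A \<mu> \<longrightarrow> cmod \<mu> > 1) \<and>
        branched_cover (oriented_torus L) riemann_sphere \<Theta> \<and>
        finite (carrier G) \<and> cyclic_group G \<and>
        induced_by_rigid_action L G \<alpha> \<Theta> \<and>
        (\<forall>t \<in> torus L. f (\<Theta> t) = \<Theta> (g t)))"

definition lattes_map :: "(real^2) set \<Rightarrow> (riemann \<Rightarrow> riemann) \<Rightarrow> bool" where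
  "lattes_map L f \<longleftrightarrow> lattes_type_map L f \<and> rational_map f"


section \<open>Degree and postcritical points\<close>

definition critical_points :: "(riemann \<Rightarrow> riemann) \<Rightarrow> riemann set" where
  "critical_points f = {p. \<exists>d\<ge>2. has_local_degree riemann_sphere riemann_sphere f p d}"

definition postcritical :: "(riemann \<Rightarrow> riemann) \<Rightarrow> riemann set" where
  "postcritical f = (\<Union>n\<in>{1..}. (f ^^ n) ` critical_points f)"

definition map_degree :: "(riemann \<Rightarrow> riemann) \<Rightarrow> nat" where
  "map_degree f = (THE N. \<forall>q. q \<notin> f ` critical_points f \<longrightarrow> card (f -` {q}) = N)"


section \<open>Tiles and the numbers \<open>D\<^sub>n\<close>\<close>

definition jordan_curve :: "riemann set \<Rightarrow> bool" where
  "jordan_curve C \<longleftrightarrow>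
     subtopology sphere_top C homeomorphic_space top_of_set (sphere (0::complex) 1)"

definition tiles :: "(riemann \<Rightarrow> riemann) \<Rightarrow> riemann set \<Rightarrow> nat \<Rightarrow> riemann set set" where
  "tiles f C n =
     (\<lambda>K. sphere_top closure_of K) `
       connected_components_of (subtopology sphere_top (- ((f ^^ n) -` C)))"

text \<open>With at least two postcritical points on \<open>C\<close>, the closed arcs into which they divide \<open>C\<close>
  are the closures of the components of the complement of these points in \<open>C\<close>.\<close>

definition zero_edges :: "(riemann \<Rightarrow> riemann) \<Rightarrow> riemann set \<Rightarrow> riemann set set" where
  "zero_edges f C =
     (\<lambda>K. sphere_top closure_of K) `
       connected_components_of (subtopology sphere_top (C - postcritical f))"

definition joins_opposite_sides ::
    "(riemann \<Rightarrow> riemann) \<Rightarrow> riemann set \<Rightarrow> riemann set \<Rightarrow> bool" where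
  "joins_opposite_sides f C K \<longleftrightarrow>
     (card (postcritical f) \<ge> 4 \<and>
        (\<exists>e \<in> zero_edges f C. \<exists>e' \<in> zero_edges f C.
           e \<inter> e' = {} \<and> K \<inter> e \<noteq> {} \<and> K \<inter> e' \<noteq> {})) \<or>
     (card (postcritical f) = 3 \<and> (\<forall>e \<in> zero_edges f C. K \<inter> e \<noteq> {}))"

definition D_num :: "(riemann \<Rightarrow> riemann) \<Rightarrow> riemann set \<Rightarrow> nat \<Rightarrow> nat" where
  "D_num f C n =
     (LEAST N. \<exists>X. (\<forall>i\<in>{1..N}. X i \<in> tiles f C n) \<and>
                   connectedin sphere_top (\<Union>i\<in>{1..N}. X i) \<and>
                   joins_opposite_sides f C (\<Union>i\<in>{1..N}. X i))"

end

theory Submission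
  imports Defs "HOL-Computational_Algebra.Fundamental_Theorem_Algebra"
begin

text \<open>Let \<open>T\<close> be the composition of \<open>\<Theta>\<close> with the projection of the plane onto the torus, and let \<open>x \<mapsto> A x + v\<close> be the affine
  map lifting \<open>f\<close>. The postcritical points of \<open>f\<close> are the critical values of \<open>T\<close>, so every component of the complement of
  \<open>C\<close> lifts to sets of bounded diameter, and an \<open>n\<close>-tile lifts to sets of diameter at most a constant times the norm of
  the inverse of \<open>A ^ n\<close>. This norm is at most a constant times \<open>(deg f) ^ (- n / 2)\<close>: as \<open>f ^^ n\<close> has degree
  \<open>(deg f) ^ n\<close>, a length-area argument shows that \<open>A ^ n\<close> has norm \<open>O ((deg f) ^ (n / 2))\<close>, and \<open>deg f \<le> det A\<close>. Finally, a
  connected union of tiles joining opposite sides of \<open>C\<close> meets edges without common point, so some function measuring the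
  distance to an edge between lifts varies on it by at least a fixed amount.\<close>

section \<open>The length-area inequality\<close>

text \<open>Expansion bounds the eigenvalues of \<open>A\<close> from below by 1 and no more. Two
  real eigenvalues of different modulus are compatible with a Lattes-type map, and tiles would then
  shrink too slowly in the weaker direction for the exponent n/2. Rationality of \<open>f\<close>
  must therefore enter quantitatively, and it does so through length and area: no direction grows
  faster than the square root of the degree, so in dimension two none grows more slowly either.
  Since \<open>\<Theta>\<close> is only topological, \<open>T\<close> is never differentiated;
  holomorphic iterates on the sphere are compared with affine iterates in the plane through an
  inverse branch of \<open>T\<close>. The second obstacle is that \<open>C\<close> is an arbitrary
  Jordan curve. The closures of its complementary domains contain critical values, so the covering
  argument reaches only the open domains, whose boundaries may be wild; bounded diameters come from
  cutting each domain into finitely many connected pieces with small lifts. Distances are taken in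
  the plane, where deck transformations are affine with uniformly bounded distortion, instead of in
  a metric on the sphere adapted to \<open>f\<close>.\<close>

definition vec2c :: "real^2 \<Rightarrow> complex" where "vec2c v = Complex (v$1) (v$2)"
definition c2vec :: "complex \<Rightarrow> real^2" where "c2vec z = vector [Re z, Im z]"

lemma vec2c_c2vec [simp]: "vec2c (c2vec z) = z" and c2vec_vec2c [simp]: "c2vec (vec2c v) = v"
  by (simp_all add: vec2c_def c2vec_def vec_eq_iff forall_2 complex_eq_iff)

lemma linear_vec2c: "linear vec2c" and linear_c2vec: "linear c2vec"
  by (auto intro!: linearI simp: vec2c_def c2vec_def vec_eq_iff forall_2 complex_eq_iff)

lemma bounded_linear_vec2c: "bounded_linear vec2c" and bounded_linear_c2vec: "bounded_linear c2vec"
  using linear_conv_bounded_linear linear_vec2c linear_c2vec by blast+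

text \<open>The formula for vector-valued integrands is applied with target \<open>real^1\<close>.
  Both sides are nonnegative integrals so that the identity can afterwards be summed over countably
  many pieces.\<close>

lemma nn_integral_change_of_variables:
  fixes g :: "real^2 \<Rightarrow> real^2" and w :: "real^2 \<Rightarrow> real"
  assumes S: "S \<in> sets lebesgue" and inj: "inj_on g S"
    and der: "\<And>x. x \<in> S \<Longrightarrow> (g has_derivative g' x) (at x within S)"
    and w: "\<And>x. 0 \<le> w x" and int: "integrable lborel w"
  shows "(\<integral>\<^sup>+x. ennreal (\<bar>det (matrix (g' x))\<bar> * w (g x)) * indicator S x \<partial>lborel)
       = (\<integral>\<^sup>+x. ennreal (w x) * indicator (g ` S) x \<partial>lborel)"
proof -
  have meas: "g ` S \<in> sets lebesgue"
    by (rule differentiable_image_in_sets_lebesgue[OF S])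
      (use der in \<open>auto simp: differentiable_on_def differentiable_def\<close>)
  have "w absolutely_integrable_on UNIV"
    using int integrable_completion[of w lborel] by (simp add: set_integrable_def)
  then have wS: "w absolutely_integrable_on (g ` S)"
    by (rule set_integrable_subset) (use meas in auto)
  then have "(\<lambda>x. vec (w x) :: real^1) absolutely_integrable_on (g ` S)"
    by (simp add: absolutely_integrable_on_1_iff)
  then have *: "(\<lambda>x. \<bar>det (matrix (g' x))\<bar> *\<^sub>R (vec (w (g x)) :: real^1)) absolutely_integrable_on S"
    "integral S (\<lambda>x. \<bar>det (matrix (g' x))\<bar> *\<^sub>R (vec (w (g x)) :: real^1)) = integral (g ` S) (\<lambda>x. vec (w x))"
    using has_absolute_integral_change_of_variables[OF S der inj, of "\<lambda>x. vec (w x) :: real^1"] by blast+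
  have "(\<lambda>x. \<bar>det (matrix (g' x))\<bar> * w (g x)) absolutely_integrable_on S"
    using *(1) by (simp add: absolutely_integrable_on_1_iff)
  moreover have "integral S (\<lambda>x. \<bar>det (matrix (g' x))\<bar> * w (g x)) = integral (g ` S) w"
    using arg_cong[OF *(2), of "\<lambda>v::real^1. v $ 1"] calculation wS
    by (simp add: integral_on_1_eq vec_eq_iff o_def)
  ultimately have 1: "((\<lambda>x. \<bar>det (matrix (g' x))\<bar> * w (g x)) has_integral integral (g ` S) w) S"
    by (simp add: has_integral_iff set_lebesgue_integral_eq_integral(1))
  have 2: "(w has_integral integral (g ` S) w) (g ` S)"
    using wS by (simp add: has_integral_iff set_lebesgue_integral_eq_integral(1))
  show ?thesis
    using nn_integral_has_integral_lebesgue'[OF _ 1] nn_integral_has_integral_lebesgue'[OF _ 2] w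
    by simp
qed

text \<open>Multiplication by a complex number is a rotation combined with a scaling, so it
  multiplies areas by the squared modulus.\<close>

lemma det_complex_mult:
  "det (matrix (\<lambda>v. c2vec (d * vec2c v))) = (cmod d)\<^sup>2"
proof -
  have "vec2c (axis 1 1) = 1" "vec2c (axis 2 1) = \<i>"
    by (auto simp: vec2c_def axis_def complex_eq_iff)
  then show ?thesis
    by (simp add: matrix_def det_2 c2vec_def cmod_power2) (simp add: power2_eq_square)
qed

lemma vec_derivative:
  assumes "(G has_field_derivative d) (at (vec2c v))"
  shows "((c2vec \<circ> G \<circ> vec2c) has_derivative (\<lambda>v. c2vec (d * vec2c v))) (at v within S)"
proof -
  have 1: "(vec2c has_derivative vec2c) (at v within S)"
    by (simp add: bounded_linear_imp_has_derivative bounded_linear_vec2c)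
  have 2: "(G has_derivative (*) d) (at (vec2c v) within vec2c ` S)"
    using assms has_derivative_at_withinI has_field_derivative_def by blast
  have 3: "(c2vec has_derivative c2vec) (at ((G \<circ> vec2c) v) within (G \<circ> vec2c) ` S)"
    by (simp add: bounded_linear_imp_has_derivative bounded_linear_c2vec)
  show ?thesis
    using diff_chain_within[OF diff_chain_within[OF 1 2] 3] by (simp add: o_def)
qed

text \<open>Half the density of the spherical metric of curvature 1, equivalently the density for
  the round sphere of radius 1/2. That its square is integrable expresses the finiteness of the area
  of the sphere.\<close>

definition sph :: "complex \<Rightarrow> real" where "sph w = 1 / (1 + (cmod w)\<^sup>2)"

lemma sph_pos: "sph w > 0"
  by (auto simp: sph_def add_pos_nonneg)

section \<open>Tonelli's theorem on the plane and the area of the sphere\<close>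

lemma continuous_on_vec2c [continuous_intros]: "continuous_on S g \<Longrightarrow> continuous_on S (\<lambda>x. vec2c (g x))"
  and continuous_on_c2vec [continuous_intros]: "continuous_on S h \<Longrightarrow> continuous_on S (\<lambda>x. c2vec (h x))"
  using bounded_linear.continuous_on bounded_linear_vec2c bounded_linear_c2vec by blast+

lemma c2vec_Complex: "c2vec (Complex x y) = vector [x, y]"
  by (simp add: c2vec_def)

lemma continuous_on_sph [continuous_intros]: "continuous_on S g \<Longrightarrow> continuous_on S (\<lambda>x. sph (g x))"
  unfolding sph_def by (intro continuous_intros) (auto simp: add_nonneg_eq_0_iff)

lemma measurable_vec2 [measurable]: "(\<lambda>(x,y). vector [x,y] :: real^2) \<in> borel \<rightarrow>\<^sub>M borel"
proof -
  have "continuous_on UNIV (\<lambda>p. c2vec (Complex (fst p) (snd p)))"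
    unfolding Complex_eq by (intro continuous_intros)
  then show ?thesis
    by (simp add: c2vec_Complex case_prod_beta borel_measurable_continuous_onI)
qed

text \<open>Both measures give a box the product of its side lengths, which determines Lebesgue
  measure. This makes Tonelli's theorem available on \<open>real^2\<close>.\<close>

lemma lborel_vec2: "(lborel :: (real^2) measure) = distr (lborel :: (real\<times>real) measure) borel (\<lambda>(x,y). vector [x,y])"
proof (rule lborel_eqI)
  fix l u :: "real^2" assume le: "\<And>b. b \<in> Basis \<Longrightarrow> l \<bullet> b \<le> u \<bullet> b"
  have l: "l $ i \<le> u $ i" for i
    using le[of "axis i 1"] by (simp add: inner_axis axis_in_Basis_iff)
  have eq: "(\<lambda>(x,y). vector [x,y] :: real^2) -` box l u = {l$1<..<u$1} \<times> {l$2<..<u$2}"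
    by (auto simp: mem_box_cart forall_2)
  have "emeasure (distr lborel borel (\<lambda>(x,y). vector [x,y])) (box l u) =
     emeasure (lborel \<Otimes>\<^sub>M lborel) ({l$1<..<u$1} \<times> {l$2<..<u$2})"
    by (subst emeasure_distr) (auto simp: eq lborel_prod)
  also have "\<dots> = ennreal (u$1 - l$1) * ennreal (u$2 - l$2)"
    using l by (subst lborel.emeasure_pair_measure_Times) auto
  also have "\<dots> = ennreal ((u$1 - l$1) * (u$2 - l$2))"
    using l by (simp add: ennreal_mult)
  also have "(u$1 - l$1) * (u$2 - l$2) = (\<Prod>i\<in>UNIV. (u - l) \<bullet> axis i 1)"
    by (simp add: UNIV_2 inner_axis)
  also have "\<dots> = (\<Prod>b\<in>Basis. (u - l) \<bullet> b)"
  proof -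
    have "(Basis :: (real^2) set) = (\<lambda>i. axis i 1) ` UNIV"
      by (auto simp: Basis_vec_def)
    moreover have "inj (\<lambda>i::2. axis i (1::real))"
      by (auto intro!: injI simp: axis_eq_axis)
    ultimately show ?thesis
      using prod.reindex[of "\<lambda>i::2. axis i (1::real)" UNIV "\<lambda>b. (u - l) \<bullet> b"] by (simp only: o_def)
  qed
  finally show "emeasure (distr lborel borel (\<lambda>(x,y). vector [x,y])) (box l u) = (\<Prod>b\<in>Basis. (u - l) \<bullet> b)" .
qed auto

lemma nn_integral_vec2:
  fixes f :: "real^2 \<Rightarrow> ennreal"
  assumes [measurable]: "f \<in> borel_measurable borel"
  shows "(\<integral>\<^sup>+v. f v \<partial>lborel) = (\<integral>\<^sup>+y. \<integral>\<^sup>+x. f (vector [x,y]) \<partial>lborel \<partial>lborel)"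
proof -
  have "(\<integral>\<^sup>+v. f v \<partial>lborel) = (\<integral>\<^sup>+p. f ((\<lambda>(x,y). vector [x,y]) p) \<partial>(lborel :: (real\<times>real) measure))"
    by (subst lborel_vec2, subst nn_integral_distr) auto
  also have "\<dots> = (\<integral>\<^sup>+p. f ((\<lambda>(x,y). vector [x,y]) p) \<partial>(lborel \<Otimes>\<^sub>M lborel))"
    by (simp add: lborel_prod)
  also have "\<dots> = (\<integral>\<^sup>+y. \<integral>\<^sup>+x. f (vector [x,y]) \<partial>lborel \<partial>lborel)"
    by (subst lborel_pair.nn_integral_snd[symmetric]) (auto simp: lborel_prod)
  finally show ?thesis .
qed

text \<open>Since (1 + x^2 + y^2)^2 is at least (1 + x^2)(1 + y^2), the integrand is dominated by a
  product of two derivatives of \<open>arctan\<close>.\<close>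

lemma integrable_sph: "integrable lborel (\<lambda>v. (sph (vec2c v))\<^sup>2)"
proof (rule integrableI_nonneg)
  have "continuous_on UNIV (\<lambda>v. (sph (vec2c v))\<^sup>2)"
    by (intro continuous_intros)
  then have [measurable]: "(\<lambda>v. (sph (vec2c v))\<^sup>2) \<in> borel_measurable borel"
    by (rule borel_measurable_continuous_onI)
  then show "(\<lambda>v. (sph (vec2c v))\<^sup>2) \<in> borel_measurable lborel" by simp
  have [measurable]: "(\<lambda>x::real. inverse (1 + x\<^sup>2)) \<in> borel_measurable borel"
    by measurable
  have *: "(\<integral>\<^sup>+x. ennreal (inverse (1 + x\<^sup>2)) \<partial>lborel) < \<infinity>"
  proof -
    have "set_integrable lborel (einterval (-\<infinity>) \<infinity>) (\<lambda>x::real. inverse (1 + x\<^sup>2))"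
    proof (rule interval_integral_FTC_nonneg(1)[where F = arctan])
      show "((arctan \<circ> real_of_ereal) \<longlongrightarrow> -(pi/2)) (at_right (-\<infinity>))"
        unfolding ereal_tendsto_simps using tendsto_arctan_at_bot by (simp add: o_def)
      show "((arctan \<circ> real_of_ereal) \<longlongrightarrow> pi/2) (at_left \<infinity>)"
        unfolding ereal_tendsto_simps using tendsto_arctan_at_top by (simp add: o_def)
      show "DERIV arctan x :> inverse (1 + x\<^sup>2)" for x by (rule DERIV_arctan)
      show "isCont (\<lambda>x. inverse (1 + x\<^sup>2)) x" for x :: real
        by (intro continuous_intros) (auto simp: add_nonneg_eq_0_iff)
    qed (auto simp: add_nonneg_nonneg)
    then show ?thesis
      by (simp add: set_integrable_def einterval_def integrable_iff_bounded abs_inverse)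
  qed
  have "(\<integral>\<^sup>+v. ennreal ((sph (vec2c v))\<^sup>2) \<partial>lborel) = (\<integral>\<^sup>+y. \<integral>\<^sup>+x. ennreal ((sph (Complex x y))\<^sup>2) \<partial>lborel \<partial>lborel)"
    by (subst nn_integral_vec2) (measurable, simp add: vec2c_def)
  also have "\<dots> \<le> (\<integral>\<^sup>+y. \<integral>\<^sup>+x. ennreal (inverse (1 + y\<^sup>2)) * ennreal (inverse (1 + x\<^sup>2)) \<partial>lborel \<partial>lborel)"
  proof (intro nn_integral_mono)
    fix x y :: real
    have pos: "(1 + x\<^sup>2) > 0" "(1 + y\<^sup>2) > 0" by (auto simp: add_pos_nonneg)
    have "(1 + y\<^sup>2) * (1 + x\<^sup>2) \<le> (1 + (x\<^sup>2 + y\<^sup>2))\<^sup>2"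
    proof -
      have "(1 + (x\<^sup>2 + y\<^sup>2))\<^sup>2 - (1 + y\<^sup>2) * (1 + x\<^sup>2) = x\<^sup>2 + y\<^sup>2 + (x\<^sup>2)\<^sup>2 + x\<^sup>2 * y\<^sup>2 + (y\<^sup>2)\<^sup>2"
        by algebra
      also have "\<dots> \<ge> 0" by (intro add_nonneg_nonneg mult_nonneg_nonneg zero_le_power2)
      finally show ?thesis by linarith
    qed
    then have "inverse ((1 + (x\<^sup>2 + y\<^sup>2))\<^sup>2) \<le> inverse ((1 + y\<^sup>2) * (1 + x\<^sup>2))"
      using pos by (intro le_imp_inverse_le) auto
    then have "(sph (Complex x y))\<^sup>2 \<le> inverse (1 + y\<^sup>2) * inverse (1 + x\<^sup>2)"
      by (simp add: sph_def cmod_power2 power_divide field_simps)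
    then show "ennreal ((sph (Complex x y))\<^sup>2) \<le> ennreal (inverse (1 + y\<^sup>2)) * ennreal (inverse (1 + x\<^sup>2))"
      using pos by (simp flip: ennreal_mult)
  qed
  also have "\<dots> = (\<integral>\<^sup>+x. ennreal (inverse (1 + x\<^sup>2)) \<partial>lborel) * (\<integral>\<^sup>+x. ennreal (inverse (1 + x\<^sup>2)) \<partial>lborel)"
    by (simp add: nn_integral_cmult nn_integral_multc)
  also have "\<dots> < \<infinity>"
    using * by (simp add: ennreal_mult_less_top)
  finally show "(\<integral>\<^sup>+v. ennreal ((sph (vec2c v))\<^sup>2) \<partial>lborel) < \<infinity>" .
qed auto

text \<open>The left side is the spherical area of the image counted with multiplicity. Zeros of the
  derivative contribute nothing, because the integrand vanishes there; the remaining open set is cut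
  into countably many disjoint pieces on which the map is injective, and the change of variables
  applies to each. A value is hit by at most \<open>M\<close> pieces.\<close>

lemma area_bound:
  assumes U: "open U" and G: "G holomorphic_on U"
    and fin: "\<And>w. finite {z\<in>U. G z = w} \<and> card {z\<in>U. G z = w} \<le> M"
  shows "(\<integral>\<^sup>+v. ennreal ((cmod (deriv G (vec2c v)) * sph (G (vec2c v)))\<^sup>2) * indicator (vec2c -` U) v \<partial>lborel)
     \<le> of_nat M * (\<integral>\<^sup>+v. ennreal ((sph (vec2c v))\<^sup>2) \<partial>lborel)"
proof -
  define g where "g = c2vec \<circ> G \<circ> vec2c"
  define w where "w v = (sph (vec2c v))\<^sup>2" for v
  define g' where "g' v = (\<lambda>u. c2vec (deriv G (vec2c v) * vec2c u))" for v
  define \<rho> where "\<rho> v = (cmod (deriv G (vec2c v)) * sph (G (vec2c v)))\<^sup>2" for v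
  define X where "X = vec2c -` U"
  have X: "open X"
    unfolding X_def using U by (intro continuous_open_vimage) (auto intro: linear_continuous_at bounded_linear_vec2c)
  have X'_eq: "{v\<in>X. deriv G (vec2c v) \<noteq> 0} = X \<inter> vec2c -` {z\<in>U. deriv G z \<in> -{0}}"
    by (auto simp: X_def)
  have U': "open {z\<in>U. deriv G z \<in> -{0}}"
    using continuous_open_preimage[OF holomorphic_on_imp_continuous_on[OF holomorphic_deriv[OF G U]] U, of "-{0}"]
    by (simp add: Int_def vimage_def open_Compl)
  have "\<exists>W. open W \<and> v \<in> W \<and> W \<subseteq> X \<and> inj_on g W" if "v \<in> X" "deriv G (vec2c v) \<noteq> 0" for v
  proof -
    have "vec2c v \<in> U" using that(1) by (simp add: X_def)
    then obtain r where r: "r > 0" "ball (vec2c v) r \<subseteq> U" "inj_on G (ball (vec2c v) r)"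
      using has_complex_derivative_locally_injective[OF G _ U \<open>deriv G (vec2c v) \<noteq> 0\<close>] by blast
    have "open (vec2c -` ball (vec2c v) r)"
      by (intro continuous_open_vimage) (auto intro: linear_continuous_at bounded_linear_vec2c)
    moreover have "inj_on g (vec2c -` ball (vec2c v) r)"
    proof (rule inj_onI)
      fix x y assume "x \<in> vec2c -` ball (vec2c v) r" "y \<in> vec2c -` ball (vec2c v) r" "g x = g y"
      then have "vec2c x = vec2c y"
        using r(3) unfolding g_def o_def by (metis inj_onD vec2c_c2vec vimageE)
      then show "x = y" by (metis c2vec_vec2c)
    qed
    ultimately show ?thesis
      using r by (intro exI[of _ "vec2c -` ball (vec2c v) r"]) (auto simp: X_def)
  qed
  then obtain Ob where Ob: "\<And>v. v \<in> X \<Longrightarrow> deriv G (vec2c v) \<noteq> 0 \<Longrightarrow> open (Ob v) \<and> v \<in> Ob v \<and> Ob v \<subseteq> X \<and> inj_on g (Ob v)"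
    by metis
  define X' where "X' = {v\<in>X. deriv G (vec2c v) \<noteq> 0}"
  obtain \<B> where \<B>: "\<B> \<subseteq> insert {} (Ob ` X')" "countable \<B>" "\<Union>\<B> = \<Union>(insert {} (Ob ` X'))"
    using Lindelof[of "insert {} (Ob ` X')"] Ob by (auto simp: X'_def)
  \<comment> \<open>Inserting the empty set makes the countable family nonempty, so that it can be
    enumerated by all natural numbers.\<close>
  define e where "e = from_nat_into (insert {} \<B>)"
  have e_in: "e i \<in> insert {} (Ob ` X')" for i
    using \<B>(1) from_nat_into[of "insert {} \<B>" i] by (auto simp: e_def)
  have "range e = insert {} \<B>"
    unfolding e_def using \<B>(2) by (intro range_from_nat_into) auto
  then have e_Un: "X' \<subseteq> (\<Union>i. e i)"
    using \<B>(3) Ob by (auto simp: X'_def)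
  define D where "D i = disjointed e i \<inter> X'" for i
  have X': "open X'"
    unfolding X'_def X'_eq using X U'
    by (intro open_Int continuous_open_vimage) (auto intro: linear_continuous_at bounded_linear_vec2c)
  have e_open: "open (e i)" "inj_on g (e i)" "e i \<subseteq> X" for i
    using e_in[of i] Ob by (auto simp: X'_def)
  have D_sets: "D i \<in> sets borel" for i
  proof -
    have "range (disjointed e) \<subseteq> sets borel"
      by (rule sets.range_disjointed_sets) (use e_open in auto)
    then show ?thesis unfolding D_def using X' by (intro sets.Int) auto
  qed
  have D_disj: "disjoint_family D"
    using disjoint_family_disjointed[of e] by (auto simp: disjoint_family_on_def D_def)
  have D_Un: "(\<Union>i. D i) = X'"
    using e_Un UN_disjointed_eq[of e] by (auto simp: D_def)
  have D_inj: "inj_on g (D i)" for i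
    by (rule inj_on_subset[OF e_open(2)[of i]]) (use disjointed_subset[of e i] in \<open>auto simp: D_def\<close>)
  have der: "(g has_derivative g' v) (at v within S)" if "v \<in> X" for v S
  proof -
    have "(G has_field_derivative deriv G (vec2c v)) (at (vec2c v))"
      using G U that unfolding X_def by (auto intro: holomorphic_derivI)
    then show ?thesis unfolding g_def g'_def by (rule vec_derivative)
  qed
  have \<rho>_eq: "\<rho> v = \<bar>det (matrix (g' v))\<bar> * w (g v)" for v
    by (simp add: \<rho>_def g'_def det_complex_mult w_def g_def power_mult_distrib)
  have piece: "(\<integral>\<^sup>+v. ennreal (\<rho> v) * indicator (D i) v \<partial>lborel) = (\<integral>\<^sup>+v. ennreal (w v) * indicator (g ` D i) v \<partial>lborel)" for i
    unfolding \<rho>_eq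
    by (rule nn_integral_change_of_variables[OF _ D_inj der])
      (use D_sets[of i] integrable_sph in \<open>auto simp: w_def[abs_def] D_def X'_def\<close>)
  have gD: "g ` D i \<in> sets lebesgue" for i
    by (rule differentiable_image_in_sets_lebesgue)
      (use D_sets[of i] der in \<open>auto simp: differentiable_on_def differentiable_def D_def X'_def\<close>)
  have w_meas: "w \<in> borel_measurable lborel"
    using borel_measurable_integrable[OF integrable_sph] by (simp add: w_def[abs_def])
  have \<rho>_meas: "(\<lambda>v. ennreal (\<rho> v) * indicator (D i) v) \<in> borel_measurable lborel" for i
  proof -
    have "continuous_on X \<rho>"
      unfolding \<rho>_def
      by (intro continuous_intros continuous_on_compose2[OF holomorphic_on_imp_continuous_on[OF G]]
          continuous_on_compose2[OF holomorphic_on_imp_continuous_on[OF holomorphic_deriv[OF G U]]])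
        (auto simp: X_def)
    then have "(\<lambda>v. indicator X v *\<^sub>R \<rho> v) \<in> borel_measurable borel"
      using borel_measurable_continuous_on_indicator[of X \<rho>] X by auto
    then have "(\<lambda>v. ennreal (indicator X v *\<^sub>R \<rho> v) * indicator (D i) v) \<in> borel_measurable borel"
      using D_sets[of i] by measurable
    also have "(\<lambda>v. ennreal (indicator X v *\<^sub>R \<rho> v) * indicator (D i) v) = (\<lambda>v. ennreal (\<rho> v) * indicator (D i) v)"
      by (auto simp: fun_eq_iff indicator_def D_def X'_def)
    finally show ?thesis by simp
  qed
  \<comment> \<open>The pieces are disjoint, so choosing a preimage of \<open>v\<close> in each
    piece whose image contains \<open>v\<close> injects the set of these indices into a fibre of
    \<open>G\<close>.\<close>
  have count: "(\<Sum>i. indicator (g ` D i) v :: ennreal) \<le> of_nat M" for v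
  proof -
    define J where "J = {i. v \<in> g ` D i}"
    define h where "h i = (SOME u. u \<in> D i \<and> g u = v)" for i
    have h: "h i \<in> D i \<and> g (h i) = v" if "i \<in> J" for i
    proof -
      have "\<exists>u. u \<in> D i \<and> g u = v" using that by (auto simp: J_def)
      then show ?thesis unfolding h_def by (rule someI_ex)
    qed
    have injh: "inj_on (vec2c \<circ> h) J"
    proof (rule inj_onI)
      fix i j assume ij: "i \<in> J" "j \<in> J" "(vec2c \<circ> h) i = (vec2c \<circ> h) j"
      then have "h i = h j" by (metis c2vec_vec2c comp_apply)
      then show "i = j" using h[OF ij(1)] h[OF ij(2)] D_disj by (auto simp: disjoint_family_on_def)
    qed
    have subh: "(vec2c \<circ> h) ` J \<subseteq> {z\<in>U. G z = vec2c v}"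
    proof
      fix z assume "z \<in> (vec2c \<circ> h) ` J"
      then obtain i where i: "i \<in> J" "z = vec2c (h i)" by auto
      have "h i \<in> X" "g (h i) = v" using h[OF i(1)] by (auto simp: D_def X'_def)
      then show "z \<in> {z\<in>U. G z = vec2c v}" using i by (auto simp: X_def g_def)
    qed
    have fin_v: "finite {z\<in>U. G z = vec2c v}" "card {z\<in>U. G z = vec2c v} \<le> M"
      using fin[of "vec2c v"] by blast+
    have J: "finite J" "card J \<le> M"
      using inj_on_finite[OF injh subh fin_v(1)] card_inj_on_le[OF injh subh fin_v(1)] fin_v(2) by linarith+
    have "(\<Sum>i. indicator (g ` D i) v :: ennreal) = (\<Sum>i\<in>J. indicator (g ` D i) v)"
      using J(1) by (intro suminf_finite) (auto simp: J_def)
    also have "\<dots> = (\<Sum>i\<in>J. 1)"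
      by (intro sum.cong) (auto simp: J_def)
    also have "\<dots> \<le> of_nat M" using J(2) by simp
    finally show ?thesis .
  qed
  have "(\<integral>\<^sup>+v. ennreal (\<rho> v) * indicator X v \<partial>lborel) = (\<integral>\<^sup>+v. (\<Sum>i. ennreal (\<rho> v) * indicator (D i) v) \<partial>lborel)"
  proof (intro nn_integral_cong)
    fix v
    have "(\<Sum>i. ennreal (\<rho> v) * indicator (D i) v) = ennreal (\<rho> v) * indicator X' v"
      using suminf_indicator[OF D_disj, of v] D_Un by (simp add: ennreal_suminf_cmult)
    also have "\<dots> = ennreal (\<rho> v) * indicator X v"
      by (auto simp: indicator_def X'_def \<rho>_def)
    finally show "ennreal (\<rho> v) * indicator X v = (\<Sum>i. ennreal (\<rho> v) * indicator (D i) v)" by simp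
  qed
  also have "\<dots> = (\<Sum>i. \<integral>\<^sup>+v. ennreal (\<rho> v) * indicator (D i) v \<partial>lborel)"
    by (rule nn_integral_suminf) (rule \<rho>_meas)
  \<comment> \<open>The images of the pieces are known only to be Lebesgue measurable, hence the
    passage to the completed measure.\<close>
  also have "\<dots> = (\<Sum>i. \<integral>\<^sup>+v. ennreal (w v) * indicator (g ` D i) v \<partial>lebesgue)"
    by (simp add: piece nn_integral_completion)
  also have "\<dots> = (\<integral>\<^sup>+v. (\<Sum>i. ennreal (w v) * indicator (g ` D i) v) \<partial>lebesgue)"
  proof (rule nn_integral_suminf[symmetric])
    fix i
    have [measurable]: "w \<in> borel_measurable lebesgue" "g ` D i \<in> sets lebesgue"
      using w_meas gD[of i] by (auto intro: measurable_completion)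
    show "(\<lambda>v. ennreal (w v) * indicator (g ` D i) v) \<in> borel_measurable lebesgue"
      by measurable
  qed
  also have "\<dots> \<le> (\<integral>\<^sup>+v. of_nat M * ennreal (w v) \<partial>lebesgue)"
  proof (intro nn_integral_mono)
    fix v
    show "(\<Sum>i. ennreal (w v) * indicator (g ` D i) v) \<le> of_nat M * ennreal (w v)"
      using mult_left_mono[OF count[of v], of "ennreal (w v)"] by (simp add: ennreal_suminf_cmult mult.commute)
  qed
  also have "\<dots> = of_nat M * (\<integral>\<^sup>+v. ennreal (w v) \<partial>lborel)"
    using w_meas by (simp add: nn_integral_completion nn_integral_cmult)
  finally show ?thesis by (simp add: \<rho>_def w_def X_def)
qed

text \<open>The Cauchy-Schwarz inequality against the constant 1, obtained by integrating 2 \<rho>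
  \<le> t \<rho>^2 + 1/t; the chosen \<open>t\<close> minimizes the resulting bound.\<close>

lemma integral_le_of_square:
  fixes \<rho> :: "real \<Rightarrow> real"
  assumes ab: "a < b" and cont: "continuous_on {a..b} \<rho>" and Q: "Q > 0" "integral {a..b} (\<lambda>x. (\<rho> x)\<^sup>2) \<le> Q"
  shows "integral {a..b} \<rho> \<le> sqrt ((b - a) * Q)"
proof -
  define t where "t = sqrt ((b - a) / Q)"
  have t: "t > 0" "t\<^sup>2 = (b - a) / Q" using ab Q by (auto simp: t_def)
  have "2 * \<rho> x \<le> t * (\<rho> x)\<^sup>2 + 1 / t" for x
  proof -
    have "0 \<le> (t * \<rho> x - 1)\<^sup>2 / t" using t by simp
    also have "\<dots> = t * (\<rho> x)\<^sup>2 + 1 / t - 2 * \<rho> x"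
      using t(1) by (simp add: field_simps power2_eq_square)
    finally show ?thesis by simp
  qed
  then have "integral {a..b} (\<lambda>x. 2 * \<rho> x) \<le> integral {a..b} (\<lambda>x. t * (\<rho> x)\<^sup>2 + 1 / t)"
    by (intro integral_le integrable_continuous_real continuous_intros cont) auto
  also have "\<dots> = t * integral {a..b} (\<lambda>x. (\<rho> x)\<^sup>2) + (b - a) / t"
    using ab by (subst Henstock_Kurzweil_Integration.integral_add)
      (auto intro!: integrable_continuous_real continuous_intros cont)
  also have "\<dots> \<le> t * Q + (b - a) / t"
    using t Q by (intro add_right_mono mult_left_mono) auto
  also have "t * Q + (b - a) / t = 2 * sqrt ((b - a) * Q)"
  proof -
    have "sqrt ((b - a) * Q) = t * Q"
    proof (rule real_sqrt_unique)
      have "(t * Q)\<^sup>2 = t\<^sup>2 * Q\<^sup>2" by (rule power_mult_distrib)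
      also have "\<dots> = (b - a) * Q" using t(2) Q by (simp add: power2_eq_square[of Q])
      finally show "(t * Q)\<^sup>2 = (b - a) * Q" .
    qed (use t Q in simp)
    moreover have "(b - a) / t = t * Q"
    proof -
      have "(b - a) / t = t\<^sup>2 * Q / t" using t(2) Q by simp
      also have "\<dots> = t * Q" using t(1) by (simp add: power2_eq_square)
      finally show ?thesis .
    qed
    ultimately show ?thesis by simp
  qed
  finally show ?thesis by simp
qed

text \<open>Averaging over heights: if the integral of the squared density exceeded \<open>Q\<close>
  on every segment, Tonelli would give the rectangle a larger image area than
  \<open>area_bound\<close> allows. The constant \<open>K\<close> is one more than the integral of
  the square of \<open>sph\<close>, the same for all functions, rectangles and \<open>M\<close>. The
  finite set \<open>F\<close> accommodates the poles of iterates, and the segment found avoids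
  it.\<close>

lemma length_area_rectangle:
  obtains K where "K > 0"
    "\<And>U F G M a b c d. open U \<Longrightarrow> finite F \<Longrightarrow> G holomorphic_on U - F \<Longrightarrow>
      (\<And>w. finite {z\<in>U-F. G z = w} \<and> card {z\<in>U-F. G z = w} \<le> M) \<Longrightarrow> M \<ge> 1 \<Longrightarrow> a < b \<Longrightarrow> c < d \<Longrightarrow>
      (\<And>x y. x \<in> {a..b} \<Longrightarrow> y \<in> {c..d} \<Longrightarrow> Complex x y \<in> U) \<Longrightarrow>
      \<exists>y\<in>{c..d}. (\<forall>x\<in>{a..b}. Complex x y \<notin> F) \<and>
        integral {a..b} (\<lambda>x. cmod (deriv G (Complex x y)) * sph (G (Complex x y))) \<le> sqrt ((b - a) / (d - c) * real M * K)"
proof -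
  define K0 where "K0 = (\<integral>\<^sup>+v. ennreal ((sph (vec2c v))\<^sup>2) \<partial>lborel)"
  have "K0 < \<infinity>"
    using integrable_sph by (simp add: K0_def integrable_iff_bounded)
  then obtain k where k: "K0 = ennreal k" "k \<ge> 0" by (cases K0) auto
  show thesis
  proof (rule that[of "k + 1"])
    show "k + 1 > 0" using k by simp
    fix U F and G :: "complex \<Rightarrow> complex" and M :: nat and a b c d :: real
    assume U: "open U" and F: "finite F" and G: "G holomorphic_on U - F"
      and fin: "\<And>w. finite {z\<in>U-F. G z = w} \<and> card {z\<in>U-F. G z = w} \<le> M" and M: "M \<ge> 1"
      and ab: "a < b" and cd: "c < d" and sub: "\<And>x y. x \<in> {a..b} \<Longrightarrow> y \<in> {c..d} \<Longrightarrow> Complex x y \<in> U"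
    have UF: "open (U - F)" using U F by (simp add: finite_imp_closed open_Diff)
    define \<rho> where "\<rho> z = cmod (deriv G z) * sph (G z)" for z
    have \<rho>_cont: "continuous_on (U - F) \<rho>"
      unfolding \<rho>_def
      by (intro continuous_intros holomorphic_on_imp_continuous_on[OF G] holomorphic_on_imp_continuous_on[OF holomorphic_deriv[OF G UF]])
    \<comment> \<open>Chosen so that \<open>Q\<close> times the height d - c is M (k + 1), strictly
      above the area bound M k.\<close>
    define Q where "Q = real M * (k + 1) / (d - c)"
    have Q: "Q > 0" using M k cd by (auto simp: Q_def)
    \<comment> \<open>Only finitely many heights meet \<open>F\<close>, so leaving them out does not
      change the measure.\<close>
    define good where "good = {c..d} - Im ` F"
    have \<rho>_seg: "continuous_on {a..b} (\<lambda>x. \<rho> (Complex x y))" if "y \<in> good" for y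
    proof (rule continuous_on_compose2[OF \<rho>_cont])
      show "continuous_on {a..b} (\<lambda>x. Complex x y)"
        unfolding Complex_eq by (intro continuous_intros)
      show "(\<lambda>x. Complex x y) ` {a..b} \<subseteq> U - F"
        using sub that by (force simp: good_def)
    qed
    have "\<exists>y\<in>good. integral {a..b} (\<lambda>x. (\<rho> (Complex x y))\<^sup>2) \<le> Q"
    proof (rule ccontr)
      assume "\<not> ?thesis"
      then have neg: "integral {a..b} (\<lambda>x. (\<rho> (Complex x y))\<^sup>2) > Q" if "y \<in> good" for y
        using that by force
      let ?f = "\<lambda>v. ennreal ((\<rho> (vec2c v))\<^sup>2) * indicator (vec2c -` (U - F)) v"
      have X: "open (vec2c -` (U - F))"
        using UF by (intro continuous_open_vimage) (auto intro: linear_continuous_at bounded_linear_vec2c)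
      have "continuous_on (vec2c -` (U - F)) (\<lambda>v. (\<rho> (vec2c v))\<^sup>2)"
        by (intro continuous_intros continuous_on_compose2[OF \<rho>_cont]) auto
      then have "(\<lambda>v. ennreal (indicator (vec2c -` (U - F)) v *\<^sub>R (\<rho> (vec2c v))\<^sup>2)) \<in> borel_measurable borel"
        using X by (intro measurable_compose[OF borel_measurable_continuous_on_indicator measurable_ennreal]) auto
      also have "(\<lambda>v. ennreal (indicator (vec2c -` (U - F)) v *\<^sub>R (\<rho> (vec2c v))\<^sup>2)) = ?f"
        by (auto simp: fun_eq_iff indicator_def)
      finally have f_meas: "?f \<in> borel_measurable borel" .
      have inner: "(\<integral>\<^sup>+x. ?f (vector [x,y]) \<partial>lborel) \<ge> ennreal Q" if y: "y \<in> good" for y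
      proof -
        have "(\<integral>\<^sup>+x. ennreal ((\<rho> (Complex x y))\<^sup>2) * indicator {a..b} x \<partial>lborel) = ennreal (integral {a..b} (\<lambda>x. (\<rho> (Complex x y))\<^sup>2))"
          by (rule nn_integral_has_integral_lebesgue')
            (use \<rho>_seg[OF y] in \<open>auto intro!: integrable_integral integrable_continuous_real continuous_intros\<close>)
        also have "\<dots> \<ge> ennreal Q" using neg[OF y] by (intro ennreal_leI) simp
        finally have "ennreal Q \<le> (\<integral>\<^sup>+x. ennreal ((\<rho> (Complex x y))\<^sup>2) * indicator {a..b} x \<partial>lborel)" .
        also have "\<dots> \<le> (\<integral>\<^sup>+x. ?f (vector [x,y]) \<partial>lborel)"
        proof (intro nn_integral_mono)
          fix x
          have "vector [x,y] \<in> vec2c -` (U - F)" if "x \<in> {a..b}"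
            using sub[OF that, of y] y by (force simp: good_def vec2c_def)
          then show "ennreal ((\<rho> (Complex x y))\<^sup>2) * indicator {a..b} x \<le> ?f (vector [x,y])"
            by (auto simp: indicator_def vec2c_def)
        qed
        finally show ?thesis .
      qed
      have "closed (Im ` F)" using F by (simp add: finite_imp_closed)
      then have good_sets: "good \<in> sets borel" unfolding good_def by (intro sets.Diff) auto
      have "ennreal (real M * (k + 1)) = ennreal Q * ennreal (d - c)"
        using cd Q by (simp add: Q_def flip: ennreal_mult)
      also have "\<dots> = ennreal Q * emeasure lborel good"
      proof -
        have "emeasure lborel good = emeasure lborel {c..d}"
          unfolding good_def
          by (rule emeasure_Diff_null_set) (use F in \<open>auto intro!: finite_imp_null_set_lborel\<close>)
        then show ?thesis using cd by simp
      qed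
      also have "\<dots> = (\<integral>\<^sup>+y. ennreal Q * indicator good y \<partial>lborel)"
        using good_sets by (intro nn_integral_cmult_indicator[symmetric]) auto
      also have "\<dots> \<le> (\<integral>\<^sup>+y. \<integral>\<^sup>+x. ?f (vector [x,y]) \<partial>lborel \<partial>lborel)"
        by (intro nn_integral_mono) (use inner in \<open>auto simp: indicator_def\<close>)
      also have "\<dots> = (\<integral>\<^sup>+v. ?f v \<partial>lborel)"
        using nn_integral_vec2[OF f_meas] by simp
      also have "\<dots> \<le> of_nat M * K0"
        using area_bound[OF UF G fin] by (simp add: \<rho>_def K0_def)
      also have "\<dots> = ennreal (real M * k)"
        using k by (simp add: ennreal_mult ennreal_of_nat_eq_real_of_nat)
      finally have "real M * (k + 1) \<le> real M * k"
        using k by (subst (asm) ennreal_le_iff) auto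
      then show False using M by simp
    qed
    then obtain y where y: "y \<in> good" "integral {a..b} (\<lambda>x. (\<rho> (Complex x y))\<^sup>2) \<le> Q" by blast
    have "integral {a..b} (\<lambda>x. \<rho> (Complex x y)) \<le> sqrt ((b - a) * Q)"
      by (rule integral_le_of_square[OF ab \<rho>_seg[OF y(1)] Q y(2)])
    also have "(b - a) * Q = (b - a) / (d - c) * real M * (k + 1)" by (simp add: Q_def)
    finally show "\<exists>y\<in>{c..d}. (\<forall>x\<in>{a..b}. Complex x y \<notin> F) \<and>
        integral {a..b} (\<lambda>x. cmod (deriv G (Complex x y)) * sph (G (Complex x y))) \<le> sqrt ((b - a) / (d - c) * real M * (k + 1))"
      using y(1) by (intro bexI[of _ y]) (force simp: \<rho>_def good_def)+
  qed
qed

section \<open>Complementary domains of planar Jordan curves\<close>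

text \<open>By connectedness the distance to \<open>g x\<close> takes every value from 0 to its
  value at \<open>y\<close>, and on each piece it stays in an interval of length \<rho>; the claim
  follows by comparing Lebesgue measures. It is applied to tiles, to pieces of a domain and to level
  bands of a length function.\<close>

lemma connected_cover_dist_bound:
  fixes g :: "'a \<Rightarrow> 'b::metric_space"
  assumes S: "connected (g ` S)"
    and I: "finite I" "S \<subseteq> (\<Union>i\<in>I. B i)"
    and diam: "\<And>i x y. i \<in> I \<Longrightarrow> x \<in> S \<inter> B i \<Longrightarrow> y \<in> S \<inter> B i \<Longrightarrow> dist (g x) (g y) \<le> \<rho>"
    and xy: "x \<in> S" "y \<in> S"
  shows "dist (g x) (g y) \<le> real (card I) * \<rho>"
proof -
  define h where "h z = dist (g x) (g z)" for z
  define J where "J = {i\<in>I. S \<inter> B i \<noteq> {}}"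
  have rho: "\<rho> \<ge> 0"
  proof -
    obtain i where "i \<in> I" "x \<in> B i" using I xy by auto
    then show ?thesis using diam[of i x x] xy by auto
  qed
  define l where "l i = Inf (h ` (S \<inter> B i))" for i
  have bdd: "bdd_below (h ` (S \<inter> B i))" for i
    by (rule bdd_belowI[of _ 0]) (auto simp: h_def)
  have l: "l i \<le> h z \<and> h z \<le> l i + \<rho>" if "i \<in> J" "z \<in> S \<inter> B i" for i z
  proof
    show "l i \<le> h z" unfolding l_def using that bdd by (intro cInf_lower) auto
    have "h z - \<rho> \<le> l i" unfolding l_def
    proof (rule cInf_greatest)
      show "h ` (S \<inter> B i) \<noteq> {}" using that by auto
      fix r assume "r \<in> h ` (S \<inter> B i)"
      then obtain u where u: "u \<in> S \<inter> B i" "r = h u" by auto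
      have "dist (g z) (g u) \<le> \<rho>" using diam that u by (auto simp: J_def)
      then show "h z - \<rho> \<le> r"
        using dist_triangle[of "g x" "g z" "g u"] u by (simp add: h_def dist_commute)
    qed
    then show "h z \<le> l i + \<rho>" by simp
  qed
  have "connected ((\<lambda>v. dist (g x) v) ` g ` S)"
    using S by (intro connected_continuous_image continuous_intros)
  then have conn: "connected (h ` S)" by (simp add: h_def image_image)
  have sub: "{0..h y} \<subseteq> (\<Union>i\<in>J. {l i..l i + \<rho>})"
  proof
    fix r assume r: "r \<in> {0..h y}"
    have "h x \<in> h ` S" "h y \<in> h ` S" "h x = 0" using xy by (auto simp: h_def)
    then have "r \<in> h ` S" using connectedD_interval[OF conn, of 0 "h y" r] r by auto
    then obtain z where z: "z \<in> S" "r = h z" by auto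
    then obtain i where "i \<in> I" "z \<in> B i" using I by auto
    then show "r \<in> (\<Union>i\<in>J. {l i..l i + \<rho>})"
      using l[of i z] z by (auto simp: J_def)
  qed
  have J: "finite J" "card J \<le> card I" using I by (auto simp: J_def intro: card_mono)
  have "h y = measure lborel {0..h y}" by (simp add: h_def)
  also have "\<dots> \<le> measure lborel (\<Union>i\<in>J. {l i..l i + \<rho>})"
  proof (rule measure_mono_fmeasurable[OF sub])
    have "{a..b} \<in> fmeasurable lborel" for a b :: real by (simp add: fmeasurable_def emeasure_lborel_Icc_eq)
    then show "(\<Union>i\<in>J. {l i..l i + \<rho>}) \<in> fmeasurable lborel"
      using J(1) by (intro fmeasurable.finite_UN) auto
  qed simp
  also have "\<dots> \<le> (\<Sum>i\<in>J. measure lborel {l i..l i + \<rho>})"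
    by (rule measure_UNION_le) (use J in auto)
  also have "\<dots> = real (card J) * \<rho>" using rho by simp
  also have "\<dots> \<le> real (card I) * \<rho>" using J rho by (intro mult_right_mono) auto
  finally show ?thesis by (simp add: h_def)
qed

text \<open>Between the angles 0 and 2 pi, measured from \<open>u\<close>, the cosine first
  decreases and then increases, so the angles of points at distance at least \<epsilon> from
  \<open>u\<close> form an interval.\<close>

lemma connected_circle_minus_ball:
  fixes u :: complex
  assumes u: "cmod u = 1"
  shows "connected (sphere 0 1 - ball u \<epsilon>)"
proof -
  define \<theta> where "\<theta> = {t\<in>{0..2*pi}. cmod (u - u * cis t) \<ge> \<epsilon>}"
  have cm: "cmod (u - u * cis t) = sqrt (2 - 2 * cos t)" for t
  proof -
    have "cmod (u - u * cis t) = cmod (1 - cis t)"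
      using u by (metis mult.right_neutral norm_mult mult_1 right_diff_distrib)
    also have "(cmod (1 - cis t))\<^sup>2 = 2 - 2 * cos t"
      by (simp add: cmod_power2 power2_diff)
    then have "cmod (1 - cis t) = sqrt (2 - 2 * cos t)"
      by (metis norm_ge_zero real_sqrt_unique)
    finally show ?thesis .
  qed
  have mono: "cos s \<le> max (cos t1) (cos t2)" if "0 \<le> t1" "t1 \<le> s" "s \<le> t2" "t2 \<le> 2*pi" for t1 s t2 :: real
  proof (cases "s \<le> pi")
    case True
    then show ?thesis using that by (intro max.coboundedI1 cos_monotone_0_pi_le) auto
  next
    case False
    have "cos (2*pi - s) \<le> cos (2*pi - t2)"
      using that False by (intro cos_monotone_0_pi_le) auto
    then show ?thesis by (simp add: cos_diff max.coboundedI2)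
  qed
  have conv: "is_interval \<theta>"
    unfolding is_interval_1 \<theta>_def cm
  proof (intro ballI impI allI)
    fix a b x assume a: "a \<in> {t \<in> {0..2 * pi}. \<epsilon> \<le> sqrt (2 - 2 * cos t)}"
      and b: "b \<in> {t \<in> {0..2 * pi}. \<epsilon> \<le> sqrt (2 - 2 * cos t)}" and x: "a \<le> x \<and> x \<le> b"
    have "cos x \<le> max (cos a) (cos b)" using mono[of a x b] a b x by auto
    then have "cos x \<le> cos a \<or> cos x \<le> cos b" by linarith
    then have "sqrt (2 - 2 * cos a) \<le> sqrt (2 - 2 * cos x) \<or> sqrt (2 - 2 * cos b) \<le> sqrt (2 - 2 * cos x)"
      by auto
    moreover have "\<epsilon> \<le> sqrt (2 - 2 * cos a)" "\<epsilon> \<le> sqrt (2 - 2 * cos b)"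
      using a b by blast+
    ultimately have "\<epsilon> \<le> sqrt (2 - 2 * cos x)"
      by linarith
    then show "x \<in> {t \<in> {0..2 * pi}. \<epsilon> \<le> sqrt (2 - 2 * cos t)}"
      using a b x by auto
  qed
  have "sphere 0 1 - ball u \<epsilon> = (\<lambda>t. u * cis t) ` \<theta>"
  proof
    show "(\<lambda>t. u * cis t) ` \<theta> \<subseteq> sphere 0 1 - ball u \<epsilon>"
      using u by (auto simp: \<theta>_def norm_mult dist_norm)
    show "sphere 0 1 - ball u \<epsilon> \<subseteq> (\<lambda>t. u * cis t) ` \<theta>"
    proof
      fix z assume z: "z \<in> sphere 0 1 - ball u \<epsilon>"
      have "cmod (z / u) = 1" using z u by (simp add: norm_divide)
      then obtain t where t: "0 \<le> t" "t < 2*pi" "z / u = cis t"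
        using complex_unimodular_polar[of "z/u"] by (metis cis.ctr complex_eq_iff cis.simps)
      moreover have "u \<noteq> 0" using u by auto
      ultimately have "z = u * cis t" by (metis nonzero_mult_div_cancel_left times_divide_eq_right)
      then show "z \<in> (\<lambda>t. u * cis t) ` \<theta>"
        using t z by (auto simp: \<theta>_def dist_norm)
    qed
  qed
  moreover have "continuous_on \<theta> (\<lambda>t. u * cis t)" by (intro continuous_intros)
  ultimately show ?thesis
    using conv by (metis connected_continuous_image is_interval_connected)
qed

text \<open>Newman's argument: for \<open>x\<close>, \<open>y\<close> close together, the points of \<open>C\<close> nearby lie on a small arc,
  and Janiszewski's theorem is applied to \<open>C\<close> and the union of the complementary arc with the outside of the ball.\<close>

lemma jordan_complement_ulc:
  fixes C :: "complex set"
  assumes hom: "sphere (0::complex) 1 homeomorphic C" and \<epsilon>: "\<epsilon> > 0"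
  obtains \<delta> where "\<delta> > 0"
    "\<And>x y. dist x y < \<delta> \<Longrightarrow> connected_component (- C) x y \<Longrightarrow> connected_component (- C \<inter> ball x \<epsilon>) x y"
proof -
  obtain \<eta> \<zeta> where hom: "homeomorphism (sphere (0::complex) 1) C \<eta> \<zeta>"
    using hom by (auto simp: homeomorphic_def)
  have h: "\<And>u. u \<in> sphere 0 1 \<Longrightarrow> \<zeta> (\<eta> u) = u" "\<eta> ` sphere 0 1 = C" "continuous_on (sphere 0 1) \<eta>"
    "\<And>z. z \<in> C \<Longrightarrow> \<eta> (\<zeta> z) = z" "\<zeta> ` C = sphere 0 1" "continuous_on C \<zeta>"
    using hom by (auto simp: homeomorphism_def)
  have comp: "compact (sphere (0::complex) 1)" by simp
  have compC: "compact C"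
    using compact_continuous_image[of "sphere 0 1" \<eta>] h by auto
  obtain d1 where d1: "d1 > 0" "\<And>u v. u \<in> sphere 0 1 \<Longrightarrow> v \<in> sphere 0 1 \<Longrightarrow> dist v u < d1 \<Longrightarrow> dist (\<eta> v) (\<eta> u) < \<epsilon>/2"
    using compact_uniformly_continuous[OF _ comp, of \<eta>] h \<epsilon> unfolding uniformly_continuous_on_def
    by (metis half_gt_zero)
  obtain d2 where d2: "d2 > 0" "\<And>u v. u \<in> C \<Longrightarrow> v \<in> C \<Longrightarrow> dist v u < d2 \<Longrightarrow> dist (\<zeta> v) (\<zeta> u) < d1"
    using compact_uniformly_continuous[OF _ compC, of \<zeta>] h d1(1) unfolding uniformly_continuous_on_def
    by metis
  \<comment> \<open>The half of \<open>d2\<close> makes any two points of \<open>C\<close> in the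
    ball of radius \<delta> around \<open>x\<close> closer than \<open>d2\<close>; the half of
    \<epsilon> keeps the small arc inside the ball of radius \<epsilon>.\<close>
  define \<delta> where "\<delta> = min (d2/2) (\<epsilon>/2)"
  have \<delta>: "\<delta> > 0" using d2 \<epsilon> by (simp add: \<delta>_def)
  show thesis
  proof (rule that[OF \<delta>])
    fix x y assume xy: "dist x y < \<delta>" and cc: "connected_component (- C) x y"
    have seg: "closed_segment x y \<subseteq> ball x \<delta>"
      using xy \<delta> by (intro closed_segment_subset) auto
    have segcc: "connected_component S x y" if "closed_segment x y \<subseteq> S" for S
      using that unfolding connected_component_def by (intro exI[of _ "closed_segment x y"]) auto
    show "connected_component (- C \<inter> ball x \<epsilon>) x y"
    proof (cases "C \<inter> ball x \<delta> = {}")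
      case True
      have "ball x \<delta> \<subseteq> ball x \<epsilon>" using \<epsilon> by (intro subset_ball) (auto simp: \<delta>_def)
      then show ?thesis using True seg by (intro segcc) auto
    next
      case False
      then obtain c where c: "c \<in> C" "dist x c < \<delta>" by auto
      \<comment> \<open>The large arc: \<open>C\<close> without the points whose parameters are
        within \<open>d1\<close> of that of \<open>c\<close>. The small arc left over lies in the
        ball of radius \<epsilon> around \<open>x\<close>, and the large arc misses the ball of
        radius \<delta>.\<close>
      define K where "K = \<eta> ` (sphere 0 1 - ball (\<zeta> c) d1)"
      have \<zeta>c: "cmod (\<zeta> c) = 1" using h c by force
      have "compact (sphere 0 1 - ball (\<zeta> c) d1)"
        by (intro compact_diff) auto
      then have K: "compact K" "connected K"
        unfolding K_def using connected_circle_minus_ball[OF \<zeta>c, of d1] h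
        by (auto intro!: compact_continuous_image connected_continuous_image intro: continuous_on_subset)
      have KC: "K \<subseteq> C" using h by (auto simp: K_def)
      have J: "C - K \<subseteq> ball x \<epsilon>"
      proof
        fix z assume z: "z \<in> C - K"
        then have zs: "\<zeta> z \<in> sphere 0 1" "\<eta> (\<zeta> z) = z" using h by auto
        then have "dist (\<zeta> z) (\<zeta> c) < d1" using z unfolding K_def
          by (metis Diff_iff image_eqI mem_ball dist_commute)
        then have "dist z c < \<epsilon>/2" using d1(2)[of "\<zeta> c" "\<zeta> z"] zs \<zeta>c h c by auto
        moreover have "dist x c < \<epsilon>/2" using c by (simp add: \<delta>_def)
        ultimately show "z \<in> ball x \<epsilon>" using dist_triangle_half_l[of x c \<epsilon> z] by (simp add: dist_commute)
      qed
      have KB: "K \<inter> ball x \<delta> = {}"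
      proof (rule ccontr)
        assume "K \<inter> ball x \<delta> \<noteq> {}"
        then obtain z where z: "z \<in> K" "dist x z < \<delta>" by auto
        have "dist z c < d2" using z c dist_triangle_half_r[of x z d2 c] by (auto simp: \<delta>_def)
        then have "dist (\<zeta> z) (\<zeta> c) < d1" using d2(2)[of c z] z KC c by auto
        moreover obtain u where "u \<in> sphere 0 1 - ball (\<zeta> c) d1" "z = \<eta> u" using z by (auto simp: K_def)
        ultimately show False using h(1)[of u] by (auto simp: dist_commute)
      qed
      have "connected_component (- (C \<union> (K \<union> - ball x \<epsilon>))) x y"
      proof (rule Janiszewski)
        show "compact C" by (rule compC)
        show "closed (K \<union> - ball x \<epsilon>)" by (intro closed_Un) (use K in \<open>auto intro: compact_imp_closed\<close>)
        have "C \<inter> (K \<union> - ball x \<epsilon>) = K" using KC J by auto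
        then show "connected (C \<inter> (K \<union> - ball x \<epsilon>))" using K by simp
        show "connected_component (- C) x y" by (rule cc)
        have "ball x \<delta> \<subseteq> ball x \<epsilon>" using \<epsilon> by (intro subset_ball) (auto simp: \<delta>_def)
        then show "connected_component (- (K \<union> - ball x \<epsilon>)) x y"
          using seg KB by (intro segcc) auto
      qed
      moreover have "- (C \<union> (K \<union> - ball x \<epsilon>)) = - C \<inter> ball x \<epsilon>" using KC by auto
      ultimately show ?thesis by simp
    qed
  qed
qed

text \<open>Property S: however wild the boundary, the domain is a finite union of connected sets
  subordinate to the given cover. With \<epsilon> a Lebesgue number of the cover and \<delta> from
  \<open>jordan_complement_ulc\<close>, take finitely many \<delta>-dense points of the domain; the
  pieces are their components in the parts of the complement of \<open>C\<close> within distance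
  \<epsilon>.\<close>

lemma jordan_domain_property_S:
  fixes C :: "complex set"
  assumes hom: "sphere (0::complex) 1 homeomorphic C" and V: "V \<in> components (- C)" "bounded V"
    and \<O>: "\<And>W. W \<in> \<O> \<Longrightarrow> open W" "closure V \<subseteq> \<Union>\<O>"
  obtains \<Q> where "finite \<Q>" "V = \<Union>\<Q>" "\<And>Q. Q \<in> \<Q> \<Longrightarrow> connected Q \<and> (\<exists>W\<in>\<O>. Q \<subseteq> W)"
proof -
  have W0: "open W" if "W \<in> \<O>" for W using \<O>(1) that .
  have ccl: "compact (closure V)" using V(2) by (simp add: compact_closure)
  obtain \<epsilon> where \<epsilon>: "\<epsilon> > 0" "\<And>x. x \<in> closure V \<Longrightarrow> \<exists>W\<in>\<O>. ball x \<epsilon> \<subseteq> W"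
    using Heine_Borel_lemma[OF ccl \<O>(2) W0] by metis
  obtain \<delta> where \<delta>: "\<delta> > 0" "\<And>x y. dist x y < \<delta> \<Longrightarrow> connected_component (- C) x y \<Longrightarrow> connected_component (- C \<inter> ball x \<epsilon>) x y"
    using jordan_complement_ulc[OF hom \<epsilon>(1)] by metis
  obtain X where X: "finite X" "X \<subseteq> V" "V \<subseteq> (\<Union>x\<in>X. ball x \<delta>)"
  proof -
    have "\<exists>X. finite X \<and> X \<subseteq> V \<and> closure V \<subseteq> (\<Union>x\<in>X. ball x \<delta>)"
    proof -
      have "closure V \<subseteq> (\<Union>x\<in>V. ball x \<delta>)"
        using \<delta>(1) by (auto simp: closure_approachable dist_commute)
      then obtain D where "D \<subseteq> V" "finite D" "closure V \<subseteq> (\<Union>x\<in>D. ball x \<delta>)"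
        using compactE_image[OF ccl, of V "\<lambda>x. ball x \<delta>"] by blast
      then show ?thesis by blast
    qed
    then show thesis using that closure_subset by (metis (no_types, lifting) order_trans)
  qed
  show thesis
  proof (rule that[of "(\<lambda>x. connected_component_set (- C \<inter> ball x \<epsilon>) x) ` X"])
    show "finite ((\<lambda>x. connected_component_set (- C \<inter> ball x \<epsilon>) x) ` X)" using X by simp
    have eqV: "V = connected_component_set (- C) x" if "x \<in> V" for x
      using V(1) that by (metis componentsE connected_component_eq)
    show "V = \<Union>((\<lambda>x. connected_component_set (- C \<inter> ball x \<epsilon>) x) ` X)"
    proof
      show "V \<subseteq> \<Union>((\<lambda>x. connected_component_set (- C \<inter> ball x \<epsilon>) x) ` X)"
      proof
        fix y assume y: "y \<in> V"
        then obtain x where x: "x \<in> X" "dist x y < \<delta>" using X by auto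
        then have "connected_component (- C) x y" using eqV[of x] y X by auto
        then show "y \<in> \<Union>((\<lambda>x. connected_component_set (- C \<inter> ball x \<epsilon>) x) ` X)"
          using \<delta>(2)[OF x(2)] x by auto
      qed
      show "\<Union>((\<lambda>x. connected_component_set (- C \<inter> ball x \<epsilon>) x) ` X) \<subseteq> V"
      proof
        fix y assume "y \<in> \<Union>((\<lambda>x. connected_component_set (- C \<inter> ball x \<epsilon>) x) ` X)"
        then obtain x where x: "x \<in> X" "connected_component (- C \<inter> ball x \<epsilon>) x y" by auto
        then have "connected_component (- C) x y" by (meson connected_component_of_subset inf_le1)
        then show "y \<in> V" using eqV[of x] x X by auto
      qed
    qed
    fix Q assume "Q \<in> (\<lambda>x. connected_component_set (- C \<inter> ball x \<epsilon>) x) ` X"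
    then obtain x where x: "x \<in> X" "Q = connected_component_set (- C \<inter> ball x \<epsilon>) x" by auto
    have "x \<in> closure V" using x X closure_subset by blast
    then obtain W where W: "W \<in> \<O>" "ball x \<epsilon> \<subseteq> W" using \<epsilon>(2) by blast
    moreover have "Q \<subseteq> ball x \<epsilon>" using x(2) connected_component_subset by blast
    ultimately show "connected Q \<and> (\<exists>W\<in>\<O>. Q \<subseteq> W)"
      using x(2) by auto
  qed
qed

section \<open>Rational maps of the sphere\<close>

lemma openin_sphere_top:
  "openin sphere_top V \<longleftrightarrow> open {z. Some z \<in> V} \<and> (None \<in> V \<longrightarrow> (\<exists>R. \<forall>z. R < norm z \<longrightarrow> Some z \<in> V))"
proof
  assume "openin sphere_top V"
  then consider U where "open U" "V = Some ` U" | C where "compact C" "V = insert None (Some ` (- C))"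
    by (auto simp: sphere_top_def openin_Alexandroff_compactification Compl_eq_Diff_UNIV)
  then show "open {z. Some z \<in> V} \<and> (None \<in> V \<longrightarrow> (\<exists>R. \<forall>z. R < norm z \<longrightarrow> Some z \<in> V))"
  proof cases
    case 1
    moreover have "{z. Some z \<in> V} = U" using 1 by auto
    ultimately show ?thesis by auto
  next
    case 2
    have "{z. Some z \<in> V} = - C" using 2 by auto
    moreover obtain R where "\<And>z. z \<in> C \<Longrightarrow> norm z \<le> R"
      using compact_imp_bounded[OF 2(1)] by (auto simp: bounded_iff)
    then have "\<forall>z. R < norm z \<longrightarrow> Some z \<in> V" using 2 by force
    ultimately show ?thesis using 2(1) by (auto simp: compact_imp_closed)
  qed
next
  assume *: "open {z. Some z \<in> V} \<and> (None \<in> V \<longrightarrow> (\<exists>R. \<forall>z. R < norm z \<longrightarrow> Some z \<in> V))"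
  show "openin sphere_top V"
  proof (cases "None \<in> V")
    case False
    then have "V = Some ` {z. Some z \<in> V}"
      by (auto simp: image_iff) (metis option.exhaust)
    then show ?thesis
      using * by (metis open_openin openin_Alexandroff_compactification sphere_top_def)
  next
    case True
    then obtain R where R: "\<forall>z. R < norm z \<longrightarrow> Some z \<in> V" using * by auto
    have V: "V = insert None (Some ` (- (- {z. Some z \<in> V})))"
      using True by (auto simp: image_iff) (metis option.exhaust)
    have "compact (- {z. Some z \<in> V})"
      unfolding compact_eq_bounded_closed
      using * R by (auto simp: bounded_iff closed_def Collect_neg_eq intro!: exI[of _ R] dest: leI)
    then show ?thesis
      unfolding sphere_top_def openin_Alexandroff_compactification
      using V by (metis Compl_eq_Diff_UNIV closed_closedin compact_imp_closed compactin_euclidean_iff topspace_euclidean)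
  qed
qed

lemma openin_sphere_Some [simp]: "openin sphere_top (Some ` U) \<longleftrightarrow> open U"
  by (auto simp: openin_sphere_top image_iff)

lemma continuous_map_Some_sphere: "continuous_map euclidean sphere_top Some"
  by (simp add: sphere_top_def continuous_map_Some)

lemma open_Some_vimage: "openin sphere_top V \<Longrightarrow> open {z. Some z \<in> V}"
  by (simp add: openin_sphere_top)

lemma compact_space_sphere: "compact_space sphere_top"
  by (simp add: sphere_top_def)

lemma Hausdorff_space_sphere: "Hausdorff_space sphere_top"
  by (simp add: sphere_top_def Hausdorff_space_Alexandroff_compactification locally_compact_space_euclidean)

section \<open>The inversion exchanging zero and infinity\<close>

definition inversion :: "riemann \<Rightarrow> riemann" where
  "inversion x = (case x of None \<Rightarrow> Some 0 | Some z \<Rightarrow> if z = 0 then None else Some (1 / z))"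

lemma inversion_simps [simp]: "inversion None = Some 0" "inversion (Some 0) = None"
  "z \<noteq> 0 \<Longrightarrow> inversion (Some z) = Some (1 / z)"
  by (auto simp: inversion_def)

lemma inversion_inversion [simp]: "inversion (inversion x) = x"
  by (auto simp: inversion_def split: option.splits)

lemma continuous_map_inversion: "continuous_map sphere_top sphere_top inversion"
proof -
  have "openin sphere_top {x. inversion x \<in> V}" if V: "openin sphere_top V" for V
    unfolding openin_sphere_top
  proof
    have o1: "open {z. Some z \<in> V}" using V by (rule open_Some_vimage)
    have o2: "open {z. z \<noteq> 0 \<and> 1 / z \<in> {z. Some z \<in> V}}"
    proof -
      have "open ((\<lambda>z. 1 / z) -` {z. Some z \<in> V} \<inter> - {0::complex})"
        by (rule continuous_on_open_vimage[THEN iffD1, rule_format]) (auto intro!: continuous_intros o1)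
      also have "(\<lambda>z. 1 / z) -` {z. Some z \<in> V} \<inter> - {0::complex} = {z. z \<noteq> 0 \<and> 1 / z \<in> {z. Some z \<in> V}}" by auto
      finally show ?thesis .
    qed
    show "open {z. Some z \<in> {x. inversion x \<in> V}}"
    proof (cases "None \<in> V")
      case False
      then have "{z. Some z \<in> {x. inversion x \<in> V}} = {z. z \<noteq> 0 \<and> 1 / z \<in> {z. Some z \<in> V}}"
        by (auto simp: inversion_def)
      then show ?thesis using o2 by simp
    next
      case True
      then obtain R where R: "\<And>z. R < norm z \<Longrightarrow> Some z \<in> V" using V by (auto simp: openin_sphere_top)
      define r where "r = 1 / (\<bar>R\<bar> + 1)"
      have r: "r > 0" by (auto simp: r_def)
      have "{z. Some z \<in> {x. inversion x \<in> V}} = {z. z \<noteq> 0 \<and> 1 / z \<in> {z. Some z \<in> V}} \<union> ball 0 r"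
      proof -
        have "Some (1 / z) \<in> V" if "z \<noteq> 0" "norm z < r" for z
        proof (rule R)
          have "norm z * (\<bar>R\<bar> + 1) < 1" using that by (simp add: r_def field_simps)
          then have "\<bar>R\<bar> + 1 < 1 / norm z" using that by (simp add: field_simps)
          then show "R < norm (1 / z)" by (simp add: norm_divide)
        qed
        then show ?thesis using True r by (auto simp: inversion_def)
      qed
      then show ?thesis using o2 by (simp add: open_Un)
    qed
    show "None \<in> {x. inversion x \<in> V} \<longrightarrow> (\<exists>R. \<forall>z. R < norm z \<longrightarrow> Some z \<in> {x. inversion x \<in> V})"
    proof
      assume "None \<in> {x. inversion x \<in> V}"
      then have "0 \<in> {z. Some z \<in> V}" by simp
      then obtain r where r: "r > 0" "ball 0 r \<subseteq> {z. Some z \<in> V}"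
        using o1 by (meson open_contains_ball)
      show "\<exists>R. \<forall>z. R < norm z \<longrightarrow> Some z \<in> {x. inversion x \<in> V}"
      proof (intro exI[of _ "1 / r"] allI impI)
        fix z :: complex assume z: "1 / r < norm z"
        then have nz: "norm z > 0" using r by (smt (verit) divide_pos_pos)
        then have "norm (1 / z) < r" using z r by (simp add: norm_divide field_simps)
        then have "Some (1 / z) \<in> V" using r by auto
        then show "Some z \<in> {x. inversion x \<in> V}" using nz by (auto simp: inversion_def)
      qed
    qed
  qed
  then show ?thesis by (simp add: continuous_map)
qed

lemma homeomorphic_maps_inversion: "homeomorphic_maps sphere_top sphere_top inversion inversion"
  by (simp add: homeomorphic_maps_def continuous_map_inversion)

lemma openin_inversion_vimage: "openin sphere_top V \<Longrightarrow> openin sphere_top {x. inversion x \<in> V}"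
  using continuous_map_inversion by (simp add: continuous_map)

section \<open>Fibres of rational maps as zero sets of polynomials\<close>

text \<open>Criticality is expressed by failure of local injectivity, a topological notion that can
  be transferred between \<open>f\<close> and \<open>T\<close>; \<open>critical_points_eq\<close>
  identifies it with local degree at least two.\<close>

definition locally_inj :: "'a topology \<Rightarrow> ('a \<Rightarrow> 'b) \<Rightarrow> 'a \<Rightarrow> bool" where
  "locally_inj X f x \<longleftrightarrow> (\<exists>U. openin X U \<and> x \<in> U \<and> inj_on f U)"

text \<open>Its zeros are the finite preimages of \<open>w\<close>; a degree below \<open>N\<close>
  signals that infinity is a preimage too.\<close>

definition fibre_poly :: "complex poly \<Rightarrow> complex poly \<Rightarrow> riemann \<Rightarrow> complex poly" where
  "fibre_poly p q w = (case w of None \<Rightarrow> q | Some c \<Rightarrow> p - smult c q)"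

text \<open>The polynomial z^N p(1/z), reversed relative to the formal degree \<open>N\<close>; it
  moves the behaviour at infinity to 0.\<close>

definition rev_poly :: "nat \<Rightarrow> complex poly \<Rightarrow> complex poly" where
  "rev_poly N p = Poly (map (\<lambda>k. coeff p (N - k)) [0..<Suc N])"

lemma coeff_rev_poly: "coeff (rev_poly N p) k = (if k \<le> N then coeff p (N - k) else 0)"
  unfolding rev_poly_def coeff_Poly_eq nth_default_def by (auto simp del: upt_Suc)

lemma poly_eq_sum_le: "degree p \<le> N \<Longrightarrow> poly p (z::complex) = (\<Sum>k\<le>N. coeff p k * z ^ k)"
  unfolding poly_altdef by (rule sum.mono_neutral_left) (auto simp: coeff_eq_0)

lemma complex_poly_root_exists:
  fixes p :: "complex poly"
  assumes "degree p > 0"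
  obtains z where "poly p z = 0"
proof -
  have "proots p \<noteq> {#}" using size_proots_complex[of p] assms by auto
  then obtain z where "z \<in># proots p" by blast
  moreover have "p \<noteq> 0" using assms by auto
  ultimately have "poly p z = 0" by simp
  then show thesis by (rule that)
qed

lemma poly_rev_poly:
  assumes "degree p \<le> N" "z \<noteq> 0"
  shows "poly (rev_poly N p) z = z ^ N * poly p (1 / z)"
proof -
  have "degree (rev_poly N p) \<le> N" by (intro degree_le) (simp add: coeff_rev_poly)
  then have "poly (rev_poly N p) z = (\<Sum>k\<le>N. coeff p (N - k) * z ^ k)"
    by (subst poly_eq_sum_le) (auto simp: coeff_rev_poly intro!: sum.cong)
  also have "\<dots> = (\<Sum>k\<le>N. coeff p k * z ^ (N - k))"
    by (rule sum.reindex_bij_witness[of _ "\<lambda>k. N - k" "\<lambda>k. N - k"]) auto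
  also have "\<dots> = (\<Sum>k\<le>N. z ^ N * (coeff p k * (1 / z) ^ k))"
    using assms(2) by (intro sum.cong) (auto simp: power_diff field_simps power_one_over)
  also have "\<dots> = z ^ N * poly p (1 / z)"
    by (subst poly_eq_sum_le[OF assms(1)]) (simp add: sum_distrib_left)
  finally show ?thesis .
qed

lemma rev_poly_diff_smult: "rev_poly N (p - smult c q) = rev_poly N p - smult c (rev_poly N q)"
  by (rule poly_eqI) (simp add: coeff_rev_poly)

text \<open>Only the values at finite points are prescribed. Thus the composition of
  \<open>f\<close> with \<open>inversion\<close> is again an instance after reversal of both
  polynomials, and statements at infinity become statements at 0.\<close>

locale rational_pair =
  fixes p q :: "complex poly" and f :: "riemann \<Rightarrow> riemann" and N :: nat
  assumes no_common: "\<And>x. poly p x \<noteq> 0 \<or> poly q x \<noteq> 0"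
    and N: "N = max (degree p) (degree q)" "N \<ge> 1"
    and f_Some: "\<And>z. f (Some z) = rational_extension p q (Some z)"
begin

lemma f_Some_eq_iff: "f (Some z) = w \<longleftrightarrow> poly (fibre_poly p q w) z = 0"
proof (cases w)
  case (Some c)
  have "poly p z \<noteq> 0 \<or> poly q z \<noteq> 0" by (rule no_common)
  then show ?thesis
    using Some by (auto simp: f_Some rational_extension_def fibre_poly_def field_simps)
qed (simp add: f_Some rational_extension_def fibre_poly_def)

lemma q_nz: "q \<noteq> 0" and p_nz: "p \<noteq> 0"
proof -
  show "q \<noteq> 0"
  proof
    assume "q = 0"
    then have "degree p > 0" using N by simp
    then obtain z where "poly p z = 0" by (rule complex_poly_root_exists)
    then show False using no_common[of z] \<open>q = 0\<close> by simp
  qed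
  show "p \<noteq> 0"
  proof
    assume "p = 0"
    then have "degree q > 0" using N by simp
    then obtain z where "poly q z = 0" by (rule complex_poly_root_exists)
    then show False using no_common[of z] \<open>p = 0\<close> by simp
  qed
qed

lemma fibre_poly_nz: "fibre_poly p q w \<noteq> 0"
proof (cases w)
  case None
  then show ?thesis using q_nz by (simp add: fibre_poly_def)
next
  case (Some c)
  show ?thesis
  proof
    assume "fibre_poly p q w = 0"
    then have eq: "p = smult c q" using Some by (simp add: fibre_poly_def)
    then have "N \<le> degree q" using N(1) degree_smult_le[of c q] by simp
    then have "degree q > 0" using N by simp
    then obtain z where "poly q z = 0" by (rule complex_poly_root_exists)
    then show False using no_common[of z] eq by simp
  qed
qed

lemma degree_fibre_le: "degree (fibre_poly p q w) \<le> N"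
  using degree_smult_le[of "the w" q] N(1)
  by (cases w) (auto simp: fibre_poly_def intro!: degree_diff_le order_trans[OF degree_smult_le])

text \<open>The value at infinity is the one \<open>w\<close> for which the coefficient of degree
  \<open>N\<close> cancels in the fibre polynomial.\<close>

lemma rext_None_eq_iff: "rational_extension p q None = w \<longleftrightarrow> degree (fibre_poly p q w) < N"
proof (cases w)
  case None
  then show ?thesis using N q_nz by (auto simp: rational_extension_def fibre_poly_def)
next
  case (Some c)
  show ?thesis
  proof (cases "degree q < degree p")
    case True
    have "degree (- smult c q) < degree p" using True degree_smult_le[of c q] by simp
    then have "degree (p + - smult c q) = degree p"
      by (rule degree_add_eq_left)
    then show ?thesis using Some True N q_nz by (simp add: rational_extension_def fibre_poly_def)
  next
    case False
    then have Nq: "N = degree q" using N by simp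
    have deg: "degree (p - smult c q) < N \<longleftrightarrow> coeff (p - smult c q) N = 0"
    proof
      assume "degree (p - smult c q) < N" then show "coeff (p - smult c q) N = 0" by (rule coeff_eq_0)
    next
      assume c0: "coeff (p - smult c q) N = 0"
      have "degree (p - smult c q) \<noteq> N"
        using c0 N(2) by (metis degree_0 leading_coeff_0_iff not_one_le_zero)
      then show "degree (p - smult c q) < N" using degree_fibre_le[of "Some c"] by (simp add: fibre_poly_def)
    qed
    have "lead_coeff q \<noteq> 0" using q_nz by simp
    then show ?thesis
      using Some False q_nz deg by (auto simp: rational_extension_def fibre_poly_def Nq field_simps)
  qed
qed

text \<open>An injective holomorphic function has a nowhere vanishing derivative. For p/q, or q/p at
  a pole, the derivative at \<open>z\<close> is a nonzero multiple of the derivative of the fibre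
  polynomial.\<close>

lemma locally_inj_imp_pderiv:
  assumes li: "locally_inj sphere_top f (Some z)"
  shows "poly (pderiv (fibre_poly p q (f (Some z)))) z \<noteq> 0"
proof -
  obtain U where U: "openin sphere_top U" "Some z \<in> U" "inj_on f U"
    using li by (auto simp: locally_inj_def)
  define U1 where "U1 = {y. Some y \<in> U}"
  have U1: "open U1" "z \<in> U1" using U open_Some_vimage by (auto simp: U1_def)
  have inj: "inj_on (\<lambda>y. f (Some y)) U1"
    using U(3) by (auto simp: inj_on_def U1_def)
  show ?thesis
  proof (cases "poly q z = 0")
    case False
    define S where "S = U1 \<inter> {y. poly q y \<noteq> 0}"
    have "open {y. poly q y \<noteq> 0}" by (intro open_Collect_neq continuous_intros)
    then have S: "open S" "z \<in> S" using U1 False by (auto simp: S_def)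
    have hol: "(\<lambda>y. poly p y / poly q y) holomorphic_on S"
      by (intro holomorphic_intros) (auto simp: S_def)
    have "inj_on (\<lambda>y. poly p y / poly q y) S"
      using inj by (auto simp: inj_on_def S_def f_Some rational_extension_def)
    then have nz: "deriv (\<lambda>y. poly p y / poly q y) z \<noteq> 0"
      using holomorphic_injective_imp_regular[OF hol S(1) _ S(2)] by blast
    have "((\<lambda>y. poly p y / poly q y) has_field_derivative
       (poly (pderiv p) z * poly q z - poly p z * poly (pderiv q) z) / (poly q z * poly q z)) (at z)"
      by (rule DERIV_divide) (use False in \<open>auto intro: poly_DERIV\<close>)
    then have "deriv (\<lambda>y. poly p y / poly q y) z =
       (poly (pderiv p) z * poly q z - poly p z * poly (pderiv q) z) / (poly q z * poly q z)"
      by (rule DERIV_imp_deriv)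
    then have "poly (pderiv p) z * poly q z - poly p z * poly (pderiv q) z \<noteq> 0" using nz by auto
    then show ?thesis
      using False by (auto simp: f_Some rational_extension_def fibre_poly_def pderiv_diff pderiv_smult field_simps)
  next
    case True
    then have pz: "poly p z \<noteq> 0" using no_common[of z] by simp
    define S where "S = U1 \<inter> {y. poly p y \<noteq> 0}"
    have "open {y. poly p y \<noteq> 0}" by (intro open_Collect_neq continuous_intros)
    then have S: "open S" "z \<in> S" using U1 pz by (auto simp: S_def)
    have hol: "(\<lambda>y. poly q y / poly p y) holomorphic_on S"
      by (intro holomorphic_intros) (auto simp: S_def)
    have "inj_on (\<lambda>y. poly q y / poly p y) S"
    proof (rule inj_onI)
      fix x y assume xy: "x \<in> S" "y \<in> S" "poly q x / poly p x = poly q y / poly p y"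
      have "f (Some x) = f (Some y)"
        using xy by (auto simp: S_def f_Some rational_extension_def field_simps)
      then show "x = y" using inj xy by (auto simp: inj_on_def S_def)
    qed
    then have nz: "deriv (\<lambda>y. poly q y / poly p y) z \<noteq> 0"
      using holomorphic_injective_imp_regular[OF hol S(1) _ S(2)] by blast
    have "((\<lambda>y. poly q y / poly p y) has_field_derivative
       (poly (pderiv q) z * poly p z - poly q z * poly (pderiv p) z) / (poly p z * poly p z)) (at z)"
      by (rule DERIV_divide) (use pz in \<open>auto intro: poly_DERIV\<close>)
    then have "deriv (\<lambda>y. poly q y / poly p y) z =
       (poly (pderiv q) z * poly p z - poly q z * poly (pderiv p) z) / (poly p z * poly p z)"
      by (rule DERIV_imp_deriv)
    then show ?thesis
      using nz True pz by (auto simp: f_Some rational_extension_def fibre_poly_def)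
  qed
qed

lemma degree_p_le: "degree p \<le> N" and degree_q_le: "degree q \<le> N"
  using N by auto

lemma lead_nz: "coeff p N \<noteq> 0 \<or> coeff q N \<noteq> 0"
  using N p_nz q_nz by (cases "degree p \<le> degree q") (auto simp: max_def)

lemma rational_pair_rev:
  assumes fN: "f None = rational_extension p q None"
  shows "rational_pair (rev_poly N p) (rev_poly N q) (f \<circ> inversion) N"
proof
  fix x
  show "poly (rev_poly N p) x \<noteq> 0 \<or> poly (rev_poly N q) x \<noteq> 0"
  proof (cases "x = 0")
    case True
    then show ?thesis using lead_nz by (simp add: poly_0_coeff_0 coeff_rev_poly)
  next
    case False
    then show ?thesis
      using no_common[of "1/x"] by (simp add: poly_rev_poly degree_p_le degree_q_le)
  qed
next
  have *: "degree (rev_poly N r) \<le> N" for r by (intro degree_le) (simp add: coeff_rev_poly)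
  show "N = max (degree (rev_poly N p)) (degree (rev_poly N q))"
  proof (rule antisym)
    show "max (degree (rev_poly N p)) (degree (rev_poly N q)) \<le> N" using * by simp
    have "poly p 0 \<noteq> 0 \<or> poly q 0 \<noteq> 0" by (rule no_common)
    then have "coeff (rev_poly N p) N \<noteq> 0 \<or> coeff (rev_poly N q) N \<noteq> 0"
      by (simp add: poly_0_coeff_0 coeff_rev_poly)
    then show "N \<le> max (degree (rev_poly N p)) (degree (rev_poly N q))"
      using le_degree by (metis le_max_iff_disj)
  qed
  show "1 \<le> N" by (rule N(2))
  fix z
  show "(f \<circ> inversion) (Some z) = rational_extension (rev_poly N p) (rev_poly N q) (Some z)"
  proof (cases "z = 0")
    case True
    have "degree q \<noteq> N" if "degree q < degree p" using that N by simp
    then have "degree q < degree p \<longleftrightarrow> coeff q N = 0"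
      using N q_nz by (cases "degree q < degree p") (auto simp: max_def coeff_eq_0)
    moreover have "N = degree q" if "\<not> degree q < degree p" using that N by simp
    ultimately show ?thesis using True q_nz fN
      by (auto simp: rational_extension_def poly_0_coeff_0 coeff_rev_poly)
  next
    case False
    then show ?thesis
      by (simp add: f_Some rational_extension_def poly_rev_poly degree_p_le degree_q_le)
  qed
qed

lemma fibre_poly_rev: "fibre_poly (rev_poly N p) (rev_poly N q) w = rev_poly N (fibre_poly p q w)"
  by (auto simp: fibre_poly_def rev_poly_diff_smult split: option.splits)

end

lemma locally_inj_comp_inversion:
  assumes "locally_inj sphere_top f (inversion x)"
  shows "locally_inj sphere_top (f \<circ> inversion) x"
proof -
  obtain U where U: "openin sphere_top U" "inversion x \<in> U" "inj_on f U"
    using assms by (auto simp: locally_inj_def)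
  have "inj_on (f \<circ> inversion) {y. inversion y \<in> U}"
    using U(3) by (auto simp: inj_on_def) (metis inversion_inversion)
  then show ?thesis
    using U openin_inversion_vimage[OF U(1)] by (auto simp: locally_inj_def)
qed

locale rational_fun = rational_pair +
  assumes f_None: "f None = rational_extension p q None"
begin

lemma fibre_eq: "f -` {w} = Some ` {z. poly (fibre_poly p q w) z = 0} \<union> (if degree (fibre_poly p q w) < N then {None} else {})"
proof -
  have "x \<in> f -` {w} \<longleftrightarrow> x \<in> Some ` {z. poly (fibre_poly p q w) z = 0} \<union> (if degree (fibre_poly p q w) < N then {None} else {})" for x
    using rext_None_eq_iff[of w] f_None by (cases x) (auto simp: f_Some_eq_iff)
  then show ?thesis by blast
qed

lemma finite_fibre: "finite (f -` {w})"
  unfolding fibre_eq using poly_roots_finite[OF fibre_poly_nz[of w]] by simp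

lemma card_fibre:
  "card (f -` {w}) = card {z. poly (fibre_poly p q w) z = 0} + (if degree (fibre_poly p q w) < N then 1 else 0)"
  unfolding fibre_eq using poly_roots_finite[OF fibre_poly_nz[of w]]
  by (subst card_Un_disjoint) (auto simp: card_image)

lemma card_fibre_le: "card (f -` {w}) \<le> N"
  using card_poly_roots_bound[OF fibre_poly_nz[of w]] degree_fibre_le[of w] by (auto simp: card_fibre)

text \<open>For the reversed polynomials the point at infinity becomes a simple zero at 0, which
  says that the coefficient of degree N - 1 does not vanish.\<close>

lemma locally_inj_None_degree:
  assumes "locally_inj sphere_top f None"
  shows "degree (fibre_poly p q (f None)) = N - 1"
proof -
  interpret R: rational_pair "rev_poly N p" "rev_poly N q" "f \<circ> inversion" N
    by (rule rational_pair_rev[OF f_None])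
  have "locally_inj sphere_top (f \<circ> inversion) (Some 0)"
    by (rule locally_inj_comp_inversion) (use assms in simp)
  from R.locally_inj_imp_pderiv[OF this]
  have "poly (pderiv (rev_poly N (fibre_poly p q (f None)))) 0 \<noteq> 0"
    by (simp add: fibre_poly_rev)
  then have "coeff (fibre_poly p q (f None)) (N - 1) \<noteq> 0"
    using N(2) by (simp add: poly_0_coeff_0 coeff_pderiv coeff_rev_poly)
  then have "N - 1 \<le> degree (fibre_poly p q (f None))" by (rule le_degree)
  moreover have "degree (fibre_poly p q (f None)) < N"
    using rext_None_eq_iff[of "f None"] f_None by metis
  ultimately show ?thesis by simp
qed

text \<open>Local injectivity makes all roots simple, so their number is the degree; if infinity
  belongs to the fibre, local injectivity there makes the degree drop by exactly one.\<close>

lemma card_fibre_regular: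
  assumes "\<And>x. f x = w \<Longrightarrow> locally_inj sphere_top f x"
  shows "card (f -` {w}) = N"
proof -
  let ?s = "fibre_poly p q w"
  have "proots ?s = mset_set {z. poly ?s z = 0}"
  proof (rule multiset_eqI)
    fix z
    show "count (proots ?s) z = count (mset_set {z. poly ?s z = 0}) z"
    proof (cases "poly ?s z = 0")
      case True
      then have "f (Some z) = w" by (simp add: f_Some_eq_iff)
      then have "poly (pderiv ?s) z \<noteq> 0"
        using locally_inj_imp_pderiv[of z] assms by auto
      then have "Polynomial.order z ?s = 1"
        using order_pderiv[OF fibre_poly_nz True] by (simp add: order_0I)
      then show ?thesis
        using True poly_roots_finite[OF fibre_poly_nz[of w]] fibre_poly_nz[of w] by simp
    next
      case False
      then show ?thesis
        using poly_roots_finite[OF fibre_poly_nz[of w]] fibre_poly_nz[of w] by (simp add: order_0I)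
    qed
  qed
  then have c: "card {z. poly ?s z = 0} = degree ?s"
    using size_proots_complex[of ?s] by simp
  show ?thesis
  proof (cases "degree ?s < N")
    case True
    then have "f None = w" using rext_None_eq_iff f_None by simp
    then have "degree ?s = N - 1" using locally_inj_None_degree assms by auto
    then show ?thesis using c True by (simp add: card_fibre)
  next
    case False
    then show ?thesis using c degree_fibre_le[of w] by (simp add: card_fibre)
  qed
qed

end

section \<open>Wronskians of fibre polynomials\<close>

text \<open>The coefficient of degree deg u + deg v - 1 is (deg u - deg v) times the product of the
  leading coefficients, which is where unequal degrees enter.\<close>

lemma degree_wronskian_ge:
  fixes u v :: "complex poly"
  assumes ne: "degree u \<noteq> degree v" and nz: "u \<noteq> 0" "v \<noteq> 0"
  shows "degree (pderiv u * v - u * pderiv v) \<ge> degree u + degree v - 1"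
proof -
  define n where "n = degree u + degree v - 1"
  have c: "coeff (pderiv u * v) n = of_nat (degree u) * lead_coeff u * lead_coeff v"
    if "degree u + degree v - 1 = n" "degree u + degree v \<ge> 1" for u v :: "complex poly"
  proof (cases "degree u = 0")
    case True
    then have "pderiv u = 0" by (simp add: pderiv_eq_0_iff)
    then show ?thesis using True by simp
  next
    case False
    then have "n = degree (pderiv u) + degree v" using that by (simp add: degree_pderiv)
    then have "coeff (pderiv u * v) n = lead_coeff (pderiv u) * lead_coeff v"
      by (simp add: coeff_mult_degree_sum)
    also have "lead_coeff (pderiv u) = of_nat (degree u) * lead_coeff u"
      using False by (simp add: degree_pderiv coeff_pderiv)
    finally show ?thesis by simp
  qed
  have ge: "degree u + degree v \<ge> 1" using ne by linarith
  have c1: "coeff (pderiv u * v) n = of_nat (degree u) * lead_coeff u * lead_coeff v"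
    by (rule c) (use ge in \<open>simp_all add: n_def\<close>)
  have c2: "coeff (pderiv v * u) n = of_nat (degree v) * lead_coeff v * lead_coeff u"
    by (rule c) (use ge in \<open>simp_all add: n_def\<close>)
  have "coeff (pderiv u * v - u * pderiv v) n = (of_nat (degree u) - of_nat (degree v)) * (lead_coeff u * lead_coeff v)"
    using c1 c2 by (simp add: mult.commute[of u "pderiv v"] left_diff_distrib)
  also have "\<dots> \<noteq> 0" using ne nz by simp
  finally show ?thesis unfolding n_def[symmetric] by (rule le_degree)
qed

text \<open>Differentiation lowers the multiplicity m + 1 of \<open>x\<close> in \<open>u\<close> to
  m. The polynomial \<open>b\<close> is the cofactor of (X - x)^m in \<open>W\<close>; at
  \<open>x\<close> only its term (m + 1) s v survives.\<close>

lemma order_wronskian: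
  fixes u v :: "complex poly"
  assumes u: "u \<noteq> 0" "poly u x = 0" and v: "poly v x \<noteq> 0" and W: "W = pderiv u * v - u * pderiv v" "W \<noteq> 0"
  shows "Polynomial.order x W + 1 = Polynomial.order x u"
proof -
  obtain s where s: "u = [:- x, 1:] ^ Polynomial.order x u * s" "\<not> [:- x, 1:] dvd s"
    using order_decomp[OF u(1)] by blast
  have "Polynomial.order x u \<noteq> 0" using u order_root by blast
  then obtain m where m: "Polynomial.order x u = Suc m" by (cases "Polynomial.order x u") auto
  have sx: "poly s x \<noteq> 0" using s(2) by (simp add: poly_eq_0_iff_dvd)
  define b where "b = (smult (of_nat (Suc m)) s + [:- x, 1:] * pderiv s) * v - [:- x, 1:] * s * pderiv v"
  have bx: "poly b x \<noteq> 0" using sx v by (simp add: b_def del: of_nat_Suc)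
  have "W = [:- x, 1:] ^ m * b"
  proof -
    have pd: "pderiv ([:- x, 1:] ^ Suc m) = smult (of_nat (Suc m)) ([:- x, 1:] ^ m)"
      by (simp add: pderiv_power_Suc pderiv_pCons del: of_nat_Suc power_Suc)
    have u': "u = [:- x, 1:] ^ Suc m * s" using s(1) m by simp
    have alg: "(smult c (L ^ m) * s + L ^ Suc m * s') * v - L ^ Suc m * s * v' = L ^ m * ((smult c s + L * s') * v - L * s * v')"
      for L s' v' :: "complex poly" and c
      by (simp add: algebra_simps)
    have "pderiv u = smult (of_nat (Suc m)) ([:- x, 1:] ^ m) * s + [:- x, 1:] ^ Suc m * pderiv s"
      unfolding u' pderiv_mult pd by (simp only: add.commute mult.commute)
    then have "W = (smult (of_nat (Suc m)) ([:- x, 1:] ^ m) * s + [:- x, 1:] ^ Suc m * pderiv s) * v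
        - [:- x, 1:] ^ Suc m * s * pderiv v"
      unfolding W(1) u'[symmetric] by (simp only:)
    then show ?thesis unfolding b_def alg .
  qed
  then have "Polynomial.order x W = Polynomial.order x ([:- x, 1:] ^ m) + Polynomial.order x b"
    using W(2) order_mult by metis
  also have "\<dots> = m" using bx by (simp add: order_power_n_n order_0I)
  finally show ?thesis using m by simp
qed

text \<open>Riemann--Hurwitz in polynomial form: the fibres over the two points are given by coprime polynomials \<open>u\<close>, \<open>v\<close>, and
  their Wronskian has no other zeros, hence the degree of the Wronskian counts the points in these fibres.\<close>

context rational_fun
begin

text \<open>The fibre polynomials lie in the pencil spanned by \<open>p\<close> and
  \<open>q\<close>, and those of two distinct values form a basis of it. Excluding \<open>w2\<close>
  makes the coefficient at \<open>w1\<close> nonzero.\<close>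

lemma fibre_poly_comb:
  assumes "w1 \<noteq> w2" "w \<noteq> w2"
  obtains \<alpha> \<beta> where "\<alpha> \<noteq> 0" "fibre_poly p q w = smult \<alpha> (fibre_poly p q w1) + smult \<beta> (fibre_poly p q w2)"
proof (cases w2)
  case None
  then obtain a c where ac: "w1 = Some a" "w = Some c" using assms by (cases w1; cases w; auto)
  show thesis
    by (rule that[of 1 "a - c"]) (auto simp: None ac fibre_poly_def smult_diff_left)
next
  case b: (Some b)
  show thesis
  proof (cases w1)
    case w1: None
    show thesis
    proof (cases w)
      case None
      show thesis by (rule that[of 1 0]) (auto simp: None w1)
    next
      case (Some c)
      then show thesis using assms b
        by (intro that[of "b - c" 1]) (auto simp: w1 fibre_poly_def smult_diff_left)
    qed
  next
    case (Some a)
    have ab: "a \<noteq> b" using assms Some b by simp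
    show thesis
    proof (cases w)
      case None
      have "q = smult (1 / (b - a)) (p - smult a q) + smult (- 1 / (b - a)) (p - smult b q)"
      proof -
        obtain d where d: "b = a + d" "d \<noteq> 0" using ab by (metis add.commute add_0 diff_add_cancel)
        show ?thesis unfolding d(1) using d(2) by (intro poly_eqI) (simp add: field_simps)
      qed
      then show thesis using ab
        by (intro that[of "1 / (b - a)" "- 1 / (b - a)"]) (auto simp: None Some b fibre_poly_def)
    next
      case c: (Some c)
      have "p - smult c q = smult ((c - b) / (a - b)) (p - smult a q) + smult ((a - c) / (a - b)) (p - smult b q)"
      proof -
        obtain d where d: "a = b + d" "d \<noteq> 0" using ab by (metis add.commute add_0 diff_add_cancel)
        show ?thesis unfolding d(1) using d(2) by (intro poly_eqI) (simp add: field_simps)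
      qed
      then show thesis using ab assms
        by (intro that[of "(c - b) / (a - b)" "(a - c) / (a - b)"]) (auto simp: c Some b fibre_poly_def)
    qed
  qed
qed

lemma card_two_fibres:
  assumes ne: "w1 \<noteq> w2" and crit: "\<And>x. \<not> locally_inj sphere_top f x \<Longrightarrow> f x \<in> {w1, w2}"
  shows "card (f -` {w1, w2}) \<le> 2"
proof -
  define u where "u = fibre_poly p q w1"
  define v where "v = fibre_poly p q w2"
  define W where "W = pderiv u * v - u * pderiv v"
  have nz: "u \<noteq> 0" "v \<noteq> 0" by (simp_all add: u_def v_def fibre_poly_nz)
  have comb: "\<exists>\<alpha> \<beta>. \<alpha> \<noteq> 0 \<and> fibre_poly p q w = smult \<alpha> u + smult \<beta> v" if "w \<noteq> w2" for w
    using fibre_poly_comb[OF ne that] unfolding u_def v_def by metis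
  \<comment> \<open>The Wronskian is alternating, so replacing \<open>u\<close> by a combination
    with \<open>v\<close> only rescales it.\<close>
  have Wcomb: "pderiv s * v - s * pderiv v = smult \<alpha> W" if "s = smult \<alpha> u + smult \<beta> v" for s \<alpha> \<beta>
    using that by (simp add: W_def pderiv_add pderiv_smult algebra_simps smult_diff_right)
  have coprime: "poly u z \<noteq> 0 \<or> poly v z \<noteq> 0" for z
    using ne f_Some_eq_iff[of z w1] f_Some_eq_iff[of z w2] by (auto simp: u_def v_def)
  have Wz: "poly W z \<noteq> 0" if "poly u z \<noteq> 0" "poly v z \<noteq> 0" for z
  proof -
    define w where "w = f (Some z)"
    have w: "w \<notin> {w1, w2}"
      using that f_Some_eq_iff[of z w1] f_Some_eq_iff[of z w2] by (auto simp: u_def v_def w_def)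
    then have "locally_inj sphere_top f (Some z)" using crit w_def by blast
    then have pd: "poly (pderiv (fibre_poly p q w)) z \<noteq> 0"
      unfolding w_def by (rule locally_inj_imp_pderiv)
    have s0: "poly (fibre_poly p q w) z = 0" using f_Some_eq_iff w_def by blast
    obtain \<alpha> \<beta> where ab: "fibre_poly p q w = smult \<alpha> u + smult \<beta> v" using comb w by blast
    have "\<alpha> * poly W z = poly (pderiv (fibre_poly p q w)) z * poly v z"
      using arg_cong[OF Wcomb[OF ab], of "\<lambda>r. poly r z"] s0 by simp
    then show ?thesis using pd that by auto
  qed
  define R where "R = {z. poly (u * v) z = 0}"
  have uv: "u * v \<noteq> 0" using nz by simp
  have finR: "finite R" unfolding R_def by (rule poly_roots_finite[OF uv])
  have "infinite (UNIV - R)" using finR infinite_UNIV_char_0 by (simp add: Diff_infinite_finite)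
  then obtain z0 where "z0 \<notin> R" by (metis DiffD2 finite.emptyI ex_in_conv)
  then have W0: "W \<noteq> 0" using Wz[of z0] by (auto simp: R_def)
  \<comment> \<open>At a zero of u v the order of \<open>W\<close> is one less than that of u v,
    elsewhere both orders are 0; adding the root set once therefore gives the roots of u v with
    multiplicity.\<close>
  have "proots W + mset_set R = proots (u * v)"
  proof (rule multiset_eqI)
    fix x
    have om: "Polynomial.order x (u * v) = Polynomial.order x u + Polynomial.order x v" by (rule order_mult[OF uv])
    consider "poly u x = 0" "poly v x \<noteq> 0" | "poly v x = 0" "poly u x \<noteq> 0" | "poly u x \<noteq> 0" "poly v x \<noteq> 0"
      using coprime by blast
    then have "Polynomial.order x W + (if x \<in> R then 1 else 0) = Polynomial.order x (u * v)"
    proof cases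
      case 1
      then show ?thesis using order_wronskian[OF nz(1) _ _ W_def W0] by (simp add: R_def om order_0I)
    next
      case 2
      have eq: "- W = pderiv v * u - v * pderiv u" by (simp add: W_def mult.commute)
      have "- W \<noteq> 0" using W0 by simp
      from order_wronskian[OF nz(2) 2 eq this]
      have "Polynomial.order x (- W) + 1 = Polynomial.order x v" .
      then have "Polynomial.order x W + 1 = Polynomial.order x v" by (simp only: order_uminus)
      then show ?thesis using 2 by (simp add: R_def om order_0I)
    next
      case 3
      then show ?thesis using Wz by (simp add: R_def om order_0I)
    qed
    then show "count (proots W + mset_set R) x = count (proots (u * v)) x"
      using W0 uv finR by (simp add: count_mset_set')
  qed
  then have "size (proots W) + card R = size (proots (u * v))"
    by (metis size_mset_set size_union)
  then have deg: "degree W + card R = degree u + degree v"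
    using nz by (simp add: size_proots_complex degree_mult_eq)
  have cardR: "card R = card {z. poly u z = 0} + card {z. poly v z = 0}"
  proof -
    have "R = {z. poly u z = 0} \<union> {z. poly v z = 0}" by (auto simp: R_def)
    then show ?thesis
      using coprime by (subst card_Un_disjoint[symmetric]) (auto simp: poly_roots_finite nz)
  qed
  have "card (f -` {w1, w2}) = card (f -` {w1} \<union> f -` {w2})" by (rule arg_cong[of _ _ card]) auto
  also have "\<dots> = card (f -` {w1}) + card (f -` {w2})"
    using ne by (subst card_Un_disjoint) (auto simp: finite_fibre)
  also have "\<dots> = card R + (if degree u < N then 1 else 0) + (if degree v < N then 1 else 0)"
    by (simp add: card_fibre cardR u_def v_def)
  finally have total: "card (f -` {w1, w2}) = card R + (if degree u < N then 1 else 0) + (if degree v < N then 1 else 0)" .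
  have degs: "degree u \<le> N" "degree v \<le> N" by (simp_all add: u_def v_def degree_fibre_le)
  have N12: "\<not> (degree u < N \<and> degree v < N)"
    using ne rext_None_eq_iff[of w1] rext_None_eq_iff[of w2] by (auto simp: u_def v_def)
  show ?thesis
  proof (cases "degree u = degree v")
    case False
    then have "degree u + degree v - 1 \<le> degree W"
      unfolding W_def by (rule degree_wronskian_ge) (use nz in auto)
    then have "card R \<le> 1" using deg False by linarith
    then show ?thesis using total N12 by auto
  next
    \<comment> \<open>Equal degrees put infinity in neither fibre. The fibre polynomial of the value
      at infinity then has degree N - 1 and, up to a nonzero factor, the same Wronskian with
      \<open>v\<close>, so the estimate for unequal degrees applies to it.\<close>
    case True
    then have duv: "degree u = N" "degree v = N" using N12 degs by auto
    have fN: "f None \<notin> {w1, w2}"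
      using duv rext_None_eq_iff[of w1] rext_None_eq_iff[of w2] f_None by (auto simp: u_def v_def)
    then have "locally_inj sphere_top f None" using crit by blast
    then have ds: "degree (fibre_poly p q (f None)) = N - 1" by (rule locally_inj_None_degree)
    obtain \<alpha> \<beta> where ab: "\<alpha> \<noteq> 0" "fibre_poly p q (f None) = smult \<alpha> u + smult \<beta> v"
      using comb fN by blast
    have "N - 1 + N - 1 \<le> degree (pderiv (fibre_poly p q (f None)) * v - fibre_poly p q (f None) * pderiv v)"
      using degree_wronskian_ge[of "fibre_poly p q (f None)" v] ds duv N nz fibre_poly_nz by auto
    also have "\<dots> = degree W"
      using Wcomb[OF ab(2)] ab(1) by simp
    finally have "card R \<le> 2" using deg duv by linarith
    then show ?thesis using total duv by simp
  qed
qed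

end

section \<open>Local degrees\<close>

text \<open>Injectivity makes the zero of h(w) - h(z) at \<open>z\<close> simple, so this difference
  is (w - z) g(w) with \<open>g\<close> free of zeros near \<open>z\<close>. Its logarithmic
  derivative is 1/(w - z) plus a holomorphic function and integrates to 2 pi i. This makes
  holomorphic coordinates orientation-preserving in the sense of winding numbers.\<close>

lemma winding_number_holomorphic_circle:
  assumes W: "open W" and h: "h holomorphic_on W" "inj_on h W" and z: "z \<in> W"
  shows "\<forall>\<^sub>F r in at_right 0. winding_number (h \<circ> circlepath z r) (h z) = 1"
proof -
  obtain R where R: "R > 0" "ball z R \<subseteq> W" using W z openE by blast
  define k where "k w = h w - h z" for w
  have hB: "h holomorphic_on ball z R" using h(1) R(2) holomorphic_on_subset by blast
  have injB: "inj_on h (ball z R)" using h(2) R(2) inj_on_subset by blast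
  have kB: "k holomorphic_on ball z R" unfolding k_def by (intro holomorphic_intros hB)
  have nck: "\<not> k constant_on ball z R"
  proof
    assume "k constant_on ball z R"
    then obtain c where "\<And>w. w \<in> ball z R \<Longrightarrow> k w = c" by (auto simp: constant_on_def)
    moreover have "z + of_real (R/2) \<in> ball z R" "z \<in> ball z R" using R by (auto simp: dist_norm)
    ultimately have "k (z + of_real (R/2)) = c" "k z = c" by blast+
    then have "h (z + of_real (R/2)) = h z" unfolding k_def by (metis diff_eq_eq add_diff_cancel_left' diff_add_cancel)
    then have "z + of_real (R/2) = z"
      using injB \<open>z + of_real (R/2) \<in> ball z R\<close> \<open>z \<in> ball z R\<close> by (meson inj_onD)
    then show False using R by simp
  qed
  have "z \<in> ball z R" "k z = 0" using R by (auto simp: k_def)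
  then have "\<exists>g r0 n. 0 < n \<and> 0 < r0 \<and> ball z r0 \<subseteq> ball z R \<and> g holomorphic_on ball z r0 \<and>
      (\<forall>w\<in>ball z r0. k w = (w - z)^n * g w) \<and> (\<forall>w\<in>ball z r0. g w \<noteq> 0)"
    by (rule holomorphic_factor_zero_nonconstant[OF kB open_ball connected_ball _ _ nck]) blast
  then obtain g r0 n where g: "0 < n" "0 < r0" "ball z r0 \<subseteq> ball z R" "g holomorphic_on ball z r0"
      "\<And>w. w \<in> ball z r0 \<Longrightarrow> k w = (w - z)^n * g w" "\<And>w. w \<in> ball z r0 \<Longrightarrow> g w \<noteq> 0"
    by blast
  have gd: "(g has_field_derivative deriv g w) (at w)" if "w \<in> ball z r0" for w
    using g(4) that by (auto intro: holomorphic_derivI)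
  have kd: "(k has_field_derivative (of_nat n * (w - z)^(n-1) * g w + (w - z)^n * deriv g w)) (at w)" if "w \<in> ball z r0" for w
  proof -
    have "((\<lambda>w. (w - z)^n * g w) has_field_derivative (of_nat n * (w - z)^(n-1) * g w + (w - z)^n * deriv g w)) (at w)"
      by (auto intro!: derivative_eq_intros gd[OF that] simp: mult_ac)
    then show ?thesis
      by (rule has_field_derivative_transform_within_open[OF _ open_ball that]) (simp add: g(5))
  qed
  have kdh: "deriv k w = deriv h w" if "w \<in> ball z r0" for w
  proof -
    have "h field_differentiable at w" using hB g(3) that holomorphic_on_imp_differentiable_at[OF hB open_ball] by blast
    then show ?thesis unfolding k_def by simp
  qed
  have "deriv h z \<noteq> 0"
    using holomorphic_injective_imp_regular[OF hB open_ball injB, of z] R by simp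
  then have "of_nat n * (z - z)^(n-1) * g z + (z - z)^n * deriv g z \<noteq> 0"
    using DERIV_imp_deriv[OF kd[of z]] kdh[of z] g(2) by simp
  then have n: "n = 1" using g(1) by (auto simp: power_0_left split: if_splits)
  have "winding_number (h \<circ> circlepath z r) (h z) = 1" if r: "0 < r" "r < r0" for r
  proof -
    have img: "path_image (circlepath z r) \<subseteq> ball z r0" using r by auto
    have hr0: "h holomorphic_on ball z r0" using hB g(3) holomorphic_on_subset by blast
    have vp: "valid_path (h \<circ> circlepath z r)"
      by (rule valid_path_compose_holomorphic[OF _ hr0 open_ball img]) simp
    have ne: "h z \<notin> path_image (h \<circ> circlepath z r)"
    proof
      assume "h z \<in> path_image (h \<circ> circlepath z r)"
      then obtain w where w: "w \<in> path_image (circlepath z r)" "h w = h z"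
        by (auto simp: path_image_compose)
      moreover have "w \<in> ball z R" using w(1) img g(3) by blast
      moreover have "z \<in> ball z R" using R by simp
      ultimately have "w = z" using injB by (meson inj_onD)
      then show False using w r by auto
    qed
    have "winding_number (h \<circ> circlepath z r) (h z) = 1 / (2 * of_real pi * \<i>) * contour_integral (h \<circ> circlepath z r) (\<lambda>w. 1 / (w - h z))"
      by (simp add: winding_number_valid_path[OF vp ne])
    also have "contour_integral (h \<circ> circlepath z r) (\<lambda>w. 1 / (w - h z)) = contour_integral (circlepath z r) (\<lambda>w. deriv h w * (1 / (h w - h z)))"
      by (rule contour_integral_comp_analyticW[of _ "ball z r0"]) (use hr0 img in \<open>auto simp: analytic_on_open\<close>)
    also have "\<dots> = 2 * of_real pi * \<i>"
    proof (rule contour_integral_unique)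
      have 1: "((\<lambda>w. 1 / (w - z)) has_contour_integral 2 * of_real pi * \<i> * 1) (circlepath z r)"
        by (rule Cauchy_integral_circlepath_simple) (use r in auto)
      have 2: "((\<lambda>w. deriv g w / g w) has_contour_integral 0) (circlepath z r)"
        by (rule Cauchy_theorem_disc_simple[of _ z r0])
          (use g r img in \<open>auto intro!: holomorphic_intros holomorphic_deriv\<close>)
      have "((\<lambda>w. 1 / (w - z) + deriv g w / g w) has_contour_integral 2 * of_real pi * \<i>) (circlepath z r)"
        using has_contour_integral_add[OF 1 2] by simp
      then show "((\<lambda>w. deriv h w * (1 / (h w - h z))) has_contour_integral 2 * of_real pi * \<i>) (circlepath z r)"
      proof (rule has_contour_integral_eq)
        fix w assume w: "w \<in> path_image (circlepath z r)"
        then have wB: "w \<in> ball z r0" "w \<noteq> z" using img r by auto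
        have dh: "deriv h w = g w + (w - z) * deriv g w"
          using DERIV_imp_deriv[OF kd[OF wB(1)]] kdh[OF wB(1)] n by simp
        have hw: "h w - h z = (w - z) * g w" using g(5)[OF wB(1)] n by (simp add: k_def)
        have "1 / e + d / c = (c + e * d) * (1 / (e * c))" if "e \<noteq> 0" "c \<noteq> 0" for e d c :: complex
          using that by (simp add: field_simps)
        then show "1 / (w - z) + deriv g w / g w = deriv h w * (1 / (h w - h z))"
          unfolding dh hw using g(6)[OF wB(1)] wB by simp
      qed
    qed
    also have "1 / (2 * of_real pi * \<i>) * (2 * of_real pi * \<i>) = (1::complex)" by simp
    finally show ?thesis .
  qed
  then show ?thesis
    unfolding eventually_at_right_field using g(2) by (auto intro!: exI[of _ r0])
qed

section \<open>Holomorphic coordinates on the sphere\<close>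

lemma openin_sphere_top_charts:
  "openin sphere_top V \<longleftrightarrow> open {z. Some z \<in> V} \<and> open {z. inversion (Some z) \<in> V}"
proof
  assume "openin sphere_top V"
  then show "open {z. Some z \<in> V} \<and> open {z. inversion (Some z) \<in> V}"
    using open_Some_vimage[of V] open_Some_vimage[OF openin_inversion_vimage[of V]] by simp
next
  assume *: "open {z. Some z \<in> V} \<and> open {z. inversion (Some z) \<in> V}"
  show "openin sphere_top V"
    unfolding openin_sphere_top
  proof (intro conjI impI)
    assume "None \<in> V"
    then have "0 \<in> {z. inversion (Some z) \<in> V}" by simp
    then obtain r where r: "r > 0" "ball 0 r \<subseteq> {z. inversion (Some z) \<in> V}"
      using * by (meson open_contains_ball)
    show "\<exists>R. \<forall>z. R < norm z \<longrightarrow> Some z \<in> V"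
    proof (intro exI[of _ "1 / r"] allI impI)
      fix z :: complex assume z: "1 / r < norm z"
      then have nz: "norm z > 0" using r by (smt (verit) divide_pos_pos)
      then have "norm (1 / z) < r" using z r by (simp add: norm_divide field_simps)
      then have "inversion (Some (1 / z)) \<in> V" using r by auto
      then show "Some z \<in> V" using nz by auto
    qed
  qed (use * in blast)
qed

text \<open>Coordinates that are holomorphic when read in either standard chart. The coordinates of
  the sphere that have to be exhibited are all of this form.\<close>

definition sphere_chart :: "riemann set \<Rightarrow> (riemann \<Rightarrow> complex) \<Rightarrow> bool" where
  "sphere_chart U \<phi> \<longleftrightarrow> openin sphere_top U \<and> inj_on \<phi> U \<and>
     (\<lambda>z. \<phi> (Some z)) holomorphic_on {z. Some z \<in> U} \<and>
     (\<lambda>z. \<phi> (inversion (Some z))) holomorphic_on {z. inversion (Some z) \<in> U}"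

lemma sphere_chart_inversion:
  assumes "sphere_chart U \<phi>" shows "sphere_chart {x. inversion x \<in> U} (\<phi> \<circ> inversion)"
  using assms openin_inversion_vimage[of U]
  by (auto simp: sphere_chart_def inj_on_def) (metis inversion_inversion)

lemma sphere_chart_Some:
  assumes B: "open B" and \<phi>: "\<phi> holomorphic_on B" "inj_on \<phi> B"
  shows "sphere_chart (Some ` B) (\<phi> \<circ> the)"
proof -
  have eq: "{z. inversion (Some z) \<in> Some ` B} = {z. z \<noteq> 0 \<and> 1 / z \<in> B}"
    by (auto simp: inversion_def image_iff)
  have "(\<phi> \<circ> (\<lambda>z. 1 / z)) holomorphic_on {z. z \<noteq> 0 \<and> 1 / z \<in> B}"
    by (intro holomorphic_on_compose_gen[OF _ \<phi>(1)] holomorphic_intros) auto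
  then have "(\<lambda>z. (\<phi> \<circ> the) (inversion (Some z))) holomorphic_on {z. z \<noteq> 0 \<and> 1 / z \<in> B}"
    by (rule holomorphic_transform) auto
  moreover have "{z. Some z \<in> Some ` B} = B" by auto
  ultimately show ?thesis
    using assms by (auto simp: sphere_chart_def eq inj_on_def)
qed

text \<open>The open mapping theorem makes the coordinate a homeomorphism onto an open set, and the
  transition from either standard chart is holomorphic and injective, so small circles wind
  once.\<close>

lemma sphere_chart_imp_local_coordinate:
  assumes "sphere_chart U \<phi>"
  shows "local_coordinate riemann_sphere U \<phi>"
proof -
  have U: "openin sphere_top U" and inj: "inj_on \<phi> U"
    and h1: "(\<lambda>z. \<phi> (Some z)) holomorphic_on {z. Some z \<in> U}"
    and h2: "(\<lambda>z. \<phi> (inversion (Some z))) holomorphic_on {z. inversion (Some z) \<in> U}"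
    using assms by (auto simp: sphere_chart_def)
  have o1: "open {z. Some z \<in> U}" and o2: "open {z. inversion (Some z) \<in> U}"
    using U openin_sphere_top_charts by blast+
  have inj1: "inj_on (\<lambda>z. \<phi> (Some z)) {z. Some z \<in> U}"
    using inj by (auto simp: inj_on_def)
  have inj2: "inj_on (\<lambda>z. \<phi> (inversion (Some z))) {z. inversion (Some z) \<in> U}"
    using inj by (auto simp: inj_on_def) (metis inversion_inversion option.inject)
  have cases: "x \<in> range Some \<or> x \<in> range (\<lambda>z. inversion (Some z))" for x
    by (cases x) (auto intro: range_eqI[of _ _ 0])
  have opn: "open (\<phi> ` V)" if V: "openin sphere_top V" "V \<subseteq> U" for V
  proof -
    have "\<phi> ` V = (\<lambda>z. \<phi> (Some z)) ` {z. Some z \<in> V} \<union> (\<lambda>z. \<phi> (inversion (Some z))) ` {z. inversion (Some z) \<in> V}"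
      using cases by (auto simp: image_iff) metis+
    moreover have "open ((\<lambda>z. \<phi> (Some z)) ` {z. Some z \<in> V})"
      by (rule open_mapping_thm3) (use V h1 inj1 openin_sphere_top_charts in \<open>auto intro: holomorphic_on_subset inj_on_subset\<close>)
    moreover have "open ((\<lambda>z. \<phi> (inversion (Some z))) ` {z. inversion (Some z) \<in> V})"
      by (rule open_mapping_thm3) (use V h2 inj2 openin_sphere_top_charts in \<open>auto intro: holomorphic_on_subset inj_on_subset\<close>)
    ultimately show ?thesis by auto
  qed
  have "homeomorphic_map (subtopology sphere_top U) (top_of_set (\<phi> ` U)) \<phi>"
  proof (rule bijective_open_imp_homeomorphic_map)
    have "openin sphere_top {x\<in>U. \<phi> x \<in> T}" if T: "open T" for T
    proof -
      have "open ({z. Some z \<in> U} \<inter> (\<lambda>z. \<phi> (Some z)) -` T)"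
        using continuous_open_preimage[OF holomorphic_on_imp_continuous_on[OF h1] o1 T] .
      moreover have "open ({z. inversion (Some z) \<in> U} \<inter> (\<lambda>z. \<phi> (inversion (Some z))) -` T)"
        using continuous_open_preimage[OF holomorphic_on_imp_continuous_on[OF h2] o2 T] .
      ultimately show ?thesis
        unfolding openin_sphere_top_charts by (simp add: Int_def vimage_def)
    qed
    then have "continuous_map (subtopology sphere_top U) euclidean \<phi>"
      using U by (auto simp: continuous_map openin_subtopology_Int2 openin_open_subtopology openin_subset)
    then show "continuous_map (subtopology sphere_top U) (top_of_set (\<phi> ` U)) \<phi>"
      by (simp add: continuous_map_in_subtopology)
    show "open_map (subtopology sphere_top U) (top_of_set (\<phi> ` U)) \<phi>"
      unfolding open_map_def
      using opn U by (auto simp: openin_open_subtopology openin_open_eq open_subset)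
  qed (use inj in auto)
  moreover have "orientation_preserving_on (\<psi> ` (U \<inter> V)) (\<phi> \<circ> inv_into V \<psi>)"
    if atlas: "(V, \<psi>) \<in> surface_atlas riemann_sphere" for V \<psi>
  proof -
    \<comment> \<open>A transition map may be replaced by a holomorphic function with which it
      agrees on \<open>W\<close>: once the circle lies in \<open>W\<close>, the winding numbers are
      the same.\<close>
    have main: "orientation_preserving_on W k"
      if W: "open W" "h holomorphic_on W" "inj_on h W" and k: "\<And>z. z \<in> W \<Longrightarrow> k z = h z" for W h k
      unfolding orientation_preserving_on_def
    proof
      fix z assume z: "z \<in> W"
      obtain R where R: "R > 0" "ball z R \<subseteq> W" using W z openE by blast
      have "\<forall>\<^sub>F r in at_right 0. r < R \<and> (0::real) < r"
        using R unfolding eventually_at_right_field by auto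
      then show "\<forall>\<^sub>F r in at_right 0. winding_number (k \<circ> circlepath z r) (k z) = 1"
        using winding_number_holomorphic_circle[OF W z]
      proof eventually_elim
        case (elim r)
        have "winding_number (k \<circ> circlepath z r) (k z) = winding_number (h \<circ> circlepath z r) (h z)"
        proof -
          have "(k \<circ> circlepath z r) t = (h \<circ> circlepath z r) t" for t
          proof -
            have "circlepath z r t \<in> ball z R"
              using elim by (simp add: circlepath dist_norm norm_mult)
            then show ?thesis using k R by auto
          qed
          then have "k \<circ> circlepath z r = h \<circ> circlepath z r" by blast
          then show ?thesis using k z by simp
        qed
        then show ?case using elim by simp
      qed
    qed
    consider "V = range Some" "\<psi> = the" | "V = - {Some 0}" "\<psi> = (\<lambda>x. case x of None \<Rightarrow> 0 | Some z \<Rightarrow> 1 / z)"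
      using atlas by (auto simp: riemann_sphere_def)
    then show ?thesis
    proof cases
      case 1
      have "\<psi> ` (U \<inter> V) = {z. Some z \<in> U}" using 1 by (auto simp: image_iff) (metis Int_iff option.sel rangeI)
      moreover have "inv_into V \<psi> z = Some z" for z
        unfolding 1 by (rule inv_into_f_eq) (auto simp: inj_on_def)
      ultimately show ?thesis using main[OF o1 h1 inj1] by simp
    next
      case 2
      have ps: "\<psi> (inversion (Some z)) = z" "inversion (Some z) \<in> V" for z
        by (auto simp: 2 inversion_def)
      have ps': "x = inversion (Some (\<psi> x))" if "x \<in> V" for x
        using that by (cases x) (auto simp: 2 inversion_def)
      have "\<psi> ` (U \<inter> V) = {z. inversion (Some z) \<in> U}"
        using ps ps' by (auto simp: image_iff) (metis Int_iff)
      moreover have "inv_into V \<psi> z = inversion (Some z)" for z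
        by (rule inv_into_f_eq) (use ps ps' in \<open>auto simp: inj_on_def, metis\<close>)
      ultimately show ?thesis using main[OF o2 h2 inj2] by simp
    qed
  qed
  ultimately show ?thesis
    using U opn[OF U] by (auto simp: local_coordinate_def riemann_sphere_def)
qed

text \<open>F - F(z0) factors as (z - z0)^d g with \<open>g\<close> free of zeros. On a disc
  \<open>g\<close> has a logarithm, hence a d-th root, which is absorbed into the
  coordinate.\<close>

lemma holomorphic_local_power_form:
  assumes F: "F holomorphic_on S" "open S" "z0 \<in> S" and nc: "\<And>r. r > 0 \<Longrightarrow> \<exists>z\<in>ball z0 r. F z \<noteq> F z0"
  obtains d B \<phi> where "d \<ge> 1" "open B" "z0 \<in> B" "B \<subseteq> S" "\<phi> holomorphic_on B" "inj_on \<phi> B" "\<phi> z0 = 0"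
    "\<And>z. z \<in> B \<Longrightarrow> F z = F z0 + \<phi> z ^ d"
proof -
  obtain R where R: "R > 0" "ball z0 R \<subseteq> S" using F openE by blast
  define k where "k z = F z - F z0" for z
  have kB: "k holomorphic_on ball z0 R"
    unfolding k_def by (intro holomorphic_intros holomorphic_on_subset[OF F(1) R(2)])
  have nck: "\<not> k constant_on ball z0 R"
  proof
    assume "k constant_on ball z0 R"
    then obtain c where c: "\<And>z. z \<in> ball z0 R \<Longrightarrow> k z = c" by (auto simp: constant_on_def)
    have "k z0 = c" by (rule c) (use R in simp)
    then have c0: "c = 0" by (simp add: k_def)
    have "F z = F z0" if "z \<in> ball z0 R" for z
      using c[OF that] unfolding c0 k_def by simp
    then show False using nc[OF R(1)] by blast
  qed
  have "z0 \<in> ball z0 R" "k z0 = 0" using R by (auto simp: k_def)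
  then have "\<exists>g r n. 0 < n \<and> 0 < r \<and> ball z0 r \<subseteq> ball z0 R \<and> g holomorphic_on ball z0 r \<and>
      (\<forall>w\<in>ball z0 r. k w = (w - z0)^n * g w) \<and> (\<forall>w\<in>ball z0 r. g w \<noteq> 0)"
    by (rule holomorphic_factor_zero_nonconstant[OF kB open_ball connected_ball _ _ nck]) blast
  then obtain g r n where g: "0 < n" "0 < r" "ball z0 r \<subseteq> ball z0 R" "g holomorphic_on ball z0 r"
      "\<And>w. w \<in> ball z0 r \<Longrightarrow> k w = (w - z0)^n * g w" "\<And>w. w \<in> ball z0 r \<Longrightarrow> g w \<noteq> 0"
    by blast
  obtain l where l: "l holomorphic_on ball z0 r" "\<And>x. x \<in> ball z0 r \<Longrightarrow> exp (l x) = g x"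
    using holomorphic_logarithm_exists[OF convex_ball open_ball g(4) g(6), of z0] g(2) by auto
  define \<phi> where "\<phi> w = (w - z0) * exp (l w / of_nat n)" for w
  have \<phi>h: "\<phi> holomorphic_on ball z0 r"
    unfolding \<phi>_def by (intro holomorphic_intros l(1)) (use g in auto)
  have \<phi>n: "\<phi> w ^ n = k w" if "w \<in> ball z0 r" for w
  proof -
    have "exp (l w / of_nat n) ^ n = g w"
      using l(2)[OF that] g(1) by (simp flip: exp_of_nat_mult)
    then show ?thesis using g(5)[OF that] by (simp add: \<phi>_def power_mult_distrib)
  qed
  have "(\<phi> has_field_derivative exp (l z0 / of_nat n)) (at z0)"
  proof -
    have "((\<lambda>w. exp (l w / of_nat n)) has_field_derivative deriv (\<lambda>w. exp (l w / of_nat n)) z0) (at z0)"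
      by (rule holomorphic_derivI[of _ "ball z0 r"]) (use g in \<open>auto intro!: holomorphic_intros l(1)\<close>)
    moreover have "((\<lambda>w. w - z0) has_field_derivative 1) (at z0)"
      by (auto intro!: derivative_eq_intros)
    ultimately have "((\<lambda>w. (w - z0) * exp (l w / of_nat n)) has_field_derivative
        1 * exp (l z0 / of_nat n) + deriv (\<lambda>w. exp (l w / of_nat n)) z0 * (z0 - z0)) (at z0)"
      by (rule DERIV_mult[rotated])
    then show ?thesis by (simp add: \<phi>_def[abs_def])
  qed
  then have "deriv \<phi> z0 \<noteq> 0" by (simp add: DERIV_imp_deriv)
  then obtain r' where r': "r' > 0" "ball z0 r' \<subseteq> ball z0 r" "inj_on \<phi> (ball z0 r')"
    using has_complex_derivative_locally_injective[OF \<phi>h _ open_ball, of z0] g(2) by auto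
  show thesis
  proof (rule that[of n "ball z0 r'" \<phi>])
    show "F z = F z0 + \<phi> z ^ n" if "z \<in> ball z0 r'" for z
      using \<phi>n[of z] that r' by (auto simp: k_def)
    show "\<phi> holomorphic_on ball z0 r'" using \<phi>h r'(2) holomorphic_on_subset by blast
  qed (use g r' R in \<open>auto simp: \<phi>_def\<close>)
qed

text \<open>The maps \<open>\<epsilon>\<close> and \<open>\<epsilon>'\<close> select the standard
  charts at the point and at its image, so that finite points, poles and infinity are treated at
  once. The source coordinate comes from \<open>holomorphic_local_power_form\<close>, the target
  coordinate is a translation.\<close>

lemma has_local_degree_exists:
  assumes \<epsilon>: "\<epsilon> \<in> {id, inversion}" "\<epsilon>' \<in> {id, inversion}"
    and F: "F holomorphic_on S" "open S" "z0 \<in> S" and nc: "\<And>r. r > 0 \<Longrightarrow> \<exists>z\<in>ball z0 r. F z \<noteq> F z0"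
    and f: "\<And>z. z \<in> S \<Longrightarrow> f (\<epsilon> (Some z)) = \<epsilon>' (Some (F z))"
  obtains d where "has_local_degree riemann_sphere riemann_sphere f (\<epsilon> (Some z0)) d"
    "d = 1 \<Longrightarrow> locally_inj sphere_top f (\<epsilon> (Some z0))"
proof -
  have ee: "\<epsilon> (\<epsilon> x) = x" "\<epsilon>' (\<epsilon>' x) = x" for x using \<epsilon> by auto
  obtain d B \<phi> where B: "d \<ge> 1" "open B" "z0 \<in> B" "B \<subseteq> S" "\<phi> holomorphic_on B" "inj_on \<phi> B" "\<phi> z0 = 0"
    "\<And>z. z \<in> B \<Longrightarrow> F z = F z0 + \<phi> z ^ d"
    using holomorphic_local_power_form[OF F nc] by blast
  define U where "U = {x. \<epsilon> x \<in> Some ` B}"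
  have cU: "sphere_chart U ((\<phi> \<circ> the) \<circ> \<epsilon>)"
    using sphere_chart_Some[OF B(2,5,6)] sphere_chart_inversion[OF sphere_chart_Some[OF B(2,5,6)]] \<epsilon>(1)
    by (auto simp: U_def)
  define V where "V = {x. \<epsilon>' x \<in> range Some}"
  define \<psi> where "\<psi> = ((\<lambda>z. z - F z0) \<circ> the) \<circ> \<epsilon>'"
  have c0: "sphere_chart (range Some) ((\<lambda>z. z - F z0) \<circ> the)"
  proof -
    have "(\<lambda>z. z - F z0) holomorphic_on UNIV" by (intro holomorphic_intros)
    then show ?thesis using sphere_chart_Some[of UNIV "\<lambda>z. z - F z0"] by (simp add: inj_on_def)
  qed
  have cV: "sphere_chart V \<psi>"
    using c0 sphere_chart_inversion[OF c0] \<epsilon>(2) by (auto simp: V_def \<psi>_def)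
  have val: "f x \<in> V \<and> \<psi> (f x) = ((\<phi> \<circ> the) \<circ> \<epsilon>) x ^ d" if "x \<in> U" for x
  proof -
    have "\<epsilon> x \<in> Some ` B" using that by (simp add: U_def)
    then obtain z where z: "z \<in> B" "\<epsilon> x = Some z" by blast
    then have "f x = \<epsilon>' (Some (F z))" using f[of z] B(4) ee by (metis subsetD)
    then show ?thesis using z B(8)[OF z(1)] ee by (simp add: V_def \<psi>_def)
  qed
  have x0: "\<epsilon> (Some z0) \<in> U" using B by (simp add: U_def ee)
  have f0: "f (\<epsilon> (Some z0)) \<in> V" "\<psi> (f (\<epsilon> (Some z0))) = 0"
    using val[OF x0] B(1,7) by (auto simp: ee)
  show thesis
  proof (rule that[of d])
    show "has_local_degree riemann_sphere riemann_sphere f (\<epsilon> (Some z0)) d"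
      unfolding has_local_degree_def
      using B(1) sphere_chart_imp_local_coordinate[OF cU] sphere_chart_imp_local_coordinate[OF cV] x0 f0 val B(7)
      by (intro conjI exI[of _ U] exI[of _ "\<phi> \<circ> the \<circ> \<epsilon>"] exI[of _ V] exI[of _ \<psi>]) (auto simp: ee)
    assume d1: "d = 1"
    have "inj_on f U"
    proof (rule inj_onI)
      fix x y assume xy: "x \<in> U" "y \<in> U" "f x = f y"
      then have "(\<phi> \<circ> the \<circ> \<epsilon>) x = (\<phi> \<circ> the \<circ> \<epsilon>) y" using val[of x] val[of y] d1 by simp
      then show "x = y" using cU xy by (auto simp: sphere_chart_def inj_on_def)
    qed
    then show "locally_inj sphere_top f (\<epsilon> (Some z0))"
      using cU x0 by (auto simp: locally_inj_def sphere_chart_def)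
  qed
qed

section \<open>Topological consequences of a local degree\<close>

lemma open_power_image:
  fixes X :: "complex set"
  assumes X: "open X" and d: "d \<ge> 1"
  shows "open ((\<lambda>z. z ^ d) ` X)"
proof (rule open_mapping_thm2)
  show "(\<lambda>z::complex. z ^ d) holomorphic_on UNIV" by (intro holomorphic_intros)
  fix Y :: "complex set" assume Y: "open Y" "Y \<noteq> {}"
  show "\<not> (\<lambda>z. z ^ d) constant_on Y"
  proof
    assume "(\<lambda>z. z ^ d) constant_on Y"
    then obtain c where c: "\<And>z. z \<in> Y \<Longrightarrow> z ^ d = c" by (auto simp: constant_on_def)
    define r where "r = monom 1 d - [:c:]"
    have "coeff r d = 1" using d by (simp add: r_def coeff_pCons split: nat.splits)
    then have "r \<noteq> 0" by auto
    then have "finite {z. poly r z = 0}" by (rule poly_roots_finite)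
    moreover have "Y \<subseteq> {z. poly r z = 0}" using c by (auto simp: r_def poly_monom)
    ultimately have "finite Y" by (rule rev_finite_subset)
    then show False using Y finite_imp_not_open by blast
  qed
qed (use X in auto)

text \<open>Only topological information is kept: near \<open>p\<close> the fibres are those of the
  d-th power in an injective continuous coordinate, and the map is open. In this form it serves for
  \<open>\<Theta>\<close> as well as for rational maps.\<close>

lemma local_degree_local_form:
  fixes S :: "'a oriented_surface"
  assumes d: "has_local_degree S S' f p d"
  obtains U and \<phi> :: "'a \<Rightarrow> complex" where "openin (surface_top S) U" "p \<in> U" "\<phi> p = 0" "open (\<phi> ` U)"
    "homeomorphic_map (subtopology (surface_top S) U) (top_of_set (\<phi> ` U)) \<phi>"
    "\<And>x y. x \<in> U \<Longrightarrow> y \<in> U \<Longrightarrow> f x = f y \<longleftrightarrow> \<phi> x ^ d = \<phi> y ^ d"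
    "\<And>W. openin (surface_top S) W \<Longrightarrow> W \<subseteq> U \<Longrightarrow> openin (surface_top S') (f ` W)"
proof -
  obtain U \<phi> V \<psi> where *: "d \<ge> 1" "local_coordinate S U \<phi>" "p \<in> U" "\<phi> p = 0" "local_coordinate S' V \<psi>"
     "\<And>x. x \<in> U \<Longrightarrow> f x \<in> V \<and> \<psi> (f x) = \<phi> x ^ d"
    using d unfolding has_local_degree_def by blast
  have U: "openin (surface_top S) U" "open (\<phi> ` U)" "homeomorphic_map (subtopology (surface_top S) U) (top_of_set (\<phi> ` U)) \<phi>"
    using *(2) by (auto simp: local_coordinate_def)
  have V: "openin (surface_top S') V" "homeomorphic_map (subtopology (surface_top S') V) (top_of_set (\<psi> ` V)) \<psi>"
    using *(5) by (auto simp: local_coordinate_def)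
  have injV: "inj_on \<psi> V"
    using homeomorphic_imp_injective_map[OF V(2)] openin_subset[OF V(1)] by (simp add: Int_absorb1)
  show thesis
  proof (rule that[OF U(1) *(3,4) U(2,3)])
    show "f x = f y \<longleftrightarrow> \<phi> x ^ d = \<phi> y ^ d" if "x \<in> U" "y \<in> U" for x y
      using *(6)[OF that(1)] *(6)[OF that(2)] injV by (metis inj_onD)
    fix W assume W: "openin (surface_top S) W" "W \<subseteq> U"
    have "openin (top_of_set (\<phi> ` U)) (\<phi> ` W)"
      using homeomorphic_imp_open_map[OF U(3)] W U(1) by (auto simp: open_map_def openin_open_subtopology)
    then have "open (\<phi> ` W)" using U(2) by (simp add: openin_open_eq)
    then have T: "open ((\<lambda>z. z ^ d) ` \<phi> ` W)" using *(1) by (rule open_power_image)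
    have eq: "f ` W = {y\<in>V. \<psi> y \<in> (\<lambda>z. z ^ d) ` \<phi> ` W}"
    proof
      show "f ` W \<subseteq> {y\<in>V. \<psi> y \<in> (\<lambda>z. z ^ d) ` \<phi> ` W}" using *(6) W(2) by auto
      show "{y\<in>V. \<psi> y \<in> (\<lambda>z. z ^ d) ` \<phi> ` W} \<subseteq> f ` W"
      proof
        fix y assume "y \<in> {y\<in>V. \<psi> y \<in> (\<lambda>z. z ^ d) ` \<phi> ` W}"
        then obtain x where x: "y \<in> V" "x \<in> W" "\<psi> y = \<phi> x ^ d" by auto
        then have "y = f x" using *(6)[of x] W(2) injV by (metis inj_onD subsetD)
        then show "y \<in> f ` W" using x by auto
      qed
    qed
    have "continuous_map (subtopology (surface_top S') V) euclidean \<psi>"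
      using homeomorphic_imp_continuous_map[OF V(2)] by (simp add: continuous_map_in_subtopology)
    then have "openin (subtopology (surface_top S') V) {y\<in>V. \<psi> y \<in> (\<lambda>z. z ^ d) ` \<phi> ` W}"
      using T openin_subset[OF V(1)] by (auto simp: continuous_map Int_absorb1)
    then show "openin (surface_top S') (f ` W)"
      using V(1) by (simp add: eq openin_open_subtopology)
  qed
qed

text \<open>With \<omega> a primitive d-th root of unity, the points with coordinates z and z
  \<omega> have the same image, and such pairs exist arbitrarily close to \<open>p\<close>.\<close>

lemma local_degree_ge_2_not_inj:
  fixes S :: "'a oriented_surface"
  assumes d: "has_local_degree S S' f p d" "d \<ge> 2"
  shows "\<not> locally_inj (surface_top S) f p"
proof
  assume "locally_inj (surface_top S) f p"
  then obtain W where W: "openin (surface_top S) W" "p \<in> W" "inj_on f W" by (auto simp: locally_inj_def)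
  obtain U and \<phi> :: "'a \<Rightarrow> complex" where U: "openin (surface_top S) U" "p \<in> U" "\<phi> p = 0" "open (\<phi> ` U)"
    "homeomorphic_map (subtopology (surface_top S) U) (top_of_set (\<phi> ` U)) \<phi>"
    "\<And>x y. x \<in> U \<Longrightarrow> y \<in> U \<Longrightarrow> f x = f y \<longleftrightarrow> \<phi> x ^ d = \<phi> y ^ d"
    by (rule local_degree_local_form[OF d(1)]) blast
  have "openin (top_of_set (\<phi> ` U)) (\<phi> ` (W \<inter> U))"
    using homeomorphic_imp_open_map[OF U(5)] W(1) U(1) by (auto simp: open_map_def openin_open_subtopology)
  then have "open (\<phi> ` (W \<inter> U))" using U(4) by (simp add: openin_open_eq)
  moreover have "0 \<in> \<phi> ` (W \<inter> U)" using W(2) U(2,3) by (auto simp: image_iff)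
  ultimately obtain r where r: "r > 0" "ball 0 r \<subseteq> \<phi> ` (W \<inter> U)" by (meson open_contains_ball)
  define z where "z = complex_of_real (r / 2)"
  define \<omega> where "\<omega> = cis (2 * pi / real d)"
  have "\<omega> ^ d = cis (real d * (2 * pi / real d))" unfolding \<omega>_def by (rule Complex.DeMoivre)
  also have "real d * (2 * pi / real d) = 2 * pi" using d(2) by simp
  finally have \<omega>: "\<omega> ^ d = 1" by simp
  have "\<omega> \<noteq> 1"
  proof
    assume "\<omega> = 1"
    then have "cos (2 * pi / real d) = 1" by (simp add: \<omega>_def complex_eq_iff)
    then obtain m :: int where "2 * pi / real d = of_int m * 2 * pi" by (auto simp: cos_one_2pi_int)
    then have "1 = of_int m * real d" using d(2) by (simp add: field_simps)
    then have "1 = m * int d" by (metis of_int_eq_iff of_int_mult of_int_1 of_int_of_nat_eq)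
    then show False using d(2) by (auto simp: zmult_eq_1_iff dest: sym)
  qed
  then have zz: "z \<noteq> z * \<omega>" using r by (auto simp: z_def)
  have "z \<in> ball 0 r" "z * \<omega> \<in> ball 0 r" using r by (auto simp: z_def \<omega>_def norm_mult)
  then have "z \<in> \<phi> ` (W \<inter> U)" "z * \<omega> \<in> \<phi> ` (W \<inter> U)" using r(2) by blast+
  then obtain x y where xy: "x \<in> W \<inter> U" "y \<in> W \<inter> U" "\<phi> x = z" "\<phi> y = z * \<omega>"
    by (elim imageE) simp
  then have "f x = f y" using U(6)[of x y] \<omega> by (auto simp: power_mult_distrib)
  then have "x = y" using W(3) xy by (auto simp: inj_on_def)
  then show False using xy zz by simp
qed

lemma (in rational_pair) local_form_Some:
  obtains F \<epsilon>' S where "\<epsilon>' \<in> {id, inversion}" "F holomorphic_on S" "open S" "z0 \<in> S"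
    "\<And>z. z \<in> S \<Longrightarrow> f (Some z) = \<epsilon>' (Some (F z))"
proof (cases "poly q z0 = 0")
  case False
  show thesis
  proof (rule that[of id "\<lambda>z. poly p z / poly q z" "{z. poly q z \<noteq> 0}"])
    show "(\<lambda>z. poly p z / poly q z) holomorphic_on {z. poly q z \<noteq> 0}"
      by (intro holomorphic_intros) auto
    show "open {z. poly q z \<noteq> 0}" by (intro open_Collect_neq continuous_intros)
  qed (use False in \<open>auto simp: f_Some rational_extension_def\<close>)
next
  case True
  show thesis
  proof (rule that[of inversion "\<lambda>z. poly q z / poly p z" "{z. poly p z \<noteq> 0}"])
    show "(\<lambda>z. poly q z / poly p z) holomorphic_on {z. poly p z \<noteq> 0}"
      by (intro holomorphic_intros) auto
    show "open {z. poly p z \<noteq> 0}" by (intro open_Collect_neq continuous_intros)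
  qed (use True no_common[of z0] in \<open>auto simp: f_Some rational_extension_def inversion_def\<close>)
qed

context rational_fun
begin

text \<open>Finiteness of the fibres makes the map nonconstant in every chart, so the local power
  form applies; at infinity it is applied to the reversed pair at 0.\<close>

lemma has_local_degree_ex:
  obtains d where "has_local_degree riemann_sphere riemann_sphere f x d"
    "d = 1 \<Longrightarrow> locally_inj sphere_top f x"
proof -
  note goal_that = that
  have main: thesis
    if e: "\<epsilon> \<in> {id, inversion}" "\<epsilon>' \<in> {id, inversion}" and F: "F holomorphic_on S" "open S" "z0 \<in> S"
      and fF: "\<And>z. z \<in> S \<Longrightarrow> f (\<epsilon> (Some z)) = \<epsilon>' (Some (F z))" and x: "x = \<epsilon> (Some z0)" for F \<epsilon> \<epsilon>' S z0
  proof -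
    have nc: "\<exists>z\<in>ball z0 r. F z \<noteq> F z0" if r: "r > 0" for r
    proof (rule ccontr)
      assume neg: "\<not> ?thesis"
      have "f (\<epsilon> (Some z)) = f (\<epsilon> (Some z0))" if "z \<in> S \<inter> ball z0 r" for z
        using fF[of z] fF[of z0] that F neg by auto
      then have "(\<lambda>z. \<epsilon> (Some z)) ` (S \<inter> ball z0 r) \<subseteq> f -` {f (\<epsilon> (Some z0))}" by blast
      then have "finite ((\<lambda>z. \<epsilon> (Some z)) ` (S \<inter> ball z0 r))" using finite_fibre finite_subset by blast
      moreover have "inj (\<lambda>z. \<epsilon> (Some z))"
        using e(1) by (auto simp: inj_on_def) (metis inversion_inversion option.inject)
      ultimately have "finite (S \<inter> ball z0 r)" by (meson finite_imageD inj_on_subset subset_UNIV)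
      moreover have "open (S \<inter> ball z0 r)" "z0 \<in> S \<inter> ball z0 r" using F r by auto
      ultimately show False using finite_imp_not_open by blast
    qed
    show thesis
      by (rule has_local_degree_exists[OF e F nc fF]) (use x goal_that in auto)
  qed
  show thesis
  proof (cases x)
    case (Some z0)
    obtain F \<epsilon>' S where "\<epsilon>' \<in> {id, inversion}" "F holomorphic_on S" "open S" "z0 \<in> S"
      "\<And>z. z \<in> S \<Longrightarrow> f (Some z) = \<epsilon>' (Some (F z))"
      by (rule local_form_Some[of z0]) blast
    then show thesis using Some by (intro main[of id \<epsilon>' F S z0]) auto
  next
    case None
    interpret R: rational_pair "rev_poly N p" "rev_poly N q" "f \<circ> inversion" N
      by (rule rational_pair_rev[OF f_None])
    obtain F \<epsilon>' S where "\<epsilon>' \<in> {id, inversion}" "F holomorphic_on S" "open S" "0 \<in> S"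
      "\<And>z. z \<in> S \<Longrightarrow> (f \<circ> inversion) (Some z) = \<epsilon>' (Some (F z))"
      by (rule R.local_form_Some[of 0]) blast
    then show thesis using None by (intro main[of inversion \<epsilon>' F S 0]) auto
  qed
qed

text \<open>Some local degree exists at every point. If it is 1 the map is locally injective, and
  any local degree of at least 2 excludes local injectivity, so the two descriptions agree.\<close>

lemma critical_points_eq: "critical_points f = {x. \<not> locally_inj sphere_top f x}"
proof -
  have st: "surface_top riemann_sphere = sphere_top" by (simp add: riemann_sphere_def)
  have "x \<in> critical_points f" if "\<not> locally_inj sphere_top f x" for x
  proof -
    obtain d where d: "has_local_degree riemann_sphere riemann_sphere f x d" "d = 1 \<Longrightarrow> locally_inj sphere_top f x"
      by (rule has_local_degree_ex[of x]) blast
    then have "d \<noteq> 1" "d \<ge> 1" using that by (auto simp: has_local_degree_def)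
    then show ?thesis using d(1) by (auto simp: critical_points_def intro!: exI[of _ d])
  qed
  moreover have "\<not> locally_inj sphere_top f x" if "x \<in> critical_points f" for x
    using that local_degree_ge_2_not_inj st by (fastforce simp: critical_points_def)
  ultimately show ?thesis by blast
qed

end

section \<open>Lattices in the plane\<close>

text \<open>The determinant with columns \<open>x\<close> and \<open>y\<close>, that is, the
  oriented area they span.\<close>

definition wedge :: "real^2 \<Rightarrow> real^2 \<Rightarrow> real" where
  "wedge x y = x$1 * y$2 - x$2 * y$1"

lemma wedge_matrix: "wedge (A *v x) (A *v y) = det A * wedge x y"
  by (simp add: wedge_def det_2 matrix_vector_mult_def sum_2 algebra_simps)

lemma wedge_bound: "\<bar>wedge x y\<bar> \<le> 2 * norm x * norm y"
proof -
  have "\<bar>wedge x y\<bar> \<le> \<bar>x$1\<bar> * \<bar>y$2\<bar> + \<bar>x$2\<bar> * \<bar>y$1\<bar>"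
    unfolding wedge_def by (metis abs_mult abs_triangle_ineq4)
  also have "\<dots> \<le> norm x * norm y + norm x * norm y"
    by (intro add_mono mult_mono component_le_norm_cart) auto
  finally show ?thesis by simp
qed

lemma wedge_linear:
  "wedge (x + y) z = wedge x z + wedge y z" "wedge x (y + z) = wedge x y + wedge x z"
  "wedge (x - y) z = wedge x z - wedge y z" "wedge x (y - z) = wedge x y - wedge x z"
  "wedge (c *\<^sub>R x) z = c * wedge x z" "wedge x (c *\<^sub>R z) = c * wedge x z"
  "wedge x x = 0"
  by (simp_all add: wedge_def algebra_simps)

lemma wedge_commute: "wedge y x = - wedge x y"
  by (simp add: wedge_def)

text \<open>Cramer's rule without division.\<close>

lemma wedge_expansion: "wedge a b *\<^sub>R x = wedge x b *\<^sub>R a + wedge a x *\<^sub>R b"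
  by (simp add: vec_eq_iff forall_2 wedge_def algebra_simps)

lemma independent_wedge:
  fixes a b :: "real^2"
  assumes "a \<noteq> b" "independent {a, b}"
  shows "wedge a b \<noteq> 0"
proof
  assume w: "wedge a b = 0"
  have b0: "b \<noteq> 0" using assms(2) dependent_zero[of "{a, b}"] by auto
  have "a \<in> span {b}"
  proof -
    have "(b \<bullet> b) *\<^sub>R a = (a \<bullet> b) *\<^sub>R b"
      using w by (simp add: vec_eq_iff forall_2 wedge_def inner_vec_def sum_2 algebra_simps)
    then have "a = ((a \<bullet> b) / (b \<bullet> b)) *\<^sub>R b"
    proof -
      have "((a \<bullet> b) / (b \<bullet> b)) *\<^sub>R b = (1 / (b \<bullet> b)) *\<^sub>R ((b \<bullet> b) *\<^sub>R a)"
        unfolding \<open>(b \<bullet> b) *\<^sub>R a = (a \<bullet> b) *\<^sub>R b\<close> by simp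
      also have "\<dots> = a" using b0 by simp
      finally show ?thesis by simp
    qed
    then show ?thesis by (metis span_base span_scale singletonI)
  qed
  then show False using assms by (simp add: independent_insert)
qed

locale lattice =
  fixes L :: "(real^2) set" and a b :: "real^2"
  assumes wedge_ab: "wedge a b \<noteq> 0" and L_eq: "L = {of_int m *\<^sub>R a + of_int n *\<^sub>R b | m n. True}"
begin

lemma in_LI: "of_int m *\<^sub>R a + of_int n *\<^sub>R b \<in> L"
  by (auto simp: L_eq)

lemma in_LE:
  assumes "x \<in> L" obtains m n where "x = of_int m *\<^sub>R a + of_int n *\<^sub>R b"
  using assms by (auto simp: L_eq)

lemma zero_in [simp]: "0 \<in> L" and a_in: "a \<in> L" and b_in: "b \<in> L"
  using in_LI[of 0 0] in_LI[of 1 0] in_LI[of 0 1] by simp_all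

lemma add_in: assumes "x \<in> L" "y \<in> L" shows "x + y \<in> L"
proof -
  obtain m n where x: "x = of_int m *\<^sub>R a + of_int n *\<^sub>R b" using assms(1) by (rule in_LE)
  obtain k l where y: "y = of_int k *\<^sub>R a + of_int l *\<^sub>R b" using assms(2) by (rule in_LE)
  have "x + y = of_int (m + k) *\<^sub>R a + of_int (n + l) *\<^sub>R b" by (simp add: x y algebra_simps)
  then show ?thesis by (metis in_LI)
qed

lemma uminus_in: assumes "x \<in> L" shows "- x \<in> L"
proof -
  obtain m n where x: "x = of_int m *\<^sub>R a + of_int n *\<^sub>R b" using assms by (rule in_LE)
  have "- x = of_int (- m) *\<^sub>R a + of_int (- n) *\<^sub>R b" by (simp add: x)
  then show ?thesis by (metis in_LI)
qed

lemma diff_in: "x \<in> L \<Longrightarrow> y \<in> L \<Longrightarrow> x - y \<in> L"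
  using add_in[of x "- y"] uminus_in by simp

lemma diff_commute_in: "x - y \<in> L \<Longrightarrow> y - x \<in> L"
  using uminus_in[of "x - y"] by simp

lemma proj_eq_iff: "torus_proj L x = torus_proj L y \<longleftrightarrow> x - y \<in> L"
proof
  assume "torus_proj L x = torus_proj L y"
  moreover have "x \<in> torus_proj L x" by (simp add: torus_proj_def)
  ultimately show "x - y \<in> L" by (simp add: torus_proj_def)
next
  assume xy: "x - y \<in> L"
  have "z - x \<in> L \<longleftrightarrow> z - y \<in> L" for z
    using add_in[OF _ xy, of "z - x"] diff_in[OF _ xy, of "z - y"] by auto
  then show "torus_proj L x = torus_proj L y" by (auto simp: torus_proj_def)
qed

lemma wedge_in_L:
  assumes "x \<in> L" "y \<in> L" obtains k :: int where "wedge x y = of_int k * wedge a b"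
proof -
  obtain m n where x: "x = of_int m *\<^sub>R a + of_int n *\<^sub>R b" using assms(1) by (rule in_LE)
  obtain k l where y: "y = of_int k *\<^sub>R a + of_int l *\<^sub>R b" using assms(2) by (rule in_LE)
  have "wedge x y = of_int (m * l - n * k) * wedge a b"
    unfolding x y wedge_def by (simp add: algebra_simps)
  then show thesis by (rule that)
qed

text \<open>By Cramer's rule the coordinates of \<open>l\<close> are \<open>wedge l b\<close> and
  \<open>wedge a l\<close> divided by \<open>wedge a b\<close>; for short \<open>l\<close> these
  integers have absolute value below 1.\<close>

lemma discrete: obtains r where "r > 0" "\<And>l. l \<in> L \<Longrightarrow> norm l < r \<Longrightarrow> l = 0"
proof -
  define M where "M = 2 * (norm a + norm b) + 1"
  have M: "M > 0" by (simp add: M_def add_nonneg_pos)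
  define r where "r = \<bar>wedge a b\<bar> / M"
  have r: "r > 0" using wedge_ab M by (simp add: r_def)
  show thesis
  proof (rule that[OF r])
    fix l assume l: "l \<in> L" "norm l < r"
    obtain m n where mn: "l = of_int m *\<^sub>R a + of_int n *\<^sub>R b" using l(1) by (rule in_LE)
    have lM: "norm l * M < \<bar>wedge a b\<bar>" using l(2) M by (simp add: r_def pos_less_divide_eq)
    have "norm l * M = 2 * norm a * norm l + 2 * norm l * norm b + norm l"
      by (simp add: M_def algebra_simps)
    moreover have "0 \<le> 2 * norm a * norm l" "0 \<le> 2 * norm l * norm b" "0 \<le> norm l" by simp_all
    ultimately have "2 * norm l * norm b \<le> norm l * M" "2 * norm a * norm l \<le> norm l * M"
      by linarith+
    then have "\<bar>wedge l b\<bar> < \<bar>wedge a b\<bar>" "\<bar>wedge a l\<bar> < \<bar>wedge a b\<bar>"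
      using wedge_bound[of l b] wedge_bound[of a l] lM by linarith+
    moreover have "wedge l b = of_int m * wedge a b" "wedge a l = of_int n * wedge a b"
      by (simp_all add: mn wedge_linear)
    ultimately have "\<bar>real_of_int m\<bar> < 1" "\<bar>real_of_int n\<bar> < 1"
      using wedge_ab by (simp_all add: abs_mult)
    then have "m = 0" "n = 0" by linarith+
    then show "l = 0" by (simp add: mn)
  qed
qed

definition fund :: "(real^2) set" where
  "fund = (\<lambda>p. fst p *\<^sub>R a + snd p *\<^sub>R b) ` ({0..1} \<times> {0..1})"

lemma compact_fund: "compact fund"
  unfolding fund_def
  by (intro compact_continuous_image compact_Times continuous_intros) simp_all

lemma fund_covers: obtains l where "l \<in> L" "x - l \<in> fund"
proof -
  define s where "s = wedge x b / wedge a b"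
  define t where "t = wedge a x / wedge a b"
  have "wedge a b *\<^sub>R x = wedge x b *\<^sub>R a + wedge a x *\<^sub>R b"
    by (rule wedge_expansion)
  also have "\<dots> = wedge a b *\<^sub>R (s *\<^sub>R a + t *\<^sub>R b)"
    using wedge_ab by (simp add: s_def t_def scaleR_add_right)
  finally have x: "x = s *\<^sub>R a + t *\<^sub>R b" using wedge_ab by simp
  show thesis
  proof (rule that[OF in_LI[of "\<lfloor>s\<rfloor>" "\<lfloor>t\<rfloor>"]])
    have "x - (of_int \<lfloor>s\<rfloor> *\<^sub>R a + of_int \<lfloor>t\<rfloor> *\<^sub>R b) = frac s *\<^sub>R a + frac t *\<^sub>R b"
      by (simp add: x frac_def algebra_simps)
    moreover have "(frac s, frac t) \<in> {0..1} \<times> {0..1}"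
      using frac_lt_1[of s] frac_lt_1[of t] by simp
    ultimately show "x - (of_int \<lfloor>s\<rfloor> *\<^sub>R a + of_int \<lfloor>t\<rfloor> *\<^sub>R b) \<in> fund"
      unfolding fund_def by (intro image_eqI[of _ _ "(frac s, frac t)"]) simp_all
  qed
qed

lemma open_map_proj: "open U \<Longrightarrow> openin (torus_top L) (torus_proj L ` U)"
proof -
  assume U: "open U"
  have "torus_proj L -` torus_proj L ` U = (\<Union>l\<in>L. (+) l ` U)"
  proof (rule Set.set_eqI, rule iffI)
    fix x assume "x \<in> torus_proj L -` torus_proj L ` U"
    then obtain u where u: "u \<in> U" "torus_proj L x = torus_proj L u" by auto
    then have "x - u \<in> L" by (simp add: proj_eq_iff)
    then show "x \<in> (\<Union>l\<in>L. (+) l ` U)" using u by (auto intro!: bexI[of _ "x - u"] image_eqI[of _ _ u])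
  next
    fix x assume "x \<in> (\<Union>l\<in>L. (+) l ` U)"
    then obtain l u where "l \<in> L" "u \<in> U" "x = l + u" by auto
    then have "torus_proj L x = torus_proj L u" by (simp add: proj_eq_iff)
    then show "x \<in> torus_proj L -` torus_proj L ` U" using \<open>u \<in> U\<close> by auto
  qed
  moreover have "open (\<Union>l\<in>L. (+) l ` U)" using U by (auto intro: open_translation)
  ultimately show ?thesis by (auto simp: openin_torus_top torus_def)
qed

lemma proj_continuous: "openin (torus_top L) V \<Longrightarrow> open (torus_proj L -` V)"
  by (simp add: openin_torus_top)

lemma proj_loc_inj: obtains r where "r > 0" "\<And>x. inj_on (torus_proj L) (ball x r)"
proof -
  obtain r where r: "r > 0" "\<And>l. l \<in> L \<Longrightarrow> norm l < r \<Longrightarrow> l = 0" using discrete by blast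
  show thesis
  proof (rule that[of "r/2"])
    show "inj_on (torus_proj L) (ball x (r/2))" for x
    proof (rule inj_onI)
      fix y z assume yz: "y \<in> ball x (r/2)" "z \<in> ball x (r/2)" "torus_proj L y = torus_proj L z"
      then have "y - z \<in> L" by (simp add: proj_eq_iff)
      moreover have "norm (y - z) < r"
        using yz dist_triangle_half_r[of x y r z] by (simp add: dist_norm)
      ultimately have "y - z = 0" by (rule r(2))
      then show "y = z" by simp
    qed
  qed (use r in simp)
qed

end

lemma rank2_lattice_imp_lattice:
  assumes "rank2_lattice L" obtains a b where "lattice L a b"
proof -
  obtain a b where "a \<noteq> b" "independent {a, b}" "L = {of_int m *\<^sub>R a + of_int n *\<^sub>R b | m n. True}"
    using assms by (auto simp: rank2_lattice_def)
  then show thesis using that[of a b] independent_wedge by (simp add: lattice_def)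
qed

section \<open>Eigenvalues and index of lattice endomorphisms\<close>

text \<open>The two roots of the characteristic polynomial have product 1, so one of them lies in
  the closed unit disc.\<close>

lemma eigenvalue_le_1:
  fixes A :: "real^2^2"
  assumes "det A = 1"
  obtains \<mu> where "complex_eigenvalue A \<mu>" "cmod \<mu> \<le> 1"
proof -
  define p q r s where "p = complex_of_real (A$1$1)" and "q = complex_of_real (A$1$2)"
    and "r = complex_of_real (A$2$1)" and "s = complex_of_real (A$2$2)"
  have det: "p * s - q * r = 1"
    using assms by (simp add: p_def q_def r_def s_def det_2 flip: of_real_mult of_real_diff)
  define \<mu>1 where "\<mu>1 = ((p + s) + csqrt ((p + s)\<^sup>2 - 4)) / 2"
  define \<mu>2 where "\<mu>2 = ((p + s) - csqrt ((p + s)\<^sup>2 - 4)) / 2"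
  have sum: "\<mu>1 + \<mu>2 = p + s" by (simp add: \<mu>1_def \<mu>2_def field_simps)
  have "\<mu>1 * \<mu>2 = ((p + s)\<^sup>2 - (csqrt ((p + s)\<^sup>2 - 4))\<^sup>2) / 4"
    by (simp add: \<mu>1_def \<mu>2_def field_simps power2_eq_square)
  then have prod: "\<mu>1 * \<mu>2 = 1" by simp
  obtain \<mu> \<nu> where mn: "\<mu> + \<nu> = p + s" "\<mu> * \<nu> = 1" "cmod \<mu> \<le> 1"
  proof (cases "cmod \<mu>1 \<le> 1")
    case True then show ?thesis using that sum prod by blast
  next
    case False
    have "cmod \<mu>1 * cmod \<mu>2 = 1" using prod by (metis norm_mult norm_one)
    then have "cmod \<mu>2 \<le> 1" using False by (smt (verit) mult_less_cancel_right2 norm_ge_zero)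
    then show ?thesis using that[of \<mu>2 \<mu>1] sum prod by (simp add: add.commute mult.commute)
  qed
  have char: "\<mu> * \<mu> = (p + s) * \<mu> - 1"
    using mn by (metis add_diff_cancel_right' distrib_right mult.commute)
  have ev: "complex_eigenvalue A \<mu>" if "x \<noteq> 0 \<or> y \<noteq> 0" "p * x + q * y = \<mu> * x" "r * x + s * y = \<mu> * y" for x y
    unfolding complex_eigenvalue_def
  proof (intro exI conjI)
    show "(vector [x, y] :: complex^2) \<noteq> 0" using that(1) by (auto simp: vec_eq_iff forall_2)
    show "(\<chi> i j. complex_of_real (A $ i $ j)) *v vector [x, y] = \<mu> *s vector [x, y]"
      using that(2,3) by (simp add: vec_eq_iff forall_2 matrix_vector_mult_def sum_2 p_def q_def r_def s_def)
  qed
  \<comment> \<open>An eigenvector is (q, \<mu> - p) or (\<mu> - s, r) unless both vanish, and then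
    the matrix is scalar.\<close>
  consider "q \<noteq> 0 \<or> \<mu> \<noteq> p" | "\<mu> \<noteq> s \<or> r \<noteq> 0" | "q = 0" "\<mu> = p" "\<mu> = s" "r = 0" by blast
  then have "complex_eigenvalue A \<mu>"
  proof cases
    case 1
    have "r * q + s * (\<mu> - p) = \<mu> * (\<mu> - p)"
      using char det by (simp add: algebra_simps)
    then show ?thesis using 1 by (intro ev[of q "\<mu> - p"]) (auto simp: algebra_simps)
  next
    case 2
    have "p * (\<mu> - s) + q * r = \<mu> * (\<mu> - s)"
      using char det by (simp add: algebra_simps)
    then show ?thesis using 2 by (intro ev[of "\<mu> - s" r]) (auto simp: algebra_simps)
  next
    case 3
    then show ?thesis by (intro ev[of 1 0]) auto
  qed
  then show thesis using that mn by blast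
qed

text \<open>Column reduction: \<open>A L\<close> contains vectors with coordinates \<open>(g, k)\<close> and \<open>(0, D / g)\<close>, where \<open>g\<close> is the greatest common
  divisor of the first row.\<close>

lemma index_le_det:
  fixes p q r s :: int
  assumes D: "p * s - q * r > 0"
  obtains R where "finite R" "card R \<le> nat (p * s - q * r)"
    "\<And>x y. \<exists>(i, j)\<in>R. \<exists>u v. x = i + (p * u + q * v) \<and> y = j + (r * u + s * v)"
proof -
  define g where "g = gcd p q"
  have g: "g > 0" using D by (auto simp: g_def)
  obtain e f where ef: "e * p + f * q = g" using bezout_int g_def by metis
  obtain p' q' where pq: "p = g * p'" "q = g * q'" by (metis g_def gcd_dvd1 gcd_dvd2 dvdE)
  define h where "h = p' * s - q' * r"
  have D_eq: "p * s - q * r = g * h" by (simp add: pq h_def algebra_simps)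
  then have h: "h > 0" using D g by (simp add: zero_less_mult_iff)
  show thesis
  proof (rule that[of "{0..<g} \<times> {0..<h}"])
    show "card ({0..<g} \<times> {0..<h}) \<le> nat (p * s - q * r)"
      using g h by (simp add: D_eq card_cartesian_product nat_mult_distrib)
    fix x y
    define i where "i = x mod g"
    define m where "m = x div g"
    define y1 where "y1 = y - m * (r * e + s * f)"
    define j where "j = y1 mod h"
    define n where "n = y1 div h"
    \<comment> \<open>The first row maps (e, f) to \<open>g\<close> and (-q', p') to 0, while the
      second row maps (-q', p') to \<open>h\<close>. So m times (e, f) adjusts the first coordinate,
      and n times the kernel vector then adjusts the second.\<close>
    define u where "u = m * e - n * q'"
    define v where "v = m * f + n * p'"
    have x: "x = i + g * m" by (simp add: i_def m_def)
    have y: "y1 = j + h * n" by (simp add: j_def n_def)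
    have "p * u + q * v = m * (e * p + f * q) + n * (q * p' - p * q')"
      by (simp add: u_def v_def algebra_simps)
    also have "q * p' - p * q' = 0" by (simp add: pq)
    finally have "x = i + (p * u + q * v)" using x ef by simp
    moreover have "r * u + s * v = m * (r * e + s * f) + n * h"
      by (simp add: u_def v_def h_def algebra_simps)
    then have "y = j + (r * u + s * v)" using y by (simp add: y1_def algebra_simps)
    moreover have "(i, j) \<in> {0..<g} \<times> {0..<h}" using g h by (simp add: i_def j_def)
    ultimately show "\<exists>(i, j)\<in>{0..<g} \<times> {0..<h}. \<exists>u v. x = i + (p * u + q * v) \<and> y = j + (r * u + s * v)"
      by blast
  qed simp
qed

section \<open>Torus coverings of the sphere\<close>

lemma connected_space_sphere: "connected_space sphere_top"
proof -
  have nc: "\<not> compact_space (euclidean :: complex topology)"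
    using not_compact_UNIV by (simp add: compact_space_def)
  have "connectedin sphere_top (range Some)"
    by (rule connectedin_continuous_map_image[OF continuous_map_Some_sphere]) (simp add: convex_connected)
  then have "connectedin sphere_top (sphere_top closure_of range Some)"
    by (rule connectedin_closure_of)
  also have "sphere_top closure_of range Some = UNIV"
    using Alexandroff_compactification_dense[OF nc] topspace_sphere_top by (simp add: sphere_top_def)
  finally show ?thesis
    using topspace_sphere_top by (metis connectedin_topspace)
qed

lemma infinite_sphere: "infinite (UNIV :: riemann set)"
  using infinite_UNIV_char_0[where 'a=complex] by (metis finite_imageD finite_subset inj_Some subset_UNIV)

locale torus_cover = lattice L a b for L a b +
  fixes \<Theta> :: "(real^2) set \<Rightarrow> riemann"
  assumes branched: "branched_cover (oriented_torus L) riemann_sphere \<Theta>"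
begin

definition T :: "real^2 \<Rightarrow> riemann" where "T x = \<Theta> (torus_proj L x)"

definition Cr :: "(real^2) set" where "Cr = {x. \<not> locally_inj euclidean T x}"

definition P :: "riemann set" where "P = T ` Cr"

lemma tops [simp]: "surface_top riemann_sphere = sphere_top" "surface_top (oriented_torus L) = torus_top L"
  by (simp_all add: riemann_sphere_def oriented_torus_def)

lemma T_continuous: "continuous_map euclidean sphere_top T"
proof -
  have "continuous_map euclidean sphere_top (\<Theta> \<circ> torus_proj L)"
    using quotient_imp_continuous_map[OF quotient_map_torus_proj] branched
    by (intro continuous_map_compose) (auto simp: branched_cover_def)
  then show ?thesis by (simp add: T_def[abs_def] o_def)
qed

lemma open_T_vimage: "openin sphere_top V \<Longrightarrow> open (T -` V)"
  using T_continuous by (auto simp: continuous_map vimage_def)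

text \<open>The projection is continuous and locally injective, so a coordinate of the branched
  cover at the point of the torus pulls back to a ball in the plane. The last clause says that
  \<open>T\<close> is open at \<open>x\<close>.\<close>

lemma T_local_form:
  obtains r and \<eta> :: "real^2 \<Rightarrow> complex" and d :: nat where "r > 0" "d \<ge> 1" "\<eta> x = 0" "inj_on \<eta> (ball x r)"
    "\<And>B. open B \<Longrightarrow> open {z\<in>ball x r. \<eta> z \<in> B}"
    "\<And>y z. y \<in> ball x r \<Longrightarrow> z \<in> ball x r \<Longrightarrow> T y = T z \<longleftrightarrow> \<eta> y ^ d = \<eta> z ^ d"
    "\<And>W. open W \<Longrightarrow> x \<in> W \<Longrightarrow> \<exists>V. openin sphere_top V \<and> T x \<in> V \<and> V \<subseteq> T ` W"
proof -
  obtain d where d: "has_local_degree (oriented_torus L) riemann_sphere \<Theta> (torus_proj L x) d"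
    using branched by (auto simp: branched_cover_def torus_def)
  then have d1: "d \<ge> 1" by (simp add: has_local_degree_def)
  obtain U and \<phi> :: "(real^2) set \<Rightarrow> complex" where U: "openin (torus_top L) U" "torus_proj L x \<in> U" "\<phi> (torus_proj L x) = 0"
    "open (\<phi> ` U)" "homeomorphic_map (subtopology (torus_top L) U) (top_of_set (\<phi> ` U)) \<phi>"
    "\<And>s t. s \<in> U \<Longrightarrow> t \<in> U \<Longrightarrow> \<Theta> s = \<Theta> t \<longleftrightarrow> \<phi> s ^ d = \<phi> t ^ d"
    "\<And>W. openin (torus_top L) W \<Longrightarrow> W \<subseteq> U \<Longrightarrow> openin sphere_top (\<Theta> ` W)"
    by (rule local_degree_local_form[OF d, unfolded tops]) blast
  obtain r0 where r0: "r0 > 0" "\<And>x. inj_on (torus_proj L) (ball x r0)" using proj_loc_inj by blast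
  have "open (torus_proj L -` U)" by (rule proj_continuous[OF U(1)])
  moreover have "x \<in> torus_proj L -` U" using U(2) by simp
  ultimately obtain r1 where r1: "r1 > 0" "ball x r1 \<subseteq> torus_proj L -` U"
    by (meson open_contains_ball)
  define r where "r = min r0 r1"
  have r: "r > 0" "ball x r \<subseteq> ball x r0" "ball x r \<subseteq> torus_proj L -` U"
    using r0 r1 by (auto simp: r_def)
  have injU: "inj_on \<phi> U"
    using homeomorphic_imp_injective_map[OF U(5)] openin_subset[OF U(1)] by (simp add: Int_absorb1)
  have contU: "openin (torus_top L) {t\<in>U. \<phi> t \<in> B}" if "open B" for B
  proof -
    have "continuous_map (subtopology (torus_top L) U) euclidean \<phi>"
      using homeomorphic_imp_continuous_map[OF U(5)] by (simp add: continuous_map_in_subtopology)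
    then have "openin (subtopology (torus_top L) U) {t \<in> torus L \<inter> U. \<phi> t \<in> B}"
      using that by (auto simp: continuous_map)
    moreover have "torus L \<inter> U = U" using openin_subset[OF U(1)] by auto
    ultimately have "openin (subtopology (torus_top L) U) {t\<in>U. \<phi> t \<in> B}" by simp
    then show ?thesis using U(1) by (simp add: openin_open_subtopology)
  qed
  show thesis
  proof (rule that[of r d "\<phi> \<circ> torus_proj L"])
    show "inj_on (\<phi> \<circ> torus_proj L) (ball x r)"
    proof (rule comp_inj_on)
      show "inj_on (torus_proj L) (ball x r)" using r0(2) r(2) by (rule inj_on_subset)
      show "inj_on \<phi> (torus_proj L ` ball x r)" using injU r(3) by (auto intro: inj_on_subset)
    qed
    show "open {z \<in> ball x r. (\<phi> \<circ> torus_proj L) z \<in> B}" if "open B" for B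
    proof -
      have "{z \<in> ball x r. (\<phi> \<circ> torus_proj L) z \<in> B} = ball x r \<inter> torus_proj L -` {t\<in>U. \<phi> t \<in> B}"
        using r(3) by auto
      then show ?thesis using proj_continuous[OF contU[OF that]] by (simp add: open_Int)
    qed
    show "T y = T z \<longleftrightarrow> (\<phi> \<circ> torus_proj L) y ^ d = (\<phi> \<circ> torus_proj L) z ^ d"
      if "y \<in> ball x r" "z \<in> ball x r" for y z
      using U(6)[of "torus_proj L y" "torus_proj L z"] that r(3) unfolding T_def o_def by blast
    show "\<exists>V. openin sphere_top V \<and> T x \<in> V \<and> V \<subseteq> T ` W" if W: "open W" "x \<in> W" for W
    proof (intro exI conjI)
      show "openin sphere_top (\<Theta> ` (torus_proj L ` W \<inter> U))"
        using open_map_proj[OF W(1)] U(1) by (intro U(7)) auto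
      show "T x \<in> \<Theta> ` (torus_proj L ` W \<inter> U)" using W(2) U(2) by (auto simp: T_def)
      show "\<Theta> ` (torus_proj L ` W \<inter> U) \<subseteq> T ` W" by (auto simp: T_def)
    qed
  qed (use r d1 U in auto)
qed

lemma T_open: "openin sphere_top (T ` W)" if W: "open W" for W
proof (subst openin_subopen, intro ballI)
  fix y assume "y \<in> T ` W"
  then obtain x where x: "x \<in> W" "y = T x" by auto
  show "\<exists>V. openin sphere_top V \<and> y \<in> V \<and> V \<subseteq> T ` W"
    unfolding x(2) by (rule T_local_form[of x]) (use W x in blast)
qed

lemma T_periodic: "l \<in> L \<Longrightarrow> T (x + l) = T x"
  using proj_eq_iff[of "x + l" x] by (simp add: T_def)

lemma T_eq_if_diff: "x - y \<in> L \<Longrightarrow> T x = T y"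
  using T_periodic[of "x - y" y] by simp

lemma T_fund: "T ` fund = range T"
proof -
  have "T x \<in> T ` fund" for x
  proof -
    obtain l where l: "l \<in> L" "x - l \<in> fund" by (rule fund_covers)
    then have "T x = T (x - l)" by (intro T_eq_if_diff) simp
    then show ?thesis using l by blast
  qed
  then show ?thesis by auto
qed

lemma closedin_T_image: "compact K \<Longrightarrow> closedin sphere_top (T ` K)"
  by (rule compactin_imp_closedin[OF Hausdorff_space_sphere])
    (metis T_continuous compactin_euclidean_iff image_compactin)

text \<open>The image of \<open>T\<close> is open, and closed as the image of a compact fundamental
  parallelogram; the sphere is connected.\<close>

lemma range_T: "range T = UNIV"
proof -
  have "openin sphere_top (range T)" by (rule T_open) simp
  moreover have "closedin sphere_top (range T)"
    unfolding T_fund[symmetric] by (rule closedin_T_image[OF compact_fund])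
  ultimately show ?thesis
    using connected_space_sphere topspace_sphere_top unfolding connected_space_clopen_in by blast
qed

lemma T_surj: obtains x where "T x = w"
  using range_T by (metis UNIV_I imageE)

lemma T_isolated: obtains r where "r > 0" "\<And>y. y \<in> ball x r \<Longrightarrow> T y = T x \<Longrightarrow> y = x"
proof -
  obtain r and \<eta> :: "real^2 \<Rightarrow> complex" and d :: nat where r: "r > 0" "d \<ge> 1" "\<eta> x = 0" "inj_on \<eta> (ball x r)"
    "\<And>y z. y \<in> ball x r \<Longrightarrow> z \<in> ball x r \<Longrightarrow> T y = T z \<longleftrightarrow> \<eta> y ^ d = \<eta> z ^ d"
    by (rule T_local_form[of x]) blast
  show thesis
  proof (rule that[OF r(1)])
    fix y assume y: "y \<in> ball x r" "T y = T x"
    then have "\<eta> y ^ d = 0" using r(5)[of y x] r(1,2,3) by (simp add: power_0_left)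
    then have "\<eta> y = \<eta> x" using r(3) by simp
    then show "y = x" using r(4) y(1) r(1) by (meson centre_in_ball inj_onD)
  qed
qed

text \<open>A d-th power is locally injective away from 0, so only the centre of the ball can be
  critical.\<close>

lemma T_crit_isolated: obtains r where "r > 0" "\<And>y. y \<in> ball x r \<Longrightarrow> y \<noteq> x \<Longrightarrow> y \<notin> Cr"
proof -
  obtain r and \<eta> :: "real^2 \<Rightarrow> complex" and d :: nat where r: "r > 0" "d \<ge> 1" "\<eta> x = 0" "inj_on \<eta> (ball x r)"
    "\<And>B. open B \<Longrightarrow> open {z\<in>ball x r. \<eta> z \<in> B}"
    "\<And>y z. y \<in> ball x r \<Longrightarrow> z \<in> ball x r \<Longrightarrow> T y = T z \<longleftrightarrow> \<eta> y ^ d = \<eta> z ^ d"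
    by (rule T_local_form[of x]) blast
  show thesis
  proof (rule that[OF r(1)])
    fix y assume y: "y \<in> ball x r" "y \<noteq> x"
    then have ny: "\<eta> y \<noteq> 0" using r(1,3,4) by (metis centre_in_ball inj_onD)
    have "deriv (\<lambda>z::complex. z ^ d) (\<eta> y) \<noteq> 0"
    proof -
      have "((\<lambda>z::complex. z ^ d) has_field_derivative of_nat d * \<eta> y ^ (d - 1)) (at (\<eta> y))"
        by (auto intro!: derivative_eq_intros)
      then show ?thesis using ny r(2) by (simp add: DERIV_imp_deriv)
    qed
    moreover have "(\<lambda>z::complex. z ^ d) holomorphic_on UNIV" by (intro holomorphic_intros)
    ultimately obtain s where s: "s > 0" "inj_on (\<lambda>z. z ^ d) (ball (\<eta> y) s)"
      using has_complex_derivative_locally_injective[OF _ UNIV_I open_UNIV] by blast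
    define U where "U = {z\<in>ball x r. \<eta> z \<in> ball (\<eta> y) s}"
    have "inj_on T U"
    proof (rule inj_onI)
      fix u v assume uv: "u \<in> U" "v \<in> U" "T u = T v"
      then have "\<eta> u ^ d = \<eta> v ^ d" using r(6)[of u v] by (simp add: U_def)
      then have "\<eta> u = \<eta> v" using s(2) uv by (simp add: inj_on_def U_def)
      then show "u = v" using r(4) uv by (auto simp: inj_on_def U_def)
    qed
    moreover have "open U" unfolding U_def by (rule r(5)) simp
    moreover have "y \<in> U" using y s by (simp add: U_def)
    ultimately show "y \<notin> Cr" by (auto simp: Cr_def locally_inj_def)
  qed
qed

lemma Cr_periodic: assumes "x - y \<in> L" "x \<in> Cr" shows "y \<in> Cr"
proof (rule ccontr)
  assume "y \<notin> Cr"
  then obtain U where U: "open U" "y \<in> U" "inj_on T U" by (auto simp: Cr_def locally_inj_def)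
  have "T (u + (y - x)) = T u" for u
    using assms(1) diff_commute_in T_periodic by blast
  then have "inj_on T ((\<lambda>u. u + (x - y)) ` U)"
    using U(3) T_periodic[OF assms(1)] by (auto simp: inj_on_def)
  moreover have "open ((\<lambda>u. u + (x - y)) ` U)" using open_translation[OF U(1), of "x - y"] by (simp add: add.commute)
  moreover have "x \<in> (\<lambda>u. u + (x - y)) ` U" using U(2) by force
  ultimately have "x \<notin> Cr" by (auto simp: Cr_def locally_inj_def)
  then show False using assms by simp
qed

lemma finite_Cr_compact: assumes K: "compact K" shows "finite (Cr \<inter> K)"
proof -
  have "\<exists>r>0. \<forall>y\<in>ball x r. y \<noteq> x \<longrightarrow> y \<notin> Cr" for x
    by (rule T_crit_isolated[of x]) blast
  then obtain r where r: "\<And>x. r x > 0" "\<And>x y. y \<in> ball x (r x) \<Longrightarrow> y \<noteq> x \<Longrightarrow> y \<notin> Cr" by metis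
  obtain D where D: "D \<subseteq> K" "finite D" "K \<subseteq> (\<Union>x\<in>D. ball x (r x))"
    using compactE_image[OF K, of K "\<lambda>x. ball x (r x)"] r(1) by (metis (no_types, lifting) UN_I centre_in_ball open_ball subsetI)
  then have "Cr \<inter> K \<subseteq> D" using r(2) by blast
  then show ?thesis using D(2) finite_subset by blast
qed

lemma P_eq: "P = T ` (Cr \<inter> fund)"
proof -
  have "T x \<in> T ` (Cr \<inter> fund)" if "x \<in> Cr" for x
  proof -
    obtain l where l: "l \<in> L" "x - l \<in> fund" by (rule fund_covers)
    then have "T x = T (x - l)" by (intro T_eq_if_diff) simp
    moreover have "x - l \<in> Cr" using Cr_periodic[of x "x - l"] l that by simp
    ultimately show ?thesis using l by blast
  qed
  then show ?thesis by (auto simp: P_def)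
qed

lemma finite_P: "finite P"
  unfolding P_eq using finite_Cr_compact[OF compact_fund] by simp

lemma finite_Cr_torus: "finite (torus_proj L ` Cr)"
proof -
  have "torus_proj L ` Cr \<subseteq> torus_proj L ` (Cr \<inter> fund)"
  proof
    fix t assume "t \<in> torus_proj L ` Cr"
    then obtain x where x: "x \<in> Cr" "t = torus_proj L x" by auto
    obtain l where l: "l \<in> L" "x - l \<in> fund" by (rule fund_covers)
    then have "t = torus_proj L (x - l)" using x by (simp add: proj_eq_iff)
    moreover have "x - l \<in> Cr" using Cr_periodic[of x "x - l"] l x by simp
    ultimately show "t \<in> torus_proj L ` (Cr \<inter> fund)" using l by blast
  qed
  then show ?thesis using finite_Cr_compact[OF compact_fund] finite_subset by blast
qed

text \<open>As \<open>T\<close> is injective near the noncritical point \<open>y0\<close>, the two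
  maps coincide near \<open>x0\<close>, and affine maps coinciding on a ball are equal. Deck
  transformations are thus determined by one noncritical value.\<close>

lemma affine_unique:
  assumes "\<And>x. T (M1 *v x + c1) = T (M2 *v x + c2)" and eq: "M1 *v x0 + c1 = y0" "M2 *v x0 + c2 = y0" and y0: "y0 \<notin> Cr"
  shows "M1 = M2" "c1 = c2"
proof -
  obtain U where U: "open U" "y0 \<in> U" "inj_on T U" using y0 by (auto simp: Cr_def locally_inj_def)
  define X where "X = (\<lambda>x. M1 *v x + c1) -` U \<inter> (\<lambda>x. M2 *v x + c2) -` U"
  have "open X" unfolding X_def
    by (intro open_Int continuous_open_vimage U) (auto intro!: continuous_intros matrix_vector_mult_linear_continuous_at)
  moreover have "x0 \<in> X" using eq U(2) by (simp add: X_def)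
  ultimately obtain \<delta> where \<delta>: "\<delta> > 0" "ball x0 \<delta> \<subseteq> X" by (meson open_contains_ball)
  have small: "M1 *v z = M2 *v z" if "norm z < \<delta>" for z
  proof -
    have "x0 + z \<in> X" using \<delta> that by (auto simp: dist_norm)
    then have "M1 *v (x0 + z) + c1 = M2 *v (x0 + z) + c2"
      using U(3) assms(1)[of "x0 + z"] by (auto simp: X_def inj_on_def)
    then have "M1 *v z + (M1 *v x0 + c1) = M2 *v z + (M2 *v x0 + c2)"
      by (simp add: matrix_vector_right_distrib algebra_simps)
    then show ?thesis unfolding eq by simp
  qed
  have "M1 *v z = M2 *v z" for z
  proof -
    define s where "s = \<delta> / (2 * (norm z + 1))"
    have s: "s > 0" using \<delta> by (simp add: s_def add_nonneg_pos)
    have "norm (s *\<^sub>R z) = \<delta> / 2 * (norm z / (norm z + 1))"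
      using s \<delta> by (simp add: s_def)
    also have "\<dots> \<le> \<delta> / 2 * 1" using \<delta> by (intro mult_left_mono) (auto simp: divide_le_eq_1 add_nonneg_pos)
    also have "\<dots> < \<delta>" using \<delta> by simp
    finally have "M1 *v (s *\<^sub>R z) = M2 *v (s *\<^sub>R z)" by (rule small)
    then show ?thesis using s by (simp add: matrix_vector_mult_scaleR)
  qed
  then show "M1 = M2" by (simp add: matrix_eq)
  then show "c1 = c2" using eq by (metis add_left_cancel)
qed

end

lemma invertible_matrix_bound:
  fixes M :: "real^2^2"
  assumes "det M \<noteq> 0"
  obtains k where "k > 0" "\<And>x. norm (M *v x) \<le> k * norm x" "\<And>x. norm x \<le> k * norm (M *v x)"
proof -
  have "bounded_linear ((*v) M)" by (simp add: matrix_vector_mul_bounded_linear)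
  then obtain k1 where k1: "\<And>x. norm (M *v x) \<le> norm x * k1" using bounded_linear.bounded by blast
  have "inj ((*v) M)" using assms by (metis invertible_det_nz invertible_left_inverse matrix_left_invertible_injective)
  then obtain B where B: "B > 0" "\<And>x. norm (M *v x) \<ge> B * norm x"
    using linear_inj_bounded_below_pos[OF matrix_vector_mul_linear, of M] by auto
  define k where "k = \<bar>k1\<bar> + 1 / B"
  show thesis
  proof (rule that[of k])
    show "k > 0" using B by (simp add: k_def add_nonneg_pos)
    show "norm (M *v x) \<le> k * norm x" for x
    proof -
      have "norm (M *v x) \<le> \<bar>k1\<bar> * norm x"
        using k1[of x] mult_left_mono[OF abs_ge_self[of k1] norm_ge_zero[of x]] by (simp add: mult.commute)
      also have "\<dots> \<le> k * norm x" using B by (intro mult_right_mono) (auto simp: k_def)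
      finally show ?thesis .
    qed
    show "norm x \<le> k * norm (M *v x)" for x
    proof -
      have "norm x \<le> 1 / B * norm (M *v x)" using B(2)[of x] B(1) by (simp add: field_simps)
      also have "\<dots> \<le> k * norm (M *v x)" using B by (intro mult_right_mono) (auto simp: k_def)
      finally show ?thesis .
    qed
  qed
qed

section \<open>Deck transformations and fibres of a rigid action\<close>

locale rigid_cover = torus_cover +
  fixes G :: "'g monoid" and \<alpha>
  assumes finite_G: "finite (carrier G)" and rigid: "induced_by_rigid_action L G \<alpha> \<Theta>"
begin

lemma action: "group_action G (torus L) \<alpha>"
  and \<Theta>_eq_iff: "t \<in> torus L \<Longrightarrow> t' \<in> torus L \<Longrightarrow> \<Theta> t = \<Theta> t' \<longleftrightarrow> (\<exists>g \<in> carrier G. t = \<alpha> g t')"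
  using rigid by (auto simp: induced_by_rigid_action_def)

lemma lift_ex:
  assumes "h \<in> carrier G"
  obtains M c where "det M > 0" "\<And>x. \<alpha> h (torus_proj L x) = torus_proj L (M *v x + c)" "\<And>x. T (M *v x + c) = T x"
proof -
  obtain M c where Mc: "induces_torus_endomorphism L M c (\<alpha> h)"
    using rigid assms by (auto simp: induced_by_rigid_action_def torus_automorphism_def)
  then have 1: "\<And>x. \<alpha> h (torus_proj L x) = torus_proj L (M *v x + c)"
    by (simp add: induces_torus_endomorphism_def)
  have "T (M *v x + c) = T x" for x
  proof -
    have tor: "torus_proj L x \<in> torus L" "\<alpha> h (torus_proj L x) \<in> torus L" by (auto simp: 1 torus_def)
    have "\<Theta> (\<alpha> h (torus_proj L x)) = \<Theta> (torus_proj L x)"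
      using \<Theta>_eq_iff[OF tor(2,1)] assms by blast
    then show ?thesis by (simp add: T_def 1)
  qed
  then show thesis using that[of M c] 1 Mc by (simp add: induces_torus_endomorphism_def)
qed

text \<open>The deck transformations of \<open>T\<close> have finitely many linear parts, since \<open>G\<close> is finite.\<close>

lemma deck:
  obtains \<kappa> where "\<kappa> > 0"
    "\<And>s t. T s = T t \<Longrightarrow> \<exists>M c. M *v t + c = s \<and> (\<forall>x. T (M *v x + c) = T x) \<and> det M > 0 \<and>
       (\<forall>x y. dist (M *v x + c) (M *v y + c) \<le> \<kappa> * dist x y) \<and> (\<forall>x y. dist x y \<le> \<kappa> * dist (M *v x + c) (M *v y + c))"
proof -
  define Q where "Q h M c k \<longleftrightarrow> det M > 0 \<and> (\<forall>x. \<alpha> h (torus_proj L x) = torus_proj L (M *v x + c)) \<and>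
      (\<forall>x. T (M *v x + c) = T x) \<and>
      k > 0 \<and> (\<forall>x. norm (M *v x) \<le> k * norm x) \<and> (\<forall>x. norm x \<le> k * norm (M *v x))"
    for h and M :: "real^2^2" and c and k :: real
  have "\<exists>M c k. Q h M c k" if h: "h \<in> carrier G" for h
  proof -
    obtain M c where Mc: "det M > 0" "\<And>x. \<alpha> h (torus_proj L x) = torus_proj L (M *v x + c)" "\<And>x. T (M *v x + c) = T x"
      by (rule lift_ex[OF h]) blast
    then have "det M \<noteq> 0" by simp
    then obtain k where "k > 0" "\<And>x. norm (M *v x) \<le> k * norm x" "\<And>x. norm x \<le> k * norm (M *v x)"
      by (rule invertible_matrix_bound) blast
    then have "Q h M c k" using Mc by (simp add: Q_def)
    then show ?thesis by blast
  qed
  then obtain M c k where Q: "\<And>h. h \<in> carrier G \<Longrightarrow> Q h (M h) (c h) (k h)" by metis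
  have M: "\<And>h. h \<in> carrier G \<Longrightarrow> det (M h) > 0"
    "\<And>h x. h \<in> carrier G \<Longrightarrow> \<alpha> h (torus_proj L x) = torus_proj L (M h *v x + c h)"
    "\<And>h x. h \<in> carrier G \<Longrightarrow> T (M h *v x + c h) = T x"
    "\<And>h. h \<in> carrier G \<Longrightarrow> k h > 0"
    "\<And>h x. h \<in> carrier G \<Longrightarrow> norm (M h *v x) \<le> k h * norm x"
    "\<And>h x. h \<in> carrier G \<Longrightarrow> norm x \<le> k h * norm (M h *v x)"
    using Q unfolding Q_def by blast+
  \<comment> \<open>The sum dominates the distortion constant of every group element, and the
    summand 1 gives positivity.\<close>
  define \<kappa> where "\<kappa> = 1 + (\<Sum>h\<in>carrier G. k h)"
  have \<kappa>: "\<kappa> > 0" unfolding \<kappa>_def using M(4) by (intro add_pos_nonneg sum_nonneg) (auto intro: less_imp_le)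
  have k_le: "k h \<le> \<kappa>" if "h \<in> carrier G" for h
    unfolding \<kappa>_def using member_le_sum[of h "carrier G" k] that M(4) finite_G by (simp add: less_imp_le)
  show thesis
  proof (rule that[OF \<kappa>])
    fix s t assume "T s = T t"
    then obtain h where h: "h \<in> carrier G" "torus_proj L s = \<alpha> h (torus_proj L t)"
      using \<Theta>_eq_iff[of "torus_proj L s" "torus_proj L t"] by (auto simp: T_def torus_def)
    then have l: "s - (M h *v t + c h) \<in> L" by (simp add: M(2) proj_eq_iff)
    \<comment> \<open>Correcting the translation by a lattice vector changes neither the linear part
      nor the composition with \<open>T\<close>, and makes \<open>t\<close> go to \<open>s\<close>
      exactly.\<close>
    define c' where "c' = c h + (s - (M h *v t + c h))"
    have "M h *v t + c' = s" by (simp add: c'_def)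
    moreover have "T (M h *v x + c') = T x" for x
      using T_periodic[OF l, of "M h *v x + c h"] M(3)[OF h(1)] by (simp add: c'_def add.assoc)
    moreover have dd: "dist (M h *v x + c') (M h *v y + c') = norm (M h *v (x - y))" for x y
      by (simp add: dist_norm matrix_vector_mult_diff_distrib)
    have "dist (M h *v x + c') (M h *v y + c') \<le> \<kappa> * dist x y" for x y
      unfolding dd using M(5)[OF h(1), of "x - y"] mult_right_mono[OF k_le[OF h(1)], of "dist x y"] by (simp add: dist_norm)
    moreover have "dist x y \<le> \<kappa> * dist (M h *v x + c') (M h *v y + c')" for x y
      unfolding dd using M(6)[OF h(1), of "x - y"] mult_right_mono[OF k_le[OF h(1)], of "norm (M h *v (x - y))"] by (simp add: dist_norm)
    ultimately show "\<exists>M c. M *v t + c = s \<and> (\<forall>x. T (M *v x + c) = T x) \<and> det M > 0 \<and>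
       (\<forall>x y. dist (M *v x + c) (M *v y + c) \<le> \<kappa> * dist x y) \<and> (\<forall>x y. dist x y \<le> \<kappa> * dist (M *v x + c) (M *v y + c))"
      using M(1)[OF h(1)] by blast
  qed
qed

definition tfib :: "riemann \<Rightarrow> (real^2) set set" where "tfib w = {t \<in> torus L. \<Theta> t = w}"

lemma tfib_eq:
  assumes "t0 \<in> tfib w" shows "tfib w = (\<lambda>F. F t0) ` (\<alpha> ` carrier G)"
proof -
  have t0: "t0 \<in> torus L" "\<Theta> t0 = w" using assms by (auto simp: tfib_def)
  have "\<alpha> g t0 \<in> torus L" if "g \<in> carrier G" for g
    using group_action.element_image[OF action that t0(1)] by simp
  then show ?thesis using \<Theta>_eq_iff t0 by (auto simp: tfib_def)
qed

lemma tfib_nonempty: "tfib w \<noteq> {}"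
proof -
  obtain x where "T x = w" by (rule T_surj)
  then show ?thesis by (auto simp: tfib_def T_def torus_def)
qed

lemma finite_tfib: "finite (tfib w)"
proof -
  obtain t0 where t0: "t0 \<in> tfib w" using tfib_nonempty by blast
  show ?thesis unfolding tfib_eq[OF t0] using finite_G by simp
qed

text \<open>If two maps of the action agree at a point over a noncritical value, suitable lifts
  agree at a point with noncritical image, and \<open>affine_unique\<close> identifies them. The set
  of maps is counted rather than the group, as different group elements may act in the same
  way.\<close>

lemma card_tfib:
  assumes w: "w \<notin> P" shows "card (tfib w) = card (\<alpha> ` carrier G)"
proof -
  obtain t0 where t0: "t0 \<in> tfib w" using tfib_nonempty by blast
  then obtain x0 where x0: "t0 = torus_proj L x0" by (auto simp: tfib_def torus_def)
  have "inj_on (\<lambda>F. F t0) (\<alpha> ` carrier G)"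
  proof (rule inj_onI, clarsimp)
    fix g h assume gh: "g \<in> carrier G" "h \<in> carrier G" "\<alpha> g t0 = \<alpha> h t0"
    obtain M1 c1 where M1: "\<And>x. \<alpha> g (torus_proj L x) = torus_proj L (M1 *v x + c1)" "\<And>x. T (M1 *v x + c1) = T x"
      by (rule lift_ex[OF gh(1)]) blast
    obtain M2 c2 where M2: "\<And>x. \<alpha> h (torus_proj L x) = torus_proj L (M2 *v x + c2)" "\<And>x. T (M2 *v x + c2) = T x"
      by (rule lift_ex[OF gh(2)]) blast
    define l where "l = (M1 *v x0 + c1) - (M2 *v x0 + c2)"
    have l: "l \<in> L" using gh(3) M1(1)[of x0] M2(1)[of x0] by (simp add: x0 proj_eq_iff l_def)
    have y0: "M1 *v x0 + c1 \<notin> Cr"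
    proof
      assume "M1 *v x0 + c1 \<in> Cr"
      then have "T x0 \<in> P" using M1(2)[of x0] by (metis P_def imageI)
      then show False using w t0 by (simp add: x0 tfib_def T_def)
    qed
    have Teq: "T (M1 *v x + c1) = T (M2 *v x + (c2 + l))" for x
      using T_periodic[OF l, of "M2 *v x + c2"] M1(2) M2(2) by (simp add: add.assoc)
    have M: "M1 = M2" "c1 = c2 + l"
      by (rule affine_unique[OF Teq refl _ y0], simp add: l_def)+
    have on: "\<alpha> g t = \<alpha> h t" if tt: "t \<in> torus L" for t
    proof -
      obtain x where "t = torus_proj L x" using tt by (auto simp: torus_def)
      then show ?thesis using M1(1) M2(1) M l by (simp add: proj_eq_iff)
    qed
    \<comment> \<open>The maps of a group action are extensional, so agreement on the torus is
      equality.\<close>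
    have "\<alpha> g \<in> extensional (torus L)" "\<alpha> h \<in> extensional (torus L)"
      using group_action.bij_prop0[OF action] gh by (auto simp: Bij_def)
    then show "\<alpha> g = \<alpha> h" using on by (rule extensionalityI)
  qed
  then show ?thesis using tfib_eq[OF t0] by (simp add: card_image)
qed

lemma card_tfib_pos: "card (\<alpha> ` carrier G) > 0"
proof -
  have "carrier G \<noteq> {}"
    using group_action.group_hom[OF action] group.is_monoid group_hom.axioms(1) monoid.one_closed by blast
  then show ?thesis using finite_G by (simp add: card_gt_0_iff)
qed

end

section \<open>Postcritical points and degree of a Lattes map\<close>

locale lattes_cover = rigid_cover L a b \<Theta> G \<alpha> + rational_fun p q f N
  for L a b \<Theta> and G :: "'g monoid" and \<alpha> p q f N +
  fixes A :: "real^2^2" and v0 :: "real^2" and g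
  assumes induces: "induces_torus_endomorphism L A v0 g"
    and expanding: "\<And>\<mu>. complex_eigenvalue A \<mu> \<Longrightarrow> cmod \<mu> > 1"
    and semiconj: "\<And>t. t \<in> torus L \<Longrightarrow> f (\<Theta> t) = \<Theta> (g t)"
begin

definition aff :: "real^2 \<Rightarrow> real^2" where "aff x = A *v x + v0"

lemma det_pos: "det A > 0" and A_L: "l \<in> L \<Longrightarrow> A *v l \<in> L" and g_proj: "g (torus_proj L x) = torus_proj L (aff x)"
proof -
  show "det A > 0" "g (torus_proj L x) = torus_proj L (aff x)"
    using induces by (auto simp: induces_torus_endomorphism_def aff_def)
  show "A *v l \<in> L" if "l \<in> L"
  proof -
    have "(A *v l + v0) - (A *v 0 + v0) \<in> L"
      using induces that unfolding induces_torus_endomorphism_def by (metis diff_zero)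
    then show ?thesis by simp
  qed
qed

lemma f_T: "f (T x) = T (aff x)"
  using semiconj[of "torus_proj L x"] by (simp add: T_def torus_def g_proj)

lemma f_T_iter: "(f ^^ n) (T x) = T ((aff ^^ n) x)"
  by (induction n) (simp_all add: f_T)

lemma aff_diff: "aff x - aff y = A *v (x - y)"
  by (simp add: aff_def matrix_vector_mult_diff_distrib)

lemma A_surj: obtains x where "A *v x = y"
proof -
  have "invertible A" using det_pos by (simp add: invertible_det_nz)
  then obtain B where "A ** B = mat 1" unfolding invertible_def by blast
  then have "A *v (B *v y) = y" by (simp add: matrix_vector_mul_assoc)
  then show thesis by (rule that)
qed

lemma A_inj: "A *v x = A *v y \<longleftrightarrow> x = y"
proof -
  have "inj ((*v) A)" using det_pos by (metis invertible_det_nz invertible_left_inverse matrix_left_invertible_injective less_irrefl)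
  then show ?thesis by (meson injD)
qed

lemma aff_surj: obtains x where "aff x = y"
proof -
  obtain x where "A *v x = y - v0" by (rule A_surj)
  then have "aff x = y" by (simp add: aff_def)
  then show thesis by (rule that)
qed

lemma aff_inj: "aff x = aff y \<longleftrightarrow> x = y"
  by (simp add: aff_def A_inj)

lemma continuous_aff: "continuous_on S aff"
  unfolding aff_def by (intro continuous_intros matrix_vector_mult_linear_continuous_on)

lemma open_aff_vimage: "open U \<Longrightarrow> open (aff -` U)"
  using continuous_aff[of UNIV] by (simp add: open_vimage)

lemma open_aff_image: "open U \<Longrightarrow> open (aff ` U)"
  by (rule invariance_of_domain[OF continuous_aff]) (auto simp: inj_on_def aff_inj)

lemma f_surj: obtains y where "f y = w"
proof -
  obtain z where "T z = w" by (rule T_surj)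
  moreover obtain x where "aff x = z" by (rule aff_surj)
  ultimately have "f (T x) = w" by (simp add: f_T)
  then show thesis by (rule that)
qed

text \<open>\<open>T\<close> is a continuous open surjection, so the preimage of an open set under
  \<open>f\<close> is the image under \<open>T\<close> of an open set in the plane.\<close>

lemma f_continuous: "continuous_map sphere_top sphere_top f"
proof -
  have "openin sphere_top (f -` V)" if V: "openin sphere_top V" for V
  proof -
    have "f -` V = T ` (aff -` (T -` V))"
    proof
      show "T ` (aff -` (T -` V)) \<subseteq> f -` V" by (auto simp: f_T)
      show "f -` V \<subseteq> T ` (aff -` (T -` V))"
      proof
        fix y assume "y \<in> f -` V"
        moreover obtain x where "y = T x" using T_surj by metis
        ultimately show "y \<in> T ` (aff -` (T -` V))" by (auto simp: f_T)
      qed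
    qed
    then show ?thesis using T_open open_aff_vimage open_T_vimage V by simp
  qed
  then show ?thesis by (simp add: continuous_map vimage_def)
qed

lemma f_open: "openin sphere_top V \<Longrightarrow> openin sphere_top (f ` V)"
proof -
  assume V: "openin sphere_top V"
  have "f ` V = T ` aff ` (T -` V)"
  proof
    show "T ` aff ` (T -` V) \<subseteq> f ` V" by (auto simp: f_T[symmetric])
    show "f ` V \<subseteq> T ` aff ` (T -` V)"
    proof
      fix y assume "y \<in> f ` V"
      then obtain z where z: "z \<in> V" "y = f z" by auto
      obtain x where x: "z = T x" using T_surj by metis
      then have "y = T (aff x)" "x \<in> T -` V" using z by (auto simp: f_T)
      then show "y \<in> T ` aff ` (T -` V)" by blast
    qed
  qed
  then show ?thesis using T_open open_aff_image open_T_vimage V by simp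
qed

text \<open>Contrapositive: T y = T z implies T (aff y) = T (aff z), so injectivity of
  \<open>T\<close> near \<open>aff x\<close> forces injectivity near \<open>x\<close>.\<close>

lemma Cr_forward: assumes "x \<in> Cr" shows "aff x \<in> Cr"
proof (rule ccontr)
  assume "aff x \<notin> Cr"
  then obtain U where U: "open U" "aff x \<in> U" "inj_on T U" by (auto simp: Cr_def locally_inj_def)
  have "inj_on T (aff -` U)"
  proof (rule inj_onI)
    fix y z assume yz: "y \<in> aff -` U" "z \<in> aff -` U" "T y = T z"
    then have "T (aff y) = T (aff z)" using f_T[of y] f_T[of z] by simp
    moreover have "aff y \<in> U" "aff z \<in> U" using yz by simp_all
    ultimately have "aff y = aff z" using U(3) by (meson inj_onD)
    then show "y = z" by (simp only: aff_inj)
  qed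
  then have "x \<notin> Cr" using U open_aff_vimage[OF U(1)] by (auto simp: Cr_def locally_inj_def)
  then show False using assms by simp
qed

lemma f_P: "y \<in> P \<Longrightarrow> f y \<in> P"
  using Cr_forward by (auto simp: P_def f_T)

text \<open>If \<open>aff x\<close> is noncritical, equality of f (T u) = T (aff u) with f (T v)
  forces u = v near \<open>x\<close>; hence \<open>f\<close> is injective on the open image under
  \<open>T\<close> of a neighbourhood of \<open>x\<close>.\<close>

lemma critical_value_in_P: assumes "\<not> locally_inj sphere_top f y" shows "f y \<in> P"
proof -
  obtain x where x: "T x = y" by (rule T_surj)
  have "aff x \<in> Cr"
  proof (rule ccontr)
    assume "aff x \<notin> Cr"
    then obtain U where U: "open U" "aff x \<in> U" "inj_on T U" by (auto simp: Cr_def locally_inj_def)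
    have "inj_on f (T ` (aff -` U))"
    proof (rule inj_onI, clarsimp)
      fix u v assume uv: "aff u \<in> U" "aff v \<in> U" "f (T u) = f (T v)"
      then have "aff u = aff v" using U(3) by (simp add: f_T inj_on_def)
      then show "T u = T v" by (simp add: aff_inj)
    qed
    moreover have "openin sphere_top (T ` (aff -` U))" by (rule T_open[OF open_aff_vimage[OF U(1)]])
    moreover have "y \<in> T ` (aff -` U)" using U(2) x by auto
    ultimately show False using assms by (auto simp: locally_inj_def)
  qed
  then show ?thesis using x by (auto simp: P_def f_T)
qed

lemma postcritical_subset: "postcritical f \<subseteq> P"
proof
  fix y assume "y \<in> postcritical f"
  then obtain n c where n: "n \<ge> 1" "c \<in> critical_points f" "y = (f ^^ n) c" by (auto simp: postcritical_def)
  have "f c \<in> P" using n(2) critical_value_in_P by (simp add: critical_points_eq)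
  then have "(f ^^ m) (f c) \<in> P" for m by (induction m) (auto intro: f_P)
  from this[of "n - 1"] show "y \<in> P"
    using n by (cases n) (simp_all add: funpow_swap1)
qed

text \<open>Otherwise \<open>A\<close> maps \<open>L\<close> onto itself, so its determinant is a
  positive integer with integral inverse, hence 1, and some eigenvalue has modulus at most 1. Such
  an \<open>r\<close> provides two torus points with the same image under \<open>g\<close>.\<close>

lemma expanding_lattice: obtains r where "r \<notin> L" "A *v r \<in> L"
proof -
  have "\<exists>r. r \<notin> L \<and> A *v r \<in> L"
  proof (rule ccontr)
    assume "\<not> ?thesis"
    then have all: "\<And>r. A *v r \<in> L \<Longrightarrow> r \<in> L" by blast
    obtain r1 r2 where r: "A *v r1 = a" "A *v r2 = b" using A_surj by metis
    then have rL: "r1 \<in> L" "r2 \<in> L" using all a_in b_in by auto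
    obtain k :: int where k: "wedge r1 r2 = of_int k * wedge a b" by (rule wedge_in_L[OF rL])
    obtain m :: int where m: "wedge (A *v a) (A *v b) = of_int m * wedge a b"
      by (rule wedge_in_L[OF A_L[OF a_in] A_L[OF b_in]])
    have dm: "det A = of_int m" using m wedge_ab by (simp add: wedge_matrix)
    have "wedge a b = det A * (of_int k * wedge a b)"
      using wedge_matrix[of A r1 r2] r k by simp
    then have "det A * of_int k = 1" using wedge_ab by simp
    then have "m * k = 1" unfolding dm by (metis of_int_1 of_int_eq_iff of_int_mult)
    moreover have "m > 0" using dm det_pos by simp
    ultimately have "m = 1" by (auto simp: zmult_eq_1_iff)
    then have "det A = 1" using dm by simp
    then obtain \<mu> where "complex_eigenvalue A \<mu>" "cmod \<mu> \<le> 1" by (rule eigenvalue_le_1)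
    then show False using expanding by force
  qed
  then show thesis using that by blast
qed

lemma locally_inj_iter:
  assumes "\<And>i. i < n \<Longrightarrow> locally_inj sphere_top f ((f ^^ i) y)"
  shows "locally_inj sphere_top (f ^^ n) y"
  using assms
proof (induction n)
  case 0
  show ?case unfolding locally_inj_def by (intro exI[of _ UNIV]) (auto simp: openin_sphere_top)
next
  case (Suc n)
  obtain U where U: "openin sphere_top U" "y \<in> U" "inj_on (f ^^ n) U"
    using Suc by (auto simp: locally_inj_def)
  obtain V where V: "openin sphere_top V" "(f ^^ n) y \<in> V" "inj_on f V"
    using Suc.prems[of n] by (auto simp: locally_inj_def)
  have cont: "continuous_map sphere_top sphere_top (f ^^ m)" for m
  proof (induction m)
    case (Suc m)
    then show ?case using continuous_map_compose[OF Suc f_continuous] by (simp add: o_def)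
  qed (simp add: id_def)
  have "openin sphere_top (U \<inter> (f ^^ n) -` V)"
    using U(1) cont[of n] V(1) by (auto simp: continuous_map vimage_def intro!: openin_Int)
  moreover have "inj_on (f ^^ Suc n) (U \<inter> (f ^^ n) -` V)"
    using U(3) V(3) by (auto simp: inj_on_def)
  ultimately show ?case using U(2) V(2) unfolding locally_inj_def
    by (intro exI[of _ "U \<inter> (f ^^ n) -` V"]) auto
qed

text \<open>If the critical value \<open>T x\<close> were not postcritical, then the whole backward orbit of \<open>x\<close> on the torus would consist
  of critical points of \<open>\<Theta>\<close>; but it is infinite.\<close>

lemma postcritical_eq: "postcritical f = P"
proof
  show "postcritical f \<subseteq> P" by (rule postcritical_subset)
  show "P \<subseteq> postcritical f"
  proof (rule ccontr)
    assume "\<not> P \<subseteq> postcritical f"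
    then obtain x where x: "x \<in> Cr" "T x \<notin> postcritical f" by (auto simp: P_def)
    \<comment> \<open>The backward orbit of \<open>x\<close> modulo \<open>L\<close>.\<close>
    define B where "B = {y. \<exists>n. (aff ^^ n) y - x \<in> L}"
    have "y \<in> Cr" if "y \<in> B" for y
    proof (rule ccontr)
      assume y: "y \<notin> Cr"
      obtain n where n: "(aff ^^ n) y - x \<in> L" using \<open>y \<in> B\<close> by (auto simp: B_def)
      have fn: "(f ^^ n) (T y) = T x" using T_eq_if_diff[OF n] by (simp add: f_T_iter)
      have "locally_inj sphere_top f ((f ^^ i) (T y))" if i: "i < n" for i
      proof (rule ccontr)
        assume "\<not> locally_inj sphere_top f ((f ^^ i) (T y))"
        then have "(f ^^ i) (T y) \<in> critical_points f" by (simp add: critical_points_eq)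
        moreover have "(f ^^ (n - i)) ((f ^^ i) (T y)) = T x"
          using fn i by (metis comp_apply funpow_add le_add_diff_inverse2 less_imp_le)
        moreover have "n - i \<in> {1..}" using i by simp
        ultimately have "T x \<in> postcritical f" unfolding postcritical_def by (metis UN_I imageI)
        then show False using x by simp
      qed
      then have "locally_inj sphere_top (f ^^ n) (T y)" by (rule locally_inj_iter)
      then obtain V where V: "openin sphere_top V" "T y \<in> V" "inj_on (f ^^ n) V" by (auto simp: locally_inj_def)
      obtain U where U: "open U" "y \<in> U" "inj_on T U" using y by (auto simp: Cr_def locally_inj_def)
      \<comment> \<open>Near \<open>y\<close> the map \<open>T\<close> is injective, and so is the
        n-th iterate of \<open>f\<close> near \<open>T y\<close>; hence \<open>T\<close> is
        injective near the n-th affine iterate of \<open>y\<close>, although this is congruent to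
        the critical point \<open>x\<close>.\<close>
      define W where "W = U \<inter> T -` V"
      have W: "open W" "y \<in> W" using U V open_T_vimage by (auto simp: W_def)
      have oi: "open ((aff ^^ m) ` W)" for m
      proof (induction m)
        case (Suc m)
        then show ?case using open_aff_image[OF Suc] by (simp add: image_comp)
      qed (use W in simp)
      have "inj_on T ((aff ^^ n) ` W)"
      proof (rule inj_onI, clarsimp)
        fix u v assume uv: "u \<in> W" "v \<in> W" "T ((aff ^^ n) u) = T ((aff ^^ n) v)"
        then have "(f ^^ n) (T u) = (f ^^ n) (T v)" by (simp add: f_T_iter)
        then have "T u = T v" using V(3) uv by (auto simp: W_def inj_on_def)
        then have "u = v" using U(3) uv by (auto simp: W_def inj_on_def)
        then show "(aff ^^ n) u = (aff ^^ n) v" by simp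
      qed
      then have "(aff ^^ n) y \<notin> Cr" using oi[of n] W(2) by (auto simp: Cr_def locally_inj_def)
      moreover have "(aff ^^ n) y \<in> Cr" using Cr_periodic[OF diff_commute_in[OF n] x(1)] .
      ultimately show False by simp
    qed
    then have "torus_proj L ` B \<subseteq> torus_proj L ` Cr" by blast
    then have fin: "finite (torus_proj L ` B)" using finite_Cr_torus finite_subset by blast
    have bwd: "z \<in> B" if zy: "aff z - y \<in> L" "y \<in> B" for y z
    proof -
      obtain n where n: "(aff ^^ n) y - x \<in> L" using zy(2) by (auto simp: B_def)
      have *: "(aff ^^ n) u - (aff ^^ n) w \<in> L" if "u - w \<in> L" for u w
        using that by (induction n) (auto simp: aff_diff A_L)
      have "(aff ^^ n) (aff z) - x \<in> L"
        using add_in[OF *[OF zy(1)] n] by simp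
      then show ?thesis by (auto simp: B_def funpow_swap1 intro!: exI[of _ "Suc n"])
    qed
    \<comment> \<open>A finite set covered by its own image is mapped injectively, but
      \<open>g\<close> does not separate the points represented by z and z + r.\<close>
    have gB: "g ` (torus_proj L ` B) \<supseteq> torus_proj L ` B"
    proof
      fix t assume "t \<in> torus_proj L ` B"
      then obtain y where y: "y \<in> B" "t = torus_proj L y" by auto
      obtain z where z: "aff z = y" by (rule aff_surj)
      then have "z \<in> B" using bwd[of z y] y by simp
      then show "t \<in> g ` (torus_proj L ` B)" using y z by (auto simp: g_proj image_iff intro!: bexI[of _ z])
    qed
    have "card (torus_proj L ` B) \<le> card (g ` torus_proj L ` B)"
      using card_mono[OF _ gB] fin by simp
    then have "card (g ` torus_proj L ` B) = card (torus_proj L ` B)"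
      using card_image_le[OF fin, of g] by simp
    then have inj: "inj_on g (torus_proj L ` B)" by (rule eq_card_imp_inj_on[OF fin])
    obtain r where r: "r \<notin> L" "A *v r \<in> L" by (rule expanding_lattice)
    have xB: "x \<in> B" by (auto simp: B_def intro!: exI[of _ 0])
    obtain z where z: "aff z = x" by (rule aff_surj)
    have "aff (z + r) - x = A *v r" using aff_diff[of "z + r" z] z by simp
    then have zB: "z + r \<in> B" "z \<in> B" using bwd[of "z + r" x] bwd[of z x] xB r z by simp_all
    have "g (torus_proj L (z + r)) = g (torus_proj L z)"
      using aff_diff[of "z + r" z] r by (simp add: g_proj proj_eq_iff)
    then have "torus_proj L (z + r) = torus_proj L z"
      using inj zB by (meson imageI inj_onD)
    then show False using r by (simp add: proj_eq_iff)
  qed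
qed

section \<open>Counting preimages on the torus and on the sphere\<close>

lemma det_int:
  obtains p' q' r' s' :: int where "A *v a = of_int p' *\<^sub>R a + of_int r' *\<^sub>R b" "A *v b = of_int q' *\<^sub>R a + of_int s' *\<^sub>R b"
    "det A = of_int (p' * s' - q' * r')"
proof -
  obtain p' r' where 1: "A *v a = of_int p' *\<^sub>R a + of_int r' *\<^sub>R b" using A_L[OF a_in] by (rule in_LE)
  obtain q' s' where 2: "A *v b = of_int q' *\<^sub>R a + of_int s' *\<^sub>R b" using A_L[OF b_in] by (rule in_LE)
  have "det A * wedge a b = wedge (A *v a) (A *v b)" by (simp add: wedge_matrix)
  also have "\<dots> = of_int (p' * s' - q' * r') * wedge a b"
    unfolding 1 2 wedge_def by (simp add: algebra_simps)
  finally have "det A = of_int (p' * s' - q' * r')" using wedge_ab by simp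
  then show thesis using that 1 2 by blast
qed

definition gfib :: "(real^2) set \<Rightarrow> (real^2) set set" where "gfib t = {s \<in> torus L. g s = t}"

text \<open>The representatives of a fibre differ by vectors that \<open>A\<close> maps into
  \<open>L\<close>, so modulo \<open>L\<close> they are counted by the index of A L in
  \<open>L\<close>. The upper bound comes from \<open>index_le_det\<close> in the basis
  \<open>a\<close>, \<open>b\<close>, the lower one from \<open>expanding_lattice\<close>.\<close>

lemma gfib_card:
  assumes t: "t \<in> torus L"
  shows "finite (gfib t)" "2 \<le> card (gfib t)" "real (card (gfib t)) \<le> det A"
proof -
  obtain y where y: "t = torus_proj L y" using t by (auto simp: torus_def)
  obtain x where x: "aff x = y" by (rule aff_surj)
  obtain p' q' r' s' :: int where m: "A *v a = of_int p' *\<^sub>R a + of_int r' *\<^sub>R b" "A *v b = of_int q' *\<^sub>R a + of_int s' *\<^sub>R b"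
    "det A = of_int (p' * s' - q' * r')" by (rule det_int)
  have "real_of_int (p' * s' - q' * r') > 0" using det_pos m(3) by argo
  then have "p' * s' - q' * r' > 0" by (simp only: of_int_0_less_iff)
  then obtain R where R: "finite R" "card R \<le> nat (p' * s' - q' * r')"
    "\<And>x y. \<exists>(i, j)\<in>R. \<exists>u v. x = i + (p' * u + q' * v) \<and> y = j + (r' * u + s' * v)"
    by (rule index_le_det) blast
  have "\<forall>ij. \<exists>w. A *v w = of_int (fst ij) *\<^sub>R a + of_int (snd ij) *\<^sub>R b" using A_surj by metis
  then obtain W where W: "\<And>i j. A *v W (i, j) = of_int i *\<^sub>R a + of_int j *\<^sub>R b" by (metis fst_conv snd_conv)
  have sub: "gfib t \<subseteq> (\<lambda>ij. torus_proj L (x + W ij)) ` R"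
  proof
    fix s assume s: "s \<in> gfib t"
    then obtain z where z: "s = torus_proj L z" by (auto simp: gfib_def torus_def)
    have "torus_proj L (aff z) = torus_proj L (aff x)" using s z y x by (simp add: gfib_def g_proj)
    then have "A *v (z - x) \<in> L" by (simp add: proj_eq_iff aff_diff)
    then obtain m1 m2 where m12: "A *v (z - x) = of_int m1 *\<^sub>R a + of_int m2 *\<^sub>R b" by (rule in_LE)
    obtain i j u v where ij: "(i, j) \<in> R" "m1 = i + (p' * u + q' * v)" "m2 = j + (r' * u + s' * v)"
      using R(3)[of m1 m2] by blast
    define l where "l = of_int u *\<^sub>R a + of_int v *\<^sub>R b"
    have "A *v l = of_int u *\<^sub>R (A *v a) + of_int v *\<^sub>R (A *v b)"
      by (simp add: l_def matrix_vector_right_distrib matrix_vector_mult_scaleR)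
    then have "A *v (z - x) = A *v (W (i, j) + l)"
      unfolding m12 ij m matrix_vector_right_distrib W by (simp add: algebra_simps)
    then have "z - x = W (i, j) + l" by (simp only: A_inj)
    then have "z - (x + W (i, j)) = l" by (simp add: algebra_simps)
    then have "s = torus_proj L (x + W (i, j))" by (simp add: z proj_eq_iff l_def in_LI)
    then show "s \<in> (\<lambda>ij. torus_proj L (x + W ij)) ` R" using ij(1) by blast
  qed
  show fin: "finite (gfib t)" using sub R(1) finite_surj by blast
  have "card (gfib t) \<le> card R" using surj_card_le[OF R(1) sub] .
  then have "int (card (gfib t)) \<le> p' * s' - q' * r'"
    using R(2) \<open>p' * s' - q' * r' > 0\<close> by linarith
  then have "real_of_int (int (card (gfib t))) \<le> real_of_int (p' * s' - q' * r')" by (simp only: of_int_le_iff)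
  then show "real (card (gfib t)) \<le> det A" unfolding m(3) by simp
  obtain r where r: "r \<notin> L" "A *v r \<in> L" by (rule expanding_lattice)
  have "torus_proj L (aff (x + r)) = torus_proj L y"
    using aff_diff[of "x + r" x] r x by (simp add: proj_eq_iff)
  then have "{torus_proj L x, torus_proj L (x + r)} \<subseteq> gfib t"
    using x y by (auto simp: gfib_def torus_def g_proj)
  moreover have "torus_proj L x \<noteq> torus_proj L (x + r)"
    using r uminus_in[of "- r"] by (auto simp: proj_eq_iff)
  ultimately show "2 \<le> card (gfib t)"
    using card_mono[OF fin, of "{torus_proj L x, torus_proj L (x + r)}"] by simp
qed

lemma g_torus: "s \<in> torus L \<Longrightarrow> g s \<in> torus L"
  by (auto simp: torus_def g_proj)

lemma card_preimage:
  assumes F: "finite F" "F \<subseteq> torus L"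
  shows "2 * card F \<le> card {s \<in> torus L. g s \<in> F}" "real (card {s \<in> torus L. g s \<in> F}) \<le> det A * card F"
proof -
  have eq: "{s \<in> torus L. g s \<in> F} = (\<Union>t\<in>F. gfib t)" by (auto simp: gfib_def)
  have "card (\<Union>t\<in>F. gfib t) = (\<Sum>t\<in>F. card (gfib t))"
    by (rule card_UN_disjoint) (use F gfib_card in \<open>auto simp: gfib_def\<close>)
  then have c: "card {s \<in> torus L. g s \<in> F} = (\<Sum>t\<in>F. card (gfib t))" by (simp add: eq)
  have "(\<Sum>t\<in>F. 2) \<le> (\<Sum>t\<in>F. card (gfib t))" by (rule sum_mono) (use F gfib_card in auto)
  then show "2 * card F \<le> card {s \<in> torus L. g s \<in> F}" using c by (simp add: mult.commute)
  have "(\<Sum>t\<in>F. real (card (gfib t))) \<le> (\<Sum>t\<in>F. det A)" by (rule sum_mono) (use F gfib_card in auto)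
  then show "real (card {s \<in> torus L. g s \<in> F}) \<le> det A * card F" using c by (simp add: mult.commute)
qed

lemma card_fibre_notin_P: assumes "w \<notin> P" shows "card (f -` {w}) = N"
  by (rule card_fibre_regular) (use critical_value_in_P assms in blast)

lemma exists_notin_P: obtains w where "w \<notin> P"
  using infinite_sphere finite_P by (metis UNIV_eq_I)

lemma tfib_preimage: "{s \<in> torus L. g s \<in> tfib w} = (\<Union>x\<in>f -` {w}. tfib x)"
  using g_torus by (auto simp: tfib_def semiconj)

text \<open>The torus points sent to \<open>w\<close> by \<open>f\<close> after
  \<open>\<Theta>\<close>, that is, by \<open>\<Theta>\<close> after \<open>g\<close>, are counted
  twice: as \<open>N\<close> fibres of \<open>\<Theta>\<close> with \<open>k\<close> points each,
  and as the preimage under \<open>g\<close> of a single such fibre.\<close>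

lemma N_bounds: "2 \<le> N" "real N \<le> det A"
proof -
  obtain w where w: "w \<notin> P" by (rule exists_notin_P)
  define k where "k = card (\<alpha> ` carrier G)"
  have k: "k > 0" using card_tfib_pos by (simp add: k_def)
  have "card (\<Union>x\<in>f -` {w}. tfib x) = (\<Sum>x\<in>f -` {w}. card (tfib x))"
    by (rule card_UN_disjoint) (use finite_fibre finite_tfib in \<open>auto simp: tfib_def\<close>)
  \<comment> \<open>\<open>P\<close> is forward invariant, so all preimages of \<open>w\<close> lie
    outside \<open>P\<close> and their fibres have full size.\<close>
  also have "\<dots> = (\<Sum>x\<in>f -` {w}. k)"
    by (rule sum.cong) (use w f_P card_tfib in \<open>auto simp: k_def\<close>)
  also have "\<dots> = N * k" using card_fibre_notin_P[OF w] by simp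
  finally have c: "card {s \<in> torus L. g s \<in> tfib w} = N * k" by (simp add: tfib_preimage)
  have tw: "finite (tfib w)" "tfib w \<subseteq> torus L" "card (tfib w) = k"
    using finite_tfib card_tfib[OF w] by (auto simp: tfib_def k_def)
  have "2 * k \<le> N * k" "real (N * k) \<le> det A * k"
    using card_preimage[OF tw(1,2)] by (simp_all add: c tw(3))
  then show "2 \<le> N" "real N \<le> det A" using k by simp_all
qed

text \<open>\<open>map_degree\<close> is a definite description; its uniqueness rests on the
  existence of a value that is not critical, supplied by the finiteness of \<open>P\<close>.\<close>

lemma map_degree_eq: "map_degree f = N"
proof -
  have 1: "card (f -` {w}) = N" if "w \<notin> f ` critical_points f" for w
    by (rule card_fibre_regular) (use that in \<open>auto simp: critical_points_eq\<close>)
  obtain w where w: "w \<notin> P" by (rule exists_notin_P)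
  then have "w \<notin> f ` critical_points f" using critical_value_in_P by (auto simp: critical_points_eq)
  then show ?thesis
    unfolding map_degree_def using 1 by (intro the_equality) auto
qed

text \<open>If \<open>P\<close> had at most two points, \<open>card_two_fibres\<close> would leave
  at most two preimages for both together. As fibres off \<open>P\<close> have N \<ge> 2 points,
  \<open>P\<close> would consist of exactly two points and be its own preimage. The torus points
  over \<open>P\<close> would then form a finite set equal to its preimage under \<open>g\<close>,
  while \<open>g\<close> is at least two to one.\<close>

lemma card_P: "card P \<ge> 3"
proof (rule ccontr)
  assume "\<not> ?thesis"
  then have cP: "card P \<le> 2" by simp
  \<comment> \<open>\<open>P\<close> is padded to two distinct points so that the estimate for two
    fibres applies.\<close>
  obtain w1 w2 where w: "w1 \<noteq> w2" "P \<subseteq> {w1, w2}"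
  proof -
    consider "card P = 0" | "card P = 1" | "card P = 2" using cP by linarith
    then show thesis
    proof cases
      case 1
      then have "P = {}" using finite_P by simp
      then show thesis using that[of None "Some 0"] by simp
    next
      case 2
      then obtain w where "P = {w}" by (rule card_1_singletonE)
      then show thesis using that[of w "if w = None then Some 0 else None"] by simp
    next
      case 3
      then obtain w1 w2 where "P = {w1, w2}" "w1 \<noteq> w2" by (auto simp: card_2_iff)
      then show thesis using that by blast
    qed
  qed
  have c2: "card (f -` {w1, w2}) \<le> 2"
    by (rule card_two_fibres[OF w(1)]) (use critical_value_in_P w(2) in blast)
  have "f -` {w1, w2} = f -` {w1} \<union> f -` {w2}" by auto
  moreover have "f -` {w1} \<inter> f -` {w2} = {}" using w(1) by auto
  ultimately have c12: "card (f -` {w1}) + card (f -` {w2}) \<le> 2"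
    using c2 finite_fibre by (simp add: card_Un_disjoint)
  have ne: "card (f -` {w}) \<ge> 1" for w
  proof -
    obtain y where "f y = w" by (rule f_surj)
    then have "f -` {w} \<noteq> {}" by auto
    then show ?thesis using finite_fibre[of w] by (simp add: Suc_le_eq card_gt_0_iff)
  qed
  \<comment> \<open>A point outside \<open>P\<close> would have at least two preimages and leave
    none for the other point.\<close>
  have "w1 \<in> P" "w2 \<in> P"
    using card_fibre_notin_P[of w1] card_fibre_notin_P[of w2] N_bounds(1) c12 ne[of w1] ne[of w2] by fastforce+
  then have P: "P = {w1, w2}" using w by blast
  have "P \<subseteq> f -` P" using f_P by blast
  moreover have "finite (f -` P)" "card (f -` P) \<le> card P"
    using c2 w(1) finite_fibre unfolding P by (auto simp: vimage_insert[of f w1 "{w2}"])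
  ultimately have inv: "f -` P = P" using card_seteq by blast
  define Z where "Z = (\<Union>w\<in>P. tfib w)"
  have Z: "finite Z" "Z \<subseteq> torus L" "Z \<noteq> {}"
    using finite_tfib finite_P tfib_nonempty P by (auto simp: Z_def tfib_def)
  have "{s \<in> torus L. g s \<in> Z} = Z"
  proof -
    have "g s \<in> Z \<longleftrightarrow> s \<in> Z" if "s \<in> torus L" for s
    proof -
      have "g s \<in> Z \<longleftrightarrow> f (\<Theta> s) \<in> P" using g_torus[OF that] semiconj[OF that] by (auto simp: Z_def tfib_def)
      also have "\<dots> \<longleftrightarrow> \<Theta> s \<in> P" using inv by blast
      also have "\<dots> \<longleftrightarrow> s \<in> Z" using that by (auto simp: Z_def tfib_def)
      finally show ?thesis .
    qed
    then show ?thesis using Z(2) by blast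
  qed
  then have "2 * card Z \<le> card Z" using card_preimage(1)[OF Z(1,2)] by simp
  then show False using Z by (simp add: card_gt_0_iff)
qed

end

section \<open>Jordan curves in the sphere\<close>

lemma continuous_map_the_sphere: "continuous_map (subtopology sphere_top (range Some)) euclidean the"
proof -
  have "openin (subtopology sphere_top (range Some)) {x \<in> range Some. the x \<in> U}" if "open U" for U
  proof -
    have "{x \<in> range Some. the x \<in> U} = Some ` U" by auto
    moreover have "openin sphere_top (range Some)" by simp
    ultimately show ?thesis using that by (auto simp: openin_open_subtopology)
  qed
  then show ?thesis by (auto simp: continuous_map)
qed

text \<open>A translation moves a finite point to 0, and the inversion sends 0 to infinity.\<close>

lemma sphere_move_to_infinity:
  obtains \<tau> \<sigma> where "homeomorphic_maps sphere_top sphere_top \<tau> \<sigma>" "\<tau> z0 = None"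
proof (cases z0)
  case None
  show thesis by (rule that[of id id]) (auto simp: None homeomorphic_maps_id)
next
  case (Some c)
  define tr where "tr c = map_option (\<lambda>z::complex. z - c)" for c
  have cont: "continuous_map sphere_top sphere_top (tr c)" for c
  proof -
    have "openin sphere_top {x. tr c x \<in> V}" if V: "openin sphere_top V" for V
      unfolding openin_sphere_top
    proof
      have "open ((\<lambda>z. z - c) -` {z. Some z \<in> V})"
        by (rule open_vimage[OF open_Some_vimage[OF V]]) (intro continuous_intros)
      then show "open {z. Some z \<in> {x. tr c x \<in> V}}" by (simp add: tr_def vimage_def)
      show "None \<in> {x. tr c x \<in> V} \<longrightarrow> (\<exists>R. \<forall>z. R < norm z \<longrightarrow> Some z \<in> {x. tr c x \<in> V})"
      proof
        assume "None \<in> {x. tr c x \<in> V}"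
        then obtain R where R: "\<And>z. R < norm z \<Longrightarrow> Some z \<in> V" using V by (auto simp: tr_def openin_sphere_top)
        have "Some z \<in> {x. tr c x \<in> V}" if "R + norm c < norm z" for z
          using R[of "z - c"] norm_triangle_ineq2[of z c] that by (simp add: tr_def)
        then show "\<exists>R. \<forall>z. R < norm z \<longrightarrow> Some z \<in> {x. tr c x \<in> V}" by blast
      qed
    qed
    then show ?thesis by (simp add: continuous_map)
  qed
  have "homeomorphic_maps sphere_top sphere_top (tr c) (tr (- c))"
    using cont[of c] cont[of "- c"] by (auto simp: homeomorphic_maps_def tr_def option.map_comp o_def option.map_ident)
  then have "homeomorphic_maps sphere_top sphere_top (inversion \<circ> tr c) (tr (- c) \<circ> inversion)"
    using homeomorphic_maps_compose homeomorphic_maps_inversion by blast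
  moreover have "(inversion \<circ> tr c) z0 = None" by (simp add: Some tr_def)
  ultimately show thesis by (rule that)
qed

lemma connectedin_sphere_Some: "connected X \<Longrightarrow> connectedin sphere_top (Some ` X)"
  using connectedin_continuous_map_image[OF continuous_map_Some_sphere] by simp

lemma connected_vimage_Some:
  assumes "connectedin sphere_top W" "W \<subseteq> range Some" shows "connected {z. Some z \<in> W}"
proof -
  have "connectedin (subtopology sphere_top (range Some)) W" using assms by (simp add: connectedin_subtopology)
  then have "connectedin euclidean (the ` W)"
    by (rule connectedin_continuous_map_image[OF continuous_map_the_sphere])
  moreover have "the ` W = {z. Some z \<in> W}" using assms(2) by force
  ultimately show ?thesis by simp
qed

lemma openin_insert_None:
  assumes "open X" "\<And>z. R < norm z \<Longrightarrow> z \<in> X" shows "openin sphere_top (insert None (Some ` X))"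
  using assms by (auto simp: openin_sphere_top image_iff)

text \<open>Infinity is in the closure of an unbounded set, and adding closure points preserves
  connectedness.\<close>

lemma connectedin_insert_None:
  assumes X: "connected X" "\<not> bounded X"
  shows "connectedin sphere_top (insert None (Some ` X))"
proof (rule connectedin_intermediate_closure_of[OF connectedin_sphere_Some[OF X(1)]])
  have "None \<in> sphere_top closure_of (Some ` X)"
    unfolding in_closure_of
  proof (intro conjI allI impI)
    fix V assume "None \<in> V \<and> openin sphere_top V"
    then obtain R where "\<And>z. R < norm z \<Longrightarrow> Some z \<in> V" by (auto simp: openin_sphere_top)
    moreover obtain z where "z \<in> X" "R < norm z" using X(2) unfolding bounded_iff by (meson not_le)
    ultimately show "\<exists>y. y \<in> Some ` X \<and> y \<in> V" by blast
  qed simp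
  then show "insert None (Some ` X) \<subseteq> sphere_top closure_of (Some ` X)"
    using closure_of_subset[of "Some ` X" sphere_top] by auto
qed auto

locale jordan =
  fixes C :: "riemann set"
  assumes jordan: "jordan_curve C"
begin

lemma circle_maps:
  obtains h h' where "homeomorphic_maps (subtopology sphere_top C) (top_of_set (sphere (0::complex) 1)) h h'"
  using jordan unfolding jordan_curve_def homeomorphic_space_def by blast

lemma closedin_C: "closedin sphere_top C"
proof -
  obtain h h' where hh: "homeomorphic_maps (subtopology sphere_top C) (top_of_set (sphere (0::complex) 1)) h h'"
    by (rule circle_maps)
  have "compact_space (top_of_set (sphere (0::complex) 1))" by (simp add: compact_space_subtopology)
  then have "compact_space (subtopology sphere_top C)"
    using hh homeomorphic_compact_space homeomorphic_space_def by blast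
  then have "compactin sphere_top C" by (simp add: compactin_subspace)
  then show ?thesis using Hausdorff_space_sphere compactin_imp_closedin by blast
qed

text \<open>An open subset of \<open>C\<close> would embed into the circle, and by invariance of
  domain its image would be open in the plane.\<close>

lemma C_empty_interior: assumes W: "openin sphere_top W" "W \<noteq> {}" shows "\<not> W \<subseteq> C"
proof
  assume WC: "W \<subseteq> C"
  obtain h h' where hh: "homeomorphic_maps (subtopology sphere_top C) (top_of_set (sphere (0::complex) 1)) h h'"
    by (rule circle_maps)
  define U where "U = {z. Some z \<in> W}"
  have U: "open U" using W open_Some_vimage by (simp add: U_def)
  have "U \<noteq> {}"
  proof
    assume "U = {}"
    then have "y = None" if "y \<in> W" for y using that by (cases y) (auto simp: U_def)
    then have "None \<in> W" using W(2) by blast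
    then obtain R where "\<And>z. R < norm z \<Longrightarrow> Some z \<in> W" using W(1) by (auto simp: openin_sphere_top)
    moreover have "R < norm (complex_of_real (\<bar>R\<bar> + 1))" by (simp only: norm_of_real)
    ultimately have "of_real (\<bar>R\<bar> + 1) \<in> U" unfolding U_def by blast
    then show False using \<open>U = {}\<close> by simp
  qed
  have inj: "inj_on (\<lambda>z. h (Some z)) U"
  proof (rule inj_onI)
    fix x y assume xy: "x \<in> U" "y \<in> U" "h (Some x) = h (Some y)"
    have h'h: "h' (h (Some u)) = Some u" if "u \<in> U" for u
      using hh WC that by (auto simp: homeomorphic_maps_def U_def)
    have "Some x = h' (h (Some x))" by (rule h'h[OF xy(1), symmetric])
    also have "\<dots> = h' (h (Some y))" by (simp only: xy(3))
    also have "\<dots> = Some y" by (rule h'h[OF xy(2)])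
    finally show "x = y" by simp
  qed
  have "continuous_map (top_of_set U) (subtopology sphere_top C) Some"
    unfolding continuous_map_in_subtopology
  proof
    show "continuous_map (top_of_set U) sphere_top Some"
      by (rule continuous_map_from_subtopology[OF continuous_map_Some_sphere])
  qed (use WC in \<open>auto simp: U_def\<close>)
  then have "continuous_map (top_of_set U) (top_of_set (sphere 0 1)) (h \<circ> Some)"
    using hh continuous_map_compose unfolding homeomorphic_maps_def by blast
  then have cont: "continuous_on U (\<lambda>z. h (Some z))" and im: "(\<lambda>z. h (Some z)) ` U \<subseteq> sphere 0 1"
    by (auto simp: o_def continuous_map_in_subtopology)
  have "open ((\<lambda>z. h (Some z)) ` U)" by (rule invariance_of_domain[OF cont U inj])
  moreover obtain u where "u \<in> U" using \<open>U \<noteq> {}\<close> by blast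
  moreover define w where "w = h (Some u)"
  ultimately have "w \<in> (\<lambda>z. h (Some z)) ` U" "open ((\<lambda>z. h (Some z)) ` U)" by blast+
  then obtain e where e: "e > 0" "ball w e \<subseteq> (\<lambda>z. h (Some z)) ` U" by (meson open_contains_ball)
  have w: "norm w = 1" using im \<open>w \<in> _\<close> by auto
  \<comment> \<open>Moving \<open>w\<close> radially outwards by half the radius of the ball stays
    in the open image but leaves the unit circle.\<close>
  have "norm (w * of_real (1 + e / 2)) = 1 + e / 2"
    unfolding norm_mult w norm_of_real using e(1) by simp
  moreover have "dist w (w * of_real (1 + e / 2)) = e / 2"
  proof -
    have "w - w * of_real (1 + e / 2) = w * of_real (- (e / 2))" by (simp add: algebra_simps)
    then show ?thesis unfolding dist_norm using e(1) by (simp only: norm_mult w norm_of_real)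
  qed
  then have "w * of_real (1 + e / 2) \<in> ball w e" unfolding mem_ball using e(1) by linarith
  then have "w * of_real (1 + e / 2) \<in> sphere 0 1" using e(2) im by blast
  ultimately show False using e(1) by simp
qed

text \<open>The curve is delivered in two forms: as a homeomorphic image of the circle for
  \<open>jordan_complement_ulc\<close>, and as a simple closed path for the Jordan curve
  theorem.\<close>

lemma planar_model:
  assumes z0: "z0 \<notin> C" and \<tau>: "homeomorphic_maps sphere_top sphere_top \<tau> \<sigma>" "\<tau> z0 = None"
  obtains C' p where "\<tau> ` C = Some ` C'" "sphere (0::complex) 1 homeomorphic C'" "simple_path p"
    "pathfinish p = pathstart p" "path_image p = C'"
proof -
  have ts: "\<tau> (\<sigma> x) = x" "\<sigma> (\<tau> x) = x" and contt: "continuous_map sphere_top sphere_top \<tau>"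
    and conts: "continuous_map sphere_top sphere_top \<sigma>" for x
    using \<tau>(1) by (auto simp: homeomorphic_maps_def)
  define C' where "C' = {z. Some z \<in> \<tau> ` C}"
  have "None \<notin> \<tau> ` C" using z0 \<tau>(2) ts by (metis imageE)
  then have C'1: "\<tau> ` C = Some ` C'" by (auto simp: C'_def image_iff) (metis not_None_eq)
  obtain h h' where hh: "homeomorphic_maps (subtopology sphere_top C) (top_of_set (sphere (0::complex) 1)) h h'"
    by (rule circle_maps)
  have h: "\<And>x. x \<in> C \<Longrightarrow> h' (h x) = x" "\<And>u. u \<in> sphere 0 1 \<Longrightarrow> h (h' u) = u"
     "continuous_map (subtopology sphere_top C) (top_of_set (sphere 0 1)) h"
     "continuous_map (top_of_set (sphere 0 1)) (subtopology sphere_top C) h'"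
    using hh by (auto simp: homeomorphic_maps_def)
  have hC: "\<And>x. x \<in> C \<Longrightarrow> h x \<in> sphere 0 1" "\<And>u. u \<in> sphere 0 1 \<Longrightarrow> h' u \<in> C"
    using h(3,4) by (auto simp: continuous_map_def)
  define \<eta> where "\<eta> u = the (\<tau> (h' u))" for u
  define \<zeta> where "\<zeta> z = h (\<sigma> (Some z))" for z
  have S\<eta>: "Some (\<eta> u) = \<tau> (h' u)" if "u \<in> sphere 0 1" for u
  proof -
    have "\<tau> (h' u) \<in> Some ` C'" using C'1 hC(2)[OF that] by blast
    then show ?thesis by (auto simp: \<eta>_def)
  qed
  have \<sigma>C: "\<sigma> (Some z) \<in> C" if "z \<in> C'" for z
    using that ts by (auto simp: C'_def)
  have trS: "\<tau> (h' u) \<in> range Some" if "u \<in> sphere 0 1" for u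
    using S\<eta>[OF that] by (metis rangeI)
  have "continuous_map (top_of_set (sphere 0 1)) sphere_top (\<tau> \<circ> h')"
    using continuous_map_compose[of "top_of_set (sphere 0 1)" sphere_top h' sphere_top \<tau>] h(4) contt
    by (simp add: continuous_map_in_subtopology)
  then have "continuous_map (top_of_set (sphere 0 1)) (subtopology sphere_top (range Some)) (\<tau> \<circ> h')"
    using trS by (auto simp: continuous_map_in_subtopology)
  then have "continuous_map (top_of_set (sphere 0 1)) euclidean (the \<circ> (\<tau> \<circ> h'))"
    using continuous_map_compose continuous_map_the_sphere by blast
  then have c1: "continuous_on (sphere 0 1) \<eta>" by (simp add: o_def \<eta>_def[abs_def])
  have "continuous_map (top_of_set C') (subtopology sphere_top C) (\<sigma> \<circ> Some)"
    using \<sigma>C by (auto simp: continuous_map_in_subtopology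
      intro!: continuous_map_compose[OF continuous_map_from_subtopology[OF continuous_map_Some_sphere] conts])
  then have "continuous_map (top_of_set C') (top_of_set (sphere 0 1)) (h \<circ> (\<sigma> \<circ> Some))"
    using continuous_map_compose h(3) by blast
  then have c2: "continuous_on C' \<zeta>" by (simp add: o_def \<zeta>_def[abs_def] continuous_map_in_subtopology)
  have \<zeta>\<eta>: "\<zeta> (\<eta> u) = u" if "u \<in> sphere 0 1" for u using that by (simp add: \<zeta>_def S\<eta> ts h)
  have \<eta>\<zeta>: "\<eta> (\<zeta> z) = z" if "z \<in> C'" for z using \<sigma>C[OF that] by (simp add: \<eta>_def \<zeta>_def h ts)
  have im1: "\<eta> u \<in> C'" if "u \<in> sphere 0 1" for u
    using S\<eta>[OF that] hC(2)[OF that] by (simp add: C'_def)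
  have im2: "\<zeta> z \<in> sphere 0 1" if "z \<in> C'" for z using hC(1)[OF \<sigma>C[OF that]] by (simp add: \<zeta>_def)
  have hom: "homeomorphism (sphere 0 1) C' \<eta> \<zeta>"
    by (rule homeomorphismI[OF c1 c2]) (use \<zeta>\<eta> \<eta>\<zeta> im1 im2 in auto)
  have inj: "inj_on \<eta> (sphere 0 1)" using \<zeta>\<eta> by (metis inj_onI)
  have "simple_path (circlepath (0::complex) 1)" by (simp add: simple_path_circlepath)
  then have "simple_path (\<eta> \<circ> circlepath 0 1)"
    using c1 inj by (intro simple_path_continuous_image) auto
  moreover have "pathfinish (\<eta> \<circ> circlepath 0 1) = pathstart (\<eta> \<circ> circlepath 0 1)"
    by (simp add: pathfinish_compose pathstart_compose)
  moreover have "path_image (\<eta> \<circ> circlepath 0 1) = C'"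
    using homeomorphism_image1[OF hom] by (simp add: path_image_compose)
  moreover have "sphere (0::complex) 1 homeomorphic C'" using hom by (auto simp: homeomorphic_def)
  ultimately show thesis using that C'1 by blast
qed

text \<open>For a component \<open>V\<close> of the complement, move a point of the other component to infinity; then \<open>V\<close> becomes the inside of a
  Jordan curve.\<close>

lemma complement_components:
  obtains V1 V2 where "connected_components_of (subtopology sphere_top (- C)) = {V1, V2}"
    "\<And>V. V \<in> {V1, V2} \<Longrightarrow> \<exists>z0. z0 \<notin> C \<and> z0 \<notin> V"
proof -
  obtain z1 where z1: "z1 \<notin> C"
    using C_empty_interior[of UNIV] openin_topspace[of sphere_top] topspace_sphere_top by auto
  obtain \<tau> \<sigma> where \<tau>: "homeomorphic_maps sphere_top sphere_top \<tau> \<sigma>" "\<tau> z1 = None"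
    by (rule sphere_move_to_infinity)
  obtain C' p where C': "\<tau> ` C = Some ` C'" "sphere (0::complex) 1 homeomorphic C'" "simple_path p"
    "pathfinish p = pathstart p" "path_image p = C'"
    by (rule planar_model[OF z1 \<tau>])
  have ts: "\<tau> (\<sigma> x) = x" "\<sigma> (\<tau> x) = x" and contt: "continuous_map sphere_top sphere_top \<tau>"
    and conts: "continuous_map sphere_top sphere_top \<sigma>" for x
    using \<tau>(1) by (auto simp: homeomorphic_maps_def)
  define I where "I = inside C'"
  define U where "U = outside C'"
  have J: "I \<noteq> {}" "open I" "connected I" "U \<noteq> {}" "open U" "connected U" "bounded I" "\<not> bounded U" "I \<inter> U = {}" "I \<union> U = - C'"
    using Jordan_inside_outside[OF C'(3,4)] unfolding C'(5) I_def U_def by blast+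
  define V1 where "V1 = \<sigma> ` Some ` I"
  define V2 where "V2 = \<sigma> ` (insert None (Some ` U))"
  have "bounded (- U)"
  proof -
    have "compact C'" using C'(3,5) compact_simple_path_image by blast
    then have "bounded (C' \<union> I)" using J(7) by (simp add: compact_imp_bounded)
    moreover have "- U = C' \<union> I" using J(9,10) by blast
    ultimately show ?thesis by simp
  qed
  then obtain R where "\<forall>z\<in>- U. norm z \<le> R" by (auto simp: bounded_iff)
  then have R: "z \<in> U" if "R < norm z" for z using that by (meson ComplI not_le)
  have img: "\<sigma> ` W = {x. \<tau> x \<in> W}" for W
    using ts by (auto simp: image_iff intro!: bexI[of _ "\<tau> _"])
  have op: "openin sphere_top (\<sigma> ` W)" if "openin sphere_top W" for W
    unfolding img using contt that by (simp add: continuous_map)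
  have V1: "openin sphere_top V1" "connectedin sphere_top V1"
    unfolding V1_def using J by (auto intro!: op connectedin_continuous_map_image[OF conts] connectedin_sphere_Some)
  have "openin sphere_top V2" unfolding V2_def by (rule op, rule openin_insert_None[OF J(5)], rule R)
  moreover have "connectedin sphere_top V2"
    unfolding V2_def by (rule connectedin_continuous_map_image[OF conts], rule connectedin_insert_None[OF J(6,8)])
  ultimately have V: "openin sphere_top V1" "openin sphere_top V2" "connectedin sphere_top V1" "connectedin sphere_top V2"
    using V1 by blast+
  have disj: "V1 \<inter> V2 = {}" unfolding V1_def V2_def img using J(9) by auto
  have ne: "V1 \<noteq> {}" "V2 \<noteq> {}" using J by (auto simp: V1_def V2_def)
  have un: "V1 \<union> V2 = - C"
  proof -
    have "x \<in> C \<longleftrightarrow> \<tau> x \<in> Some ` C'" for x using C'(1) ts by (metis imageE imageI)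
    moreover have "y \<notin> Some ` C' \<longleftrightarrow> y \<in> Some ` I \<or> y \<in> insert None (Some ` U)" for y
      using J(10) by (cases y) auto
    moreover have "x \<in> V1 \<union> V2 \<longleftrightarrow> \<tau> x \<in> Some ` I \<or> \<tau> x \<in> insert None (Some ` U)" for x
      by (simp only: V1_def V2_def img Un_iff mem_Collect_eq)
    ultimately have "x \<in> V1 \<union> V2 \<longleftrightarrow> x \<in> - C" for x by (simp only: Compl_iff)
    then show ?thesis by (rule Set.set_eqI)
  qed
  have comp: "connected_components_of (subtopology sphere_top (- C)) = {V1, V2}"
  proof -
    have "W = V1 \<or> W = V2" if W: "W \<in> connected_components_of (subtopology sphere_top (- C))" for W
    proof -
      have Wc: "connectedin (subtopology sphere_top (- C)) W" "W \<noteq> {}" "W \<subseteq> - C"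
        using W connectedin_connected_components_of nonempty_connected_components_of connected_components_of_subset by fastforce+
      then have Ws: "connectedin sphere_top W" by (simp add: connectedin_subtopology)
      have "W \<subseteq> V1 \<or> W \<subseteq> V2"
      proof (rule ccontr)
        assume "\<not> ?thesis"
        then have "V1 \<inter> W \<noteq> {}" "V2 \<inter> W \<noteq> {}" using Wc(3) un by auto
        then show False
          using Ws V(1,2) disj Wc(3) un unfolding connectedin by blast
      qed
      moreover have "connectedin (subtopology sphere_top (- C)) V1" "connectedin (subtopology sphere_top (- C)) V2"
        using V un by (auto simp: connectedin_subtopology)
      ultimately show ?thesis
        using connected_components_of_maximal[OF W] Wc(2) by (metis disjnt_def inf.absorb_iff2 inf.commute subset_antisym)
    qed
    moreover have "\<exists>W\<in>connected_components_of (subtopology sphere_top (- C)). x \<in> W" if "x \<notin> C" for x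
      using Union_connected_components_of[of "subtopology sphere_top (- C)"] that by auto
    moreover obtain x1 x2 where "x1 \<in> V1" "x2 \<in> V2" using ne by blast
    moreover have "x1 \<notin> C" "x2 \<notin> C" "x1 \<notin> V2" "x2 \<notin> V1" using calculation un disj by blast+
    ultimately show ?thesis by blast
  qed
  show thesis
  proof (rule that[OF comp])
    fix V assume "V \<in> {V1, V2}"
    then show "\<exists>z0. z0 \<notin> C \<and> z0 \<notin> V" using ne un disj by blast
  qed
qed

text \<open>The point sent to infinity lies neither on \<open>C\<close> nor in \<open>V\<close>,
  which forces the image of \<open>V\<close> to be the inside of the planar curve. Boundedness
  serves for property S, simple connectedness for lifting.\<close>

lemma component_planar_model:
  assumes V: "V \<in> connected_components_of (subtopology sphere_top (- C))"
  obtains \<tau> \<sigma> C' V' where "homeomorphic_maps sphere_top sphere_top \<tau> \<sigma>" "\<tau> ` V = Some ` V'"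
    "sphere (0::complex) 1 homeomorphic C'" "V' \<in> components (- C')" "bounded V'" "open V'" "simply_connected V'"
proof -
  have "\<exists>z0. z0 \<notin> C \<and> z0 \<notin> V"
    by (rule complement_components) (use V in auto)
  then obtain z0 where z0: "z0 \<notin> C" "z0 \<notin> V" by blast
  obtain \<tau> \<sigma> where \<tau>: "homeomorphic_maps sphere_top sphere_top \<tau> \<sigma>" "\<tau> z0 = None"
    by (rule sphere_move_to_infinity)
  obtain C' p where C': "\<tau> ` C = Some ` C'" "sphere (0::complex) 1 homeomorphic C'" "simple_path p"
    "pathfinish p = pathstart p" "path_image p = C'"
    by (rule planar_model[OF z0(1) \<tau>])
  have ts: "\<tau> (\<sigma> x) = x" "\<sigma> (\<tau> x) = x" and contt: "continuous_map sphere_top sphere_top \<tau>"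
    and conts: "continuous_map sphere_top sphere_top \<sigma>" for x
    using \<tau>(1) by (auto simp: homeomorphic_maps_def)
  have J: "inside C' \<noteq> {}" "open (inside C')" "connected (inside C')" "connected (outside C')" "bounded (inside C')"
    "\<not> bounded (outside C')" "inside C' \<inter> outside C' = {}" "inside C' \<union> outside C' = - C'"
    using Jordan_inside_outside[OF C'(3,4)] unfolding C'(5) by blast+
  have Vc: "connectedin (subtopology sphere_top (- C)) V" "V \<noteq> {}" "V \<subseteq> - C"
    using V connectedin_connected_components_of nonempty_connected_components_of connected_components_of_subset by fastforce+
  have max: "W \<subseteq> V" if "connectedin sphere_top W" "W \<subseteq> - C" "W \<inter> V \<noteq> {}" for W
    using connected_components_of_maximal[OF V, of W] that by (auto simp: connectedin_subtopology disjnt_def)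
  define V' where "V' = {z. Some z \<in> \<tau> ` V}"
  have "None \<notin> \<tau> ` V" using z0(2) \<tau>(2) ts by (metis imageE)
  then have V'1: "\<tau> ` V = Some ` V'" by (auto simp: V'_def image_iff) (metis not_None_eq)
  have mem: "z \<in> V' \<longleftrightarrow> \<sigma> (Some z) \<in> V" "z \<in> C' \<longleftrightarrow> \<sigma> (Some z) \<in> C" for z
  proof -
    have "y \<in> \<tau> ` W \<longleftrightarrow> \<sigma> y \<in> W" for y W
      using ts by (auto simp: image_iff intro!: bexI[of _ "\<sigma> y"])
    moreover have "z \<in> C' \<longleftrightarrow> Some z \<in> \<tau> ` C" unfolding C'(1) by auto
    ultimately show "z \<in> V' \<longleftrightarrow> \<sigma> (Some z) \<in> V" "z \<in> C' \<longleftrightarrow> \<sigma> (Some z) \<in> C"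
      by (auto simp: V'_def)
  qed
  have con: "connected V'"
  proof -
    have "connectedin sphere_top (\<tau> ` V)"
      by (rule connectedin_continuous_map_image[OF contt]) (use Vc in \<open>simp add: connectedin_subtopology\<close>)
    then show ?thesis unfolding V'_def by (rule connected_vimage_Some) (auto simp: V'1)
  qed
  have sub: "V' \<subseteq> - C'" using Vc(3) mem by blast
  have ne: "V' \<noteq> {}" using Vc(2) V'1 by auto
  have max': "X \<subseteq> V'" if X: "connected X" "X \<subseteq> - C'" "X \<inter> V' \<noteq> {}" for X
  proof -
    have "\<sigma> ` Some ` X \<subseteq> V"
    proof (rule max)
      show "connectedin sphere_top (\<sigma> ` Some ` X)"
        using X(1) by (intro connectedin_continuous_map_image[OF conts] connectedin_sphere_Some)
      show "\<sigma> ` Some ` X \<subseteq> - C" using X(2) mem by blast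
      obtain x where "x \<in> X" "x \<in> V'" using X(3) by blast
      then have "\<sigma> (Some x) \<in> \<sigma> ` Some ` X \<inter> V" using mem by blast
      then show "\<sigma> ` Some ` X \<inter> V \<noteq> {}" by blast
    qed
    then show ?thesis using mem by blast
  qed
  \<comment> \<open>If V' met the outside it would contain it and be unbounded; adding infinity
    would keep it connected, so \<open>z0\<close> would belong to \<open>V\<close>.\<close>
  have out: "V' \<inter> outside C' = {}"
  proof (rule ccontr)
    assume "V' \<inter> outside C' \<noteq> {}"
    then have "outside C' \<subseteq> V'" using max'[of "outside C'"] J by blast
    then have "\<not> bounded V'" using J(6) bounded_subset by blast
    then have "connectedin sphere_top (insert None (Some ` V'))" using con by (intro connectedin_insert_None)
    then have c: "connectedin sphere_top (\<sigma> ` insert None (Some ` V'))"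
      by (rule connectedin_continuous_map_image[OF conts])
    have z: "\<sigma> None = z0" using \<tau>(2) ts by metis
    have "\<sigma> ` insert None (Some ` V') \<subseteq> V"
    proof (rule max[OF c])
      show "\<sigma> ` insert None (Some ` V') \<subseteq> - C" using z z0(1) mem sub by blast
      obtain x where "x \<in> V'" using ne by blast
      then have "\<sigma> (Some x) \<in> \<sigma> ` insert None (Some ` V') \<inter> V" using mem by blast
      then show "\<sigma> ` insert None (Some ` V') \<inter> V \<noteq> {}" by blast
    qed
    then show False using z z0 by auto
  qed
  then have "V' \<subseteq> inside C'" using sub J by blast
  moreover have "inside C' \<subseteq> V'" using max'[of "inside C'"] J calculation ne by blast
  ultimately have Veq: "V' = inside C'" by blast
  have "V' \<in> components (- C')"
    unfolding in_components_maximal using con sub ne max' by (metis inf.absorb_iff2 inf_commute subset_antisym)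
  moreover have "simply_connected V'"
    using simply_connected_inside_simple_path[OF C'(3)] by (simp add: Veq C'(5))
  ultimately show thesis using that \<tau>(1) V'1 C'(2) J Veq by blast
qed

end

section \<open>Distances between lifts\<close>

context torus_cover
begin

text \<open>\<open>T\<close> is an open quotient map, and local connectedness passes from the plane
  to the quotient.\<close>

lemma locally_connected_sphere: "locally_connected_space sphere_top"
proof (rule locally_connected_space_quotient_map_image)
  show "locally_connected_space (euclidean :: (real^2) topology)"
    unfolding locally_connected_space_def neighbourhood_base_of
  proof (intro allI impI)
    fix W and x :: "real^2" assume "openin euclidean W \<and> x \<in> W"
    then obtain e where "e > 0" "ball x e \<subseteq> W" by (auto simp: open_contains_ball)
    then show "\<exists>U V. openin euclidean U \<and> connectedin euclidean V \<and> x \<in> U \<and> U \<subseteq> V \<and> V \<subseteq> W"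
      by (intro exI[of _ "ball x e"]) (simp add: connected_ball)
  qed
  show "quotient_map euclidean sphere_top T"
    by (rule continuous_open_imp_quotient_map)
      (use T_continuous T_open range_T in \<open>auto simp: open_map_def\<close>)
qed

end

context rigid_cover
begin

text \<open>Compares the sphere near \<open>w\<close> with the plane near all lifts of
  \<open>w\<close>, uniformly since deck transformations have distortion at most \<kappa>. A
  connected set over \<open>W\<close> is moved by a deck transformation so as to meet a small ball
  around \<open>t0\<close>; it cannot cross the boundary of that ball, because the image of the
  boundary is disjoint from \<open>W\<close>.\<close>

lemma small_nbhd:
  assumes \<epsilon>: "\<epsilon> > 0"
  obtains W where "openin sphere_top W" "w \<in> W"
    "\<And>S s t. connected S \<Longrightarrow> T ` S \<subseteq> W \<Longrightarrow> s \<in> S \<Longrightarrow> t \<in> S \<Longrightarrow> dist s t \<le> \<epsilon>"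
    "\<And>t. T t \<in> W \<Longrightarrow> \<exists>s. T s = w \<and> dist s t \<le> \<epsilon>"
    "\<And>x s. x \<in> W \<Longrightarrow> T s = w \<Longrightarrow> \<exists>t. T t = x \<and> dist s t \<le> \<epsilon>"
proof -
  obtain \<kappa> where \<kappa>: "\<kappa> > 0" "\<And>s t. T s = T t \<Longrightarrow> \<exists>M c. M *v t + c = s \<and> (\<forall>x. T (M *v x + c) = T x) \<and> det M > 0 \<and>
       (\<forall>x y. dist (M *v x + c) (M *v y + c) \<le> \<kappa> * dist x y) \<and> (\<forall>x y. dist x y \<le> \<kappa> * dist (M *v x + c) (M *v y + c))"
    by (rule deck) blast
  obtain t0 where t0: "T t0 = w" by (rule T_surj)
  obtain r0 where r0: "r0 > 0" "\<And>y. y \<in> ball t0 r0 \<Longrightarrow> T y = T t0 \<Longrightarrow> y = t0"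
    by (rule T_isolated[of t0]) blast
  \<comment> \<open>Less than \<open>r0\<close>, so that no lift of \<open>w\<close> lies on the
    circle of radius \<open>r\<close> around \<open>t0\<close>; and so small that a diameter of 2 r
    stays below \<epsilon> after distortion by \<kappa>.\<close>
  define r where "r = min (r0 / 2) (\<epsilon> / (2 * \<kappa>))"
  have r: "r > 0" "r < r0" "\<kappa> * (2 * r) \<le> \<epsilon>"
  proof -
    show "r > 0" "r < r0" using r0(1) \<epsilon> \<kappa>(1) by (auto simp: r_def)
    have "r \<le> \<epsilon> / (2 * \<kappa>)" by (simp add: r_def)
    then have "r * (2 * \<kappa>) \<le> \<epsilon>" using \<kappa>(1) by (simp only: pos_le_divide_eq mult_pos_pos zero_less_numeral)
    then show "\<kappa> * (2 * r) \<le> \<epsilon>" by (simp only: mult.commute mult.left_commute)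
  qed
  have r1: "\<kappa> * r \<le> \<epsilon>"
  proof -
    have "0 \<le> \<kappa> * r" using \<kappa>(1) r(1) by simp
    then show ?thesis using r(3) by (simp add: algebra_simps)
  qed
  define W where "W = T ` ball t0 r \<inter> (UNIV - T ` sphere t0 r)"
  show thesis
  proof (rule that[of W])
    have "closedin sphere_top (T ` sphere t0 r)" by (rule closedin_T_image) simp
    then have "openin sphere_top (UNIV - T ` sphere t0 r)"
      using openin_diff[OF openin_topspace[of sphere_top]] topspace_sphere_top by metis
    then show "openin sphere_top W" unfolding W_def by (intro openin_Int T_open) simp_all
    have "w \<notin> T ` sphere t0 r"
    proof
      assume "w \<in> T ` sphere t0 r"
      then obtain y where y: "dist t0 y = r" "T y = T t0" using t0 by auto
      then have "y = t0" using r0(2)[of y] r by simp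
      then show False using y r by simp
    qed
    moreover have "w \<in> T ` ball t0 r" using t0 r(1) by (intro image_eqI[of _ _ t0]) auto
    ultimately show "w \<in> W" by (simp add: W_def)
  next
    fix S s t assume S: "connected S" "T ` S \<subseteq> W" and st: "s \<in> S" "t \<in> S"
    have "T s \<in> T ` ball t0 r" using S st by (auto simp: W_def)
    then obtain b where b: "b \<in> ball t0 r" "T b = T s" by auto
    obtain M c where Mc: "M *v s + c = b" "\<And>x. T (M *v x + c) = T x"
       "\<And>x y. dist x y \<le> \<kappa> * dist (M *v x + c) (M *v y + c)"
      using \<kappa>(2)[OF b(2)] by blast
    define S' where "S' = (\<lambda>x. M *v x + c) ` S"
    have "connected S'" unfolding S'_def
      by (intro connected_continuous_image S continuous_intros matrix_vector_mult_linear_continuous_on)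
    have TS': "T ` S' = T ` S" using Mc(2) by (auto simp: S'_def image_iff)
    have "S' \<inter> sphere t0 r = {}"
    proof (rule ccontr)
      assume "S' \<inter> sphere t0 r \<noteq> {}"
      then obtain y where y: "y \<in> S'" "y \<in> sphere t0 r" by blast
      then have "T y \<in> W" using TS' S(2) by blast
      then show False using y(2) by (auto simp: W_def)
    qed
    then have "S' \<inter> frontier (ball t0 r) = {}" using r(1) by (simp add: frontier_ball)
    moreover have "S' \<inter> ball t0 r \<noteq> {}" using st(1) Mc(1) b(1) by (auto simp: S'_def)
    ultimately have sub: "S' \<subseteq> ball t0 r"
      using connected_Int_frontier[OF \<open>connected S'\<close>, of "ball t0 r"] by blast
    then have "M *v s + c \<in> ball t0 r" "M *v t + c \<in> ball t0 r" using st by (auto simp: S'_def)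
    then have "dist (M *v s + c) (M *v t + c) \<le> 2 * r"
      using dist_triangle[of "M *v s + c" "M *v t + c" t0] by (simp add: dist_commute)
    then have "\<kappa> * dist (M *v s + c) (M *v t + c) \<le> \<kappa> * (2 * r)"
      using \<kappa>(1) by (intro mult_left_mono) auto
    then show "dist s t \<le> \<epsilon>" using Mc(3)[of s t] r(3) by linarith
  next
    fix t assume "T t \<in> W"
    then have "T t \<in> T ` ball t0 r" by (simp add: W_def)
    then obtain b where b: "b \<in> ball t0 r" "T t = T b" by auto
    obtain M c where Mc: "M *v b + c = t" "\<And>x. T (M *v x + c) = T x"
       "\<And>x y. dist (M *v x + c) (M *v y + c) \<le> \<kappa> * dist x y"
      using \<kappa>(2)[OF b(2)] by blast
    have "dist (M *v t0 + c) t \<le> \<kappa> * dist t0 b" using Mc(3)[of t0 b] Mc(1) by simp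
    also have "\<dots> \<le> \<kappa> * r" using b(1) \<kappa>(1) by (intro mult_left_mono) auto
    finally show "\<exists>s. T s = w \<and> dist s t \<le> \<epsilon>" using Mc(2)[of t0] t0 r1 by (intro exI[of _ "M *v t0 + c"]) auto
  next
    fix x s assume "x \<in> W" and s: "T s = w"
    then have "x \<in> T ` ball t0 r" by (simp add: W_def)
    then obtain b where b: "b \<in> ball t0 r" "x = T b" by auto
    have "T s = T t0" using s t0 by simp
    then obtain M c where Mc: "M *v t0 + c = s" "\<And>x. T (M *v x + c) = T x"
       "\<And>x y. dist (M *v x + c) (M *v y + c) \<le> \<kappa> * dist x y"
      using \<kappa>(2)[of s t0] by blast
    have "dist s (M *v b + c) \<le> \<kappa> * dist t0 b" using Mc(3)[of t0 b] Mc(1) by simp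
    also have "\<dots> \<le> \<kappa> * r" using b(1) \<kappa>(1) by (intro mult_left_mono) auto
    finally show "\<exists>t. T t = x \<and> dist s t \<le> \<epsilon>" using Mc(2)[of b] b(2) r1 by (intro exI[of _ "M *v b + c"]) auto
  qed
qed

section \<open>Distance to a set, measured between lifts\<close>

text \<open>A substitute for the distance to \<open>e\<close> on the sphere. It is continuous and
  vanishes on \<open>e\<close>, and since it is computed in the plane, its variation on a tile can
  be estimated through lifts of the tile.\<close>

definition lift_dist :: "riemann set \<Rightarrow> riemann \<Rightarrow> real" where
  "lift_dist e x = Inf ((\<lambda>t. infdist t (T -` e)) ` (T -` {x}))"

lemma lift_dist_le: "T t = x \<Longrightarrow> lift_dist e x \<le> infdist t (T -` e)"
  unfolding lift_dist_def by (rule cInf_lower) (auto intro!: bdd_belowI[of _ 0] infdist_nonneg)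

lemma lift_dist_greatest: "(\<And>t. T t = x \<Longrightarrow> c \<le> infdist t (T -` e)) \<Longrightarrow> c \<le> lift_dist e x"
  unfolding lift_dist_def using T_surj[of x] by (intro cInf_greatest) auto

lemma lift_dist_nonneg: "lift_dist e x \<ge> 0"
  by (rule lift_dist_greatest) (rule infdist_nonneg)

text \<open>The hypothesis concerns every lift of \<open>x\<close>, because the infimum defining
  \<open>lift_dist e x\<close> may be approached along any of them, whereas the lift of
  \<open>y\<close> can be chosen.\<close>

lemma lift_dist_triangle:
  assumes "\<And>t. T t = x \<Longrightarrow> \<exists>t'. T t' = y \<and> dist t t' \<le> c"
  shows "lift_dist e y \<le> lift_dist e x + c"
proof -
  have "lift_dist e y - c \<le> lift_dist e x"
  proof (rule lift_dist_greatest)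
    fix t assume "T t = x"
    then obtain t' where t': "T t' = y" "dist t t' \<le> c" using assms by blast
    show "lift_dist e y - c \<le> infdist t (T -` e)"
      using lift_dist_le[OF t'(1), of e] infdist_triangle[of t' "T -` e" t] t'(2) by (simp add: dist_commute)
  qed
  then show ?thesis by simp
qed

lemma continuous_lift_dist: "continuous_map sphere_top euclideanreal (lift_dist e)"
proof -
  have "openin sphere_top {x. lift_dist e x \<in> B}" if B: "open B" for B
  proof (subst openin_subopen, intro ballI)
    fix w assume "w \<in> {x. lift_dist e x \<in> B}"
    then obtain \<epsilon> where \<epsilon>: "\<epsilon> > 0" "ball (lift_dist e w) \<epsilon> \<subseteq> B" using B by (auto simp: open_contains_ball)
    then have e2: "\<epsilon> / 2 > 0" by simp
    obtain W where W: "openin sphere_top W" "w \<in> W"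
      "\<And>t. T t \<in> W \<Longrightarrow> \<exists>s. T s = w \<and> dist s t \<le> \<epsilon> / 2"
      "\<And>x s. x \<in> W \<Longrightarrow> T s = w \<Longrightarrow> \<exists>t. T t = x \<and> dist s t \<le> \<epsilon> / 2"
      by (rule small_nbhd[OF e2, of w]) blast
    have "W \<subseteq> {x. lift_dist e x \<in> B}"
    proof
      fix x assume x: "x \<in> W"
      have "lift_dist e x \<le> lift_dist e w + \<epsilon> / 2"
        by (rule lift_dist_triangle) (use W(4)[OF x] in blast)
      moreover have "lift_dist e w \<le> lift_dist e x + \<epsilon> / 2"
        by (rule lift_dist_triangle) (use W(3) x in \<open>auto simp: dist_commute\<close>)
      ultimately have "lift_dist e x \<in> ball (lift_dist e w) \<epsilon>" using \<epsilon>(1) by (simp add: dist_real_def)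
      then show "x \<in> {x. lift_dist e x \<in> B}" using \<epsilon>(2) by blast
    qed
    then show "\<exists>W. openin sphere_top W \<and> w \<in> W \<and> W \<subseteq> {x. lift_dist e x \<in> B}" using W by blast
  qed
  then show ?thesis by (simp add: continuous_map)
qed

lemma lift_dist_zero: "x \<in> e \<Longrightarrow> lift_dist e x = 0"
proof -
  assume x: "x \<in> e"
  obtain t where t: "T t = x" by (rule T_surj)
  then have "infdist t (T -` e) = 0" using x by (intro infdist_zero) simp
  then show ?thesis using lift_dist_le[OF t, of e] lift_dist_nonneg[of e x] by simp
qed

text \<open>The infimum runs over infinitely many lifts of \<open>x\<close>. A ball around one lift
  \<open>t0\<close> misses the lifts of \<open>e\<close>, and deck transformations carry this gap to
  every other lift, shrinking it at most by the factor \<kappa>.\<close>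

lemma lift_dist_pos:
  assumes e: "closedin sphere_top e" "e \<noteq> {}" and x: "x \<notin> e"
  shows "lift_dist e x > 0"
proof -
  obtain \<kappa> where \<kappa>: "\<kappa> > 0" "\<And>s t. T s = T t \<Longrightarrow> \<exists>M c. M *v t + c = s \<and> (\<forall>x. T (M *v x + c) = T x) \<and> det M > 0 \<and>
       (\<forall>x y. dist (M *v x + c) (M *v y + c) \<le> \<kappa> * dist x y) \<and> (\<forall>x y. dist x y \<le> \<kappa> * dist (M *v x + c) (M *v y + c))"
    by (rule deck) blast
  obtain t0 where t0: "T t0 = x" by (rule T_surj)
  have "openin sphere_top (UNIV - e)"
    using openin_diff[OF openin_topspace[of sphere_top] e(1)] topspace_sphere_top by metis
  then have "open (T -` (UNIV - e))" by (rule open_T_vimage)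
  moreover have "t0 \<in> T -` (UNIV - e)" using t0 x by simp
  ultimately obtain \<delta> where \<delta>: "\<delta> > 0" "ball t0 \<delta> \<subseteq> T -` (UNIV - e)" by (meson open_contains_ball)
  obtain w where "w \<in> e" using e by blast
  moreover obtain u where "T u = w" by (rule T_surj)
  ultimately have neE: "T -` e \<noteq> {}" by blast
  have "\<delta> / \<kappa> \<le> lift_dist e x"
  proof (rule lift_dist_greatest)
    fix t assume t: "T t = x"
    show "\<delta> / \<kappa> \<le> infdist t (T -` e)"
      unfolding infdist_notempty[OF neE]
    proof (rule cINF_greatest[OF neE])
      fix s assume s: "s \<in> T -` e"
      have "T t0 = T t" using t t0 by simp
      then obtain M c where Mc: "M *v t + c = t0" "\<And>x. T (M *v x + c) = T x"
         "\<And>x y. dist (M *v x + c) (M *v y + c) \<le> \<kappa> * dist x y"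
        using \<kappa>(2)[of t0 t] by blast
      have "M *v s + c \<notin> ball t0 \<delta>" using \<delta>(2) s Mc(2)[of s] by auto
      then have "\<delta> \<le> dist t0 (M *v s + c)" by simp
      also have "\<dots> \<le> \<kappa> * dist t s" using Mc(3)[of t s] Mc(1) by simp
      finally show "\<delta> / \<kappa> \<le> dist t s" using \<kappa>(1) by (simp add: pos_divide_le_eq mult.commute)
    qed
  qed
  moreover have "\<delta> / \<kappa> > 0" using \<delta>(1) \<kappa>(1) by simp
  ultimately show ?thesis by linarith
qed

text \<open>The sum of the functions is continuous and positive on the compact sphere. At each point
  some summand is at least the average, so the minimum of the sum divided by the number of sets is a
  valid \<delta>.\<close>

lemma no_common_point_gap:
  assumes fin: "finite \<E>" and e: "\<And>e. e \<in> \<E> \<Longrightarrow> closedin sphere_top e \<and> e \<noteq> {}" and emp: "\<Inter>\<E> = {}"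
  obtains \<delta> where "\<delta> > 0" "\<And>x. \<exists>e\<in>\<E>. \<delta> \<le> lift_dist e x"
proof -
  define H where "H x = (\<Sum>e\<in>\<E>. lift_dist e x)" for x
  have ne: "\<E> \<noteq> {}" using emp by auto
  have Hpos: "H x > 0" for x
  proof -
    obtain e where e': "e \<in> \<E>" "x \<notin> e" using emp by blast
    have "0 < lift_dist e x" using lift_dist_pos e e' by blast
    also have "\<dots> \<le> H x" unfolding H_def by (rule member_le_sum) (use e' fin lift_dist_nonneg in auto)
    finally show ?thesis .
  qed
  have "continuous_map sphere_top euclideanreal H"
    unfolding H_def by (rule continuous_map_sum[OF fin]) (rule continuous_lift_dist)
  moreover have "compactin sphere_top UNIV" using compact_space_sphere topspace_sphere_top by (metis compact_space_def)
  ultimately have "compactin euclideanreal (range H)" by (rule image_compactin[rotated])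
  then have "compact (range H)" by simp
  then obtain x0 where x0: "\<And>x. H x0 \<le> H x"
    using compact_attains_inf[of "range H"] by auto
  define \<delta> where "\<delta> = H x0 / card \<E>"
  have \<delta>: "\<delta> > 0" using Hpos[of x0] fin ne by (simp add: \<delta>_def card_gt_0_iff)
  show thesis
  proof (rule that[OF \<delta>], rule ccontr)
    fix x assume "\<not> (\<exists>e\<in>\<E>. \<delta> \<le> lift_dist e x)"
    then have "\<And>e. e \<in> \<E> \<Longrightarrow> lift_dist e x < \<delta>" by force
    then have "H x < (\<Sum>e\<in>\<E>. \<delta>)" unfolding H_def by (intro sum_strict_mono fin ne)
    also have "\<dots> = H x0" using fin ne by (simp add: \<delta>_def)
    finally show False using x0[of x] by simp
  qed
qed

end

section \<open>Lifts of the complementary components of the curve\<close>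

locale rigid_curve = rigid_cover L a b \<Theta> G \<alpha> + jordan C for L a b \<Theta> and G :: "'g monoid" and \<alpha> C +
  assumes P_C: "P \<subseteq> C"
begin

text \<open>\<open>V\<close> contains no critical value, so \<open>T\<close> is a covering over it;
  \<open>V\<close> is simply connected, so a connected set over \<open>V\<close> lies in the image
  of a section. Property S cuts \<open>V\<close> into finitely many connected pieces, each of which
  the section sends to a set of diameter at most 1.\<close>

lemma component_lifts_bounded:
  assumes V: "V \<in> connected_components_of (subtopology sphere_top (- C))"
  obtains m where "\<And>S s t. connected S \<Longrightarrow> T ` S \<subseteq> V \<Longrightarrow> s \<in> S \<Longrightarrow> t \<in> S \<Longrightarrow> dist s t \<le> m"
proof -
  obtain \<tau> \<sigma> C' V' where \<tau>: "homeomorphic_maps sphere_top sphere_top \<tau> \<sigma>" "\<tau> ` V = Some ` V'"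
    and C': "sphere (0::complex) 1 homeomorphic C'" "V' \<in> components (- C')" "bounded V'" "open V'" "simply_connected V'"
    by (rule component_planar_model[OF V]) blast
  have ts: "\<tau> (\<sigma> x) = x" "\<sigma> (\<tau> x) = x" and contt: "continuous_map sphere_top sphere_top \<tau>"
    and conts: "continuous_map sphere_top sphere_top \<sigma>" for x
    using \<tau>(1) by (auto simp: homeomorphic_maps_def)
  have VC: "V \<subseteq> - C" using connected_components_of_subset[OF V] by auto
  have memV: "x \<in> V \<longleftrightarrow> \<tau> x \<in> Some ` V'" for x
    unfolding \<tau>(2)[symmetric] using ts by (auto simp: image_iff) metis
  have opt: "openin sphere_top {x. \<tau> x \<in> W}" if "openin sphere_top W" for W
    using contt that by (simp add: continuous_map)
  have ops: "openin sphere_top {x. \<sigma> x \<in> W}" if "openin sphere_top W" for W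
    using conts that by (simp add: continuous_map)
  have "V = {x. \<tau> x \<in> Some ` V'}" using memV by blast
  then have "openin sphere_top V" using opt[of "Some ` V'"] C'(4) by simp
  define E where "E = T -` V"
  have E: "open E" unfolding E_def by (rule open_T_vimage[OF \<open>openin sphere_top V\<close>])
  \<comment> \<open>\<open>T\<close> read in the planar model of \<open>V\<close>; only its values
    on \<open>E\<close> matter.\<close>
  define F where "F x = the (\<tau> (T x))" for x
  have SF: "Some (F x) = \<tau> (T x)" "F x \<in> V'" "T x = \<sigma> (Some (F x))" if "x \<in> E" for x
  proof -
    have "\<tau> (T x) \<in> Some ` V'" using that memV by (simp add: E_def)
    then show 1: "Some (F x) = \<tau> (T x)" "F x \<in> V'" by (auto simp: F_def)
    show "T x = \<sigma> (Some (F x))" unfolding 1 by (simp add: ts)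
  qed
  have inE: "x \<in> E" if "T x = \<sigma> (Some z)" "z \<in> V'" for x z
    using that memV ts by (simp add: E_def)
  have F_eq: "F x = F y \<longleftrightarrow> T x = T y" if "x \<in> E" "y \<in> E" for x y
    using SF(3)[OF that(1)] SF(3)[OF that(2)] by (auto simp: F_def)
  have contF: "continuous_on E F"
    unfolding continuous_on_open_vimage[OF E]
  proof (intro allI impI)
    fix B :: "complex set" assume B: "open B"
    have "F -` B \<inter> E = T -` {w. \<tau> w \<in> Some ` B} \<inter> E"
      using SF(1) by (auto simp: image_iff) (metis option.inject)+
    moreover have "open (T -` {w. \<tau> w \<in> Some ` B})" using B by (intro open_T_vimage opt) simp
    ultimately show "open (F -` B \<inter> E)" using E by (simp add: open_Int)
  qed
  have FE: "F ` E = V'"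
  proof
    show "F ` E \<subseteq> V'" using SF(2) by auto
    show "V' \<subseteq> F ` E"
    proof
      fix z assume z: "z \<in> V'"
      obtain x where x: "T x = \<sigma> (Some z)" by (rule T_surj)
      then have "x \<in> E" using inE z by blast
      moreover have "F x = z" by (simp add: F_def x ts)
      ultimately show "z \<in> F ` E" by blast
    qed
  qed
  have cov: "covering_space E F V'"
    unfolding covering_space_def
  proof (intro conjI contF FE ballI)
    fix z assume z: "z \<in> V'"
    obtain x0 where x0: "T x0 = \<sigma> (Some z)" by (rule T_surj)
    then have x0E: "x0 \<in> E" using inE z by blast
    have notCr: "x \<notin> Cr" if "x \<in> E" for x using that VC P_C by (auto simp: E_def P_def)
    obtain U0 where U0: "open U0" "x0 \<in> U0" "inj_on T U0" using notCr[OF x0E] by (auto simp: Cr_def locally_inj_def)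
    define B where "B = U0 \<inter> E"
    have B: "open B" "x0 \<in> B" "inj_on T B" "B \<subseteq> E"
      using U0 E x0E by (auto simp: B_def inj_on_def)
    have FB: "F ` B = {u. Some u \<in> {y. \<sigma> y \<in> T ` B}}"
    proof
      show "F ` B \<subseteq> {u. Some u \<in> {y. \<sigma> y \<in> T ` B}}"
      proof
        fix u assume "u \<in> F ` B"
        then obtain x where x: "x \<in> B" "u = F x" by auto
        then have "\<sigma> (Some u) = T x" using SF(3)[of x] B(4) by auto
        then show "u \<in> {u. Some u \<in> {y. \<sigma> y \<in> T ` B}}" using x(1) by simp
      qed
      show "{u. Some u \<in> {y. \<sigma> y \<in> T ` B}} \<subseteq> F ` B"
      proof
        fix u assume "u \<in> {u. Some u \<in> {y. \<sigma> y \<in> T ` B}}"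
        then obtain x where x: "x \<in> B" "\<sigma> (Some u) = T x" by auto
        then have "F x = u" unfolding F_def by (metis ts(1) option.sel)
        then show "u \<in> F ` B" using x by blast
      qed
    qed
    have opFB: "open (F ` B)" unfolding FB by (intro open_Some_vimage ops T_open B)
    \<comment> \<open>The orientation-preserving affine deck transformations of \<open>T\<close>.
      The sheets over the image of \<open>B\<close> are the translates of \<open>B\<close> by them,
      and \<open>deck\<close> shows that these exhaust the preimage.\<close>
    define \<Gamma> where "\<Gamma> = {(M :: real^2^2, c). det M > 0 \<and> (\<forall>x. T (M *v x + c) = T x)}"
    define ap where "ap = (\<lambda>(M :: real^2^2, c) x. M *v x + c)"
    have ap_T: "T (ap \<gamma> x) = T x" if "\<gamma> \<in> \<Gamma>" for \<gamma> x using that by (auto simp: \<Gamma>_def ap_def)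
    have ap_inj: "inj_on (ap \<gamma>) S" if "\<gamma> \<in> \<Gamma>" for \<gamma> S
    proof -
      obtain M c where g: "\<gamma> = (M, c)" by (cases \<gamma>)
      then have "det M \<noteq> 0" using that by (auto simp: \<Gamma>_def)
      then obtain k where k: "k > 0" "\<And>x. norm x \<le> k * norm (M *v x)" by (rule invertible_matrix_bound) blast
      show ?thesis
      proof (rule inj_onI)
        fix x y assume "ap \<gamma> x = ap \<gamma> y"
        then have "M *v (x - y) = 0" by (simp add: g ap_def matrix_vector_mult_diff_distrib)
        then show "x = y" using k(2)[of "x - y"] by simp
      qed
    qed
    have ap_cont: "continuous_on S (ap \<gamma>)" for \<gamma> S
      unfolding ap_def case_prod_beta by (intro continuous_intros matrix_vector_mult_linear_continuous_on)
    have ap_open: "open (ap \<gamma> ` B)" if "\<gamma> \<in> \<Gamma>" for \<gamma>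
      by (rule invariance_of_domain[OF ap_cont B(1) ap_inj[OF that]])
    have ap_E: "ap \<gamma> ` B \<subseteq> E" if "\<gamma> \<in> \<Gamma>" for \<gamma>
      using ap_T[OF that] B(4) by (auto simp: E_def)
    have injTap: "inj_on T (ap \<gamma> ` B)" if "\<gamma> \<in> \<Gamma>" for \<gamma>
    proof (rule inj_onI, clarsimp simp: ap_T[OF that])
      fix x y assume "x \<in> B" "y \<in> B" "T x = T y"
      then show "ap \<gamma> x = ap \<gamma> y" using B(3) by (auto dest: inj_onD)
    qed
    have deck_ex: "\<exists>M c. M *v t + c = s \<and> (\<forall>x. T (M *v x + c) = T x) \<and> det M > 0" if "T s = T t" for s t
      by (rule deck) (use that in blast)
    show "\<exists>W. z \<in> W \<and> openin (top_of_set V') W \<and>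
            (\<exists>v. \<Union>v = E \<inter> F -` W \<and> (\<forall>u\<in>v. openin (top_of_set E) u) \<and> pairwise disjnt v \<and> (\<forall>u\<in>v. \<exists>q. homeomorphism u W F q))"
    proof (intro exI[of _ "F ` B"] conjI exI[of _ "(\<lambda>\<gamma>. ap \<gamma> ` B) ` \<Gamma>"] ballI)
      show "z \<in> F ` B" using B(2) x0 by (intro image_eqI[of _ _ x0]) (auto simp: F_def ts)
      show "openin (top_of_set V') (F ` B)" using opFB FE B(4) by (intro open_subset) auto
      show "\<Union> ((\<lambda>\<gamma>. ap \<gamma> ` B) ` \<Gamma>) = E \<inter> F -` F ` B"
      proof
        show "\<Union> ((\<lambda>\<gamma>. ap \<gamma> ` B) ` \<Gamma>) \<subseteq> E \<inter> F -` F ` B"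
        proof
          fix x assume "x \<in> \<Union> ((\<lambda>\<gamma>. ap \<gamma> ` B) ` \<Gamma>)"
          then obtain \<gamma> y where gy: "\<gamma> \<in> \<Gamma>" "y \<in> B" "x = ap \<gamma> y" by auto
          then have "x \<in> E" using ap_E by blast
          moreover have "F x = F y" using gy ap_T by (simp add: F_def)
          ultimately show "x \<in> E \<inter> F -` F ` B" using gy by auto
        qed
        show "E \<inter> F -` F ` B \<subseteq> \<Union> ((\<lambda>\<gamma>. ap \<gamma> ` B) ` \<Gamma>)"
        proof
          fix x assume "x \<in> E \<inter> F -` F ` B"
          then obtain y where y: "x \<in> E" "y \<in> B" "F x = F y" by auto
          then have "T x = T y" using F_eq B(4) by blast
          then obtain M c where Mc: "M *v y + c = x" "\<forall>x. T (M *v x + c) = T x" "det M > 0"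
            using deck_ex by blast
          then have "(M, c) \<in> \<Gamma>" "x = ap (M, c) y" by (auto simp: \<Gamma>_def ap_def)
          then show "x \<in> \<Union> ((\<lambda>\<gamma>. ap \<gamma> ` B) ` \<Gamma>)" using y(2) by blast
        qed
      qed
      show "pairwise disjnt ((\<lambda>\<gamma>. ap \<gamma> ` B) ` \<Gamma>)"
      proof (rule pairwise_imageI)
        fix \<gamma> \<gamma>' assume g: "\<gamma> \<in> \<Gamma>" "\<gamma>' \<in> \<Gamma>" "ap \<gamma> ` B \<noteq> ap \<gamma>' ` B"
        show "disjnt (ap \<gamma> ` B) (ap \<gamma>' ` B)"
        proof (rule ccontr)
          assume "\<not> disjnt (ap \<gamma> ` B) (ap \<gamma>' ` B)"
          then obtain x y where xy: "x \<in> B" "y \<in> B" "ap \<gamma> x = ap \<gamma>' y" by (auto simp: disjnt_def)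
          have "T x = T y" using ap_T[OF g(1), of x] ap_T[OF g(2), of y] xy(3) by simp
          then have "x = y" using B(3) xy by (auto dest: inj_onD)
          obtain M1 c1 M2 c2 where G: "\<gamma> = (M1, c1)" "\<gamma>' = (M2, c2)" by (cases \<gamma>, cases \<gamma>') auto
          have Teq: "T (M1 *v u + c1) = T (M2 *v u + c2)" for u using g G by (auto simp: \<Gamma>_def)
          have e1: "M1 *v x + c1 = ap \<gamma> x" and e2: "M2 *v x + c2 = ap \<gamma> x"
            using xy(3) \<open>x = y\<close> by (auto simp: G ap_def)
          \<comment> \<open>Overlapping sheets come from deck transformations that agree at a point
            with noncritical value, and such transformations are equal.\<close>
          have "ap \<gamma> x \<notin> Cr" using ap_E[OF g(1)] xy(1) notCr by blast
          then have "M1 = M2" "c1 = c2" using affine_unique[OF Teq e1 e2] by auto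
          then show False using g(3) G by simp
        qed
      qed
      fix u assume "u \<in> (\<lambda>\<gamma>. ap \<gamma> ` B) ` \<Gamma>"
      then obtain \<gamma> where \<gamma>: "\<gamma> \<in> \<Gamma>" "u = ap \<gamma> ` B" by auto
      show "openin (top_of_set E) u" unfolding \<gamma>(2) by (rule open_subset[OF ap_E[OF \<gamma>(1)] ap_open[OF \<gamma>(1)]])
      have "inj_on F u"
      proof (rule inj_onI)
        fix x y assume xy: "x \<in> u" "y \<in> u" "F x = F y"
        then have "x \<in> E" "y \<in> E" using ap_E \<gamma> by blast+
        then have "T x = T y" using xy F_eq by blast
        then show "x = y" using injTap[OF \<gamma>(1)] xy \<gamma>(2) by (auto dest: inj_onD)
      qed
      moreover have "F ` u = F ` B" using ap_T[OF \<gamma>(1)] by (auto simp: \<gamma>(2) F_def image_iff)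
      moreover have "continuous_on u F" using contF ap_E \<gamma> continuous_on_subset by blast
      moreover have "open u" using ap_open \<gamma> by simp
      moreover have dim: "DIM(complex) \<le> DIM(real^2)" by simp
      ultimately obtain q where "homeomorphism u (F ` u) F q"
        using invariance_of_domain_homeomorphism[of u F] by blast
      then show "\<exists>q. homeomorphism u (F ` B) F q" unfolding \<open>F ` u = F ` B\<close> by blast
    qed
  qed
  have "\<exists>W. openin sphere_top W \<and> w \<in> W \<and> (\<forall>S s t. connected S \<longrightarrow> T ` S \<subseteq> W \<longrightarrow> s \<in> S \<longrightarrow> t \<in> S \<longrightarrow> dist s t \<le> 1)" for w
    by (rule small_nbhd[of 1 w]) auto
  then obtain W where W: "\<And>w. openin sphere_top (W w)" "\<And>w. w \<in> W w"
    "\<And>w S s t. connected S \<Longrightarrow> T ` S \<subseteq> W w \<Longrightarrow> s \<in> S \<Longrightarrow> t \<in> S \<Longrightarrow> dist s t \<le> 1" by metis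
  \<comment> \<open>The sets over which connected sets in the plane have diameter at most 1, carried
    to the planar model. They cover the whole plane, hence the closure of V'.\<close>
  define \<O> where "\<O> = range (\<lambda>w. {z. Some z \<in> {y. \<sigma> y \<in> W w}})"
  have O1: "open X" if "X \<in> \<O>" for X using that W(1) by (auto simp: \<O>_def simp del: mem_Collect_eq intro!: open_Some_vimage ops)
  have O2: "closure V' \<subseteq> \<Union>\<O>" using W(2) by (auto simp: \<O>_def)
  have "\<exists>\<Q>. finite \<Q> \<and> V' = \<Union>\<Q> \<and> (\<forall>Q\<in>\<Q>. connected Q \<and> (\<exists>X\<in>\<O>. Q \<subseteq> X))"
  proof (rule jordan_domain_property_S[OF C'(1-3) O1 O2])
    fix \<Q> assume "finite \<Q>" "V' = \<Union>\<Q>" and Q: "\<And>Q. Q \<in> \<Q> \<Longrightarrow> connected Q \<and> (\<exists>X\<in>\<O>. Q \<subseteq> X)"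
    moreover have "\<forall>Q\<in>\<Q>. connected Q \<and> (\<exists>X\<in>\<O>. Q \<subseteq> X)" using Q by (rule ballI)
    ultimately show ?thesis by (intro exI[of _ \<Q>] conjI)
  qed
  then obtain \<Q> where \<Q>: "finite \<Q>" "V' = \<Union>\<Q>" and \<Q>2: "\<And>Q. Q \<in> \<Q> \<Longrightarrow> connected Q \<and> (\<exists>X\<in>\<O>. Q \<subseteq> X)"
    by (elim exE conjE) (rule that, assumption, assumption, drule (1) bspec)
  show thesis
  proof (rule that[of "real (card \<Q>) * 1"])
    fix S s t assume S: "connected S" "T ` S \<subseteq> V" and st: "s \<in> S" "t \<in> S"
    have SE: "S \<subseteq> E" using S(2) by (auto simp: E_def)
    have sE: "s \<in> E" using SE st by blast
    obtain g where g: "continuous_on V' g" "g \<in> V' \<rightarrow> E" "g (F s) = s" "\<And>y. y \<in> V' \<Longrightarrow> F (g y) = y"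
      by (rule covering_space_lift_strong[OF cov sE SF(2)[OF sE] C'(5) open_imp_locally_path_connected[OF C'(4)],
            of "\<lambda>x. x"]) auto
    have cFS: "continuous_on S F" using contF SE continuous_on_subset by blast
    \<comment> \<open>The inclusion of \<open>S\<close> and the section after \<open>F\<close> lift
      the same map and agree at \<open>s\<close>, so they agree on the connected set
      \<open>S\<close>.\<close>
    have gF: "g (F u) = u" if u: "u \<in> S" for u
    proof -
      have "(g \<circ> F) u = (\<lambda>x. x) u"
      proof (rule covering_space_lift_unique[OF cov _ cFS, of "g \<circ> F" s "\<lambda>x. x"])
        show "continuous_on S (g \<circ> F)"
          by (rule continuous_on_compose[OF cFS continuous_on_subset[OF g(1)]]) (use SF(2) SE in auto)
        show "F \<in> S \<rightarrow> V'" "g \<circ> F \<in> S \<rightarrow> E" "(\<lambda>x. x) \<in> S \<rightarrow> E"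
          using SF(2) SE funcset_mem[OF g(2)] by (auto simp: Pi_iff)
        show "F x = F ((g \<circ> F) x)" if "x \<in> S" for x using g(4) SF(2) SE that by auto
      qed (use g(3) S(1) st u in auto)
      then show ?thesis by simp
    qed
    have "dist (g (F s)) (g (F t)) \<le> real (card \<Q>) * 1"
    proof (rule connected_cover_dist_bound[OF _ \<Q>(1), of g V' "\<lambda>Q. Q" 1])
      show "connected (g ` V')"
        using g(1) C'(2) in_components_connected connected_continuous_image by blast
      show "V' \<subseteq> (\<Union>Q\<in>\<Q>. Q)" using \<Q>(2) by auto
      show "F s \<in> V'" "F t \<in> V'" using SF(2) SE st by auto
      fix Q x y assume Q: "Q \<in> \<Q>" and xy: "x \<in> V' \<inter> Q" "y \<in> V' \<inter> Q"
      have QV: "Q \<subseteq> V'" using Q \<Q>(2) by blast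
      obtain w where w: "Q \<subseteq> {z. Some z \<in> {y. \<sigma> y \<in> W w}}" using \<Q>2[OF Q] by (auto simp: \<O>_def)
      have "T (g q) = \<sigma> (Some q)" if "q \<in> Q" for q
        using SF(3)[of "g q"] g(4) funcset_mem[OF g(2)] QV that by auto
      then have "T ` g ` Q \<subseteq> W w" using w by auto
      moreover have "connected (g ` Q)"
        using \<Q>2[OF Q] g(1) QV by (intro connected_continuous_image) (auto intro: continuous_on_subset)
      ultimately show "dist (g x) (g y) \<le> 1" using W(3) xy by blast
    qed
    then show "dist s t \<le> real (card \<Q>) * 1" using gF st by simp
  qed
qed

lemma all_component_lifts_bounded:
  obtains m where "m > 0" "\<And>S s t V. V \<in> connected_components_of (subtopology sphere_top (- C)) \<Longrightarrow> connected S \<Longrightarrow>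
     T ` S \<subseteq> V \<Longrightarrow> s \<in> S \<Longrightarrow> t \<in> S \<Longrightarrow> dist s t \<le> m"
proof -
  obtain V1 V2 where V12: "connected_components_of (subtopology sphere_top (- C)) = {V1, V2}"
    by (rule complement_components) blast
  have in12: "V1 \<in> connected_components_of (subtopology sphere_top (- C))" "V2 \<in> connected_components_of (subtopology sphere_top (- C))"
    unfolding V12 by simp_all
  obtain m1 where m1: "\<And>S s t. connected S \<Longrightarrow> T ` S \<subseteq> V1 \<Longrightarrow> s \<in> S \<Longrightarrow> t \<in> S \<Longrightarrow> dist s t \<le> m1"
    by (rule component_lifts_bounded[OF in12(1)]) blast
  obtain m2 where m2: "\<And>S s t. connected S \<Longrightarrow> T ` S \<subseteq> V2 \<Longrightarrow> s \<in> S \<Longrightarrow> t \<in> S \<Longrightarrow> dist s t \<le> m2"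
    by (rule component_lifts_bounded[OF in12(2)]) blast
  show thesis
  proof (rule that[of "max 1 (max m1 m2)"])
    fix S s t V assume "V \<in> connected_components_of (subtopology sphere_top (- C))" and S: "connected S" "T ` S \<subseteq> V" "s \<in> S" "t \<in> S"
    then consider "V = V1" | "V = V2" unfolding V12 by blast
    then show "dist s t \<le> max 1 (max m1 m2)"
    proof cases
      case 1 then show ?thesis using m1[of S s t] S by simp
    next
      case 2 then show ?thesis using m2[of S s t] S by simp
    qed
  qed simp
qed

end

section \<open>Growth of the linear part\<close>

text \<open>Stereographic projection, onto a sphere through the origin; for points of the plane, \<open>sph\<close> is the last
  coordinate and the density of the spherical metric.\<close>

definition embed :: "riemann \<Rightarrow> complex \<times> real" where
  "embed x = (case x of None \<Rightarrow> (0, 0) | Some z \<Rightarrow> (sph z *\<^sub>R z, sph z))"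

lemma inj_embed: "inj embed"
proof (rule injI)
  fix x y assume xy: "embed x = embed y"
  have pos: "sph z \<noteq> 0" for z using sph_pos[of z] by simp
  show "x = y"
  proof (cases x; cases y)
    fix z w assume zw: "x = Some z" "y = Some w"
    then have "(sph z *\<^sub>R z, sph z) = (sph w *\<^sub>R w, sph w)" using xy by (simp only: embed_def option.case)
    then have e: "sph z *\<^sub>R z = sph w *\<^sub>R w \<and> sph z = sph w" unfolding prod.inject .
    note s1 = conjunct2[OF e] and s2 = conjunct1[OF e]
    have "sph w *\<^sub>R z = sph w *\<^sub>R w" using s2 unfolding s1 .
    then have "z = w" using pos[of w] by (metis scaleR_cancel_left)
    then show ?thesis using zw by simp
  qed (use xy pos in \<open>auto simp: embed_def\<close>)
qed

lemma continuous_embed: "continuous_map sphere_top euclidean embed"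
proof -
  have "openin sphere_top {x. embed x \<in> B}" if B: "open B" for B
    unfolding openin_sphere_top
  proof
    have "open ((\<lambda>z. (sph z *\<^sub>R z, sph z)) -` B)"
      by (rule open_vimage[OF B]) (intro continuous_intros)
    then show "open {z. Some z \<in> {x. embed x \<in> B}}" by (simp add: embed_def vimage_def)
    show "None \<in> {x. embed x \<in> B} \<longrightarrow> (\<exists>R. \<forall>z. R < norm z \<longrightarrow> Some z \<in> {x. embed x \<in> B})"
    proof
      assume "None \<in> {x. embed x \<in> B}"
      then have "(0, 0) \<in> B" by (simp add: embed_def)
      then obtain e where e: "e > 0" "ball (0, 0) e \<subseteq> B" using B by (auto simp: open_contains_ball)
      have "Some z \<in> {x. embed x \<in> B}" if z: "max 1 (2 / e) < norm z" for z
      proof -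
        define r where "r = norm z"
        have r: "r > 1" "2 / e < r" using z by (simp_all add: r_def)
        have "r * r \<ge> r" using r by simp
        moreover have "(r + 1) * r = r * r + r" by (simp add: algebra_simps)
        ultimately have "(r + 1) * r \<le> 2 * (1 + r\<^sup>2)" by (simp add: power2_eq_square)
        moreover have "1 + r\<^sup>2 > 0" by (simp add: add_pos_nonneg)
        ultimately have "1 / (1 + r\<^sup>2) * r + 1 / (1 + r\<^sup>2) \<le> 2 / r" using r by (simp add: field_simps)
        also have "2 / r < e" using r e by (simp add: field_simps)
        finally have lt: "sph z * norm z + sph z < e" by (simp add: sph_def r_def)
        have "norm (sph z *\<^sub>R z, sph z) \<le> norm (sph z *\<^sub>R z) + norm (sph z)" by (rule norm_Pair_le)
        also have "\<dots> = sph z * norm z + sph z" using sph_pos[of z] by simp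
        finally have "norm (sph z *\<^sub>R z, sph z) < e" using lt by linarith
        then have "(sph z *\<^sub>R z, sph z) \<in> ball (0, 0) e" using dist_0_norm[of "(sph z *\<^sub>R z, sph z)"]
            by (simp only: mem_ball zero_prod_def)
        then show ?thesis using e(2) by (auto simp: embed_def)
      qed
      then show "\<exists>R. \<forall>z. R < norm z \<longrightarrow> Some z \<in> {x. embed x \<in> B}" by blast
    qed
  qed
  then show ?thesis by (simp add: continuous_map)
qed

text \<open>A chord is at most the integral of the speed of the embedded curve. The constant 4 is
  crude, the embedding being isometric for the density \<open>sph\<close>; it comes from estimating
  the parts of the derivative separately.\<close>

lemma embed_path_length:
  fixes \<gamma> \<gamma>' :: "real \<Rightarrow> complex"
  assumes xy: "x \<le> y" and d: "\<And>t. t \<in> {x..y} \<Longrightarrow> (\<gamma> has_vector_derivative \<gamma>' t) (at t within {x..y})"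
    and cont: "continuous_on {x..y} \<gamma>'"
  shows "dist (embed (Some (\<gamma> x))) (embed (Some (\<gamma> y))) \<le> 4 * integral {x..y} (\<lambda>t. norm (\<gamma>' t) * sph (\<gamma> t))"
proof -
  define s' where "s' t = - 2 * (\<gamma> t \<bullet> \<gamma>' t) * (sph (\<gamma> t))\<^sup>2" for t
  define k' where "k' t = (s' t *\<^sub>R \<gamma> t + sph (\<gamma> t) *\<^sub>R \<gamma>' t, s' t)" for t
  have c\<gamma>: "continuous_on {x..y} \<gamma>"
    using d by (meson continuous_on_eq_continuous_within has_vector_derivative_continuous)
  have ds: "((\<lambda>t. sph (\<gamma> t)) has_vector_derivative s' t) (at t within {x..y})" if t: "t \<in> {x..y}" for t
  proof -
    have "((\<lambda>t. \<gamma> t \<bullet> \<gamma> t) has_vector_derivative (\<gamma> t \<bullet> \<gamma>' t + \<gamma>' t \<bullet> \<gamma> t)) (at t within {x..y})"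
      by (rule bounded_bilinear.has_vector_derivative[OF bounded_bilinear_inner d[OF t] d[OF t]])
    then have "((\<lambda>t. 1 + \<gamma> t \<bullet> \<gamma> t) has_real_derivative (2 * (\<gamma> t \<bullet> \<gamma>' t))) (at t within {x..y})"
      by (auto intro!: derivative_eq_intros simp: has_real_derivative_iff_has_vector_derivative inner_commute)
    moreover have "1 + \<gamma> t \<bullet> \<gamma> t \<noteq> 0" using inner_ge_zero[of "\<gamma> t"] by linarith
    ultimately have "((\<lambda>t. inverse (1 + \<gamma> t \<bullet> \<gamma> t)) has_real_derivative
       - (inverse (1 + \<gamma> t \<bullet> \<gamma> t) * (2 * (\<gamma> t \<bullet> \<gamma>' t)) * inverse (1 + \<gamma> t \<bullet> \<gamma> t))) (at t within {x..y})"
      by (rule DERIV_inverse')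
    moreover have sphi: "sph z = inverse (1 + z \<bullet> z)" for z by (simp add: sph_def inverse_eq_divide power2_norm_eq_inner)
    ultimately show ?thesis
      unfolding has_real_derivative_iff_has_vector_derivative s'_def sphi
      by (simp add: power2_eq_square mult_ac)
  qed
  have dk: "((\<lambda>t. embed (Some (\<gamma> t))) has_vector_derivative k' t) (at t within {x..y})" if t: "t \<in> {x..y}" for t
  proof -
    have "((\<lambda>t. sph (\<gamma> t) *\<^sub>R \<gamma> t) has_vector_derivative (sph (\<gamma> t) *\<^sub>R \<gamma>' t + s' t *\<^sub>R \<gamma> t)) (at t within {x..y})"
      by (rule bounded_bilinear.has_vector_derivative[OF bounded_bilinear_scaleR ds[OF t] d[OF t]])
    from has_vector_derivative_Pair[OF this ds[OF t]] show ?thesis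
      by (simp add: embed_def k'_def add.commute)
  qed
  have ftc: "(k' has_integral (embed (Some (\<gamma> y)) - embed (Some (\<gamma> x)))) {x..y}"
    by (rule fundamental_theorem_of_calculus[OF xy dk])
  \<comment> \<open>With r and m the norms of the point and of the velocity and s the value of
    \<open>sph\<close>, the inequalities 2 r s \<le> 1 and r^2 s \<le> 1 bound the three terms by 1,
    2 and 1 times m s.\<close>
  have bound: "norm (k' t) \<le> 4 * (norm (\<gamma>' t) * sph (\<gamma> t))" for t
  proof -
    define r where "r = norm (\<gamma> t)"
    define m where "m = norm (\<gamma>' t)"
    define s where "s = sph (\<gamma> t)"
    have s: "s > 0" "s * (1 + r\<^sup>2) = 1"
      using sph_pos[of "\<gamma> t"] by (auto simp: s_def sph_def r_def add_nonneg_eq_0_iff)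
    have rm: "r \<ge> 0" "m \<ge> 0" by (simp_all add: r_def m_def)
    have "0 \<le> (r - 1)\<^sup>2" by simp
    then have "2 * r \<le> 1 + r\<^sup>2" by (simp add: power2_diff)
    then have "s * (2 * r) \<le> s * (1 + r\<^sup>2)" using s(1) by (intro mult_left_mono) auto
    then have sr: "s * (2 * r) \<le> 1" using s(2) by simp
    have "s * r\<^sup>2 \<le> s * (1 + r\<^sup>2)" using s(1) by (intro mult_left_mono) auto
    then have sr2: "s * r\<^sup>2 \<le> 1" using s(2) by simp
    have "\<bar>\<gamma> t \<bullet> \<gamma>' t\<bar> \<le> r * m" unfolding r_def m_def by (rule Cauchy_Schwarz_ineq2)
    then have s'b: "\<bar>s' t\<bar> \<le> 2 * (r * m) * s\<^sup>2"
      unfolding s'_def s_def[symmetric] by (simp add: abs_mult mult_right_mono)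
    also have "2 * (r * m) * s\<^sup>2 = (s * (2 * r)) * (m * s)" by (simp add: power2_eq_square)
    also have "\<dots> \<le> 1 * (m * s)" using sr rm s by (intro mult_right_mono) auto
    finally have b1: "\<bar>s' t\<bar> \<le> m * s" by simp
    have "\<bar>s' t\<bar> * r \<le> 2 * (r * m) * s\<^sup>2 * r" using s'b rm by (intro mult_right_mono) auto
    also have "\<dots> = (s * r\<^sup>2) * (2 * m * s)" by (simp add: power2_eq_square)
    also have "\<dots> \<le> 1 * (2 * m * s)" using sr2 rm s by (intro mult_right_mono) auto
    finally have b2: "\<bar>s' t\<bar> * r \<le> 2 * (m * s)" by simp
    have "norm (s' t *\<^sub>R \<gamma> t + sph (\<gamma> t) *\<^sub>R \<gamma>' t) \<le> \<bar>s' t\<bar> * r + s * m"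
      using norm_triangle_ineq[of "s' t *\<^sub>R \<gamma> t" "sph (\<gamma> t) *\<^sub>R \<gamma>' t"] s(1) by (simp add: r_def m_def s_def)
    moreover have "norm (k' t) \<le> norm (s' t *\<^sub>R \<gamma> t + sph (\<gamma> t) *\<^sub>R \<gamma>' t) + norm (s' t)"
      unfolding k'_def by (rule norm_Pair_le)
    moreover have "s * m = m * s" by simp
    ultimately have "norm (k' t) \<le> 4 * (m * s)" using b1 b2 unfolding real_norm_def by linarith
    then show ?thesis by (simp only: m_def s_def)
  qed
  have int: "(\<lambda>t. 4 * (norm (\<gamma>' t) * sph (\<gamma> t))) integrable_on {x..y}"
    by (intro integrable_continuous_real continuous_intros cont c\<gamma>)
  have "norm (integral {x..y} k') \<le> integral {x..y} (\<lambda>t. 4 * (norm (\<gamma>' t) * sph (\<gamma> t)))"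
    by (rule integral_norm_bound_integral) (use ftc int bound in auto)
  moreover have "integral {x..y} k' = embed (Some (\<gamma> y)) - embed (Some (\<gamma> x))" using ftc by (rule integral_unique)
  ultimately show ?thesis by (simp add: dist_norm norm_minus_commute)
qed

section \<open>Iterates of the rational map and inverse branches of \<open>T\<close>\<close>

context rational_fun
begin

lemma iterate_fibre: "finite ((f ^^ n) -` {w}) \<and> card ((f ^^ n) -` {w}) \<le> N ^ n"
proof (induction n arbitrary: w)
  case 0
  have "(f ^^ 0) -` {w} = {w}" by auto
  then show ?case by simp
next
  case (Suc n)
  have eq: "(f ^^ Suc n) -` {w} = (\<Union>x\<in>f -` {w}. (f ^^ n) -` {x})" by auto
  have "card (\<Union>x\<in>f -` {w}. (f ^^ n) -` {x}) \<le> (\<Sum>x\<in>f -` {w}. card ((f ^^ n) -` {x}))"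
    by (rule card_UN_le[OF finite_fibre])
  also have "\<dots> \<le> (\<Sum>x\<in>f -` {w}. N ^ n)" by (rule sum_mono) (use Suc in blast)
  also have "\<dots> \<le> N * N ^ n" using card_fibre_le[of w] by (simp add: mult_right_mono)
  finally have "card ((f ^^ Suc n) -` {w}) \<le> N ^ Suc n" unfolding eq by simp
  moreover have "finite ((f ^^ Suc n) -` {w})" unfolding eq using finite_fibre Suc by blast
  ultimately show ?case by blast
qed

text \<open>The exceptional set collects the points sent to infinity by an iterate up to the n-th;
  it is finite because the fibres of iterates are.\<close>

lemma iterate_holomorphic:
  obtains H F where "finite F" "H holomorphic_on - F" "\<And>z. z \<notin> F \<Longrightarrow> (f ^^ n) (Some z) = Some (H z)"
proof -
  have "\<exists>H F. finite F \<and> H holomorphic_on - F \<and> (\<forall>z. z \<notin> F \<longrightarrow> (f ^^ n) (Some z) = Some (H z))"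
  proof (induction n)
    case 0
    show ?case by (intro exI[of _ "\<lambda>z. z"] exI[of _ "{}"]) (auto intro: holomorphic_intros)
  next
    case (Suc n)
    then obtain H F where HF: "finite F" "H holomorphic_on - F" "\<And>z. z \<notin> F \<Longrightarrow> (f ^^ n) (Some z) = Some (H z)" by blast
    define F' where "F' = F \<union> {z. (f ^^ Suc n) (Some z) = None}"
    have "finite (Some -` ((f ^^ Suc n) -` {None}))"
    proof (rule finite_vimageI)
      show "finite ((f ^^ Suc n) -` {None})" using iterate_fibre by blast
    qed simp
    then have "finite {z. (f ^^ Suc n) (Some z) = None}" by (simp add: vimage_def)
    then have fin: "finite F'" using HF(1) by (simp add: F'_def)
    have q: "poly q (H z) \<noteq> 0" if "z \<notin> F'" for z
    proof
      assume "poly q (H z) = 0"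
      then have "f (Some (H z)) = None" by (simp add: f_Some rational_extension_def)
      then have "(f ^^ Suc n) (Some z) = None" using HF(3)[of z] that by (simp add: F'_def)
      then show False using that by (simp add: F'_def)
    qed
    have hol: "(\<lambda>z. poly p (H z) / poly q (H z)) holomorphic_on - F'"
    proof -
      have "H holomorphic_on - F'" by (rule holomorphic_on_subset[OF HF(2)]) (auto simp: F'_def)
      then show ?thesis using q by (intro holomorphic_intros) auto
    qed
    have val: "(f ^^ Suc n) (Some z) = Some (poly p (H z) / poly q (H z))" if "z \<notin> F'" for z
      using HF(3)[of z] q[OF that] that by (simp add: F'_def f_Some rational_extension_def)
    show ?case using fin hol val by blast
  qed
  then show thesis using that by blast
qed

end

context rigid_cover
begin

text \<open>The sets of \<open>small_nbhd\<close> for diameter 1 cover the sphere, and a Lebesgue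
  number of this cover on the compact embedded sphere gives a uniform \<delta>.\<close>

lemma path_displacement:
  obtains \<delta> where "\<delta> > 0"
    "\<And>S s t. connected S \<Longrightarrow> s \<in> S \<Longrightarrow> t \<in> S \<Longrightarrow> (\<And>u. u \<in> S \<Longrightarrow> dist (embed (T s)) (embed (T u)) < \<delta>) \<Longrightarrow> dist s t \<le> 1"
proof -
  have "\<exists>W. openin sphere_top W \<and> w \<in> W \<and> (\<forall>S s t. connected S \<longrightarrow> T ` S \<subseteq> W \<longrightarrow> s \<in> S \<longrightarrow> t \<in> S \<longrightarrow> dist s t \<le> 1)" for w
    by (rule small_nbhd[of 1 w]) auto
  then obtain W where W: "\<And>w. openin sphere_top (W w)" "\<And>w. w \<in> W w"
    "\<And>w S s t. connected S \<Longrightarrow> T ` S \<subseteq> W w \<Longrightarrow> s \<in> S \<Longrightarrow> t \<in> S \<Longrightarrow> dist s t \<le> 1" by metis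
  have cpt: "compact (embed ` K)" if "closedin sphere_top K" for K
    using image_compactin[OF closedin_compact_space[OF compact_space_sphere that] continuous_embed] by simp
  \<comment> \<open>The embedded sphere is not open in its ambient space. The complement of the
    compact image of the complement of \<open>W w\<close> is an open set that meets the embedded
    sphere exactly in the image of \<open>W w\<close>.\<close>
  define X where "X w = - embed ` (- W w)" for w
  have X: "open (X w)" for w
  proof -
    have "closedin sphere_top (topspace sphere_top - W w)" by (rule closedin_diff) (simp_all only: W(1) closedin_topspace)
    then have "closedin sphere_top (- W w)" by (simp only: topspace_sphere_top Compl_eq_Diff_UNIV)
    then show ?thesis unfolding X_def using compact_imp_closed[OF cpt] by (simp add: open_Compl)
  qed
  have Xmem: "embed x \<in> X w \<longleftrightarrow> x \<in> W w" for x w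
    unfolding X_def using inj_embed by (auto dest: injD)
  have "closedin sphere_top UNIV" by (metis closedin_topspace topspace_sphere_top)
  then have cr: "compact (range embed)" by (rule cpt)
  have cov: "range embed \<subseteq> \<Union> (range X)" using Xmem W(2) by blast
  have opX: "open Y" if "Y \<in> range X" for Y using that X by auto
  obtain \<delta> where \<delta>: "\<delta> > 0" "\<And>k. k \<in> range embed \<Longrightarrow> \<exists>Y\<in>range X. ball k \<delta> \<subseteq> Y"
    using Heine_Borel_lemma[OF cr cov opX] by blast
  show thesis
  proof (rule that[OF \<delta>(1)])
    fix S s t assume S: "connected S" "s \<in> S" "t \<in> S" and close: "\<And>u. u \<in> S \<Longrightarrow> dist (embed (T s)) (embed (T u)) < \<delta>"
    obtain w where w: "ball (embed (T s)) \<delta> \<subseteq> X w" using \<delta>(2)[of "embed (T s)"] by blast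
    have "T ` S \<subseteq> W w"
    proof
      fix y assume "y \<in> T ` S"
      then obtain u where u: "u \<in> S" "y = T u" by auto
      then have "embed (T u) \<in> ball (embed (T s)) \<delta>" using close by simp
      then show "y \<in> W w" using w Xmem u(2) by blast
    qed
    then show "dist s t \<le> 1" using W(3) S by blast
  qed
qed

text \<open>An inverse branch of \<open>T\<close> near a finite noncritical value. It relates the
  complex coordinate, in which iterates of \<open>f\<close> are holomorphic, to the plane, in which
  they are affine.\<close>

lemma local_section:
  obtains Q \<xi> where "open Q" "Q \<noteq> {}" "continuous_on Q \<xi>" "\<And>z. z \<in> Q \<Longrightarrow> T (\<xi> z) = Some z"
    "inj_on \<xi> Q" "\<And>Z. open Z \<Longrightarrow> Z \<subseteq> Q \<Longrightarrow> open (\<xi> ` Z)"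
proof -
  have "finite (insert None P)" using finite_P by simp
  then obtain w where w: "w \<notin> insert None P" using infinite_sphere by (metis UNIV_eq_I)
  obtain x1 where x1: "T x1 = w" by (rule T_surj)
  then have "x1 \<notin> Cr" using w by (auto simp: P_def)
  then obtain U0 where U0: "open U0" "x1 \<in> U0" "inj_on T U0" by (auto simp: Cr_def locally_inj_def)
  define U where "U = U0 \<inter> T -` range Some"
  have U: "open U" "inj_on T U" unfolding U_def using U0 open_T_vimage[of "range Some"] by (auto simp: inj_on_def intro!: open_Int)
  have "w \<in> range Some" using w by (cases w) auto
  then have x1U: "x1 \<in> U" using U0 x1 by (simp add: U_def)
  define Q where "Q = {z. Some z \<in> T ` U}"
  define \<xi> where "\<xi> z = inv_into U T (Some z)" for z
  have T\<xi>: "T (\<xi> z) = Some z" "\<xi> z \<in> U" if "z \<in> Q" for z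
    using that unfolding Q_def \<xi>_def by (auto intro: f_inv_into_f inv_into_into)
  have \<xi>T: "\<xi> z = u" if "u \<in> U" "T u = Some z" for u z
    unfolding \<xi>_def using that U(2) by (metis inv_into_f_f)
  have Q: "open Q" unfolding Q_def by (rule open_Some_vimage[OF T_open[OF U(1)]])
  show thesis
  proof (rule that[of Q \<xi>])
    show "Q \<noteq> {}"
    proof -
      obtain z where "w = Some z" using \<open>w \<in> range Some\<close> by blast
      then have "z \<in> Q" using x1 x1U by (auto simp: Q_def image_iff intro!: bexI[of _ x1])
      then show ?thesis by blast
    qed
    show "continuous_on Q \<xi>"
      unfolding continuous_on_open_vimage[OF Q]
    proof (intro allI impI)
      fix B :: "(real^2) set" assume B: "open B"
      have "\<xi> -` B \<inter> Q = {z. Some z \<in> T ` (B \<inter> U)}"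
      proof
        show "\<xi> -` B \<inter> Q \<subseteq> {z. Some z \<in> T ` (B \<inter> U)}"
        proof
          fix z assume "z \<in> \<xi> -` B \<inter> Q"
          then have "\<xi> z \<in> B \<inter> U" "Some z = T (\<xi> z)" using T\<xi>[of z] by auto
          then show "z \<in> {z. Some z \<in> T ` (B \<inter> U)}" by blast
        qed
        show "{z. Some z \<in> T ` (B \<inter> U)} \<subseteq> \<xi> -` B \<inter> Q"
        proof
          fix z assume "z \<in> {z. Some z \<in> T ` (B \<inter> U)}"
          then obtain u where u: "u \<in> B" "u \<in> U" "Some z = T u" by auto
          then have "\<xi> z = u" using \<xi>T[of u z] by simp
          then show "z \<in> \<xi> -` B \<inter> Q" using u by (auto simp: Q_def)
        qed
      qed
      then show "open (\<xi> -` B \<inter> Q)" using open_Some_vimage[OF T_open[OF open_Int[OF B U(1)]]] by (simp only:)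
    qed
    show "inj_on \<xi> Q"
    proof (rule inj_onI)
      fix y z assume yz: "y \<in> Q" "z \<in> Q" "\<xi> y = \<xi> z"
      have "Some y = T (\<xi> y)" using T\<xi>(1)[OF yz(1)] by (rule sym)
      also have "\<dots> = Some z" unfolding yz(3) by (rule T\<xi>(1)[OF yz(2)])
      finally show "y = z" by (simp only: option.inject)
    qed
    fix Z :: "complex set" assume Z: "open Z" "Z \<subseteq> Q"
    have "\<xi> ` Z = U \<inter> T -` (Some ` Z)"
    proof
      show "\<xi> ` Z \<subseteq> U \<inter> T -` (Some ` Z)" using T\<xi> Z(2) by auto
      show "U \<inter> T -` (Some ` Z) \<subseteq> \<xi> ` Z"
      proof
        fix u assume "u \<in> U \<inter> T -` (Some ` Z)"
        then obtain z where z: "u \<in> U" "z \<in> Z" "T u = Some z" by auto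
        then have "u = \<xi> z" using \<xi>T by simp
        then show "u \<in> \<xi> ` Z" using z(2) by blast
      qed
    qed
    then show "open (\<xi> ` Z)" using U(1) open_T_vimage[of "Some ` Z"] Z(1) by (simp add: open_Int)
  qed (use Q T\<xi> in auto)
qed

end

context lattes_cover
begin

lemma aff_iter_diff: "(aff ^^ n) x - (aff ^^ n) y = ((*v) A ^^ n) (x - y)"
  by (induction n) (simp_all add: aff_diff)

lemma A_iter_linear: "((*v) A ^^ n) (x + y) = ((*v) A ^^ n) x + ((*v) A ^^ n) y" "((*v) A ^^ n) (c *\<^sub>R x) = c *\<^sub>R ((*v) A ^^ n) x"
  by (induction n) (simp_all add: matrix_vector_right_distrib matrix_vector_mult_scaleR)

lemma A_iter_uminus: "((*v) A ^^ n) (- x) = - ((*v) A ^^ n) x"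
  using A_iter_linear(2)[of n "-1" x] by simp

lemma wedge_iter: "wedge (((*v) A ^^ n) x) (((*v) A ^^ n) y) = det A ^ n * wedge x y"
  by (induction n) (simp_all add: wedge_matrix)

lemma continuous_aff_iter: "continuous_on S (aff ^^ n)"
proof (induction n)
  case (Suc n)
  have "continuous_on S (aff \<circ> (aff ^^ n))" by (rule continuous_on_compose[OF Suc continuous_aff])
  then show ?case by (simp add: o_def)
qed (simp add: id_def)

text \<open>Length-area argument: \<open>f ^^ n\<close> is at most \<open>N ^ n\<close> to one, hence some segment of the rectangle has an image of spherical
  length \<open>O(sqrt (N ^ n))\<close>; the length controls the displacement of the lift.\<close>

lemma rectangle_displacement:
  fixes \<omega> :: complex
  assumes Q: "open Q" "continuous_on Q \<xi>" "\<And>z. z \<in> Q \<Longrightarrow> T (\<xi> z) = Some z"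
    and \<omega>: "\<omega> \<noteq> 0" and ab: "x0 < x1" and cd: "y0 < y1"
    and rect: "\<And>x y. x \<in> {x0..x1} \<Longrightarrow> y \<in> {y0..y1} \<Longrightarrow> \<omega> * Complex x y \<in> Q"
  obtains k where "k > 0"
    "\<And>n. \<exists>y\<in>{y0..y1}. norm (((*v) A ^^ n) (\<xi> (\<omega> * Complex x1 y) - \<xi> (\<omega> * Complex x0 y))) \<le> k * sqrt (real N ^ n)"
proof -
  obtain K where K: "K > 0"
    "\<And>U F G M a b c d. open U \<Longrightarrow> finite F \<Longrightarrow> G holomorphic_on U - F \<Longrightarrow>
      (\<And>w. finite {z\<in>U-F. G z = w} \<and> card {z\<in>U-F. G z = w} \<le> M) \<Longrightarrow> M \<ge> 1 \<Longrightarrow> a < b \<Longrightarrow> c < d \<Longrightarrow>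
      (\<And>x y. x \<in> {a..b} \<Longrightarrow> y \<in> {c..d} \<Longrightarrow> Complex x y \<in> U) \<Longrightarrow>
      \<exists>y\<in>{c..d}. (\<forall>x\<in>{a..b}. Complex x y \<notin> F) \<and>
        integral {a..b} (\<lambda>x. cmod (deriv G (Complex x y)) * sph (G (Complex x y))) \<le> sqrt ((b - a) / (d - c) * real M * K)"
    by (rule length_area_rectangle) blast
  obtain \<delta> where \<delta>: "\<delta> > 0"
    "\<And>S s t. connected S \<Longrightarrow> s \<in> S \<Longrightarrow> t \<in> S \<Longrightarrow> (\<And>u. u \<in> S \<Longrightarrow> dist (embed (T s)) (embed (T u)) < \<delta>) \<Longrightarrow> dist s t \<le> 1"
    by (rule path_displacement) blast
  \<comment> \<open>\<open>embed_path_length\<close> loses a factor 4, so a piece of spherical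
    length \<eta> stays within \<delta>/2 of its starting point.\<close>
  define \<eta> where "\<eta> = \<delta> / 8"
  have \<eta>: "\<eta> > 0" "4 * \<eta> < \<delta>" using \<delta>(1) by (simp_all add: \<eta>_def)
  \<comment> \<open>The bound of \<open>length_area_rectangle\<close> for multiplicity N^n, with the
    factor sqrt (N^n) taken out.\<close>
  define c where "c = sqrt ((x1 - x0) / (y1 - y0) * K)"
  have c: "c \<ge> 0" using ab cd K(1) by (simp add: c_def)
  show thesis
  proof (rule that[of "c / \<eta> + 1"])
    show "c / \<eta> + 1 > 0" using c \<eta> by (simp add: add_nonneg_pos)
    fix n
    obtain H F where HF: "finite F" "H holomorphic_on - F" "\<And>z. z \<notin> F \<Longrightarrow> (f ^^ n) (Some z) = Some (H z)"
      by (rule iterate_holomorphic[of n]) blast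
    define U where "U = (\<lambda>z. \<omega> * z) -` Q"
    define F' where "F' = (\<lambda>z. \<omega> * z) -` F"
    \<comment> \<open>The factor \<omega> rotates the rectangle: for \<omega> = \<i>, horizontal
      segments become vertical ones.\<close>
    define G where "G z = H (\<omega> * z)" for z
    have inj\<omega>: "inj (\<lambda>z. \<omega> * z)" using \<omega> by (simp add: inj_on_def)
    have U: "open U" unfolding U_def by (rule open_vimage[OF Q(1)]) (intro continuous_intros)
    have F': "finite F'" unfolding F'_def by (rule finite_vimageI[OF HF(1) inj\<omega>])
    have "(H \<circ> (\<lambda>z. \<omega> * z)) holomorphic_on U - F'"
      by (rule holomorphic_on_compose_gen[OF _ HF(2)]) (auto intro!: holomorphic_intros simp: F'_def)
    then have G: "G holomorphic_on U - F'" by (simp add: G_def[abs_def] o_def)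
    have fG: "(f ^^ n) (Some (\<omega> * z)) = Some (G z)" if "z \<notin> F'" for z
      using HF(3)[of "\<omega> * z"] that by (simp add: F'_def G_def)
    have mult: "finite {z\<in>U-F'. G z = w} \<and> card {z\<in>U-F'. G z = w} \<le> N ^ n" for w
    proof -
      have inj: "inj_on (\<lambda>z. Some (\<omega> * z)) {z\<in>U-F'. G z = w}" using \<omega> by (simp add: inj_on_def)
      have sub: "(\<lambda>z. Some (\<omega> * z)) ` {z\<in>U-F'. G z = w} \<subseteq> (f ^^ n) -` {Some w}" using fG by auto
      have it: "finite ((f ^^ n) -` {Some w})" "card ((f ^^ n) -` {Some w}) \<le> N ^ n" using iterate_fibre by blast+
      show ?thesis
        using inj_on_finite[OF inj sub it(1)] card_inj_on_le[OF inj sub it(1)] it(2) by linarith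
    qed
    have Nn: "N ^ n \<ge> 1" using N(2) by simp
    obtain y where y: "y \<in> {y0..y1}" "\<forall>x\<in>{x0..x1}. Complex x y \<notin> F'"
      "integral {x0..x1} (\<lambda>x. cmod (deriv G (Complex x y)) * sph (G (Complex x y))) \<le> sqrt ((x1 - x0) / (y1 - y0) * real (N ^ n) * K)"
      using K(2)[OF U F' G mult Nn ab cd] rect unfolding U_def by auto
    define I where "I = integral {x0..x1} (\<lambda>x. cmod (deriv G (Complex x y)) * sph (G (Complex x y)))"
    have "sqrt ((x1 - x0) / (y1 - y0) * real (N ^ n) * K) = c * sqrt (real N ^ n)"
      by (simp add: c_def real_sqrt_mult[symmetric] mult_ac)
    then have I: "I \<le> c * sqrt (real N ^ n)" using y(3) by (simp add: I_def)
    have inU: "Complex x y \<in> U - F'" if "x \<in> {x0..x1}" for x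
      using rect[OF that y(1)] y(2) that by (simp add: U_def)
    have UF: "open (U - F')" using U F' by (simp add: finite_imp_closed open_Diff)
    have segc: "continuous_on S (\<lambda>x. Complex x y)" for S unfolding Complex_eq by (intro continuous_intros)
    have dG: "((\<lambda>x. G (Complex x y)) has_vector_derivative deriv G (Complex x y)) (at x within S)" if "x \<in> {x0..x1}" for x S
    proof -
      have "(G has_field_derivative deriv G (Complex x y)) (at (Complex x y))"
        using holomorphic_derivI[OF G UF inU[OF that]] .
      then have g: "(G has_derivative (*) (deriv G (Complex x y))) (at (Complex x y))"
        by (simp add: has_field_derivative_def)
      have s: "((\<lambda>x. Complex x y) has_derivative of_real) (at x within S)"
        unfolding Complex_eq by (auto intro!: derivative_eq_intros)
      have "((G \<circ> (\<lambda>x. Complex x y)) has_derivative (*) (deriv G (Complex x y)) \<circ> of_real) (at x within S)"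
        by (rule diff_chain_within[OF s has_derivative_at_withinI[OF g]])
      then show ?thesis
        by (simp add: has_vector_derivative_def o_def scaleR_conv_of_real mult.commute)
    qed
    have cdG: "continuous_on {x0..x1} (\<lambda>x. deriv G (Complex x y))"
      by (rule continuous_on_compose2[OF holomorphic_on_imp_continuous_on[OF holomorphic_deriv[OF G UF]] segc]) (use inU in auto)
    have cG: "continuous_on {x0..x1} (\<lambda>x. G (Complex x y))"
      by (rule continuous_on_compose2[OF holomorphic_on_imp_continuous_on[OF G] segc]) (use inU in auto)
    define \<rho> where "\<rho> x = cmod (deriv G (Complex x y)) * sph (G (Complex x y))" for x
    have c\<rho>: "continuous_on {x0..x1} \<rho>" unfolding \<rho>_def by (intro continuous_intros cdG cG)
    have \<rho>0: "\<rho> x \<ge> 0" for x using sph_pos[of "G (Complex x y)"] by (simp add: \<rho>_def)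
    have \<rho>int: "\<rho> integrable_on {u..v}" if "x0 \<le> u" "v \<le> x1" for u v
      by (rule integrable_continuous_real[OF continuous_on_subset[OF c\<rho>]]) (use that in auto)
    \<comment> \<open>Spherical length accumulated along the segment. The bands where it lies
      between consecutive multiples of \<eta> are the pieces counted below.\<close>
    define \<Phi> where "\<Phi> x = integral {x0..x} \<rho>" for x
    have \<Phi>diff: "integral {u..v} \<rho> = \<Phi> v - \<Phi> u" if "x0 \<le> u" "u \<le> v" "v \<le> x1" for u v
      using Henstock_Kurzweil_Integration.integral_combine[of x0 u v \<rho>] that \<rho>int[of x0 v] by (simp add: \<Phi>_def)
    have \<Phi>mono: "\<Phi> u \<le> \<Phi> v" if "x0 \<le> u" "u \<le> v" "v \<le> x1" for u v
      using \<Phi>diff[OF that] integral_nonneg[OF \<rho>int[of u v]] \<rho>0 that by simp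
    have \<Phi>0: "\<Phi> x0 = 0" by (simp add: \<Phi>_def)
    have \<Phi>1: "\<Phi> x1 = I" unfolding \<Phi>_def I_def by (rule arg_cong[of _ _ "integral {x0..x1}"]) (auto simp: \<rho>_def)
    define S where "S x = (aff ^^ n) (\<xi> (\<omega> * Complex x y))" for x
    have segQ: "\<omega> * Complex x y \<in> Q" if "x \<in> {x0..x1}" for x using rect[OF that y(1)] .
    have cS: "continuous_on {x0..x1} S"
      unfolding S_def
      by (rule continuous_on_compose2[OF continuous_aff_iter[of UNIV]], rule continuous_on_compose2[OF Q(2)])
        (auto intro!: continuous_intros segc segQ)
    have TS: "T (S x) = Some (G (Complex x y))" if "x \<in> {x0..x1}" for x
    proof -
      have "T (S x) = (f ^^ n) (T (\<xi> (\<omega> * Complex x y)))" by (simp add: S_def f_T_iter)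
      also have "\<dots> = (f ^^ n) (Some (\<omega> * Complex x y))" using Q(3)[OF segQ[OF that]] by simp
      also have "\<dots> = Some (G (Complex x y))" using fG inU[OF that] by simp
      finally show ?thesis .
    qed
    have step: "dist (S u) (S v) \<le> 1" if uv: "x0 \<le> u" "u \<le> v" "v \<le> x1" "\<Phi> v - \<Phi> u \<le> \<eta>" for u v
    proof (rule \<delta>(2)[of "S ` {u..v}"])
      show "connected (S ` {u..v})"
        by (rule connected_continuous_image[OF continuous_on_subset[OF cS]]) (use uv in auto)
      show "S u \<in> S ` {u..v}" "S v \<in> S ` {u..v}" using uv by auto
      fix s assume "s \<in> S ` {u..v}"
      then obtain x where x: "x \<in> {u..v}" "s = S x" by auto
      have ux: "x0 \<le> u" "u \<le> x" "x \<le> x1" using x uv by auto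
      have "dist (embed (T (S u))) (embed (T (S x))) = dist (embed (Some (G (Complex u y)))) (embed (Some (G (Complex x y))))"
        using TS[of u] TS[of x] ux by simp
      also have "\<dots> \<le> 4 * integral {u..x} (\<lambda>t. norm (deriv G (Complex t y)) * sph (G (Complex t y)))"
        by (rule embed_path_length[OF ux(2)]) (use dG ux in \<open>auto intro: continuous_on_subset[OF cdG]\<close>)
      also have "integral {u..x} (\<lambda>t. norm (deriv G (Complex t y)) * sph (G (Complex t y))) = \<Phi> x - \<Phi> u"
        using \<Phi>diff[OF ux] by (simp add: \<rho>_def[abs_def])
      finally show "dist (embed (T (S u))) (embed (T s)) < \<delta>"
        using \<Phi>mono[of x v] uv \<eta>(2) x by simp
    qed
    define m where "m = nat \<lfloor>I / \<eta>\<rfloor>"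
    have I0: "I \<ge> 0" using \<Phi>mono[of x0 x1] \<Phi>0 \<Phi>1 ab by simp
    have "dist (S x0) (S x1) \<le> real (card {0..m}) * 1"
    proof (rule connected_cover_dist_bound[of S "{x0..x1}" "{0..m}" "\<lambda>j. {x. real j * \<eta> \<le> \<Phi> x \<and> \<Phi> x < (real j + 1) * \<eta>}"])
      show "connected (S ` {x0..x1})" by (rule connected_continuous_image[OF cS]) simp
      show "{x0..x1} \<subseteq> (\<Union>j\<in>{0..m}. {x. real j * \<eta> \<le> \<Phi> x \<and> \<Phi> x < (real j + 1) * \<eta>})"
      proof
        fix x assume x: "x \<in> {x0..x1}"
        define j where "j = nat \<lfloor>\<Phi> x / \<eta>\<rfloor>"
        have \<Phi>x: "0 \<le> \<Phi> x" "\<Phi> x \<le> I" using \<Phi>mono[of x0 x] \<Phi>mono[of x x1] \<Phi>0 \<Phi>1 x by auto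
        have "real j = of_int \<lfloor>\<Phi> x / \<eta>\<rfloor>" using \<Phi>x \<eta> by (simp add: j_def)
        then have "real j \<le> \<Phi> x / \<eta>" "\<Phi> x / \<eta> < real j + 1" by linarith+
        then have "real j * \<eta> \<le> \<Phi> x" "\<Phi> x < (real j + 1) * \<eta>"
          using \<eta>(1) by (simp_all add: pos_le_divide_eq pos_divide_less_eq)
        moreover have "j \<le> m" unfolding j_def m_def using \<Phi>x \<eta>(1) by (intro nat_mono floor_mono divide_right_mono) auto
        ultimately show "x \<in> (\<Union>j\<in>{0..m}. {x. real j * \<eta> \<le> \<Phi> x \<and> \<Phi> x < (real j + 1) * \<eta>})" by auto
      qed
      fix j u v assume "u \<in> {x0..x1} \<inter> {x. real j * \<eta> \<le> \<Phi> x \<and> \<Phi> x < (real j + 1) * \<eta>}"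
        and "v \<in> {x0..x1} \<inter> {x. real j * \<eta> \<le> \<Phi> x \<and> \<Phi> x < (real j + 1) * \<eta>}"
      then have uv: "u \<in> {x0..x1}" "v \<in> {x0..x1}" "\<Phi> u - \<Phi> v \<le> \<eta>" "\<Phi> v - \<Phi> u \<le> \<eta>" by (auto simp: algebra_simps)
      show "dist (S u) (S v) \<le> 1"
      proof (cases "u \<le> v")
        case True then show ?thesis using step[of u v] uv by simp
      next
        case False then show ?thesis using step[of v u] uv by (simp add: dist_commute)
      qed
    qed (use ab in auto)
    also have "real (card {0..m}) * 1 \<le> I / \<eta> + 1"
    proof -
      have "real m = of_int \<lfloor>I / \<eta>\<rfloor>" using I0 \<eta> by (simp add: m_def)
      then have "real m \<le> I / \<eta>" by linarith
      then show ?thesis by simp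
    qed
    \<comment> \<open>The additive 1 from rounding up the number of pieces is absorbed, since N^n is
      at least 1.\<close>
    also have "\<dots> \<le> c * sqrt (real N ^ n) / \<eta> + sqrt (real N ^ n)"
    proof (rule add_mono)
      show "I / \<eta> \<le> c * sqrt (real N ^ n) / \<eta>" using I \<eta>(1) by (intro divide_right_mono) auto
      have "1 \<le> real N ^ n" using N(2) by (simp add: one_le_power)
      then show "1 \<le> sqrt (real N ^ n)" by simp
    qed
    also have "\<dots> = (c / \<eta> + 1) * sqrt (real N ^ n)" by (simp add: algebra_simps)
    finally have "dist (S x0) (S x1) \<le> (c / \<eta> + 1) * sqrt (real N ^ n)" .
    moreover have "dist (S x0) (S x1) = norm (((*v) A ^^ n) (\<xi> (\<omega> * Complex x1 y) - \<xi> (\<omega> * Complex x0 y)))"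
      unfolding dist_commute[of "S x0"] unfolding S_def dist_norm aff_iter_diff ..
    ultimately show "\<exists>y\<in>{y0..y1}. norm (((*v) A ^^ n) (\<xi> (\<omega> * Complex x1 y) - \<xi> (\<omega> * Complex x0 y))) \<le> (c / \<eta> + 1) * sqrt (real N ^ n)"
      using y(1) by auto
  qed
qed

end

section \<open>Vectors of controlled growth under the linear part\<close>

context lattes_cover
begin

text \<open>The height of the segment found by the length-area argument depends on \<open>n\<close>.
  Control is therefore obtained only for a vector d' close to \<open>d\<close> that varies with
  \<open>n\<close>, at any prescribed accuracy and with one constant for all
  \<open>n\<close>.\<close>

definition tame :: "real^2 \<Rightarrow> bool" where
  "tame d \<longleftrightarrow> (\<forall>\<epsilon>>0. \<exists>k>0. \<forall>n. \<exists>d'. norm (d' - d) \<le> \<epsilon> \<and> norm (((*v) A ^^ n) d') \<le> k * sqrt (real N ^ n))"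

lemma tame_zero: "tame 0"
  unfolding tame_def
proof (intro allI impI)
  fix \<epsilon> :: real assume "\<epsilon> > 0"
  have "((*v) A ^^ n) 0 = 0" for n using A_iter_linear(2)[of n 0 0] by simp
  then show "\<exists>k>0. \<forall>n. \<exists>d'. norm (d' - 0) \<le> \<epsilon> \<and> norm (((*v) A ^^ n) d') \<le> k * sqrt (real N ^ n)"
    using \<open>\<epsilon> > 0\<close> by (intro exI[of _ 1] conjI allI exI[of _ 0]) auto
qed

lemma tame_uminus: assumes d: "tame d" shows "tame (- d)"
  unfolding tame_def
proof (intro allI impI)
  fix \<epsilon> :: real assume "\<epsilon> > 0"
  then obtain k where k: "k > 0" "\<And>n. \<exists>d'. norm (d' - d) \<le> \<epsilon> \<and> norm (((*v) A ^^ n) d') \<le> k * sqrt (real N ^ n)"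
    using d unfolding tame_def by blast
  have "\<exists>d'. norm (d' - (- d)) \<le> \<epsilon> \<and> norm (((*v) A ^^ n) d') \<le> k * sqrt (real N ^ n)" for n
  proof -
    obtain d' where d': "norm (d' - d) \<le> \<epsilon>" "norm (((*v) A ^^ n) d') \<le> k * sqrt (real N ^ n)" using k(2) by blast
    have "norm (- d' - (- d)) \<le> \<epsilon>" using d'(1) by (simp add: norm_minus_commute)
    then show ?thesis using d'(2) A_iter_uminus[of n d'] by (intro exI[of _ "- d'"]) simp
  qed
  then show "\<exists>k>0. \<forall>n. \<exists>d'. norm (d' - (- d)) \<le> \<epsilon> \<and> norm (((*v) A ^^ n) d') \<le> k * sqrt (real N ^ n)"
    using k(1) by blast
qed

lemma tame_add: assumes d: "tame d" and e: "tame e" shows "tame (d + e)"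
  unfolding tame_def
proof (intro allI impI)
  fix \<epsilon> :: real assume "\<epsilon> > 0"
  then have \<epsilon>: "\<epsilon> / 2 > 0" by simp
  obtain k where k: "k > 0" "\<And>n. \<exists>d'. norm (d' - d) \<le> \<epsilon> / 2 \<and> norm (((*v) A ^^ n) d') \<le> k * sqrt (real N ^ n)"
    using d \<epsilon> unfolding tame_def by blast
  obtain l where l: "l > 0" "\<And>n. \<exists>d'. norm (d' - e) \<le> \<epsilon> / 2 \<and> norm (((*v) A ^^ n) d') \<le> l * sqrt (real N ^ n)"
    using e \<epsilon> unfolding tame_def by blast
  have "\<exists>d'. norm (d' - (d + e)) \<le> \<epsilon> \<and> norm (((*v) A ^^ n) d') \<le> (k + l) * sqrt (real N ^ n)" for n
  proof -
    obtain d' where d': "norm (d' - d) \<le> \<epsilon> / 2" "norm (((*v) A ^^ n) d') \<le> k * sqrt (real N ^ n)" using k(2) by blast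
    obtain e' where e': "norm (e' - e) \<le> \<epsilon> / 2" "norm (((*v) A ^^ n) e') \<le> l * sqrt (real N ^ n)" using l(2) by blast
    have "norm ((d' + e') - (d + e)) \<le> norm (d' - d) + norm (e' - e)" by (rule norm_diff_triangle_ineq)
    then have "norm ((d' + e') - (d + e)) \<le> \<epsilon>" using d'(1) e'(1) by linarith
    moreover have "norm (((*v) A ^^ n) (d' + e')) \<le> (k + l) * sqrt (real N ^ n)"
      unfolding A_iter_linear(1) distrib_right using norm_triangle_le[OF add_mono[OF d'(2) e'(2)]] .
    ultimately show ?thesis by blast
  qed
  moreover have "k + l > 0" using k l by simp
  ultimately show "\<exists>k>0. \<forall>n. \<exists>d'. norm (d' - (d + e)) \<le> \<epsilon> \<and> norm (((*v) A ^^ n) d') \<le> k * sqrt (real N ^ n)"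
    by blast
qed

text \<open>On a thin rectangle around height \<open>y\<close>, continuity of \<open>\<xi>\<close>
  makes the displacement at every height \<epsilon>-close to the one at \<open>y\<close>. Hence it
  is harmless that \<open>rectangle_displacement\<close> chooses its height in terms of
  \<open>n\<close>.\<close>

lemma tame_segment:
  fixes \<omega> :: complex
  assumes Q: "open Q" "continuous_on Q \<xi>" "\<And>z. z \<in> Q \<Longrightarrow> T (\<xi> z) = Some z" and \<omega>: "\<omega> \<noteq> 0"
    and sq: "\<And>x y. \<bar>x - xc\<bar> < r \<Longrightarrow> \<bar>y - yc\<bar> < r \<Longrightarrow> \<omega> * Complex x y \<in> Q"
    and x: "\<bar>x0 - xc\<bar> < r" "\<bar>x1 - xc\<bar> < r" "x0 < x1" and y: "\<bar>y - yc\<bar> < r"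
  shows "tame (\<xi> (\<omega> * Complex x1 y) - \<xi> (\<omega> * Complex x0 y))"
  unfolding tame_def
proof (intro allI impI)
  fix \<epsilon> :: real assume \<epsilon>: "\<epsilon> > 0"
  then have e2: "\<epsilon> / 2 > 0" by simp
  define Y where "Y = {y. \<bar>y - yc\<bar> < r}"
  have cont: "continuous_on Y (\<lambda>y. \<xi> (\<omega> * Complex x y))" if "\<bar>x - xc\<bar> < r" for x
    by (rule continuous_on_compose2[OF Q(2)])
      (use that in \<open>auto simp: Y_def Complex_eq[symmetric] intro!: sq\<close>, simp add: Complex_eq, intro continuous_intros)
  have yY: "y \<in> Y" using y by (simp add: Y_def)
  have "\<exists>\<eta>>0. \<forall>y'\<in>Y. dist y' y < \<eta> \<longrightarrow> dist (\<xi> (\<omega> * Complex x y')) (\<xi> (\<omega> * Complex x y)) < \<epsilon> / 2" if "\<bar>x - xc\<bar> < r" for x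
    using cont[OF that] yY e2 unfolding continuous_on_iff by blast
  from this[OF x(1)] this[OF x(2)] obtain \<eta>0 \<eta>1 where \<eta>0: "\<eta>0 > 0" "\<And>y'. y' \<in> Y \<Longrightarrow> dist y' y < \<eta>0 \<Longrightarrow> dist (\<xi> (\<omega> * Complex x0 y')) (\<xi> (\<omega> * Complex x0 y)) < \<epsilon> / 2"
    and \<eta>1: "\<eta>1 > 0" "\<And>y'. y' \<in> Y \<Longrightarrow> dist y' y < \<eta>1 \<Longrightarrow> dist (\<xi> (\<omega> * Complex x1 y')) (\<xi> (\<omega> * Complex x1 y)) < \<epsilon> / 2" by blast
  define \<eta> where "\<eta> = min (min \<eta>0 \<eta>1) (r - \<bar>y - yc\<bar>) / 2"
  have \<eta>: "\<eta> > 0" "\<eta> < \<eta>0" "\<eta> < \<eta>1" "\<eta> < r - \<bar>y - yc\<bar>" using \<eta>0(1) \<eta>1(1) y by (auto simp: \<eta>_def min_def)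
  have near: "y' \<in> Y \<and> dist y' y \<le> \<eta>" if "y' \<in> {y - \<eta>..y + \<eta>}" for y'
    using that \<eta>(4) by (auto simp: Y_def dist_real_def)
  have rect: "\<omega> * Complex x y' \<in> Q" if "x \<in> {x0..x1}" "y' \<in> {y - \<eta>..y + \<eta>}" for x y'
    by (rule sq) (use that x(1,2) near[OF that(2)] in \<open>auto simp: Y_def\<close>)
  have yy: "y - \<eta> < y + \<eta>" using \<eta>(1) by simp
  obtain k where k: "k > 0" "\<And>n. \<exists>y'\<in>{y - \<eta>..y + \<eta>}. norm (((*v) A ^^ n) (\<xi> (\<omega> * Complex x1 y') - \<xi> (\<omega> * Complex x0 y'))) \<le> k * sqrt (real N ^ n)"
    by (rule rectangle_displacement[OF Q \<omega> x(3) yy rect]) blast+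
  have "\<exists>d'. norm (d' - (\<xi> (\<omega> * Complex x1 y) - \<xi> (\<omega> * Complex x0 y))) \<le> \<epsilon> \<and> norm (((*v) A ^^ n) d') \<le> k * sqrt (real N ^ n)" for n
  proof -
    obtain y' where y': "y' \<in> {y - \<eta>..y + \<eta>}"
      "norm (((*v) A ^^ n) (\<xi> (\<omega> * Complex x1 y') - \<xi> (\<omega> * Complex x0 y'))) \<le> k * sqrt (real N ^ n)" using k(2) by blast
    note n = near[OF y'(1)]
    have "dist (\<xi> (\<omega> * Complex x0 y')) (\<xi> (\<omega> * Complex x0 y)) < \<epsilon> / 2" "dist (\<xi> (\<omega> * Complex x1 y')) (\<xi> (\<omega> * Complex x1 y)) < \<epsilon> / 2"
      using \<eta>0(2)[of y'] \<eta>1(2)[of y'] n \<eta> by auto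
    then have "norm (\<xi> (\<omega> * Complex x1 y') - \<xi> (\<omega> * Complex x0 y') - (\<xi> (\<omega> * Complex x1 y) - \<xi> (\<omega> * Complex x0 y))) \<le> \<epsilon>"
      using norm_triangle_ineq4[of "\<xi> (\<omega> * Complex x1 y') - \<xi> (\<omega> * Complex x1 y)" "\<xi> (\<omega> * Complex x0 y') - \<xi> (\<omega> * Complex x0 y)"]
      by (simp add: dist_norm algebra_simps)
    then show ?thesis using y'(2) by blast
  qed
  then show "\<exists>k>0. \<forall>n. \<exists>d'. norm (d' - (\<xi> (\<omega> * Complex x1 y) - \<xi> (\<omega> * Complex x0 y))) \<le> \<epsilon> \<and> norm (((*v) A ^^ n) d') \<le> k * sqrt (real N ^ n)"
    using k(1) by blast
qed

lemma tame_diff_commute: "tame (x - y) \<Longrightarrow> tame (y - x)"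
  using tame_uminus[of "x - y"] by simp

lemma tame_segment_any:
  fixes \<omega> :: complex
  assumes Q: "open Q" "continuous_on Q \<xi>" "\<And>z. z \<in> Q \<Longrightarrow> T (\<xi> z) = Some z" and \<omega>: "\<omega> \<noteq> 0"
    and sq: "\<And>x y. \<bar>x - xc\<bar> < r \<Longrightarrow> \<bar>y - yc\<bar> < r \<Longrightarrow> \<omega> * Complex x y \<in> Q"
    and x: "\<bar>x0 - xc\<bar> < r" "\<bar>x1 - xc\<bar> < r" and y: "\<bar>y - yc\<bar> < r"
  shows "tame (\<xi> (\<omega> * Complex x1 y) - \<xi> (\<omega> * Complex x0 y))"
proof (cases x0 x1 rule: linorder_cases)
  case less
  show ?thesis by (rule tame_segment[OF Q \<omega> sq x less y])
next
  case equal
  then show ?thesis by (simp add: tame_zero)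
next
  case greater
  show ?thesis by (rule tame_diff_commute, rule tame_segment[OF Q \<omega> sq x(2,1) greater y])
qed

text \<open>In a square within the domain of the inverse branch every point is reached from the
  centre by a horizontal and a vertical segment. As \<open>\<xi>\<close> is open, the resulting
  displacements fill a ball.\<close>

lemma tame_ball: obtains \<rho> where "\<rho> > 0" "\<And>d. norm d < \<rho> \<Longrightarrow> tame d"
proof -
  obtain Q \<xi> where Q: "open Q" "Q \<noteq> {}" "continuous_on Q \<xi>" "\<And>z. z \<in> Q \<Longrightarrow> T (\<xi> z) = Some z"
    "inj_on \<xi> Q" "\<And>Z. open Z \<Longrightarrow> Z \<subseteq> Q \<Longrightarrow> open (\<xi> ` Z)" by (rule local_section) blast
  obtain z1 where z1: "z1 \<in> Q" using Q(2) by blast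
  then obtain e where e: "e > 0" "ball z1 e \<subseteq> Q" using Q(1) by (auto simp: open_contains_ball)
  define r where "r = e / 2"
  have r: "r > 0" using e by (simp add: r_def)
  define Z where "Z = {z. \<bar>Re z - Re z1\<bar> < r \<and> \<bar>Im z - Im z1\<bar> < r}"
  have ZQ: "Z \<subseteq> Q"
  proof
    fix z assume "z \<in> Z"
    then have "dist z1 z < e" using cmod_le[of "z1 - z"] by (auto simp: Z_def r_def dist_norm abs_minus_commute)
    then show "z \<in> Q" using e(2) by auto
  qed
  have oZ: "open Z" unfolding Z_def by (intro open_Collect_conj open_Collect_less continuous_intros)
  have hQ: "1 * Complex x y \<in> Q" if "\<bar>x - Re z1\<bar> < r" "\<bar>y - Im z1\<bar> < r" for x y
    using that ZQ by (auto simp: Z_def)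
  have h: "tame (\<xi> (Complex x1 y) - \<xi> (Complex x0 y))" if "\<bar>x0 - Re z1\<bar> < r" "\<bar>x1 - Re z1\<bar> < r" "\<bar>y - Im z1\<bar> < r" for x0 x1 y
    using tame_segment_any[OF Q(1,3,4) one_neq_zero hQ that] by simp
  have iC: "\<i> * Complex u v = Complex (- v) u" for u v by (simp add: complex_eq_iff)
  have v: "tame (\<xi> (Complex x y1) - \<xi> (Complex x y0))" if "\<bar>x - Re z1\<bar> < r" "\<bar>y0 - Im z1\<bar> < r" "\<bar>y1 - Im z1\<bar> < r" for x y0 y1
  proof -
    have "\<i> * Complex u w \<in> Q" if "\<bar>u - Im z1\<bar> < r" "\<bar>w - (- Re z1)\<bar> < r" for u w
      unfolding iC using that ZQ by (auto simp: Z_def)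
    \<comment> \<open>The vertical segment at abscissa x is \<i> times the horizontal segment at
      height -x.\<close>
    then have "tame (\<xi> (\<i> * Complex y1 (- x)) - \<xi> (\<i> * Complex y0 (- x)))"
      using that by (intro tame_segment_any[OF Q(1,3,4), of \<i> "Im z1" r "- Re z1"]) auto
    then show ?thesis by (simp add: iC)
  qed
  have "\<xi> z1 \<in> \<xi> ` Z" using r by (simp add: Z_def)
  then obtain \<rho> where \<rho>: "\<rho> > 0" "ball (\<xi> z1) \<rho> \<subseteq> \<xi> ` Z" using Q(6)[OF oZ ZQ] by (auto simp: open_contains_ball)
  show thesis
  proof (rule that[OF \<rho>(1)])
    fix d :: "real^2" assume "norm d < \<rho>"
    then have "\<xi> z1 + d \<in> ball (\<xi> z1) \<rho>" by (simp add: dist_norm)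
    then obtain z where z: "z \<in> Z" "\<xi> z1 + d = \<xi> z" using \<rho>(2) by blast
    have "tame (\<xi> (Complex (Re z) (Im z1)) - \<xi> (Complex (Re z1) (Im z1)))" using z r by (intro h) (auto simp: Z_def)
    moreover have "tame (\<xi> (Complex (Re z) (Im z)) - \<xi> (Complex (Re z) (Im z1)))" using z r by (intro v) (auto simp: Z_def)
    ultimately have "tame (\<xi> z - \<xi> z1)" using tame_add by fastforce
    moreover have "\<xi> z - \<xi> z1 = d" using z(2) by (simp add: algebra_simps)
    ultimately show "tame d" by simp
  qed
qed

text \<open>For each \<open>n\<close> two nearly orthogonal vectors of controlled growth span an
  area bounded from below, and Cramer's rule expands an arbitrary \<open>x\<close> in them with
  coefficients bounded by a constant times its norm.\<close>

lemma A_iter_bound: obtains c where "c > 0" "\<And>n x. norm (((*v) A ^^ n) x) \<le> c * sqrt (real N ^ n) * norm x"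
proof -
  obtain \<rho> where \<rho>: "\<rho> > 0" "\<And>d. norm d < \<rho> \<Longrightarrow> tame d" by (rule tame_ball) blast
  define s where "s = \<rho> / 2"
  have s: "s > 0" "s < \<rho>" using \<rho> by (simp_all add: s_def)
  define d1 :: "real^2" where "d1 = vector [s, 0]"
  define d2 :: "real^2" where "d2 = vector [0, s]"
  have n12: "norm d1 = s" "norm d2 = s" using s by (simp_all add: d1_def d2_def norm_vec_def L2_set_def sum_2)
  have w12: "wedge d1 d2 = s * s" by (simp add: wedge_def d1_def d2_def)
  \<comment> \<open>Errors of s/16 change the spanned area s^2 by at most 33/128 of it, so that at
    least s^2/2 remains.\<close>
  have s16: "s / 16 > 0" using s by simp
  have t1: "tame d1" and t2: "tame d2" using \<rho>(2) n12 s by auto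
  obtain k1 where k1: "k1 > 0" "\<And>n. \<exists>d'. norm (d' - d1) \<le> s / 16 \<and> norm (((*v) A ^^ n) d') \<le> k1 * sqrt (real N ^ n)"
    using t1 s16 unfolding tame_def by blast
  obtain k2 where k2: "k2 > 0" "\<And>n. \<exists>d'. norm (d' - d2) \<le> s / 16 \<and> norm (((*v) A ^^ n) d') \<le> k2 * sqrt (real N ^ n)"
    using t2 s16 unfolding tame_def by blast
  show thesis
  proof (rule that[of "8 * (k1 + k2) / s"])
    show "8 * (k1 + k2) / s > 0" using k1 k2 s by simp
    fix n x
    define R where "R = sqrt (real N ^ n)"
    have R: "R \<ge> 0" by (simp add: R_def)
    obtain d1' where d1': "norm (d1' - d1) \<le> s / 16" "norm (((*v) A ^^ n) d1') \<le> k1 * R" using k1(2)[of n] unfolding R_def by blast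
    obtain d2' where d2': "norm (d2' - d2) \<le> s / 16" "norm (((*v) A ^^ n) d2') \<le> k2 * R" using k2(2)[of n] unfolding R_def by blast
    have n1: "norm d1' \<le> 17 / 16 * s" using norm_triangle_ineq[of "d1' - d1" d1] d1'(1) n12 by simp
    have n2: "norm d2' \<le> 17 / 16 * s" using norm_triangle_ineq[of "d2' - d2" d2] d2'(1) n12 by simp
    have eq: "wedge d1' d2' = s * s + wedge (d1' - d1) d2' + wedge d1 (d2' - d2)"
      unfolding w12[symmetric] by (simp add: wedge_linear)
    have "\<bar>wedge (d1' - d1) d2'\<bar> \<le> 2 * (s / 16) * (17 / 16 * s)"
      by (rule order_trans[OF wedge_bound]) (use d1' n2 s in \<open>intro mult_mono; simp\<close>)
    moreover have "\<bar>wedge d1 (d2' - d2)\<bar> \<le> 2 * s * (s / 16)"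
      by (rule order_trans[OF wedge_bound]) (use d2' n12 s in \<open>intro mult_mono; simp\<close>)
    ultimately have w: "wedge d1' d2' \<ge> s * s / 2"
      using eq s by simp
    have "wedge d1' d2' * norm (((*v) A ^^ n) x) \<le> \<bar>wedge d1' d2'\<bar> * norm (((*v) A ^^ n) x)"
      by (intro mult_right_mono) auto
    also have "\<dots> = norm (((*v) A ^^ n) (wedge d1' d2' *\<^sub>R x))" by (simp add: A_iter_linear)
    also have "\<dots> = norm (wedge x d2' *\<^sub>R ((*v) A ^^ n) d1' + wedge d1' x *\<^sub>R ((*v) A ^^ n) d2')"
      by (simp only: wedge_expansion[of d1' d2' x] A_iter_linear)
    also have "\<dots> \<le> \<bar>wedge x d2'\<bar> * norm (((*v) A ^^ n) d1') + \<bar>wedge d1' x\<bar> * norm (((*v) A ^^ n) d2')"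
      by (rule order_trans[OF norm_triangle_ineq]) simp
    also have "\<dots> \<le> (2 * norm x * (17 / 16 * s)) * (k1 * R) + (2 * norm x * (17 / 16 * s)) * (k2 * R)"
    proof (intro add_mono mult_mono d1' d2')
      show "\<bar>wedge x d2'\<bar> \<le> 2 * norm x * (17 / 16 * s)"
        by (rule order_trans[OF wedge_bound]) (use n2 in \<open>intro mult_left_mono; simp\<close>)
      have "\<bar>wedge d1' x\<bar> = \<bar>wedge x d1'\<bar>" using wedge_commute[of x d1'] by simp
      also have "\<dots> \<le> 2 * norm x * (17 / 16 * s)"
        by (rule order_trans[OF wedge_bound]) (use n1 in \<open>intro mult_left_mono; simp\<close>)
      finally show "\<bar>wedge d1' x\<bar> \<le> 2 * norm x * (17 / 16 * s)" .
    qed (use s in auto)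
    also have "\<dots> = 17 / 8 * s * ((k1 + k2) * R * norm x)" by (simp add: algebra_simps)
    also have "\<dots> \<le> 4 * s * ((k1 + k2) * R * norm x)" using s k1 k2 R by (intro mult_right_mono) auto
    finally have "wedge d1' d2' * norm (((*v) A ^^ n) x) \<le> 4 * s * ((k1 + k2) * R * norm x)" .
    moreover have "s * s / 2 * norm (((*v) A ^^ n) x) \<le> wedge d1' d2' * norm (((*v) A ^^ n) x)"
      using w by (intro mult_right_mono) auto
    ultimately have "s * (s * norm (((*v) A ^^ n) x)) \<le> s * (8 * ((k1 + k2) * R * norm x))" by (simp add: algebra_simps)
    then have "s * norm (((*v) A ^^ n) x) \<le> 8 * ((k1 + k2) * R * norm x)" using s by simp
    then show "norm (((*v) A ^^ n) x) \<le> 8 * (k1 + k2) / s * sqrt (real N ^ n) * norm x"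
      using s unfolding R_def[symmetric] by (simp add: field_simps)
  qed
qed

text \<open>In dimension two the upper bound for \<open>A ^^ n\<close> and \<open>N \<le> det A\<close> give a lower bound, since \<open>A ^^ n\<close> multiplies areas
  by \<open>det A ^ n\<close>.\<close>

lemma aff_iter_expands:
  obtains c where "c > 0" "\<And>n x y. dist x y \<le> c / sqrt (real N ^ n) * dist ((aff ^^ n) x) ((aff ^^ n) y)"
proof -
  obtain c where c: "c > 0" "\<And>n x. norm (((*v) A ^^ n) x) \<le> c * sqrt (real N ^ n) * norm x" by (rule A_iter_bound) blast
  show thesis
  proof (rule that[of "2 * c"])
    fix n and x y :: "real^2"
    define u where "u = x - y"
    \<comment> \<open>\<open>u\<close> rotated by a right angle, so that the oriented area of
      \<open>u\<close> and u' is the squared norm of \<open>u\<close>.\<close>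
    define u' :: "real^2" where "u' = vector [- (u $ 2), u $ 1]"
    define R where "R = sqrt (real N ^ n)"
    have R: "R > 0" "R * R = real N ^ n" using N_bounds by (simp_all add: R_def)
    have nu': "norm u' = norm u" by (simp add: u'_def norm_vec_def L2_set_def sum_2 add.commute)
    have "wedge u u' = norm u * norm u"
      by (simp add: u'_def wedge_def norm_vec_def L2_set_def sum_2 power2_eq_square add_nonneg_nonneg)
    then have "det A ^ n * (norm u * norm u) = wedge (((*v) A ^^ n) u) (((*v) A ^^ n) u')" by (simp add: wedge_iter)
    also have "\<dots> \<le> 2 * norm (((*v) A ^^ n) u) * norm (((*v) A ^^ n) u')" using wedge_bound abs_le_D1 by blast
    also have "\<dots> \<le> 2 * norm (((*v) A ^^ n) u) * (c * R * norm u)"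
      using c(2)[of n u'] by (intro mult_left_mono) (auto simp: R_def nu')
    finally have 1: "det A ^ n * (norm u * norm u) \<le> 2 * norm (((*v) A ^^ n) u) * (c * R * norm u)" .
    have "(real N) ^ n \<le> det A ^ n" using N_bounds by (intro power_mono) auto
    then have "R * R * (norm u * norm u) \<le> det A ^ n * (norm u * norm u)" unfolding R(2) by (intro mult_right_mono) auto
    then have "(R * norm u) * (R * norm u) \<le> (2 * c * norm (((*v) A ^^ n) u)) * (R * norm u)" using 1 by (simp add: mult_ac)
    then have "R * norm u \<le> 2 * c * norm (((*v) A ^^ n) u)"
    proof (cases "norm u = 0")
      case False
      then have "R * norm u > 0" using R by simp
      then show ?thesis using \<open>(R * norm u) * (R * norm u) \<le> _\<close> mult_le_cancel_right_pos by blast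
    qed (use c in simp)
    then have "norm u \<le> 2 * c / R * norm (((*v) A ^^ n) u)" using R(1) by (simp add: field_simps)
    then show "dist x y \<le> 2 * c / sqrt (real N ^ n) * dist ((aff ^^ n) x) ((aff ^^ n) y)"
      by (simp add: dist_norm u_def R_def aff_iter_diff)
  qed (use c in simp)
qed

end

section \<open>Tiles\<close>

text \<open>In the applications \<open>Kc\<close> is the closure of \<open>K\<close>.\<close>

lemma clopen_image_eq:
  assumes V: "connectedin Y V" and K: "K \<noteq> {}" "h ` K \<subseteq> V" "openin Y (h ` K)"
    and Kc: "K \<subseteq> Kc" "closedin Y (h ` Kc)" "h ` Kc \<inter> V \<subseteq> h ` K"
  shows "h ` K = V"
proof (rule ccontr)
  assume "h ` K \<noteq> V"
  \<comment> \<open>Otherwise the open image of \<open>K\<close> and the complement of the closed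
    image of \<open>Kc\<close> would disconnect \<open>V\<close>.\<close>
  then have "(topspace Y - h ` Kc) \<inter> V \<noteq> {}" using K(2) Kc(3) connectedin_subset_topspace[OF V] by blast
  moreover have "openin Y (topspace Y - h ` Kc)" using Kc(2) by auto
  moreover have "V \<subseteq> h ` K \<union> (topspace Y - h ` Kc)" using Kc(3) connectedin_subset_topspace[OF V] by blast
  moreover have "h ` K \<inter> (topspace Y - h ` Kc) \<inter> V = {}" using Kc(1) by blast
  moreover have "h ` K \<inter> V \<noteq> {}" using K(1,2) by blast
  ultimately show False using V K(3) unfolding connectedin by blast
qed

locale lattes_curve = lattes_cover L a b \<Theta> G \<alpha> p q f N A v0 g + rigid_curve L a b \<Theta> G \<alpha> C
  for L a b \<Theta> and G :: "'g monoid" and \<alpha> p q f N A v0 g C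
begin

lemma iter_continuous: "continuous_map sphere_top sphere_top (f ^^ n)"
proof (induction n)
  case (Suc n)
  show ?case using continuous_map_compose[OF Suc f_continuous] by (simp add: o_def)
qed (simp add: id_def)

lemma iter_open: "openin sphere_top W \<Longrightarrow> openin sphere_top ((f ^^ n) ` W)"
proof (induction n)
  case (Suc n)
  have "(f ^^ Suc n) ` W = f ` ((f ^^ n) ` W)" by (simp add: image_image)
  then show ?case using f_open Suc by simp
qed simp

lemma iter_closed: assumes "closedin sphere_top K" shows "closedin sphere_top ((f ^^ n) ` K)"
  by (rule compactin_imp_closedin[OF Hausdorff_space_sphere])
    (rule image_compactin[OF closedin_compact_space[OF compact_space_sphere assms] iter_continuous])

lemma closed_preimage: "closedin sphere_top ((f ^^ n) -` C)"
  using closedin_continuous_map_preimage[OF iter_continuous closedin_C, of n] by (simp add: vimage_def)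

lemma open_complement: "openin sphere_top (- ((f ^^ n) -` C))"
  using openin_diff[OF openin_topspace closed_preimage[of n]] by (simp add: Compl_eq_Diff_UNIV)

text \<open>A component of an open set is open because the sphere is locally connected. It is also
  relatively closed, so its closure adds only points of the preimage of \<open>C\<close>.\<close>

lemma tile_interior:
  assumes K: "K \<in> connected_components_of (subtopology sphere_top (- ((f ^^ n) -` C)))"
  shows "openin sphere_top K" "connectedin sphere_top K" "K \<noteq> {}" "K \<subseteq> - ((f ^^ n) -` C)"
    "sphere_top closure_of K \<inter> - ((f ^^ n) -` C) \<subseteq> K"
    "\<exists>V \<in> connected_components_of (subtopology sphere_top (- C)). (f ^^ n) ` K \<subseteq> V"
proof -
  show 1: "openin sphere_top K"
    using locally_connected_sphere open_complement K unfolding locally_connected_space_open_connected_components by blast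
  show 3: "K \<noteq> {}" by (rule nonempty_connected_components_of[OF K])
  have "connectedin (subtopology sphere_top (- ((f ^^ n) -` C))) K" by (rule connectedin_connected_components_of[OF K])
  then show 2: "connectedin sphere_top K" and 4: "K \<subseteq> - ((f ^^ n) -` C)" by (auto simp: connectedin_subtopology)
  have "closedin (subtopology sphere_top (- ((f ^^ n) -` C))) K" by (rule closedin_connected_components_of[OF K])
  then obtain D where D: "closedin sphere_top D" "K = D \<inter> - ((f ^^ n) -` C)" unfolding closedin_subtopology by blast
  have "sphere_top closure_of K \<subseteq> D" by (rule closure_of_minimal) (use D in auto)
  then show "sphere_top closure_of K \<inter> - ((f ^^ n) -` C) \<subseteq> K" using D(2) by blast
  have "connectedin sphere_top ((f ^^ n) ` K)" by (rule connectedin_continuous_map_image[OF iter_continuous 2])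
  moreover have sub: "(f ^^ n) ` K \<subseteq> - C" using 4 by blast
  ultimately have c: "connectedin (subtopology sphere_top (- C)) ((f ^^ n) ` K)" by (simp add: connectedin_subtopology)
  have "topspace (subtopology sphere_top (- C)) \<noteq> {}" using sub 3 by auto
  then have "subtopology sphere_top (- C) \<noteq> trivial_topology" by (metis topspace_discrete_topology)
  from exists_connected_component_of_superset[OF c this]
  show "\<exists>V \<in> connected_components_of (subtopology sphere_top (- C)). (f ^^ n) ` K \<subseteq> V" by blast
qed

text \<open>The n-th affine iterate sends a component \<Omega> of the lift of the open tile over a
  component of the complement of \<open>C\<close>, so its image has diameter at most
  \<open>m\<close> and \<Omega> stays within k m of its point \<open>t0\<close>. It covers the open
  tile, since its image there is open and relatively closed, and its compact closure covers
  \<open>X\<close>. The slack \<epsilon> is for \<open>s\<close> over the boundary of the tile,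
  where \<Omega> is only nearby.\<close>

lemma tile_lift:
  assumes X: "X \<in> tiles f C n" and k: "k \<ge> 0" "\<And>x y. dist x y \<le> k * dist ((aff ^^ n) x) ((aff ^^ n) y)"
    and m: "\<And>S s t V. V \<in> connected_components_of (subtopology sphere_top (- C)) \<Longrightarrow> connected S \<Longrightarrow>
      T ` S \<subseteq> V \<Longrightarrow> s \<in> S \<Longrightarrow> t \<in> S \<Longrightarrow> dist s t \<le> m"
    and s: "T s \<in> X" and y: "y \<in> X" and \<epsilon>: "\<epsilon> > 0"
  shows "\<exists>t. T t = y \<and> dist s t \<le> k * m + \<epsilon>"
proof -
  obtain K where K: "K \<in> connected_components_of (subtopology sphere_top (- ((f ^^ n) -` C)))" "X = sphere_top closure_of K"
    using X unfolding tiles_def by blast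
  note Kp = tile_interior[OF K(1)]
  have "openin sphere_top (T ` ball s \<epsilon>)" by (rule T_open) simp
  moreover have "T s \<in> T ` ball s \<epsilon>" using \<epsilon> by simp
  ultimately obtain z where "z \<in> K" "z \<in> T ` ball s \<epsilon>" using s unfolding K(2) in_closure_of by blast
  then obtain t0 where t0: "dist s t0 < \<epsilon>" "T t0 \<in> K" by auto
  define \<Omega> where "\<Omega> = connected_component_set (T -` K) t0"
  have oTK: "open (T -` K)" by (rule open_T_vimage[OF Kp(1)])
  have o\<Omega>: "open \<Omega>" unfolding \<Omega>_def by (rule open_connected_component[OF oTK])
  have c\<Omega>: "connected \<Omega>" unfolding \<Omega>_def by (rule connected_connected_component)
  have t0\<Omega>: "t0 \<in> \<Omega>" using t0 by (simp add: \<Omega>_def connected_component_refl)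
  have \<Omega>K: "T ` \<Omega> \<subseteq> K" using connected_component_subset[of "T -` K" t0] by (auto simp: \<Omega>_def)
  obtain V where V: "V \<in> connected_components_of (subtopology sphere_top (- C))" "(f ^^ n) ` K \<subseteq> V" using Kp(6) by blast
  have diam: "dist t0 t \<le> k * m" if t: "t \<in> \<Omega>" for t
  proof -
    have "connected ((aff ^^ n) ` \<Omega>)" by (rule connected_continuous_image[OF continuous_aff_iter c\<Omega>])
    moreover have "T ` (aff ^^ n) ` \<Omega> \<subseteq> V"
    proof
      fix w assume "w \<in> T ` (aff ^^ n) ` \<Omega>"
      then obtain r where r: "r \<in> \<Omega>" "w = T ((aff ^^ n) r)" by blast
      then have "w = (f ^^ n) (T r)" by (simp add: f_T_iter)
      then show "w \<in> V" using r(1) \<Omega>K V(2) by blast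
    qed
    ultimately have "dist ((aff ^^ n) t0) ((aff ^^ n) t) \<le> m" using m[OF V(1)] t0\<Omega> t by blast
    then show ?thesis using k(2)[of t0 t] mult_left_mono[OF _ k(1)] by (meson order_trans)
  qed
  have "\<Omega> \<subseteq> cball t0 (k * m)" using diam by auto
  then have "closure \<Omega> \<subseteq> cball t0 (k * m)" by (simp add: closure_minimal)
  moreover from this have "compact (closure \<Omega>)" by (simp add: compact_eq_bounded_closed bounded_subset[OF bounded_cball])
  moreover have "T ` \<Omega> = K"
  proof (rule clopen_image_eq[OF Kp(2) _ \<Omega>K T_open[OF o\<Omega>] closure_subset])
    show "closedin sphere_top (T ` closure \<Omega>)" by (rule closedin_T_image) fact
    show "T ` closure \<Omega> \<inter> K \<subseteq> T ` \<Omega>"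
    proof
      fix w assume w: "w \<in> T ` closure \<Omega> \<inter> K"
      then obtain r where r: "r \<in> closure \<Omega>" "w = T r" by blast
      then have rK: "r \<in> T -` K" using w by simp
      obtain D where D: "closed D" "\<Omega> = T -` K \<inter> D"
        using closedin_connected_component[of "T -` K" t0] unfolding \<Omega>_def[symmetric] closedin_closed by blast
      have "closure \<Omega> \<subseteq> D" using D by (intro closure_minimal) auto
      then have "r \<in> \<Omega>" using r(1) rK D(2) by blast
      then show "w \<in> T ` \<Omega>" using r(2) by blast
    qed
  qed (use t0\<Omega> in auto)
  ultimately have c: "closure \<Omega> \<subseteq> cball t0 (k * m)" "closedin sphere_top (T ` closure \<Omega>)" "T ` \<Omega> = K"
    using closedin_T_image by auto
  have "X \<subseteq> T ` closure \<Omega>"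
    unfolding K(2) by (rule closure_of_minimal[OF _ c(2)]) (use c(3) closure_subset in blast)
  then obtain t where t: "t \<in> closure \<Omega>" "T t = y" using y by blast
  then have "dist t0 t \<le> k * m" using c(1) by auto
  then have "dist s t \<le> k * m + \<epsilon>" using dist_triangle[of s t t0] t0(1) by linarith
  then show ?thesis using t(2) by blast
qed

text \<open>Some \<open>e\<close> has lift distance at least \<delta> from a point \<open>x0\<close>
  of the union, and the union also meets \<open>e\<close>. So \<open>lift_dist e\<close> falls from
  at least \<delta> to 0 on a connected union of \<open>M\<close> tiles and varies by at most 2 k m
  on each.\<close>

lemma tiles_number_bound:
  assumes X: "\<And>i. i \<in> {1..M} \<Longrightarrow> X i \<in> tiles f C n" and conn: "connectedin sphere_top (\<Union>i\<in>{1..M}. X i)"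
    and k: "k > 0" "\<And>x y. dist x y \<le> k * dist ((aff ^^ n) x) ((aff ^^ n) y)"
    and m: "m > 0" "\<And>S s t V. V \<in> connected_components_of (subtopology sphere_top (- C)) \<Longrightarrow> connected S \<Longrightarrow>
      T ` S \<subseteq> V \<Longrightarrow> s \<in> S \<Longrightarrow> t \<in> S \<Longrightarrow> dist s t \<le> m"
    and \<delta>: "\<And>x. \<exists>e\<in>\<E>. \<delta> \<le> lift_dist e x" and meets: "\<And>e. e \<in> \<E> \<Longrightarrow> (\<Union>i\<in>{1..M}. X i) \<inter> e \<noteq> {}"
  shows "\<delta> \<le> real M * (2 * k * m)"
proof -
  define K where "K = (\<Union>i\<in>{1..M}. X i)"
  obtain e1 where "e1 \<in> \<E>" using \<delta> by blast
  then obtain x0 where x0: "x0 \<in> K" using meets unfolding K_def by blast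
  obtain e where e: "e \<in> \<E>" "\<delta> \<le> lift_dist e x0" using \<delta> by blast
  obtain x1 where x1: "x1 \<in> K" "x1 \<in> e" using meets[OF e(1)] unfolding K_def by blast
  \<comment> \<open>The slack in \<open>tile_lift\<close> is taken to be k m itself, whence the
    factor 2.\<close>
  have km: "k * m > 0" using k m by simp
  have step: "lift_dist e y \<le> lift_dist e x + 2 * k * m" if i: "i \<in> {1..M}" and x: "x \<in> X i" and y: "y \<in> X i" for x y i
  proof (rule lift_dist_triangle)
    fix t assume "T t = x"
    then have "T t \<in> X i" using x by simp
    from tile_lift[OF X[OF i] less_imp_le[OF k(1)] k(2) m(2) this y km]
    show "\<exists>t'. T t' = y \<and> dist t t' \<le> 2 * k * m" by (simp add: mult.assoc)
  qed
  have "dist (lift_dist e x0) (lift_dist e x1) \<le> real (card {1..M}) * (2 * k * m)"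
  proof (rule connected_cover_dist_bound[of "lift_dist e" K "{1..M}" X])
    show "connected (lift_dist e ` K)"
      using connectedin_continuous_map_image[OF continuous_lift_dist conn] by (simp add: K_def)
    show "K \<subseteq> (\<Union>i\<in>{1..M}. X i)" by (simp add: K_def)
    fix i x y assume i: "i \<in> {1..M}" and "x \<in> K \<inter> X i" "y \<in> K \<inter> X i"
    then have "x \<in> X i" "y \<in> X i" by auto
    then show "dist (lift_dist e x) (lift_dist e y) \<le> 2 * k * m"
      using step[OF i, of x y] step[OF i, of y x] by (simp add: dist_real_def abs_le_iff)
  qed (use x0 x1 in auto)
  then show ?thesis using lift_dist_zero[OF x1(2)] e(2) lift_dist_nonneg[of e x0] by (simp add: dist_real_def)
qed

text \<open>The n-th iterate maps an open tile onto a full component of the complement of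
  \<open>C\<close>. Each tile thus contains a preimage of one of two chosen points, and these
  preimages are finitely many.\<close>

lemma finite_tiles: "finite (tiles f C n)"
proof -
  obtain V1 V2 where V12: "connected_components_of (subtopology sphere_top (- C)) = {V1, V2}"
    by (rule complement_components) blast
  have "V1 \<noteq> {}" "V2 \<noteq> {}" using nonempty_connected_components_of V12 by (metis insertCI)+
  then obtain v1 v2 where v: "v1 \<in> V1" "v2 \<in> V2" by blast
  define Z where "Z = (f ^^ n) -` {v1} \<union> (f ^^ n) -` {v2}"
  have Z: "finite Z" unfolding Z_def using iterate_fibre by blast
  define \<K> where "\<K> = connected_components_of (subtopology sphere_top (- ((f ^^ n) -` C)))"
  have ex: "\<exists>z\<in>Z. z \<in> K" if "K \<in> \<K>" for K
  proof -
    note Kp = tile_interior[OF that[unfolded \<K>_def]]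
    obtain V where V: "V \<in> {V1, V2}" "(f ^^ n) ` K \<subseteq> V" using Kp(6) unfolding V12 by blast
    then have V': "V \<in> connected_components_of (subtopology sphere_top (- C))" using V12 by simp
    have cV: "connectedin sphere_top V" "V \<subseteq> - C"
      using connectedin_connected_components_of[OF V'] by (auto simp: connectedin_subtopology)
    have "(f ^^ n) ` K = V"
    proof (rule clopen_image_eq[OF cV(1) Kp(3) V(2) iter_open[OF Kp(1)]])
      show "K \<subseteq> sphere_top closure_of K" by (rule closure_of_subset) simp
      show "closedin sphere_top ((f ^^ n) ` (sphere_top closure_of K))" by (rule iter_closed) simp
      show "(f ^^ n) ` (sphere_top closure_of K) \<inter> V \<subseteq> (f ^^ n) ` K" using Kp(5) cV(2) by blast
    qed
    then have "v1 \<in> (f ^^ n) ` K \<or> v2 \<in> (f ^^ n) ` K" using V(1) v by blast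
    then show ?thesis unfolding Z_def by blast
  qed
  then obtain \<zeta> where \<zeta>: "\<And>K. K \<in> \<K> \<Longrightarrow> \<zeta> K \<in> Z \<and> \<zeta> K \<in> K" by metis
  have "inj_on \<zeta> \<K>"
  proof (rule inj_onI)
    fix K K' assume K: "K \<in> \<K>" "K' \<in> \<K>" "\<zeta> K = \<zeta> K'"
    then have "\<not> disjnt K K'" using \<zeta>[OF K(1)] \<zeta>[OF K(2)] by (auto simp: disjnt_def)
    then show "K = K'" using connected_components_of_disjoint K unfolding \<K>_def by blast
  qed
  moreover have "\<zeta> ` \<K> \<subseteq> Z" using \<zeta> by blast
  ultimately have "finite \<K>" using Z inj_on_finite by blast
  then show ?thesis unfolding tiles_def \<K>_def by simp
qed

text \<open>Finitely many closed tiles leave out an open set contained in the preimage of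
  \<open>C\<close>; were it nonempty, its image under the open iterate would be a nonempty open
  subset of \<open>C\<close>.\<close>

lemma Union_tiles: "\<Union>(tiles f C n) = UNIV"
proof (rule ccontr)
  assume ne: "\<Union>(tiles f C n) \<noteq> UNIV"
  define W where "W = - \<Union>(tiles f C n)"
  have "closedin sphere_top (\<Union>(tiles f C n))"
    by (rule closedin_Union[OF finite_tiles]) (auto simp: tiles_def)
  then have oW: "openin sphere_top W"
    unfolding W_def using openin_diff[OF openin_topspace] by (metis Compl_eq_Diff_UNIV topspace_sphere_top)
  have "W \<subseteq> (f ^^ n) -` C"
  proof
    fix x assume xW: "x \<in> W"
    show "x \<in> (f ^^ n) -` C"
    proof (rule ccontr)
      assume "x \<notin> (f ^^ n) -` C"
      then have "x \<in> topspace (subtopology sphere_top (- ((f ^^ n) -` C)))" by simp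
      then have "x \<in> \<Union>(connected_components_of (subtopology sphere_top (- ((f ^^ n) -` C))))"
        by (simp only: Union_connected_components_of)
      then obtain K where K: "K \<in> connected_components_of (subtopology sphere_top (- ((f ^^ n) -` C)))" "x \<in> K"
        by (rule UnionE)
      have "K \<subseteq> sphere_top closure_of K" by (rule closure_of_subset) simp
      then show False using K xW unfolding W_def tiles_def by blast
    qed
  qed
  then have "(f ^^ n) ` W \<subseteq> C" by blast
  moreover have "(f ^^ n) ` W \<noteq> {}" using ne by (auto simp: W_def)
  ultimately show False using C_empty_interior[OF iter_open[OF oW]] by blast
qed

text \<open>All tiles together form an admissible chain, so \<open>D_num\<close> is a minimum that
  is attained and not an unspecified value of \<open>LEAST\<close>.\<close>

lemma tiles_chain_exists:
  assumes "joins_opposite_sides f C UNIV"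
  shows "\<exists>(M::nat) X. (\<forall>i\<in>{1..M}. X i \<in> tiles f C n) \<and> connectedin sphere_top (\<Union>i\<in>{1..M}. X i) \<and>
           joins_opposite_sides f C (\<Union>i\<in>{1..M}. X i)"
proof -
  obtain X where "bij_betw X {1..card (tiles f C n)} (tiles f C n)"
    using ex_bij_betw_nat_finite_1[OF finite_tiles] by blast
  then have im: "X ` {1..card (tiles f C n)} = tiles f C n" by (rule bij_betw_imp_surj_on)
  then have U: "(\<Union>i\<in>{1..card (tiles f C n)}. X i) = UNIV" using Union_tiles by metis
  have c: "connectedin sphere_top UNIV" using connected_space_sphere by (metis connectedin_topspace topspace_sphere_top)
  have "\<forall>i\<in>{1..card (tiles f C n)}. X i \<in> tiles f C n" using im by blast
  moreover have "connectedin sphere_top (\<Union>i\<in>{1..card (tiles f C n)}. X i)" unfolding U by (rule c)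
  moreover have "joins_opposite_sides f C (\<Union>i\<in>{1..card (tiles f C n)}. X i)" unfolding U by (rule assms)
  ultimately show ?thesis by (intro exI[of _ "card (tiles f C n)"] exI[of _ X] conjI)
qed

end

section \<open>Edges\<close>

lemma clopen_connected_in_components:
  assumes "connectedin X K" "K \<noteq> {}" "openin X K" "closedin X K"
  shows "K \<in> connected_components_of X"
proof -
  obtain x where x: "x \<in> K" using assms(2) by blast
  then have xt: "x \<in> topspace X" using assms(3) openin_subset by blast
  have xc: "x \<in> connected_component_of_set X x" using xt by (simp add: connected_component_of_refl)
  have "connectedin X (connected_component_of_set X x)" by (rule connectedin_connected_component_of)
  then have "connected_component_of_set X x \<subseteq> K"
    using connectedin_clopen_cases[OF _ assms(4,3)] x xc by (auto simp: disjnt_def)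
  moreover have "K \<subseteq> connected_component_of_set X x" by (rule connected_component_of_maximal[OF assms(1) x])
  ultimately have "K = connected_component_of_set X x" by blast
  then show ?thesis using xt connected_component_in_connected_components_of[of X x] by simp
qed

context jordan
begin

lemma circle_param:
  assumes p0: "p0 \<in> C"
  obtains \<psi> :: "real \<Rightarrow> riemann" where "continuous_map euclideanreal sphere_top \<psi>" "\<psi> 0 = p0" "\<psi> 1 = p0" "\<psi> ` {0..1} = C"
    "\<And>s t. s \<in> {0..1} \<Longrightarrow> t \<in> {0..1} \<Longrightarrow> \<psi> s = \<psi> t \<Longrightarrow> s = t \<or> s = 0 \<and> t = 1 \<or> s = 1 \<and> t = 0"
proof -
  obtain h h' where hh: "homeomorphic_maps (subtopology sphere_top C) (top_of_set (sphere (0::complex) 1)) h h'"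
    by (rule circle_maps)
  have h: "h c \<in> sphere 0 1" "h' (h c) = c" if "c \<in> C" for c
    using hh that unfolding homeomorphic_maps_def continuous_map_def by (auto simp: Pi_iff)
  have h': "h' z \<in> C" "h (h' z) = z" if "z \<in> sphere 0 1" for z
    using hh that unfolding homeomorphic_maps_def continuous_map_def by (auto simp: Pi_iff)
  have ch': "continuous_map (top_of_set (sphere 0 1)) sphere_top h'"
    using hh unfolding homeomorphic_maps_def by (meson continuous_map_in_subtopology)
  define u where "u = h p0"
  have u: "norm u = 1" using h(1)[OF p0] by (simp add: u_def)
  define \<phi> where "\<phi> t = u * exp (\<i> * of_real (2 * pi * t))" for t
  have \<phi>s: "\<phi> t \<in> sphere 0 1" for t using u by (simp add: \<phi>_def norm_mult)
  define \<psi> where "\<psi> t = h' (\<phi> t)" for t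
  have \<phi>01: "\<phi> 0 = u" "\<phi> 1 = u" using exp_two_pi_i by (simp_all add: \<phi>_def mult_ac)
  show thesis
  proof (rule that[of \<psi>])
    have "continuous_map euclideanreal (top_of_set (sphere 0 1)) \<phi>"
      using \<phi>s by (auto simp: continuous_map_in_subtopology \<phi>_def[abs_def] intro!: continuous_intros)
    from continuous_map_compose[OF this ch'] show "continuous_map euclideanreal sphere_top \<psi>"
      by (simp add: \<psi>_def[abs_def] o_def)
    show "\<psi> 0 = p0" "\<psi> 1 = p0" using h(2)[OF p0] by (simp_all only: \<psi>_def \<phi>01 u_def)
    show "\<psi> ` {0..1} = C"
    proof
      show "\<psi> ` {0..1} \<subseteq> C" using h'(1)[OF \<phi>s] by (auto simp: \<psi>_def)
      show "C \<subseteq> \<psi> ` {0..1}"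
      proof
        fix c assume c: "c \<in> C"
        define v where "v = h c / u"
        have nv: "norm v = 1" using h(1)[OF c] u by (simp add: v_def norm_divide)
        define t where "t = Arg2pi v / (2 * pi)"
        have "v = exp (\<i> * of_real (Arg2pi v))" using Arg2pi_eq[of v] nv by simp
        then have "\<phi> t = h c" using u by (auto simp: \<phi>_def t_def v_def field_simps)
        then have "\<psi> t = c" using h(2)[OF c] by (simp add: \<psi>_def)
        moreover have "t \<in> {0..1}" using Arg2pi_ge_0[of v] Arg2pi_lt_2pi[of v] by (simp add: t_def)
        ultimately show "c \<in> \<psi> ` {0..1}" by blast
      qed
    qed
    fix s t :: real assume st: "s \<in> {0..1}" "t \<in> {0..1}" "\<psi> s = \<psi> t"
    have "h (\<psi> s) = h (\<psi> t)" unfolding st(3) ..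
    then have "\<phi> s = \<phi> t" unfolding \<psi>_def h'(2)[OF \<phi>s] .
    moreover have "u \<noteq> 0" using u by auto
    ultimately have "exp (\<i> * of_real (2 * pi * s)) = exp (\<i> * of_real (2 * pi * t))" by (simp add: \<phi>_def)
    then obtain n :: int where "\<i> * of_real (2 * pi * s) = \<i> * of_real (2 * pi * t) + of_real (of_int (2 * n) * pi) * \<i>"
      using exp_eq by blast
    then have "Im (\<i> * of_real (2 * pi * s)) = Im (\<i> * of_real (2 * pi * t) + of_real (of_int (2 * n) * pi) * \<i>)" by (rule arg_cong)
    then have "2 * pi * s = 2 * pi * t + 2 * of_int n * pi" by simp
    then have "2 * pi * (s - t - of_int n) = 0" by (simp add: algebra_simps)
    then have n: "s - t = of_int n" by simp
    then have "n = 0 \<or> n = 1 \<or> n = -1" using st(1,2) by auto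
    then show "s = t \<or> s = 0 \<and> t = 1 \<or> s = 1 \<and> t = 0" using n st(1,2) by auto
  qed
qed

text \<open>The parameters of the points of \<open>P\<close> cut the parameter interval, and the
  components are the images of the gaps between consecutive ones. Three consecutive arcs from
  \<open>p0\<close> are singled out: they have no common point, and if \<open>P\<close> has at least
  four points, the first and the third are disjoint.\<close>

lemma arcs:
  assumes P: "P \<subseteq> C" "finite P" "card P \<ge> 3"
  defines "\<A> \<equiv> (\<lambda>K. sphere_top closure_of K) ` connected_components_of (subtopology sphere_top (C - P))"
  shows "finite \<A>" "\<And>e. e \<in> \<A> \<Longrightarrow> closedin sphere_top e \<and> e \<noteq> {}" "card P = 3 \<Longrightarrow> \<Inter>\<A> = {}"
    "card P \<ge> 4 \<Longrightarrow> \<exists>e\<in>\<A>. \<exists>e'\<in>\<A>. e \<inter> e' = {}"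
proof -
  obtain p0 where p0: "p0 \<in> P" using P(3) by fastforce
  obtain \<psi> :: "real \<Rightarrow> riemann" where \<psi>: "continuous_map euclideanreal sphere_top \<psi>" "\<psi> 0 = p0" "\<psi> 1 = p0" "\<psi> ` {0..1} = C"
    "\<And>s t. s \<in> {0..1} \<Longrightarrow> t \<in> {0..1} \<Longrightarrow> \<psi> s = \<psi> t \<Longrightarrow> s = t \<or> s = 0 \<and> t = 1 \<or> s = 1 \<and> t = 0"
    by (rule circle_param[of p0]) (use p0 P(1) in blast)+
  \<comment> \<open>The point \<open>p0\<close> is represented twice, by 0 and by 1; the parameters
    below 1 correspond bijectively to \<open>P\<close>.\<close>
  define F where "F = {t \<in> {0..1}. \<psi> t \<in> P}"
  have F01: "0 \<in> F" "1 \<in> F" using \<psi>(2,3) p0 by (simp_all add: F_def)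
  have Fin: "s \<in> {0..1}" if "s \<in> F" for s using that by (simp add: F_def)
  have inj: "inj_on \<psi> {0..<1}"
    by (rule inj_onI) (use \<psi>(5) in fastforce)
  have F1: "F = insert 1 (F \<inter> {0..<1})" using F01 Fin by force
  have "\<psi> ` (F \<inter> {0..<1}) = P"
  proof
    show "\<psi> ` (F \<inter> {0..<1}) \<subseteq> P" by (auto simp: F_def)
    show "P \<subseteq> \<psi> ` (F \<inter> {0..<1})"
    proof
      fix y assume y: "y \<in> P"
      then obtain t where t: "t \<in> {0..1}" "y = \<psi> t" using P(1) \<psi>(4) by blast
      show "y \<in> \<psi> ` (F \<inter> {0..<1})"
      proof (cases "t = 1")
        case True
        then have "y = \<psi> 0" using t \<psi>(2,3) by simp
        moreover have "0 \<in> F \<inter> {0..<1}" using F01 by simp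
        ultimately show ?thesis by blast
      next
        case False
        then have "t \<in> F \<inter> {0..<1}" using t y by (simp add: F_def)
        then show ?thesis using t(2) by blast
      qed
    qed
  qed
  then have bij: "bij_betw \<psi> (F \<inter> {0..<1}) P" using inj unfolding bij_betw_def by (auto intro: inj_on_subset)
  have finF0: "finite (F \<inter> {0..<1})" using bij_betw_finite[OF bij] P(2) by simp
  have cardF0: "card (F \<inter> {0..<1}) = card P" using bij_betw_same_card[OF bij] .
  have finF: "finite F" using finF0 F1 by (metis finite_insert)
  have clos\<psi>: "closedin sphere_top (\<psi> ` K)" if "compact K" for K
    by (rule compactin_imp_closedin[OF Hausdorff_space_sphere], rule image_compactin[OF _ \<psi>(1)]) (use that in simp)
  have arc: "\<psi> ` {s<..<t} \<in> connected_components_of (subtopology sphere_top (C - P))"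
    "sphere_top closure_of (\<psi> ` {s<..<t}) \<subseteq> \<psi> ` {s..t}"
    if st: "s \<in> F" "t \<in> F" "s < t" "{s<..<t} \<inter> F = {}" for s t
  proof -
    have st01: "0 \<le> s" "t \<le> 1" using Fin st by auto
    have sub: "\<psi> ` {s<..<t} \<subseteq> C - P"
    proof
      fix y assume "y \<in> \<psi> ` {s<..<t}"
      then obtain r where r: "r \<in> {s<..<t}" "y = \<psi> r" by blast
      then have "r \<in> {0..1}" "r \<notin> F" using st01 st(4) by auto
      then show "y \<in> C - P" using r(2) \<psi>(4) by (auto simp: F_def)
    qed
    have cls: "closedin sphere_top (\<psi> ` {s..t})" by (rule clos\<psi>) simp
    then show "sphere_top closure_of (\<psi> ` {s<..<t}) \<subseteq> \<psi> ` {s..t}"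
      by (intro closure_of_minimal) auto
    have endsP: "\<psi> s \<in> P" "\<psi> t \<in> P" using st by (auto simp: F_def)
    show "\<psi> ` {s<..<t} \<in> connected_components_of (subtopology sphere_top (C - P))"
    proof (rule clopen_connected_in_components)
      have "connectedin sphere_top (\<psi> ` {s<..<t})"
        by (rule connectedin_continuous_map_image[OF \<psi>(1)]) simp
      then show "connectedin (subtopology sphere_top (C - P)) (\<psi> ` {s<..<t})" using sub by (simp add: connectedin_subtopology)
      show "\<psi> ` {s<..<t} \<noteq> {}" using st(3) by simp
      have "\<psi> ` {s<..<t} = \<psi> ` {s..t} \<inter> (C - P)"
      proof
        show "\<psi> ` {s<..<t} \<subseteq> \<psi> ` {s..t} \<inter> (C - P)" using sub by auto
        show "\<psi> ` {s..t} \<inter> (C - P) \<subseteq> \<psi> ` {s<..<t}"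
        proof
          fix y assume y: "y \<in> \<psi> ` {s..t} \<inter> (C - P)"
          then obtain r where r: "r \<in> {s..t}" "y = \<psi> r" by blast
          then have "r \<noteq> s" "r \<noteq> t" using y endsP by auto
          then show "y \<in> \<psi> ` {s<..<t}" using r by auto
        qed
      qed
      then show "closedin (subtopology sphere_top (C - P)) (\<psi> ` {s<..<t})"
        using cls by (auto simp: closedin_subtopology)
      have "\<psi> ` {s<..<t} = (topspace sphere_top - (\<psi> ` {0..s} \<union> \<psi> ` {t..1})) \<inter> (C - P)"
      proof
        show "\<psi> ` {s<..<t} \<subseteq> (topspace sphere_top - (\<psi> ` {0..s} \<union> \<psi> ` {t..1})) \<inter> (C - P)"
        proof
          fix y assume y: "y \<in> \<psi> ` {s<..<t}"
          then obtain r where r: "r \<in> {s<..<t}" "y = \<psi> r" by blast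
          have "y \<noteq> \<psi> v" if "v \<in> {0..s} \<union> {t..1}" for v
          proof
            assume "y = \<psi> v"
            then show False using \<psi>(5)[of r v] r that st01 by auto
          qed
          then have "y \<notin> \<psi> ` {0..s} \<union> \<psi> ` {t..1}" by blast
          moreover have "y \<in> C - P" using y sub by blast
          ultimately show "y \<in> (topspace sphere_top - (\<psi> ` {0..s} \<union> \<psi> ` {t..1})) \<inter> (C - P)" by simp
        qed
        show "(topspace sphere_top - (\<psi> ` {0..s} \<union> \<psi> ` {t..1})) \<inter> (C - P) \<subseteq> \<psi> ` {s<..<t}"
        proof
          fix y assume y: "y \<in> (topspace sphere_top - (\<psi> ` {0..s} \<union> \<psi> ` {t..1})) \<inter> (C - P)"
          then obtain r where r: "r \<in> {0..1}" "y = \<psi> r" using \<psi>(4) by blast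
          have "r \<notin> {0..s}" "r \<notin> {t..1}" using y r(2) by auto
          then show "y \<in> \<psi> ` {s<..<t}" using r by auto
        qed
      qed
      moreover have "openin sphere_top (topspace sphere_top - (\<psi> ` {0..s} \<union> \<psi> ` {t..1}))"
        by (intro openin_diff openin_topspace closedin_Un clos\<psi>) simp_all
      ultimately show "openin (subtopology sphere_top (C - P)) (\<psi> ` {s<..<t})"
        unfolding openin_subtopology by blast
    qed
  qed
  have comp: "\<exists>s\<in>F. \<exists>t\<in>F. K = \<psi> ` {s<..<t}" if K: "K \<in> connected_components_of (subtopology sphere_top (C - P))" for K
  proof -
    obtain x where x: "x \<in> K" using nonempty_connected_components_of[OF K] by blast
    then have "x \<in> C - P" using connected_components_of_subset[OF K] by auto
    then obtain r where r: "r \<in> {0..1}" "x = \<psi> r" "r \<notin> F" using \<psi>(4) by (auto simp: F_def)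
    have r01: "0 < r" "r < 1" using r F01 by (auto simp: less_le)
    define s where "s = Max {s\<in>F. s < r}"
    define t where "t = Min {t\<in>F. r < t}"
    have s: "s \<in> {s\<in>F. s < r}" unfolding s_def by (rule Max_in) (use finF F01 r01 in auto)
    have t: "t \<in> {t\<in>F. r < t}" unfolding t_def by (rule Min_in) (use finF F01 r01 in auto)
    have "{s<..<t} \<inter> F = {}"
    proof (rule ccontr)
      assume "{s<..<t} \<inter> F \<noteq> {}"
      then obtain v where v: "s < v" "v < t" "v \<in> F" by auto
      then have "v \<noteq> r" using r by auto
      moreover have "v \<le> s" if "v < r" unfolding s_def using finF v that by (intro Max_ge) auto
      moreover have "t \<le> v" if "r < v" unfolding t_def using finF v that by (intro Min_le) auto
      ultimately show False using v by linarith
    qed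
    then have c: "\<psi> ` {s<..<t} \<in> connected_components_of (subtopology sphere_top (C - P))" using arc(1) s t by auto
    moreover have "x \<in> \<psi> ` {s<..<t}" using r(2) s t by auto
    ultimately have "K = \<psi> ` {s<..<t}" using connected_components_of_disjoint[OF K c] x by (auto simp: disjnt_def)
    then show ?thesis using s t by blast
  qed
  have "\<A> \<subseteq> (\<lambda>(s, t). sphere_top closure_of (\<psi> ` {s<..<t})) ` (F \<times> F)"
  proof
    fix e assume "e \<in> \<A>"
    then obtain K where K: "K \<in> connected_components_of (subtopology sphere_top (C - P))" "e = sphere_top closure_of K"
      unfolding \<A>_def by blast
    obtain s t where "s \<in> F" "t \<in> F" "K = \<psi> ` {s<..<t}" using comp[OF K(1)] by blast
    then show "e \<in> (\<lambda>(s, t). sphere_top closure_of (\<psi> ` {s<..<t})) ` (F \<times> F)" using K(2) by auto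
  qed
  then show "finite \<A>" using finF finite_subset by blast
  show "closedin sphere_top e \<and> e \<noteq> {}" if "e \<in> \<A>" for e
  proof -
    obtain K where K: "K \<in> connected_components_of (subtopology sphere_top (C - P))" "e = sphere_top closure_of K"
      using \<open>e \<in> \<A>\<close> unfolding \<A>_def by blast
    have "K \<subseteq> e" unfolding K(2) by (rule closure_of_subset) simp
    then show ?thesis using nonempty_connected_components_of[OF K(1)] K(2) by auto
  qed
  define nx where "nx s = Min {t\<in>F. s < t}" for s
  have nx: "nx s \<in> F" "s < nx s" "{s<..<nx s} \<inter> F = {}" "F \<inter> {..<nx s} \<subseteq> F \<inter> {..s}" if "s < 1" for s
  proof -
    have "nx s \<in> {t\<in>F. s < t}" unfolding nx_def by (rule Min_in) (use finF F01 that in auto)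
    then show "nx s \<in> F" "s < nx s" by auto
    have le: "nx s \<le> v" if "v \<in> F" "s < v" for v unfolding nx_def using finF that by (intro Min_le) auto
    then show "{s<..<nx s} \<inter> F = {}" by force
    show "F \<inter> {..<nx s} \<subseteq> F \<inter> {..s}" using le by force
  qed
  define a where "a = nx 0"
  define b where "b = nx a"
  define c where "c = nx b"
  have a: "a \<in> F" "0 < a" "{0<..<a} \<inter> F = {}" "F \<inter> {..<a} \<subseteq> F \<inter> {..0}" unfolding a_def using nx[of 0] by simp_all
  have F0: "F \<inter> {..0} \<subseteq> {0}" using Fin by force
  \<comment> \<open>Used to see that the next parameter is not yet 1: otherwise too few parameters
    below 1 would remain for the points of \<open>P\<close>.\<close>
  have small: "card P \<le> card X" if "F \<inter> {..<1} \<subseteq> X" "finite X" for X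
  proof -
    have "card (F \<inter> {0..<1}) \<le> card X" using that by (intro card_mono) auto
    then show ?thesis using cardF0 by simp
  qed
  have "a \<noteq> 1"
  proof
    assume "a = 1"
    then have "card P \<le> card {0::real}" using a(4) F0 by (intro small) auto
    then show False using P(3) by simp
  qed
  then have a1: "a < 1" using Fin[OF a(1)] by simp
  have b: "b \<in> F" "a < b" "{a<..<b} \<inter> F = {}" "F \<inter> {..<b} \<subseteq> F \<inter> {..a}" unfolding b_def using nx[OF a1] by simp_all
  have Fa: "F \<inter> {..a} \<subseteq> {0, a}" using a(4) F0 by force
  have "b \<noteq> 1"
  proof
    assume "b = 1"
    then have "card P \<le> card {0, a}" using b(4) Fa by (intro small) auto
    then show False using P(3) a(2) by simp
  qed
  then have b1: "b < 1" using Fin[OF b(1)] by simp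
  have c: "c \<in> F" "b < c" "{b<..<c} \<inter> F = {}" "F \<inter> {..<c} \<subseteq> F \<inter> {..b}" unfolding c_def using nx[OF b1] by simp_all
  have Fb: "F \<inter> {..b} \<subseteq> {0, a, b}" using b(4) Fa by force
  have c1: "c \<le> 1" using Fin[OF c(1)] by simp
  have A1: "sphere_top closure_of (\<psi> ` {0<..<a}) \<in> \<A>" and A2: "sphere_top closure_of (\<psi> ` {a<..<b}) \<in> \<A>"
    and A3: "sphere_top closure_of (\<psi> ` {b<..<c}) \<in> \<A>"
    unfolding \<A>_def using arc(1)[OF F01(1) a(1,2,3)] arc(1)[OF a(1) b(1,2,3)] arc(1)[OF b(1) c(1,2,3)] by blast+
  note sub1 = arc(2)[OF F01(1) a(1,2,3)] and sub2 = arc(2)[OF a(1) b(1,2,3)] and sub3 = arc(2)[OF b(1) c(1,2,3)]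
  show "\<Inter>\<A> = {}" if "card P = 3"
  proof (rule ccontr)
    assume "\<Inter>\<A> \<noteq> {}"
    then obtain y where "y \<in> \<Inter>\<A>" by blast
    then have "y \<in> \<psi> ` {0..a}" "y \<in> \<psi> ` {a..b}" "y \<in> \<psi> ` {b..c}" using A1 A2 A3 sub1 sub2 sub3 by blast+
    then obtain r s t where rst: "r \<in> {0..a}" "s \<in> {a..b}" "t \<in> {b..c}" "y = \<psi> r" "y = \<psi> s" "y = \<psi> t" by blast
    have rs: "r = s" using \<psi>(5)[of r s] rst a a1 b b1 by auto
    have st: "s = t" using \<psi>(5)[of s t] rst a a1 b b1 c1 by auto
    show False using rs st rst b(2) by auto
  qed
  show "\<exists>e\<in>\<A>. \<exists>e'\<in>\<A>. e \<inter> e' = {}" if "card P \<ge> 4"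
  proof (rule bexI[OF _ A1], rule bexI[OF _ A3])
    have "c \<noteq> 1"
    proof
      assume "c = 1"
      then have "card P \<le> card {0, a, b}" using c(4) Fb by (intro small) auto
      also have "card {0, a, b} \<le> 3" by (simp add: card_insert_if)
      finally show False using that by simp
    qed
    then have c1': "c < 1" using c1 by simp
    have "\<psi> ` {0..a} \<inter> \<psi> ` {b..c} = {}"
    proof (rule ccontr)
      assume "\<psi> ` {0..a} \<inter> \<psi> ` {b..c} \<noteq> {}"
      then obtain y where "y \<in> \<psi> ` {0..a}" "y \<in> \<psi> ` {b..c}" by blast
      then obtain r t where "r \<in> {0..a}" "y = \<psi> r" "t \<in> {b..c}" "y = \<psi> t" by blast
      then have rt: "r \<in> {0..a}" "t \<in> {b..c}" "\<psi> r = \<psi> t" by simp_all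
      then have "r = t" using \<psi>(5)[of r t] a a1 b b1 c1' by auto
      then show False using rt b(2) by auto
    qed
    then show "sphere_top closure_of (\<psi> ` {0<..<a}) \<inter> sphere_top closure_of (\<psi> ` {b<..<c}) = {}" using sub1 sub3 by blast
  qed
qed

end

section \<open>The lower bound\<close>

context lattes_curve
begin

lemma zero_edges:
  shows "finite (zero_edges f C)" "\<And>e. e \<in> zero_edges f C \<Longrightarrow> closedin sphere_top e \<and> e \<noteq> {}"
    "card P = 3 \<Longrightarrow> \<Inter>(zero_edges f C) = {}"
    "card P \<ge> 4 \<Longrightarrow> \<exists>e\<in>zero_edges f C. \<exists>e'\<in>zero_edges f C. e \<inter> e' = {}"
  unfolding zero_edges_def postcritical_eq by (fact arcs[OF P_C finite_P card_P])+

text \<open>Both ways of joining opposite sides say that \<open>K\<close> meets every member of a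
  family of edges without common point: two disjoint edges, or all three. Such families are finitely
  many, so one \<delta> serves for all of them.\<close>

lemma joins_gap:
  obtains \<delta> where "\<delta> > 0"
    "\<And>K. joins_opposite_sides f C K \<Longrightarrow> \<exists>\<E>. (\<forall>x. \<exists>e\<in>\<E>. \<delta> \<le> lift_dist e x) \<and> (\<forall>e\<in>\<E>. K \<inter> e \<noteq> {})"
proof -
  define \<F> where "\<F> = {\<E>. \<E> \<subseteq> zero_edges f C \<and> \<Inter>\<E> = {}}"
  have fin: "finite \<F>" by (rule finite_subset[of _ "Pow (zero_edges f C)"]) (auto simp: \<F>_def zero_edges(1))
  have "\<exists>\<delta>>0. \<forall>x. \<exists>e\<in>\<E>. \<delta> \<le> lift_dist e x" if "\<E> \<in> \<F>" for \<E>
  proof -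
    have \<E>: "\<E> \<subseteq> zero_edges f C" "\<Inter>\<E> = {}" using that by (auto simp: \<F>_def)
    have fE: "finite \<E>" by (rule finite_subset[OF \<E>(1) zero_edges(1)])
    have cE: "closedin sphere_top e \<and> e \<noteq> {}" if "e \<in> \<E>" for e using zero_edges(2) \<E>(1) that by blast
    obtain \<delta> where "\<delta> > 0" "\<And>x. \<exists>e\<in>\<E>. \<delta> \<le> lift_dist e x" by (rule no_common_point_gap[OF fE cE \<E>(2)]) blast+
    then show ?thesis by blast
  qed
  then obtain d where d: "\<And>\<E>. \<E> \<in> \<F> \<Longrightarrow> d \<E> > 0 \<and> (\<forall>x. \<exists>e\<in>\<E>. d \<E> \<le> lift_dist e x)" by metis
  \<comment> \<open>The inserted 1 makes the set nonempty in every case, so that its minimum is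
    meaningful.\<close>
  define \<delta> where "\<delta> = Min (insert (1::real) (d ` \<F>))"
  have \<delta>: "\<delta> > 0" unfolding \<delta>_def using fin d by (subst Min_gr_iff) auto
  have le: "\<delta> \<le> d \<E>" if "\<E> \<in> \<F>" for \<E> unfolding \<delta>_def using fin that by (intro Min_le) auto
  have gap: "\<forall>x. \<exists>e\<in>\<E>. \<delta> \<le> lift_dist e x" if "\<E> \<in> \<F>" for \<E>
    using d[OF that] le[OF that] by (meson order_trans)
  show thesis
  proof (rule that[OF \<delta>])
    fix K assume "joins_opposite_sides f C K"
    then consider (disjoint) e e' where "e \<in> zero_edges f C" "e' \<in> zero_edges f C" "e \<inter> e' = {}" "K \<inter> e \<noteq> {}" "K \<inter> e' \<noteq> {}"
      | (all) "card P = 3" "\<forall>e\<in>zero_edges f C. K \<inter> e \<noteq> {}"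
      unfolding joins_opposite_sides_def postcritical_eq by blast
    then show "\<exists>\<E>. (\<forall>x. \<exists>e\<in>\<E>. \<delta> \<le> lift_dist e x) \<and> (\<forall>e\<in>\<E>. K \<inter> e \<noteq> {})"
    proof cases
      case disjoint
      then have "{e, e'} \<in> \<F>" by (simp add: \<F>_def)
      moreover have "\<forall>a\<in>{e, e'}. K \<inter> a \<noteq> {}" using disjoint by simp
      ultimately show ?thesis using gap by blast
    next
      case all
      then have "zero_edges f C \<in> \<F>" using zero_edges(3) by (simp add: \<F>_def)
      then show ?thesis using gap all(2) by blast
    qed
  qed
qed

lemma joins_UNIV: "joins_opposite_sides f C UNIV"
proof -
  have ne: "e \<noteq> {}" if "e \<in> zero_edges f C" for e using zero_edges(2) that by blast
  show ?thesis
  proof (cases "card P = 3")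
    case True
    then show ?thesis unfolding joins_opposite_sides_def postcritical_eq using ne by simp
  next
    case False
    then have "card P \<ge> 4" using card_P by simp
    moreover obtain e e' where "e \<in> zero_edges f C" "e' \<in> zero_edges f C" "e \<inter> e' = {}" using zero_edges(4)[OF calculation] by blast
    ultimately show ?thesis unfolding joins_opposite_sides_def postcritical_eq using ne by (metis inf_top_left)
  qed
qed

text \<open>With the contraction factor k / sqrt (N^n) and the bound \<open>m\<close> for lifted
  components, \<open>tiles_number_bound\<close> yields that \<delta> is at most 2 k m / sqrt (N^n)
  times the number of tiles; hence the constant \<delta> / (2 k m).\<close>

lemma D_num_bound: "\<exists>c>0. \<forall>n. real (D_num f C n) \<ge> c * real (map_degree f) powr (real n / 2)"
proof -
  obtain \<delta> where \<delta>: "\<delta> > 0"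
    "\<And>K. joins_opposite_sides f C K \<Longrightarrow> \<exists>\<E>. (\<forall>x. \<exists>e\<in>\<E>. \<delta> \<le> lift_dist e x) \<and> (\<forall>e\<in>\<E>. K \<inter> e \<noteq> {})"
    by (rule joins_gap) blast
  obtain k where k: "k > 0" "\<And>n x y. dist x y \<le> k / sqrt (real N ^ n) * dist ((aff ^^ n) x) ((aff ^^ n) y)"
    by (rule aff_iter_expands) blast
  obtain m where m: "m > 0" "\<And>S s t V. V \<in> connected_components_of (subtopology sphere_top (- C)) \<Longrightarrow> connected S \<Longrightarrow>
      T ` S \<subseteq> V \<Longrightarrow> s \<in> S \<Longrightarrow> t \<in> S \<Longrightarrow> dist s t \<le> m"
    by (rule all_component_lifts_bounded) blast
  have "\<delta> / (2 * k * m) * real (map_degree f) powr (real n / 2) \<le> real (D_num f C n)" for n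
  proof -
    define M where "M = D_num f C n"
    have "\<exists>X. (\<forall>i\<in>{1..M}. X i \<in> tiles f C n) \<and> connectedin sphere_top (\<Union>i\<in>{1..M}. X i) \<and>
             joins_opposite_sides f C (\<Union>i\<in>{1..M}. X i)"
      unfolding M_def D_num_def by (rule LeastI_ex[OF tiles_chain_exists[OF joins_UNIV]])
    then obtain X where X: "\<And>i. i \<in> {1..M} \<Longrightarrow> X i \<in> tiles f C n" "connectedin sphere_top (\<Union>i\<in>{1..M}. X i)"
      "joins_opposite_sides f C (\<Union>i\<in>{1..M}. X i)" by blast
    obtain \<E> where \<E>: "\<And>x. \<exists>e\<in>\<E>. \<delta> \<le> lift_dist e x" "\<And>e. e \<in> \<E> \<Longrightarrow> (\<Union>i\<in>{1..M}. X i) \<inter> e \<noteq> {}"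
      using \<delta>(2)[OF X(3)] by blast
    have N0: "real N > 0" using N(2) by simp
    define R where "R = sqrt (real N ^ n)"
    have R: "R > 0" using N0 by (simp add: R_def)
    have "real N powr (real n / 2) = (real N powr real n) powr (1 / 2)" by (simp add: powr_powr)
    also have "\<dots> = R" unfolding R_def using N0 by (simp add: powr_realpow powr_half_sqrt)
    finally have powr: "real (map_degree f) powr (real n / 2) = R" by (simp add: map_degree_eq)
    have kR: "k / R > 0" using k(1) R by simp
    have "\<delta> \<le> real M * (2 * (k / R) * m)"
      by (rule tiles_number_bound[OF X(1,2) kR k(2)[of _ _ n, folded R_def] m \<E>])
    then have "\<delta> * R \<le> real M * (2 * k * m)" using R by (simp add: field_simps)
    then show ?thesis unfolding powr M_def[symmetric] using k(1) m(1) by (simp add: field_simps)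
  qed
  moreover have "\<delta> / (2 * k * m) > 0" using \<delta>(1) k(1) m(1) by simp
  ultimately show ?thesis by blast
qed

end

text \<open>Coprimality excludes common zeros of \<open>p\<close> and \<open>q\<close>. As
  \<open>T\<close> and the affine map are onto, so is \<open>f\<close>; hence \<open>p\<close> and
  \<open>q\<close> are not both constant, which gives the degree of at least 1 demanded by
  \<open>rational_pair\<close>.\<close>

lemma lattes_map_lattes_cover:
  assumes "rank2_lattice L" "lattes_map L f"
  obtains a b \<Theta> and G :: "int monoid" and \<alpha> p q N A v g where "lattes_cover L a b \<Theta> G \<alpha> p q f N A v g"
proof -
  obtain a b where ab: "lattice L a b" by (rule rank2_lattice_imp_lattice[OF assms(1)])
  obtain A v g \<Theta> and G :: "int monoid" and \<alpha> where g: "induces_torus_endomorphism L A v g"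
    "\<And>\<mu>. complex_eigenvalue A \<mu> \<Longrightarrow> cmod \<mu> > 1" "branched_cover (oriented_torus L) riemann_sphere \<Theta>"
    "finite (carrier G)" "induced_by_rigid_action L G \<alpha> \<Theta>" "\<And>t. t \<in> torus L \<Longrightarrow> f (\<Theta> t) = \<Theta> (g t)"
    using assms(2) unfolding lattes_map_def lattes_type_map_def by blast
  obtain p q where pq: "coprime p q" "f = rational_extension p q"
    using assms(2) unfolding lattes_map_def rational_map_def by blast
  interpret rigid_cover L a b \<Theta> G \<alpha>
    using ab g(3-5) by (simp add: rigid_cover_def torus_cover_def rigid_cover_axioms_def torus_cover_axioms_def)
  have "invertible A" using g(1) by (simp add: induces_torus_endomorphism_def invertible_det_nz)
  then obtain B where B: "A ** B = mat 1" unfolding invertible_def by blast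
  have surj: "w \<in> range f" for w
  proof -
    obtain x where x: "T x = w" by (rule T_surj)
    have "A *v (B *v (x - v)) + v = x" by (simp add: matrix_vector_mul_assoc B)
    then have "g (torus_proj L (B *v (x - v))) = torus_proj L x"
      using g(1) by (simp add: induces_torus_endomorphism_def)
    then have "f (\<Theta> (torus_proj L (B *v (x - v)))) = w"
      using g(6)[of "torus_proj L (B *v (x - v))"] x by (simp add: T_def torus_def)
    then show ?thesis by blast
  qed
  have nc: "poly p x \<noteq> 0 \<or> poly q x \<noteq> 0" for x using coprime_poly_0[OF pq(1)] by blast
  have "max (degree p) (degree q) \<ge> 1"
  proof (rule ccontr)
    assume "\<not> ?thesis"
    then have "degree p = 0" "degree q = 0" by auto
    then obtain c d where "p = [:c:]" "q = [:d:]" by (meson degree_eq_zeroE)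
    then have "f x = (if d = 0 then None else Some (c / d))" for x
      by (auto simp: pq(2) rational_extension_def split: option.split)
    then have "range f \<subseteq> {if d = 0 then None else Some (c / d)}" by blast
    then have "finite (UNIV :: riemann set)" using surj by (metis UNIV_I finite.emptyI finite.insertI finite_subset subsetI subset_trans)
    then show False using infinite_sphere by simp
  qed
  then have "rational_fun p q f (max (degree p) (degree q))"
    using nc by (simp add: rational_fun_def rational_pair_def rational_fun_axioms_def pq(2))
  then have "lattes_cover L a b \<Theta> G \<alpha> p q f (max (degree p) (degree q)) A v g"
    using g rigid_cover_axioms by (simp add: lattes_cover_def lattes_cover_axioms_def)
  then show thesis by (rule that)
qed

theorem proposition5p11:
  fixes L :: "(real^2) set" and f :: "riemann \<Rightarrow> riemann" and C :: "riemann set"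
  assumes "rank2_lattice L"
    and "lattes_map L f"
    and "jordan_curve C"
    and "postcritical f \<subseteq> C"
  shows "\<exists>c::real. c > 0 \<and>
    (\<forall>n::nat. n > 0 \<longrightarrow> real (D_num f C n) \<ge> c * real (map_degree f) powr (real n / 2))"
proof -
  obtain a b \<Theta> and G :: "int monoid" and \<alpha> p q N A v g where "lattes_cover L a b \<Theta> G \<alpha> p q f N A v g"
    by (rule lattes_map_lattes_cover[OF assms(1,2)])
  then interpret lattes_cover L a b \<Theta> G \<alpha> p q f N A v g .
  interpret lattes_curve L a b \<Theta> G \<alpha> p q f N A v g C
    by unfold_locales (use assms(3,4) postcritical_eq in auto)
  show ?thesis using D_num_bound by blast
qed

end
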